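(* Let $X$ be a Banach space, $1<p_0\le p_1<\infty$, $q_0,q_1\in[1,\infty]$, $s_0,s_1\in\mathbb{R}$, and $w_0(x)=|x|^{\gamma_0}$, $w_1(x)=|x|^{\gamma_1}$ with $\gamma_0,\gamma_1>-d$. The following are equivalent: (1) One has the continuous embedding $F^{s_0}_{p_0,q_0}(\mathbb{R}^d,w_0;X)\hookrightarrow F^{s_1}_{p_1,q_1}(\mathbb{R}^d,w_1;X)$. (2) Either ($\gamma_0=\gamma_1$, $p_0=p_1$, and either $s_0>s_1$ or [$s_0=s_1$ and $q_0\le q_1$]), or $\frac{\gamma_1}{p_1}\le\frac{\gamma_0}{p_0}$, $\frac{d+\gamma_1}{p_1}<\frac{d+\gamma_0}{p_0}$ and $s_0-\frac{d+\gamma_0}{p_0}\ge s_1-\frac{d+\gamma_1}{p_1}$.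
   Context: $A_p$ denotes the Muckenhoupt class and $A_\infty=\bigcup_{1\le p<\infty}A_p$; power weights $|x|^\gamma$, $\gamma>-d$, lie in $A_\infty$. For a weight $w$ and $p\in[1,\infty)$, $L^p(\mathbb{R}^d,w;X)$ is the space of strongly measurable $f$ with $\int\|f\|^pw\,dx<\infty$. Fourier transform $\hat f(\xi)=(2\pi)^{-d/2}\int f(x)e^{-ix\cdot\xi}dx$ on $X$-valued tempered distributions $\mathcal{S}'(\mathbb{R}^d;X)$. Fix $\varphi\in\mathcal{S}(\mathbb{R}^d)$ with $0\le\hat\varphi\le1$, $\hat\varphi=1$ on $\{|\xi|\le1\}$, $\hat\varphi=0$ on $\{|\xi|\ge3/2\}$; $\hat\varphi_0=\hat\varphi$, $\hat\varphi_k(\xi)=\hat\varphi(2^{-k}\xi)-\hat\varphi(2^{-k+1}\xi)$ ($k\ge1$), $S_kf=\mathcal{F}^{-1}[\hat\varphi_k\hat f]$. For $w\in A_\infty$, $s\in\mathbb{R}$, $p\in[1,\infty)$, $q\in[1,\infty]$, the weighted Triebel–Lizorkin space $F^s_{p,q}(\mathbb{R}^d,w;X)$ consists of all $f\in\mathcal{S}'(\mathbb{R}^d;X)$ with $\|f\|_{F^s_{p,q}}=\big\|\,\|(2^{ks}\|S_kf(\cdot)\|)_{k\ge0}\|_{\ell^q}\big\|_{L^p(\mathbb{R}^d,w)}<\infty$ (independent of the choice of $\varphi$ up to equivalent norms). *)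

theory Defs
  imports "HOL-Analysis.Analysis"
begin

text \<open>Iterated partial derivatives along coordinate directions: a multi-index is
  represented as a list of coordinate directions.\<close>
fun dpart :: "'d::finite list \<Rightarrow> (real^'d \<Rightarrow> real) \<Rightarrow> real^'d \<Rightarrow> real" where
  "dpart [] f = f"
| "dpart (i # is) f = (\<lambda>x. deriv (\<lambda>t. dpart is f (x + t *\<^sub>R axis i 1)) 0)"

definition schwartz :: "(real^'d::finite \<Rightarrow> real) \<Rightarrow> bool" where
  "schwartz f \<longleftrightarrow>
     (\<forall>is x. dpart is f differentiable (at x)) \<and>
     (\<forall>is (N::nat). bounded (range (\<lambda>x. (1 + norm x) ^ N * dpart is f x)))"

definition snorm :: "nat \<Rightarrow> 'd::finite list \<Rightarrow> (real^'d \<Rightarrow> real) \<Rightarrow> real" where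
  "snorm N is f = (SUP x. (1 + norm x) ^ N * \<bar>dpart is f x\<bar>)"

text \<open>X-valued tempered distributions: linear maps on the Schwartz space, continuous
  w.r.t. its Frechet topology (i.e. bounded by finitely many seminorms).\<close>
definition tempered :: "((real^'d::finite \<Rightarrow> real) \<Rightarrow> 'x::banach) \<Rightarrow> bool" where
  "tempered T \<longleftrightarrow>
     (\<forall>f g (a::real) b. schwartz f \<longrightarrow> schwartz g \<longrightarrow>
        T (\<lambda>x. a * f x + b * g x) = a *\<^sub>R T f + b *\<^sub>R T g) \<and>
     (\<exists>C (N::nat). \<forall>f. schwartz f \<longrightarrow>
        norm (T f) \<le> C * (\<Sum>is\<in>{is::'d list. length is \<le> N}. \<Sum>n\<le>N. snorm n is f))"

definition fourier :: "(real^'d::finite \<Rightarrow> real) \<Rightarrow> real^'d \<Rightarrow> complex" where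
  "fourier f \<xi> = complex_of_real ((2 * pi) powr (- real CARD('d) / 2)) *
      integral\<^sup>L lborel (\<lambda>x. complex_of_real (f x) * cis (- (x \<bullet> \<xi>)))"

definition admissible :: "(real^'d::finite \<Rightarrow> real) \<Rightarrow> bool" where
  "admissible \<phi> \<longleftrightarrow> schwartz \<phi> \<and>
     (\<forall>\<xi>. Im (fourier \<phi> \<xi>) = 0 \<and> 0 \<le> Re (fourier \<phi> \<xi>) \<and> Re (fourier \<phi> \<xi>) \<le> 1) \<and>
     (\<forall>\<xi>. norm \<xi> \<le> 1 \<longrightarrow> fourier \<phi> \<xi> = 1) \<and>
     (\<forall>\<xi>. norm \<xi> \<ge> 3/2 \<longrightarrow> fourier \<phi> \<xi> = 0)"

text \<open>phi_k = inverse Fourier transform of phi^_k, written out via dilation: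
  F^{-1}[phi^(2^{-k} .)](x) = 2^{kd} phi(2^k x).\<close>
definition phik :: "(real^'d::finite \<Rightarrow> real) \<Rightarrow> nat \<Rightarrow> real^'d \<Rightarrow> real" where
  "phik \<phi> k x = (if k = 0 then \<phi> x
     else 2 ^ (k * CARD('d)) * \<phi> ((2 ^ k) *\<^sub>R x)
          - 2 ^ ((k - 1) * CARD('d)) * \<phi> ((2 ^ (k - 1)) *\<^sub>R x))"

text \<open>S_k T = F^{-1}[phi^_k T^] = phi_k * T, evaluated pointwise.\<close>
definition Sk :: "(real^'d::finite \<Rightarrow> real) \<Rightarrow> nat \<Rightarrow> ((real^'d \<Rightarrow> real) \<Rightarrow> 'x::banach) \<Rightarrow> real^'d \<Rightarrow> 'x" where
  "Sk \<phi> k T x = T (\<lambda>y. phik \<phi> k (x - y))"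

text \<open>a powr r on [0,\<infinity>] for r > 0.\<close>
definition enn_powr :: "ennreal \<Rightarrow> real \<Rightarrow> ennreal" where
  "enn_powr a r = (if a = top then top else ennreal (enn2real a powr r))"

definition lq_norm :: "ennreal \<Rightarrow> (nat \<Rightarrow> real) \<Rightarrow> ennreal" where
  "lq_norm q a = (if q = top then (SUP k. ennreal \<bar>a k\<bar>)
     else enn_powr (\<Sum>k. ennreal (\<bar>a k\<bar> powr enn2real q)) (1 / enn2real q))"

definition TL_norm :: "(real^'d::finite \<Rightarrow> real) \<Rightarrow> real \<Rightarrow> real \<Rightarrow> ennreal \<Rightarrow> (real^'d \<Rightarrow> real)
     \<Rightarrow> ((real^'d \<Rightarrow> real) \<Rightarrow> 'x::banach) \<Rightarrow> ennreal" where
  "TL_norm \<phi> s p q w T =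
     enn_powr (\<integral>\<^sup>+ x. enn_powr (lq_norm q (\<lambda>k. 2 powr (real k * s) * norm (Sk \<phi> k T x))) p
                        * ennreal (w x) \<partial>lborel) (1 / p)"

definition pw :: "real \<Rightarrow> real^'d::finite \<Rightarrow> real" where
  "pw \<gamma> x = norm x powr \<gamma>"

end

theory Submission
  imports Defs "HOL-Probability.Characteristic_Functions"
begin

text \<open>
  Sufficiency. A frequency block \<open>f\<^sub>k\<close> at scale \<open>2\<^sup>-\<^sup>k\<close> reproduces itself under convolution with a
  rescaled copy of \<open>\<phi>\<close>. Absorbing the ball of radius \<open>c 2\<^sup>-\<^sup>k\<close> around the origin into the left-hand side
  leaves only points at which the power weight is comparable to a constant at scale \<open>2\<^sup>-\<^sup>k\<close>, whatever
  \<open>\<gamma>\<^sub>0\<close> is, so every \<open>f\<^sub>k(x)\<close> is controlled by the weighted \<open>L\<^sup>p\<close> norm. Let \<open>g = sup\<^sub>k 2\<^sup>k\<^sup>s \<bar>f\<^sub>k\<bar>\<close> with \<open>s = s\<^sub>0\<close>.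
  For \<open>2\<^sup>k \<bar>x\<bar> \<le> 1\<close> the blocks are summed by a dyadic Hardy inequality; for \<open>2\<^sup>k \<bar>x\<bar> \<ge> 1\<close> the two bounds of \<open>f\<^sub>k(x)\<close>
  by \<open>g(x)\<close> and by the norm of \<open>g\<close> are balanced in a geometric sum. This embeds the space with
  \<open>q\<^sub>0 = \<infinity>\<close> into the one with \<open>q\<^sub>1 = 1\<close>.

  Necessity. Modulated bumps, whose spectrum meets a single cut-off, are dilated about the origin,
  translated to infinity, and superposed lacunarily; at every point one of two consecutive waves
  has size at least one half since \<open>\<bar>cos t\<bar> \<ge> 1/2\<close> or \<open>\<bar>cos 2t\<bar> \<ge> 1/2\<close>.
\<close>

section \<open>Fourier injectivity and convolution identities\<close>

text \<open>For large \<gamma>0 the weight |x|^\<gamma>0 leaves the Muckenhoupt class of exponent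
  p0, so no maximal inequality is available on the weighted space. Everything rests on pointwise
  bounds drawn from the reproducing formula; only norms of blocks occur in them, which admits any
  Banach space. Put \<epsilon> = \<gamma>0/p0 - \<gamma>1/p1 and \<eta> = d/p0 - d/p1. The second
  alternative reads \<epsilon> >= 0, \<epsilon> + \<eta> > 0, s0 - s1 >= \<epsilon> + \<eta>, and p0
  <= p1 gives \<eta> >= 0. Hence the strict inequality excludes only p0 = p1 with \<gamma>0 =
  \<gamma>1, the setting of the first alternative. Elsewhere a positive exponent is left for a
  geometric sum over k: \<epsilon> if p0 = p1, \<eta> if p0 < p1. This slack pays for replacing a
  supremum over k by a sum. In the excluded case weights and exponents give no gain, and the
  sequence norms are compared directly. Conversely, dilates yield the inequality between s0 and s1,
  translates yield \<epsilon> >= 0, and lacunary sums yield q0 <= q1 when \<epsilon> = \<eta> = 0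
  and s0 = s1.\<close>

lemma lborel_integrable_prod_Basis:
  fixes f :: "'a::euclidean_space \<Rightarrow> real \<Rightarrow> complex"
  assumes "\<And>b. b \<in> Basis \<Longrightarrow> integrable lborel (f b)"
  shows "integrable lborel (\<lambda>x::'a. \<Prod>b\<in>Basis. f b (x \<bullet> b))"
    and "integral\<^sup>L lborel (\<lambda>x::'a. \<Prod>b\<in>Basis. f b (x \<bullet> b)) = (\<Prod>b\<in>Basis. integral\<^sup>L lborel (f b))"
proof -
  interpret product_sigma_finite "\<lambda>_::'a. lborel :: real measure" ..
  have lb: "(lborel :: 'a measure) = distr (\<Pi>\<^sub>M b\<in>Basis. lborel) borel (\<lambda>f. \<Sum>b\<in>Basis. f b *\<^sub>R b)"
    using lborel_def[where 'a='a] by (simp add: lborel_eq_real)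
  have meas: "(\<lambda>x::'a. \<Prod>b\<in>Basis. f b (x \<bullet> b)) \<in> borel_measurable borel"
    using assms by (intro borel_measurable_prod) (auto intro!: measurable_compose[where g="f _" and N=borel] dest!: borel_measurable_integrable)
  have inn: "(\<Sum>b\<in>Basis. g b *\<^sub>R b) \<bullet> b = g b" if "b \<in> Basis" for g and b :: 'a
    using that by simp
  have eq: "(\<Prod>b\<in>Basis. f b ((\<Sum>b\<in>Basis. g b *\<^sub>R b) \<bullet> b)) = (\<Prod>b\<in>Basis. f b (g b))" for g
    by (intro prod.cong) auto
  have mm: "(\<lambda>f. \<Sum>b\<in>Basis. f b *\<^sub>R b) \<in> measurable (\<Pi>\<^sub>M b\<in>Basis. lborel) (borel::'a measure)"
    by measurable
  have i: "integrable (\<Pi>\<^sub>M b\<in>Basis. lborel) (\<lambda>g. \<Prod>b\<in>Basis. f b (g b))"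
    using assms by (intro product_integrable_prod) auto
  show "integrable lborel (\<lambda>x::'a. \<Prod>b\<in>Basis. f b (x \<bullet> b))"
    unfolding lb by (subst integrable_distr_eq[OF mm]) (use meas eq i in auto)
  show "integral\<^sup>L lborel (\<lambda>x::'a. \<Prod>b\<in>Basis. f b (x \<bullet> b)) = (\<Prod>b\<in>Basis. integral\<^sup>L lborel (f b))"
    unfolding lb using assms
    by (subst integral_distr[OF mm]) (auto simp: meas eq intro!: product_integral_prod)
qed

text \<open>The value is the characteristic function of the standard normal law, multiplied by the
  factor sqrt (2 pi) that separates the exponential from its density.\<close>

lemma gaussian_fourier_1:
  fixes s :: real
  shows "integrable lborel (\<lambda>t. cis (s * t) * complex_of_real (exp (- t\<^sup>2 / 2)))"
    and "integral\<^sup>L lborel (\<lambda>t. cis (s * t) * complex_of_real (exp (- t\<^sup>2 / 2)))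
      = complex_of_real (sqrt (2 * pi) * exp (- s\<^sup>2 / 2))"
proof -
  have i: "integrable lborel (\<lambda>t. complex_of_real (std_normal_density t))"
    using integrable_std_normal_moment[of 0] by (auto simp: complex_of_real_integrable_eq)
  have d: "complex_of_real (exp (- t\<^sup>2 / 2)) = complex_of_real (sqrt (2 * pi)) * complex_of_real (std_normal_density t)" for t
    by (simp add: std_normal_density_def exp_minus del: of_real_divide flip: of_real_mult)
  have i2: "integrable lborel (\<lambda>t. cis (s * t) * complex_of_real (std_normal_density t))"
    by (rule Bochner_Integration.integrable_bound[OF i]) (auto simp: norm_mult cis_conv_exp)
  show "integrable lborel (\<lambda>t. cis (s * t) * complex_of_real (exp (- t\<^sup>2 / 2)))"
    unfolding d using integrable_mult_right[OF i2, of "complex_of_real (sqrt (2 * pi))"] by (simp add: ac_simps)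
  have "char std_normal_distribution s = integral\<^sup>L lborel (\<lambda>t. std_normal_density t *\<^sub>R iexp (s * t))"
    unfolding char_def by (subst integral_density) auto
  also have "\<dots> = integral\<^sup>L lborel (\<lambda>t. cis (s * t) * complex_of_real (std_normal_density t))"
    by (intro Bochner_Integration.integral_cong) (auto simp: scaleR_conv_of_real cis_conv_exp ac_simps)
  finally have e: "integral\<^sup>L lborel (\<lambda>t. cis (s * t) * complex_of_real (std_normal_density t)) = complex_of_real (exp (- s\<^sup>2 / 2))"
    by (simp add: char_std_normal_distribution)
  have "integral\<^sup>L lborel (\<lambda>t. cis (s * t) * complex_of_real (exp (- t\<^sup>2 / 2)))
    = integral\<^sup>L lborel (\<lambda>t. complex_of_real (sqrt (2 * pi)) * (cis (s * t) * complex_of_real (std_normal_density t)))"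
    unfolding d by (simp add: ac_simps)
  also have "\<dots> = complex_of_real (sqrt (2 * pi) * exp (- s\<^sup>2 / 2))"
    unfolding integral_mult_right_zero e by simp
  finally show "integral\<^sup>L lborel (\<lambda>t. cis (s * t) * complex_of_real (exp (- t\<^sup>2 / 2)))
      = complex_of_real (sqrt (2 * pi) * exp (- s\<^sup>2 / 2))" .
qed

lemma cis_sum: "finite A \<Longrightarrow> cis (\<Sum>a\<in>A. f a) = (\<Prod>a\<in>A. cis (f a))"
  by (induction A rule: finite_induct) (auto simp flip: cis_mult)

text \<open>The Gaussian and the character both factor over an orthonormal basis, so the transform
  is a product of one-dimensional ones.\<close>

lemma gaussian_fourier:
  fixes x :: "'a::euclidean_space"
  shows "integrable lborel (\<lambda>\<xi>::'a. cis (x \<bullet> \<xi>) * complex_of_real (exp (- (norm \<xi>)\<^sup>2 / 2)))"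
    and "integral\<^sup>L lborel (\<lambda>\<xi>::'a. cis (x \<bullet> \<xi>) * complex_of_real (exp (- (norm \<xi>)\<^sup>2 / 2)))
      = complex_of_real (sqrt (2 * pi) ^ DIM('a) * exp (- (norm x)\<^sup>2 / 2))"
proof -
  define f where "f = (\<lambda>(b::'a) t. cis ((x \<bullet> b) * t) * complex_of_real (exp (- t\<^sup>2 / 2)))"
  have n2: "exp (- (norm y)\<^sup>2 / 2) = (\<Prod>b\<in>Basis. exp (- (y \<bullet> b)\<^sup>2 / 2))" for y :: 'a
  proof -
    have "- (norm y)\<^sup>2 / 2 = (\<Sum>b\<in>Basis. - (y \<bullet> b)\<^sup>2 / 2)"
      unfolding power2_norm_eq_inner euclidean_inner[of y y] by (simp add: power2_eq_square sum_divide_distrib sum_negf)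
    thus ?thesis by (simp add: exp_sum)
  qed
  have eq: "cis (x \<bullet> \<xi>) * complex_of_real (exp (- (norm \<xi>)\<^sup>2 / 2)) = (\<Prod>b\<in>Basis. f b (\<xi> \<bullet> b))" for \<xi>
    unfolding f_def n2 prod.distrib euclidean_inner[of x \<xi>] by (simp add: cis_sum)
  have fi: "integrable lborel (f b)" for b
    unfolding f_def by (rule gaussian_fourier_1)
  have fv: "integral\<^sup>L lborel (f b) = complex_of_real (sqrt (2 * pi) * exp (- (x \<bullet> b)\<^sup>2 / 2))" for b
    unfolding f_def by (rule gaussian_fourier_1)
  show "integrable lborel (\<lambda>\<xi>::'a. cis (x \<bullet> \<xi>) * complex_of_real (exp (- (norm \<xi>)\<^sup>2 / 2)))"
    unfolding eq by (rule lborel_integrable_prod_Basis(1)[OF fi])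
  show "integral\<^sup>L lborel (\<lambda>\<xi>::'a. cis (x \<bullet> \<xi>) * complex_of_real (exp (- (norm \<xi>)\<^sup>2 / 2)))
      = complex_of_real (sqrt (2 * pi) ^ DIM('a) * exp (- (norm x)\<^sup>2 / 2))"
    unfolding eq lborel_integrable_prod_Basis(2)[OF fi] fv unfolding n2 by (simp add: prod.distrib)
qed

lemma integral_lborel_affine:
  fixes f :: "'a::euclidean_space \<Rightarrow> 'b::{banach, second_countable_topology}"
  assumes "f \<in> borel_measurable borel" "c \<noteq> 0"
  shows "integral\<^sup>L lborel f = \<bar>c\<bar> ^ DIM('a) *\<^sub>R integral\<^sup>L lborel (\<lambda>x. f (t + c *\<^sub>R x))"
  using assms by (subst lborel_affine[OF assms(2), of t]) (simp add: integral_density integral_distr)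

lemma nn_integral_lborel_affine:
  fixes f :: "'a::euclidean_space \<Rightarrow> ennreal"
  assumes "f \<in> borel_measurable borel" "c \<noteq> 0"
  shows "(\<integral>\<^sup>+x. f x \<partial>lborel) = ennreal (\<bar>c\<bar> ^ DIM('a)) * (\<integral>\<^sup>+x. f (t + c *\<^sub>R x) \<partial>lborel)"
  using assms by (subst lborel_affine[OF assms(2), of t])
    (simp add: nn_integral_density nn_integral_distr nn_integral_cmult)

lemma integrable_lborel_affine:
  fixes f :: "'a::euclidean_space \<Rightarrow> 'b::{banach, second_countable_topology}"
  assumes "integrable lborel f" "c \<noteq> 0"
  shows "integrable lborel (\<lambda>x. f (t + c *\<^sub>R x))"
proof -
  have f: "f \<in> borel_measurable borel" using assms by auto
  have "integrable (density (distr lborel borel (\<lambda>x. t + c *\<^sub>R x)) (\<lambda>_. ennreal (\<bar>c\<bar> ^ DIM('a)))) f"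
    using assms lborel_affine[OF assms(2), of t] by simp
  hence "integrable lborel (\<lambda>x. \<bar>c\<bar> ^ DIM('a) *\<^sub>R f (t + c *\<^sub>R x))"
    using f by (subst (asm) integrable_density) (auto simp: integrable_distr_eq)
  hence "integrable lborel (\<lambda>x. inverse (\<bar>c\<bar> ^ DIM('a)) *\<^sub>R (\<bar>c\<bar> ^ DIM('a) *\<^sub>R f (t + c *\<^sub>R x)))"
    by (rule integrable_scaleR_right)
  thus ?thesis using assms(2) by simp
qed

text \<open>Pairing the vanishing transform with a Gaussian shows that all Gaussian averages of the
  function vanish; shrinking the Gaussian recovers the point values.\<close>
lemma fourier_injective:
  fixes h :: "'a::euclidean_space \<Rightarrow> real"
  assumes i: "integrable lborel h" and c: "continuous_on UNIV h" and b: "\<And>x. \<bar>h x\<bar> \<le> B"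
    and z: "\<And>\<xi>. integral\<^sup>L lborel (\<lambda>x. complex_of_real (h x) * cis (- (x \<bullet> \<xi>))) = 0"
  shows "h a = 0"
proof -
  define g where "g = (\<lambda>y::'a. exp (- (norm y)\<^sup>2 / 2))"
  have gm[measurable]: "g \<in> borel_measurable borel" unfolding g_def by measurable
  have hm[measurable]: "h \<in> borel_measurable borel" using c by (simp add: borel_measurable_continuous_onI)
  have gi: "integrable lborel g"
    using gaussian_fourier(1)[of "0::'a"] by (simp add: g_def complex_of_real_integrable_eq)
  have gpos: "integral\<^sup>L lborel g = sqrt (2 * pi) ^ DIM('a)"
    using gaussian_fourier(2)[of "0::'a"]
    by (simp add: g_def flip: of_real_power of_real_mult)
  have zero: "integral\<^sup>L lborel (\<lambda>x. h (a + e *\<^sub>R x) * g x) = 0" if e: "e > 0" for e :: real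
  proof -
    \<comment> \<open>Integrating \<open>k\<close> over x first gives the transform of a rescaled
      \<open>h\<close>, hence zero; integrating over \<xi> first gives the Gaussian back, which is
      its own transform up to a constant.\<close>
    define k where "k = (\<lambda>(x::'a) \<xi>. complex_of_real (h (a + e *\<^sub>R x)) * cis (- (x \<bullet> \<xi>)) * complex_of_real (g \<xi>))"
    have km: "case_prod k \<in> borel_measurable (lborel \<Otimes>\<^sub>M lborel)"
      unfolding k_def split_beta' cis_conv_exp by measurable
    have hi: "integrable lborel (\<lambda>x. h (a + e *\<^sub>R x))"
      using integrable_lborel_affine[OF i, of e a] e by simp
    have ki: "integrable (lborel \<Otimes>\<^sub>M lborel) (case_prod k)"
    proof (rule lborel_pair.Fubini_integrable[OF km])
      have "(LINT y|lborel. norm (case (x, y) of (x, y) \<Rightarrow> k x y)) = \<bar>h (a + e *\<^sub>R x)\<bar> * integral\<^sup>L lborel g" for x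
        by (simp add: k_def norm_mult g_def)
      thus "integrable lborel (\<lambda>x. LINT y|lborel. norm (case (x, y) of (x, y) \<Rightarrow> k x y))"
        using hi by (simp)
      show "AE x in lborel. integrable lborel (\<lambda>y. case (x, y) of (x, y) \<Rightarrow> k x y)"
      proof (rule AE_I2)
        fix x
        have "integrable lborel (\<lambda>y. complex_of_real (h (a + e *\<^sub>R x)) * (cis ((-x) \<bullet> y) * complex_of_real (g y)))"
          unfolding g_def by (intro integrable_mult_right gaussian_fourier(1))
        thus "integrable lborel (\<lambda>y. case (x, y) of (x, y) \<Rightarrow> k x y)"
          by (simp add: k_def mult.assoc)
      qed
    qed
    have A: "(LINT y|lborel. LINT x|lborel. k x y) = (LINT x|lborel. LINT y|lborel. k x y)"
      using lborel_pair.Fubini_integral[OF ki] by simp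
    have in0: "(LINT x|lborel. k x y) = 0" for y
    proof -
      have "(LINT x|lborel. k x y) = (LINT x|lborel. complex_of_real (h (a + e *\<^sub>R x)) * cis (- (x \<bullet> y))) * complex_of_real (g y)"
        unfolding k_def by simp
      moreover have "(LINT x|lborel. complex_of_real (h (a + e *\<^sub>R x)) * cis (- (x \<bullet> y))) = 0"
      proof -
        \<comment> \<open>The frequency y/e is chosen so that the substitution by a + e x restores
          the frequency y; what is left over is a constant phase, which does not vanish and can be
          removed.\<close>
        have "0 = (LINT x|lborel. complex_of_real (h x) * cis (- (x \<bullet> (y /\<^sub>R e))))" using z[of "y /\<^sub>R e"] by simp
        also have "\<dots> = \<bar>e\<bar> ^ DIM('a) *\<^sub>R (LINT x|lborel. complex_of_real (h (a + e *\<^sub>R x)) * cis (- ((a + e *\<^sub>R x) \<bullet> (y /\<^sub>R e))))"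
          using e by (intro integral_lborel_affine) (auto simp: cis_conv_exp)
        also have "(\<lambda>x. complex_of_real (h (a + e *\<^sub>R x)) * cis (- ((a + e *\<^sub>R x) \<bullet> (y /\<^sub>R e))))
           = (\<lambda>x. cis (- (a \<bullet> y) / e) * (complex_of_real (h (a + e *\<^sub>R x)) * cis (- (x \<bullet> y))))"
        proof
          fix x
          have ph: "- ((a + e *\<^sub>R x) \<bullet> (y /\<^sub>R e)) = - (a \<bullet> y) / e + - (x \<bullet> y)"
            using e by (simp add: inner_simps field_simps)
          show "complex_of_real (h (a + e *\<^sub>R x)) * cis (- ((a + e *\<^sub>R x) \<bullet> (y /\<^sub>R e)))
            = cis (- (a \<bullet> y) / e) * (complex_of_real (h (a + e *\<^sub>R x)) * cis (- (x \<bullet> y)))"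
            unfolding ph cis_mult[symmetric] by (simp add: ac_simps)
        qed
        finally show ?thesis using e by simp
      qed
      ultimately show ?thesis by simp
    qed
    have in1: "(LINT y|lborel. k x y) = complex_of_real (sqrt (2 * pi) ^ DIM('a) * (h (a + e *\<^sub>R x) * g x))" for x
    proof -
      have "(LINT y|lborel. k x y) = complex_of_real (h (a + e *\<^sub>R x)) * (LINT y|lborel. cis ((-x) \<bullet> y) * complex_of_real (g y))"
        unfolding k_def by (simp add: mult.assoc)
      thus ?thesis unfolding g_def by (subst (asm) gaussian_fourier(2)) simp
    qed
    from A have "0 = (LINT x|lborel. complex_of_real (sqrt (2 * pi) ^ DIM('a) * (h (a + e *\<^sub>R x) * g x)))"
      unfolding in0 in1 by simp
    also have "\<dots> = complex_of_real (LINT x|lborel. sqrt (2 * pi) ^ DIM('a) * (h (a + e *\<^sub>R x) * g x))"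
      by (rule integral_complex_of_real)
    finally have "sqrt (2 * pi) ^ DIM('a) * (LINT x|lborel. (h (a + e *\<^sub>R x) * g x)) = 0"
      unfolding integral_mult_right_zero by (metis of_real_eq_0_iff)
    thus ?thesis by simp
  qed
  have "(\<lambda>n. integral\<^sup>L lborel (\<lambda>x. h (a + (1 / Suc n) *\<^sub>R x) * g x)) \<longlonglongrightarrow> integral\<^sup>L lborel (\<lambda>x. h a * g x)"
  proof (rule integral_dominated_convergence[where w="\<lambda>x. B * g x"])
    show "AE x in lborel. (\<lambda>n. h (a + (1 / Suc n) *\<^sub>R x) * g x) \<longlonglongrightarrow> h a * g x"
    proof (intro AE_I2 tendsto_intros)
      fix x
      have "(\<lambda>n. a + (1 / Suc n) *\<^sub>R x) \<longlonglongrightarrow> a + 0 *\<^sub>R x"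
        by (intro tendsto_intros LIMSEQ_inverse_real_of_nat[unfolded inverse_eq_divide])
      thus "(\<lambda>n. h (a + (1 / Suc n) *\<^sub>R x)) \<longlonglongrightarrow> h a"
        using c by (intro continuous_on_tendsto_compose[of UNIV h]) auto
    qed
    show "AE x in lborel. norm (h (a + (1 / Suc n) *\<^sub>R x) * g x) \<le> B * g x" for n
      using b by (auto simp: abs_mult g_def intro!: mult_right_mono)
  qed (use gi in auto)
  hence "(\<lambda>n::nat. 0) \<longlonglongrightarrow> h a * sqrt (2 * pi) ^ DIM('a)"
    using zero gpos by simp
  hence "h a * sqrt (2 * pi) ^ DIM('a) = 0" by (simp add: LIMSEQ_const_iff)
  thus ?thesis by simp
qed

text \<open>The difference of the two sides is integrable, continuous and bounded, and its transform
  vanishes by Fubini and the hypothesis on \<open>fourier\<close>; \<open>fourier_injective\<close>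
  makes it zero at every point. The factor (2 pi)^(d/2) comes from the symmetric normalisation of
  the transform. In the applications \<open>m\<close> is 0 or 1, according to whether a cut-off
  kills or preserves \<open>h\<close>.\<close>

lemma convolution_eqI:
  fixes u v h :: "real^'d::finite \<Rightarrow> real"
  assumes i: "integrable lborel u" "integrable lborel v" "integrable lborel h"
    and c: "continuous_on UNIV u" "continuous_on UNIV h"
    and b: "\<And>x. \<bar>u x\<bar> \<le> B" "\<And>x. \<bar>h x\<bar> \<le> B'"
    and F: "\<And>\<xi>. fourier u \<xi> * fourier v \<xi> = of_real m * fourier h \<xi>"
  shows "integral\<^sup>L lborel (\<lambda>y. u (x - y) * v y) = (2 * pi) powr (real CARD('d) / 2) * m * h x"
proof -
  define \<kappa> where "\<kappa> = (2 * pi) powr (real CARD('d) / 2)"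
  have k0: "\<kappa> > 0" by (simp add: \<kappa>_def)
  have ki: "(2 * pi) powr (- real CARD('d) / 2) = inverse \<kappa>" by (simp add: \<kappa>_def powr_minus)
  define FT where "FT = (\<lambda>f (\<xi>::real^'d). LINT x|lborel. complex_of_real (f x) * cis (- (x \<bullet> \<xi>)))"
  have fo: "fourier f \<xi> = of_real (inverse \<kappa>) * FT f \<xi>" for f \<xi>
    unfolding fourier_def FT_def ki ..
  have FT: "FT u \<xi> * FT v \<xi> = of_real (\<kappa> * m) * FT h \<xi>" for \<xi>
  proof -
    have "FT u \<xi> * FT v \<xi> = of_real \<kappa> * of_real \<kappa> * (fourier u \<xi> * fourier v \<xi>)"
      using k0 by (simp add: fo field_simps)
    thus ?thesis unfolding F using k0 by (simp add: fo)
  qed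
  have [measurable]: "u \<in> borel_measurable borel" "v \<in> borel_measurable borel" "h \<in> borel_measurable borel"
    using i by auto
  have cis_meas[measurable]: "(\<lambda>x. cis (- (x \<bullet> \<xi>))) \<in> borel_measurable borel" for \<xi> :: "real^'d"
    unfolding cis_conv_exp by measurable
  have tr: "integrable lborel (\<lambda>x. u (x - y))" for y
    using integrable_lborel_affine[OF i(1), of 1 "-y"] by simp
  have ucis: "integrable lborel (\<lambda>x. complex_of_real (u x) * cis (- (x \<bullet> \<xi>)))" for \<xi>
    by (rule Bochner_Integration.integrable_bound[OF i(1)]) (auto simp: norm_mult)
  have hcis: "integrable lborel (\<lambda>x. complex_of_real (h x) * cis (- (x \<bullet> \<xi>)))" for \<xi>
    by (rule Bochner_Integration.integrable_bound[OF i(3)]) (auto simp: norm_mult)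
  have shift: "(LINT x|lborel. f (x - y)) = (LINT x|lborel. f x)" if "f \<in> borel_measurable borel" for f :: "real^'d \<Rightarrow> real" and y
    using integral_lborel_affine[of f 1 "-y"] that by simp
  have shiftc: "(LINT x|lborel. f (x - y)) = (LINT x|lborel. f x)" if "f \<in> borel_measurable borel" for f :: "real^'d \<Rightarrow> complex" and y
    using integral_lborel_affine[of f 1 "-y"] that by simp
  have prod: "integrable (lborel \<Otimes>\<^sub>M lborel) (\<lambda>(y, x). u (x - y) * v y)"
  proof (rule lborel_pair.Fubini_integrable)
    have "(LINT x|lborel. norm (case (y, x) of (y, x) \<Rightarrow> u (x - y) * v y)) = (LINT x|lborel. \<bar>u x\<bar>) * \<bar>v y\<bar>" for y
      using shift[of "\<lambda>x. \<bar>u x\<bar>" y] by (simp add: abs_mult)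
    thus "integrable lborel (\<lambda>y. LINT x|lborel. norm (case (y, x) of (y, x) \<Rightarrow> u (x - y) * v y))"
      using i(2) by simp
    show "AE y in lborel. integrable lborel (\<lambda>x. case (y, x) of (y, x) \<Rightarrow> u (x - y) * v y)"
      using tr by simp
  qed simp
  have B: "0 \<le> B" using b(1)[of 0] by linarith
  have uv: "integrable lborel (\<lambda>y. u (x - y) * v y)" for x
    by (rule Bochner_Integration.integrable_bound[of _ "\<lambda>y. B * v y"])
      (use i(2) b(1) B in \<open>auto simp: abs_mult intro!: mult_right_mono\<close>)
  define w where "w = (\<lambda>x. (LINT y|lborel. u (x - y) * v y) - \<kappa> * m * h x)"
  have ci: "integrable lborel (\<lambda>x. LINT y|lborel. u (x - y) * v y)"
    using lborel_pair.integrable_snd[OF prod] by simp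
  have "w x = 0"
  proof (rule fourier_injective[where h=w and a=x and B="(LINT y|lborel. B * \<bar>v y\<bar>) + \<kappa> * \<bar>m\<bar> * B'"])
    show "integrable lborel w" unfolding w_def using ci i(3) by simp
    \<comment> \<open>Continuity is inherited from \<open>u\<close> by dominated convergence with
      majorant B |v|; of \<open>v\<close> only integrability is known.\<close>
    have "continuous_on UNIV (\<lambda>x. LINT y|lborel. u (x - y) * v y)"
      unfolding continuous_on_sequentially
    proof (intro allI ballI impI)
      fix X a assume X: "(\<forall>n. X n \<in> (UNIV::(real^'d) set)) \<and> X \<longlonglongrightarrow> a"
      show "((\<lambda>x. LINT y|lborel. u (x - y) * v y) \<circ> X) \<longlonglongrightarrow> (LINT y|lborel. u (a - y) * v y)"
        unfolding o_def
      proof (rule integral_dominated_convergence[where w="\<lambda>y. B * \<bar>v y\<bar>"])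
        show "AE y in lborel. (\<lambda>n. u (X n - y) * v y) \<longlonglongrightarrow> u (a - y) * v y"
          using X by (intro AE_I2 tendsto_intros continuous_on_tendsto_compose[OF c(1)]) auto
        show "AE y in lborel. norm (u (X n - y) * v y) \<le> B * \<bar>v y\<bar>" for n
          using b(1) by (auto simp: abs_mult intro!: mult_right_mono)
      qed (use i(2) in auto)
    qed
    thus "continuous_on UNIV w" unfolding w_def using c by (intro continuous_intros)
    fix z
    have "\<bar>LINT y|lborel. u (z - y) * v y\<bar> \<le> (LINT y|lborel. B * \<bar>v y\<bar>)"
      using integrable_abs[OF uv[of z]] i(2) b(1) by (intro order_trans[OF integral_abs_bound] integral_mono)
        (auto simp: abs_mult intro!: mult_right_mono)
    moreover have "\<bar>\<kappa> * m * h z\<bar> \<le> \<kappa> * \<bar>m\<bar> * B'"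
      using b(2)[of z] k0 by (auto simp: abs_mult intro!: mult_left_mono)
    ultimately show "\<bar>w z\<bar> \<le> (LINT y|lborel. B * \<bar>v y\<bar>) + \<kappa> * \<bar>m\<bar> * B'"
      unfolding w_def by linarith
  next
    fix \<xi> :: "real^'d"
    have p2: "integrable (lborel \<Otimes>\<^sub>M lborel) (\<lambda>(y, x). complex_of_real (u (x - y) * v y) * cis (- (x \<bullet> \<xi>)))"
      by (rule Bochner_Integration.integrable_bound[OF prod]) (auto simp: norm_mult split_beta')
    have "(LINT x|lborel. complex_of_real (LINT y|lborel. u (x - y) * v y) * cis (- (x \<bullet> \<xi>)))
      = (LINT x|lborel. LINT y|lborel. complex_of_real (u (x - y) * v y) * cis (- (x \<bullet> \<xi>)))"
      unfolding integral_complex_of_real[symmetric] integral_mult_left_zero[symmetric] ..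
    also have "\<dots> = (LINT y|lborel. LINT x|lborel. complex_of_real (u (x - y) * v y) * cis (- (x \<bullet> \<xi>)))"
      using lborel_pair.Fubini_integral[OF p2] by simp
    also have "\<dots> = (LINT y|lborel. FT u \<xi> * (complex_of_real (v y) * cis (- (y \<bullet> \<xi>))))"
    proof (intro Bochner_Integration.integral_cong refl)
      fix y
      have "(LINT x|lborel. complex_of_real (u (x - y) * v y) * cis (- (x \<bullet> \<xi>)))
        = (LINT x|lborel. (complex_of_real (u (x - y)) * cis (- ((x - y) \<bullet> \<xi>))) * (complex_of_real (v y) * cis (- (y \<bullet> \<xi>))))"
        by (intro Bochner_Integration.integral_cong) (auto simp: inner_simps cis_mult ac_simps)
      also have "\<dots> = (LINT x|lborel. (complex_of_real (u (x - y)) * cis (- ((x - y) \<bullet> \<xi>)))) * (complex_of_real (v y) * cis (- (y \<bullet> \<xi>)))"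
        by (rule integral_mult_left_zero)
      finally show "(LINT x|lborel. complex_of_real (u (x - y) * v y) * cis (- (x \<bullet> \<xi>)))
       = FT u \<xi> * (complex_of_real (v y) * cis (- (y \<bullet> \<xi>)))"
        using shiftc[of "\<lambda>x. complex_of_real (u x) * cis (- (x \<bullet> \<xi>))" y] by (simp add: FT_def)
    qed
    also have "\<dots> = FT u \<xi> * FT v \<xi>"
      unfolding FT_def by (rule integral_mult_right_zero)
    finally have A: "(LINT x|lborel. complex_of_real (LINT y|lborel. u (x - y) * v y) * cis (- (x \<bullet> \<xi>))) = FT u \<xi> * FT v \<xi>" .
    have "(LINT x|lborel. complex_of_real (w x) * cis (- (x \<bullet> \<xi>)))
      = (LINT x|lborel. complex_of_real (LINT y|lborel. u (x - y) * v y) * cis (- (x \<bullet> \<xi>))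
          - of_real (\<kappa> * m) * (complex_of_real (h x) * cis (- (x \<bullet> \<xi>))))"
      unfolding w_def by (intro Bochner_Integration.integral_cong) (auto simp: algebra_simps)
    also have "\<dots> = FT u \<xi> * FT v \<xi> - of_real (\<kappa> * m) * FT h \<xi>"
    proof (subst Bochner_Integration.integral_diff)
      show "(LINT x|lborel. complex_of_real (LINT y|lborel. u (x - y) * v y) * cis (- (x \<bullet> \<xi>)))
        - (LINT x|lborel. of_real (\<kappa> * m) * (complex_of_real (h x) * cis (- (x \<bullet> \<xi>))))
        = FT u \<xi> * FT v \<xi> - of_real (\<kappa> * m) * FT h \<xi>"
        unfolding A FT_def integral_mult_right_zero ..
      show "integrable lborel (\<lambda>x. complex_of_real (LINT y|lborel. u (x - y) * v y) * cis (- (x \<bullet> \<xi>)))"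
        by (rule Bochner_Integration.integrable_bound[OF ci]) (use ci in \<open>auto simp: norm_mult dest!: borel_measurable_integrable\<close>)
    qed (intro integrable_mult_right hcis)
    finally show "(LINT x|lborel. complex_of_real (w x) * cis (- (x \<bullet> \<xi>))) = 0" using FT by simp
  qed
  thus ?thesis by (simp add: w_def \<kappa>_def)
qed

lemma fourier_dilate:
  fixes f :: "real^'d::finite \<Rightarrow> real"
  assumes "f \<in> borel_measurable borel" "c > 0"
  shows "fourier (\<lambda>x. c ^ CARD('d) * f (c *\<^sub>R x)) \<xi> = fourier f (\<xi> /\<^sub>R c)"
proof -
  have [measurable]: "(\<lambda>x. cis (- (x \<bullet> \<xi>))) \<in> borel_measurable borel" for \<xi> :: "real^'d"
    unfolding cis_conv_exp by measurable
  have "(LINT x|lborel. complex_of_real (f x) * cis (- (x \<bullet> (\<xi> /\<^sub>R c))))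
    = c ^ CARD('d) *\<^sub>R (LINT x|lborel. complex_of_real (f (0 + c *\<^sub>R x)) * cis (- ((0 + c *\<^sub>R x) \<bullet> (\<xi> /\<^sub>R c))))"
    using assms by (subst integral_lborel_affine[of _ c 0]) (auto simp del: inner_scaleR_right)
  also have "\<dots> = (LINT x|lborel. complex_of_real (c ^ CARD('d) * f (c *\<^sub>R x)) * cis (- (x \<bullet> \<xi>)))"
  proof -
    have "(0 + c *\<^sub>R x) \<bullet> (\<xi> /\<^sub>R c) = x \<bullet> \<xi>" for x using assms by simp
    hence eq: "c ^ CARD('d) *\<^sub>R (LINT x|lborel. complex_of_real (f (0 + c *\<^sub>R x)) * cis (- ((0 + c *\<^sub>R x) \<bullet> (\<xi> /\<^sub>R c))))
      = (LINT x|lborel. c ^ CARD('d) *\<^sub>R (complex_of_real (f (c *\<^sub>R x)) * cis (- (x \<bullet> \<xi>))))"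
      by (simp only: integral_scaleR_right add_0)
    show ?thesis unfolding eq by (simp add: scaleR_conv_of_real[where 'a=complex] mult.assoc)
  qed
  finally show ?thesis by (simp add: fourier_def)
qed

section \<open>Schwartz functions and tempered distributions\<close>

lemma ennreal_le_suminf: "f j \<le> (\<Sum>j. f j :: ennreal)"
  using sum_le_suminf[of f "{j}"] by auto

text \<open>If j is least with |x| <= 2^j, then 2^j <= 2 (1 + |x|), so the integrand is at most 2^M
  2^(-jM) on a ball of volume proportional to 2^(jd). The resulting series has ratio 2^(d - M) <
  1.\<close>

lemma poly_decay_nn_integral:
  assumes M: "M > DIM('a::euclidean_space)"
  shows "(\<integral>\<^sup>+(x::'a). ennreal (1 / (1 + norm x) ^ M) \<partial>lborel) < \<infinity>"
proof -
  define V where "V = unit_ball_vol (real DIM('a))"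
  have V: "V \<ge> 0" by (simp add: V_def)
  have "(\<integral>\<^sup>+(x::'a). ennreal (1 / (1 + norm x) ^ M) \<partial>lborel)
    \<le> (\<integral>\<^sup>+(x::'a). (\<Sum>j. ennreal (2 ^ M / 2 ^ (j * M)) * indicator (cball 0 (2 ^ j)) x) \<partial>lborel)"
  proof (rule nn_integral_mono)
    fix x :: 'a
    obtain n where "norm x < 2 ^ n" using real_arch_pow[of 2 "norm x"] by auto
    hence ex: "norm x \<le> 2 ^ n" by simp
    define j where "j = (LEAST j. norm x \<le> 2 ^ j)"
    have j: "norm x \<le> 2 ^ j" unfolding j_def by (rule LeastI[of "\<lambda>j. norm x \<le> 2 ^ j", OF ex])
    have "2 ^ j \<le> 2 * (1 + norm x)"
    proof (cases j)
      case (Suc i)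
      hence "\<not> norm x \<le> 2 ^ i" using not_less_Least[of i "\<lambda>j. norm x \<le> 2 ^ j"] by (simp add: j_def)
      thus ?thesis using Suc by simp
    qed simp
    hence "(2 ^ j) ^ M \<le> 2 ^ M * (1 + norm x) ^ M"
      unfolding power_mult_distrib[symmetric] by (intro power_mono) auto
    moreover have "(1 + norm x) ^ M > 0" by (intro zero_less_power) (simp add: add_pos_nonneg)
    ultimately have "1 / (1 + norm x) ^ M \<le> 2 ^ M / 2 ^ (j * M)"
      unfolding power_mult by (simp add: field_simps)
    hence "ennreal (1 / (1 + norm x) ^ M) \<le> ennreal (2 ^ M / 2 ^ (j * M)) * indicator (cball 0 (2 ^ j)) x"
      using j by (auto simp: indicator_def intro!: ennreal_leI)
    also have "\<dots> \<le> (\<Sum>j. ennreal (2 ^ M / 2 ^ (j * M)) * indicator (cball 0 (2 ^ j)) x)"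
      by (rule ennreal_le_suminf)
    finally show "ennreal (1 / (1 + norm x) ^ M) \<le> (\<Sum>j. ennreal (2 ^ M / 2 ^ (j * M)) * indicator (cball 0 (2 ^ j)) x)" .
  qed
  also have "\<dots> = (\<Sum>j. ennreal (2 ^ M / 2 ^ (j * M)) * emeasure lborel (cball (0::'a) (2 ^ j)))"
  proof (subst nn_integral_suminf)
    show "(\<lambda>x::'a. ennreal (2 ^ M / 2 ^ (j * M)) * indicator (cball 0 (2 ^ j)) x) \<in> borel_measurable lborel" for j
    proof -
      have [measurable]: "cball (0::'a) (2 ^ j) \<in> sets borel" by simp
      show ?thesis by measurable
    qed
  qed (intro suminf_cong nn_integral_cmult_indicator, simp)
  also have "\<dots> = (\<Sum>j. ennreal (2 ^ M * V * ((1/2) ^ (M - DIM('a))) ^ j))"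
  proof (intro suminf_cong)
    fix j
    have "(2::real) ^ (j * M) = 2 ^ (j * (M - DIM('a))) * 2 ^ (j * DIM('a))"
      using M by (simp flip: power_add add: algebra_simps diff_mult_distrib2)
    hence "2 ^ M / 2 ^ (j * M) * (V * (2 ^ j) ^ DIM('a)) = 2 ^ M * V * ((1/2) ^ (M - DIM('a))) ^ j"
    proof -
      assume e: "(2::real) ^ (j * M) = 2 ^ (j * (M - DIM('a))) * 2 ^ (j * DIM('a))"
      have "((1/2::real) ^ (M - DIM('a))) ^ j = 1 / 2 ^ (j * (M - DIM('a)))"
        by (simp add: power_one_over mult.commute flip: power_mult)
      moreover have "((2::real) ^ j) ^ DIM('a) = 2 ^ (j * DIM('a))" by (simp flip: power_mult)
      ultimately show ?thesis unfolding e by simp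
    qed
    thus "ennreal (2 ^ M / 2 ^ (j * M)) * emeasure lborel (cball (0::'a) (2 ^ j)) = ennreal (2 ^ M * V * ((1/2) ^ (M - DIM('a))) ^ j)"
      using V by (simp add: emeasure_cball V_def[symmetric] flip: ennreal_mult)
  qed
  also have "\<dots> < \<infinity>"
  proof -
    have "(1/2::real) ^ (M - DIM('a)) < 1" using M by (intro power_Suc_less_one power_less_one_iff[THEN iffD2]) auto
    hence "summable (\<lambda>j. 2 ^ M * V * ((1/2) ^ (M - DIM('a))) ^ j)"
      by (intro summable_mult summable_geometric) auto
    thus ?thesis using V by (subst suminf_ennreal2) auto
  qed
  finally show ?thesis .
qed

lemma poly_decay_integrable:
  fixes f :: "'a::euclidean_space \<Rightarrow> real"
  assumes m: "f \<in> borel_measurable borel" and b: "\<And>x. (1 + norm x) ^ (DIM('a) + 1) * \<bar>f x\<bar> \<le> C"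
  shows "integrable lborel f"
proof (rule Bochner_Integration.integrable_bound)
  show "integrable lborel (\<lambda>x::'a. C * (1 / (1 + norm x) ^ (DIM('a) + 1)))"
    using poly_decay_nn_integral[of "DIM('a) + 1"]
    by (intro integrable_mult_right integrableI_bounded) (auto simp: abs_power_minus)
  have "\<bar>f x\<bar> \<le> \<bar>C * (1 / (1 + norm x) ^ (DIM('a) + 1))\<bar>" for x
  proof -
    have "0 < (1 + norm x) ^ (DIM('a) + 1)" by (intro zero_less_power) (simp add: add_pos_nonneg)
    hence "\<bar>f x\<bar> \<le> C * (1 / (1 + norm x) ^ (DIM('a) + 1))" using b[of x] by (simp add: field_simps)
    thus ?thesis by linarith
  qed
  thus "AE x in lborel. norm (f x) \<le> norm (C * (1 / (1 + norm x) ^ (DIM('a) + 1)))" by simp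
qed (use m in simp)

section \<open>Partial derivatives and stability of the Schwartz class\<close>

lemma deriv_direction:
  assumes "(f has_derivative f') (at (x::'a::real_normed_vector))"
  shows "deriv (\<lambda>t. f (x + t *\<^sub>R v) :: real) 0 = f' v"
proof -
  interpret bounded_linear f' using assms by (rule has_derivative_bounded_linear)
  have "((\<lambda>t. f (x + t *\<^sub>R v)) has_derivative (\<lambda>t. f' (t *\<^sub>R v))) (at 0)"
  proof (rule has_derivative_compose[of "\<lambda>t. x + t *\<^sub>R v" "\<lambda>t. t *\<^sub>R v" 0 UNIV f f'])
    show "((\<lambda>t. x + t *\<^sub>R v) has_derivative (\<lambda>t. t *\<^sub>R v)) (at 0)" by (auto intro!: derivative_eq_intros)
  qed (use assms in simp)
  hence "((\<lambda>t. f (x + t *\<^sub>R v)) has_field_derivative f' v) (at 0)"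
    unfolding has_field_derivative_def by (simp add: scaleR mult.commute[of _ "f' v"])
  thus ?thesis by (rule DERIV_imp_deriv)
qed

lemma schwartz_has_derivative:
  assumes "schwartz f"
  shows "(dpart is f has_derivative frechet_derivative (dpart is f) (at x)) (at x)"
  using assms by (simp add: schwartz_def frechet_derivative_works)

text \<open>\<open>dpart\<close> is built from one-dimensional derivatives. In this form linearity,
  the chain rule and the mean value inequality for Frechet derivatives become applicable to
  it.\<close>

lemma dpart_Cons_frechet:
  assumes "schwartz f"
  shows "dpart (i # is) f x = frechet_derivative (dpart is f) (at x) (axis i 1)"
  using deriv_direction[OF schwartz_has_derivative[OF assms]] by simp

lemma schwartz_decay:
  assumes "schwartz f"
  obtains C where "C > 0" "\<And>x. (1 + norm x) ^ N * \<bar>dpart is f x\<bar> \<le> C"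
proof -
  have "bounded (range (\<lambda>x. (1 + norm x) ^ N * dpart is f x))" using assms by (simp add: schwartz_def)
  then obtain C where C: "C > 0" "\<And>x. norm ((1 + norm x) ^ N * dpart is f x) \<le> C"
    unfolding bounded_pos by blast
  have "\<bar>1 + norm x\<bar> = 1 + norm x" for x :: "real^'a" by simp
  with C show ?thesis by (intro that[of C]) (auto simp: abs_mult power_abs)
qed

lemma schwartz_continuous: "schwartz f \<Longrightarrow> continuous_on UNIV (dpart is f)"
  unfolding schwartz_def by (simp add: continuous_on_eq_continuous_within differentiable_imp_continuous_within)

lemma schwartz_measurable: "schwartz f \<Longrightarrow> dpart is f \<in> borel_measurable borel"
  by (intro borel_measurable_continuous_onI schwartz_continuous)

lemma schwartz_integrable:
  assumes "schwartz (f :: real^'d::finite \<Rightarrow> real)"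
  shows "integrable lborel (\<lambda>x. (1 + norm x) ^ N * dpart is f x)"
proof -
  obtain C where C: "\<And>x. (1 + norm x) ^ (DIM(real^'d) + 1 + N) * \<bar>dpart is f x\<bar> \<le> C"
    using schwartz_decay[OF assms] by metis
  have "\<bar>1 + norm x\<bar> = 1 + norm x" for x :: "real^'d" by simp
  thus ?thesis using C schwartz_measurable[OF assms]
    by (intro poly_decay_integrable[of _ C]) (auto simp: abs_mult power_abs power_add mult.assoc)
qed

lemma bounded_range_realI: "(\<And>x. \<bar>f x\<bar> \<le> (C::real)) \<Longrightarrow> bounded (range f)"
  unfolding bounded_iff by auto

lemma dpart_affine:
  assumes "schwartz f"
  shows "dpart is (\<lambda>y. f (x + c *\<^sub>R y)) = (\<lambda>y. c ^ length is * dpart is f (x + c *\<^sub>R y))"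
proof (induction "is")
  case (Cons i js)
  show ?case
  proof
    fix y
    let ?f' = "frechet_derivative (dpart js f) (at (x + c *\<^sub>R y))"
    interpret bounded_linear ?f'
      using schwartz_has_derivative[OF assms] by (rule has_derivative_bounded_linear)
    have "((\<lambda>y. c ^ length js * dpart js f (x + c *\<^sub>R y)) has_derivative (\<lambda>v. c ^ length js * ?f' (c *\<^sub>R v))) (at y)"
      by (intro has_derivative_mult_right has_derivative_compose[where f="\<lambda>y. x + c *\<^sub>R y" and g="dpart js f"]
           schwartz_has_derivative[OF assms]) (auto intro!: derivative_eq_intros)
    from deriv_direction[OF this, of "axis i 1"]
    show "dpart (i # js) (\<lambda>y. f (x + c *\<^sub>R y)) y = c ^ length (i # js) * dpart (i # js) f (x + c *\<^sub>R y)"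
      by (simp add: Cons dpart_Cons_frechet[OF assms] scaleR del: dpart.simps(2)) (simp add: Cons)
  qed
qed simp

lemma schwartz_affine:
  assumes f: "schwartz f" and c: "c \<noteq> 0"
  shows "schwartz (\<lambda>y. f (x + c *\<^sub>R y))"
  unfolding schwartz_def dpart_affine[OF f]
proof safe
  fix "is" y
  have d: "dpart is f differentiable (at (x + c *\<^sub>R y))" using f by (simp add: schwartz_def)
  have "(dpart is f \<circ> (\<lambda>y. x + c *\<^sub>R y)) differentiable (at y)"
    by (rule differentiable_chain_at) (use d in auto)
  thus "(\<lambda>y. c ^ length is * dpart is f (x + c *\<^sub>R y)) differentiable (at y)"
    by (intro differentiable_mult) (auto simp: o_def)
next
  fix "is" N
  obtain C where C: "C > 0" "\<And>x. (1 + norm x) ^ N * \<bar>dpart is f x\<bar> \<le> C"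
    using schwartz_decay[OF f] by metis
  \<comment> \<open>Chosen so that 1 + |y| <= K (1 + |x + c y|), which carries the decay of
    \<open>f\<close> in its own argument over to decay in y.\<close>
  define K where "K = 1 + norm x + 1 / \<bar>c\<bar> + norm x / \<bar>c\<bar>"
  have K0: "K \<ge> 0" by (simp add: K_def)
  show "bounded (range (\<lambda>y. (1 + norm y) ^ N * (c ^ length is * dpart is f (x + c *\<^sub>R y))))"
  proof (rule bounded_range_realI)
    fix y
    have "\<bar>c\<bar> * norm y = norm ((x + c *\<^sub>R y) - x)" by simp
    also have "\<dots> \<le> norm (x + c *\<^sub>R y) + norm x" by (rule norm_triangle_ineq4)
    finally have "norm y \<le> (norm (x + c *\<^sub>R y) + norm x) / \<bar>c\<bar>" using c by (simp add: field_simps)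
    also have "\<dots> = norm (x + c *\<^sub>R y) * (1 / \<bar>c\<bar>) + norm x / \<bar>c\<bar>" by (simp add: add_divide_distrib)
    also have "\<dots> \<le> norm (x + c *\<^sub>R y) * K + norm x / \<bar>c\<bar>"
      by (intro add_right_mono mult_left_mono) (auto simp: K_def)
    finally have "1 + norm y \<le> K * (1 + norm (x + c *\<^sub>R y))"
      by (simp add: K_def algebra_simps)
        (smt (verit) divide_nonneg_nonneg norm_ge_zero abs_ge_zero)
    hence "(1 + norm y) ^ N \<le> K ^ N * (1 + norm (x + c *\<^sub>R y)) ^ N"
      unfolding power_mult_distrib[symmetric] by (intro power_mono) auto
    hence "(1 + norm y) ^ N * \<bar>dpart is f (x + c *\<^sub>R y)\<bar> \<le> K ^ N * (1 + norm (x + c *\<^sub>R y)) ^ N * \<bar>dpart is f (x + c *\<^sub>R y)\<bar>"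
      by (intro mult_right_mono) auto
    also have "\<dots> \<le> K ^ N * C" using C(2)[of "x + c *\<^sub>R y"] K0 by (simp add: mult.assoc mult_left_mono)
    finally have *: "(1 + norm y) ^ N * \<bar>dpart is f (x + c *\<^sub>R y)\<bar> \<le> K ^ N * C" .
    have "\<bar>1 + norm y\<bar> = 1 + norm y" by simp
    hence "\<bar>(1 + norm y) ^ N * (c ^ length is * dpart is f (x + c *\<^sub>R y))\<bar>
      = \<bar>c\<bar> ^ length is * ((1 + norm y) ^ N * \<bar>dpart is f (x + c *\<^sub>R y)\<bar>)"
      by (simp add: abs_mult power_abs)
    also have "\<dots> \<le> \<bar>c\<bar> ^ length is * (K ^ N * C)" using * by (intro mult_left_mono) auto
    finally show "\<bar>(1 + norm y) ^ N * (c ^ length is * dpart is f (x + c *\<^sub>R y))\<bar> \<le> \<bar>c\<bar> ^ length is * (K ^ N * C)" .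
  qed
qed

lemma dpart_lincomb:
  assumes "schwartz f" "schwartz g"
  shows "dpart is (\<lambda>y. a * f y + b * g y) = (\<lambda>y. a * dpart is f y + b * dpart is g y)"
proof (induction "is")
  case (Cons i js)
  show ?case
  proof
    fix y
    have "((\<lambda>y. a * dpart js f y + b * dpart js g y) has_derivative
        (\<lambda>v. a * frechet_derivative (dpart js f) (at y) v + b * frechet_derivative (dpart js g) (at y) v)) (at y)"
      by (intro has_derivative_add has_derivative_mult_right schwartz_has_derivative assms)
    from deriv_direction[OF this, of "axis i 1"]
    show "dpart (i # js) (\<lambda>y. a * f y + b * g y) y = a * dpart (i # js) f y + b * dpart (i # js) g y"
      by (simp add: Cons dpart_Cons_frechet assms del: dpart.simps(2)) (simp add: Cons)
  qed
qed simp

lemma schwartz_lincomb: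
  assumes "schwartz f" "schwartz g"
  shows "schwartz (\<lambda>y. a * f y + b * g y)"
  unfolding schwartz_def dpart_lincomb[OF assms]
proof safe
  fix "is" x
  show "(\<lambda>y. a * dpart is f y + b * dpart is g y) differentiable (at x)"
    using assms by (auto simp: schwartz_def intro!: differentiable_add differentiable_mult)
next
  fix "is" N
  obtain C where C: "C > 0" "\<And>x. (1 + norm x) ^ N * \<bar>dpart is f x\<bar> \<le> C"
    using schwartz_decay[OF assms(1)] by metis
  obtain D where D: "D > 0" "\<And>x. (1 + norm x) ^ N * \<bar>dpart is g x\<bar> \<le> D"
    using schwartz_decay[OF assms(2)] by metis
  show "bounded (range (\<lambda>x. (1 + norm x) ^ N * (a * dpart is f x + b * dpart is g x)))"
  proof (rule bounded_range_realI)
    fix x :: "real^'a"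
    have "\<bar>1 + norm x\<bar> = 1 + norm x" by simp
    hence "\<bar>(1 + norm x) ^ N * (a * dpart is f x + b * dpart is g x)\<bar>
      = (1 + norm x) ^ N * \<bar>a * dpart is f x + b * dpart is g x\<bar>" by (simp add: abs_mult power_abs)
    also have "\<dots> \<le> (1 + norm x) ^ N * (\<bar>a\<bar> * \<bar>dpart is f x\<bar> + \<bar>b\<bar> * \<bar>dpart is g x\<bar>)"
      by (intro mult_left_mono order_trans[OF abs_triangle_ineq]) (auto simp: abs_mult)
    also have "\<dots> = \<bar>a\<bar> * ((1 + norm x) ^ N * \<bar>dpart is f x\<bar>) + \<bar>b\<bar> * ((1 + norm x) ^ N * \<bar>dpart is g x\<bar>)"
      by (simp add: algebra_simps)
    also have "\<dots> \<le> \<bar>a\<bar> * C + \<bar>b\<bar> * D" using C D by (intro add_mono mult_left_mono) auto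
    finally show "\<bar>(1 + norm x) ^ N * (a * dpart is f x + b * dpart is g x)\<bar> \<le> \<bar>a\<bar> * C + \<bar>b\<bar> * D" .
  qed
qed

lemma dpart_zero: "dpart is (\<lambda>x. 0) = (\<lambda>x. 0)"
  by (induction "is") auto

lemma schwartz_zero: "schwartz (\<lambda>x. 0)"
  unfolding schwartz_def dpart_zero by auto

text \<open>The three facts share one induction, because every step of the last two uses the
  Schwartz property of the partial sum.\<close>

lemma
  assumes "finite A" "\<And>v. v \<in> A \<Longrightarrow> schwartz (f v)"
  shows schwartz_sum: "schwartz (\<lambda>y. \<Sum>v\<in>A. c v * f v y)"
    and dpart_sum: "dpart is (\<lambda>y. \<Sum>v\<in>A. c v * f v y) = (\<lambda>y. \<Sum>v\<in>A. c v * dpart is (f v) y)"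
    and tempered_sum: "tempered T \<Longrightarrow> T (\<lambda>y. \<Sum>v\<in>A. c v * f v y) = (\<Sum>v\<in>A. c v *\<^sub>R T (f v))"
proof -
  have "schwartz (\<lambda>y. \<Sum>v\<in>A. c v * f v y) \<and> dpart is (\<lambda>y. \<Sum>v\<in>A. c v * f v y) = (\<lambda>y. \<Sum>v\<in>A. c v * dpart is (f v) y)
    \<and> (tempered T \<longrightarrow> T (\<lambda>y. \<Sum>v\<in>A. c v * f v y) = (\<Sum>v\<in>A. c v *\<^sub>R T (f v)))"
    using assms
  proof (induction A rule: finite_induct)
    case empty
    have "T (\<lambda>x. 0) = 0" if "tempered T"
    proof -
      have "T (\<lambda>x. 0 * (\<lambda>x. 0) x + 0 * (\<lambda>x. 0) x) = 0 *\<^sub>R T (\<lambda>x. 0) + 0 *\<^sub>R T (\<lambda>x. 0)"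
        using that schwartz_zero unfolding tempered_def by blast
      thus ?thesis by simp
    qed
    thus ?case by (simp add: schwartz_zero dpart_zero)
  next
    case (insert v A)
    have IH: "schwartz (\<lambda>y. \<Sum>v\<in>A. c v * f v y)" "dpart is (\<lambda>y. \<Sum>v\<in>A. c v * f v y) = (\<lambda>y. \<Sum>v\<in>A. c v * dpart is (f v) y)"
      "tempered T \<longrightarrow> T (\<lambda>y. \<Sum>v\<in>A. c v * f v y) = (\<Sum>v\<in>A. c v *\<^sub>R T (f v))" and fv: "schwartz (f v)"
      using insert by auto
    have "tempered T \<longrightarrow> T (\<lambda>y. c v * f v y + 1 * (\<Sum>v\<in>A. c v * f v y)) = c v *\<^sub>R T (f v) + 1 *\<^sub>R T (\<lambda>y. \<Sum>v\<in>A. c v * f v y)"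
      using fv IH(1) unfolding tempered_def by blast
    thus ?case using schwartz_lincomb[OF fv IH(1), of "c v" 1] dpart_lincomb[OF fv IH(1), of "is" "c v" 1] IH(2,3) insert.hyps
      by simp
  qed
  thus "schwartz (\<lambda>y. \<Sum>v\<in>A. c v * f v y)" "dpart is (\<lambda>y. \<Sum>v\<in>A. c v * f v y) = (\<lambda>y. \<Sum>v\<in>A. c v * dpart is (f v) y)"
    "tempered T \<Longrightarrow> T (\<lambda>y. \<Sum>v\<in>A. c v * f v y) = (\<Sum>v\<in>A. c v *\<^sub>R T (f v))" by auto
qed

text \<open>The mean value inequality is used on the segment joining the two arguments, where the
  gradient decays like (1 + |w|)^(-N). For w on this segment x - z - w is a convex combination of v
  and v', so the weight moves from w to z at the price of (1 + |x|)(1 + |v| + |v'|) to the power N.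
  The growth in v and v' is harmless: it is later integrated against a Schwartz function.\<close>

lemma schwartz_translate_lipschitz:
  fixes f :: "real^'d::finite \<Rightarrow> real"
  assumes f: "schwartz f"
  obtains C where "C > 0"
    "\<And>v v' z. (1 + norm z) ^ N * \<bar>dpart is f (x - v - z) - dpart is f (x - v' - z)\<bar>
       \<le> C * (norm (v - v') * (1 + norm v + norm v') ^ N)"
proof -
  have "\<exists>C. \<forall>i. C i > 0 \<and> (\<forall>x. (1 + norm x) ^ N * \<bar>dpart (i # is) f x\<bar> \<le> C i)"
    using schwartz_decay[OF f, of N] by (intro choice) metis
  then obtain C where C: "\<And>i. C i > 0" "\<And>i x. (1 + norm x) ^ N * \<bar>dpart (i # is) f x\<bar> \<le> C i" by blast
  define D where "D = (\<Sum>i\<in>UNIV. C i)"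
  have D: "D > 0" unfolding D_def using C by (intro sum_pos) auto
  let ?f' = "\<lambda>w. frechet_derivative (dpart is f) (at w)"
  have on: "onorm (?f' w) \<le> D / (1 + norm w) ^ N" for w
  proof (rule onorm_le)
    fix h :: "real^'d"
    have p: "(1 + norm w) ^ N > 0" by (intro zero_less_power) (simp add: add_pos_nonneg)
    interpret bounded_linear "?f' w"
      using schwartz_has_derivative[OF f] by (rule has_derivative_bounded_linear)
    have "?f' w h = ?f' w (\<Sum>i\<in>UNIV. h $ i *\<^sub>R axis i 1)"
      using basis_expansion[of h] by (simp add: scalar_mult_eq_scaleR)
    also have "\<dots> = (\<Sum>i\<in>UNIV. h $ i * dpart (i # is) f w)"
      by (simp add: sum scaleR dpart_Cons_frechet[OF f] del: dpart.simps(2))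
    finally have "norm (?f' w h) \<le> (\<Sum>i\<in>UNIV. \<bar>h $ i\<bar> * \<bar>dpart (i # is) f w\<bar>)"
      by (metis (no_types, lifting) real_norm_def sum_abs abs_mult sum.cong)
    also have "\<dots> \<le> (\<Sum>i\<in>UNIV. norm h * (C i / (1 + norm w) ^ N))"
      using C p by (intro sum_mono mult_mono component_le_norm_cart) (auto simp: field_simps)
    also have "\<dots> = D / (1 + norm w) ^ N * norm h"
      by (simp add: D_def sum_distrib_left sum_distrib_right sum_divide_distrib ac_simps)
    finally show "norm (?f' w h) \<le> D / (1 + norm w) ^ N * norm h" .
  qed
  show ?thesis
  proof (rule that[of "D * (1 + norm x) ^ N"])
    show "D * (1 + norm x) ^ N > 0" using D by (intro mult_pos_pos zero_less_power) (auto simp: add_pos_nonneg)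
    fix v v' z :: "real^'d"
    let ?B = "D * ((1 + norm x) * (1 + norm v + norm v')) ^ N / (1 + norm z) ^ N"
    have pz: "(1 + norm z) ^ N > 0" by (intro zero_less_power) (simp add: add_pos_nonneg)
    have "norm (dpart is f (x - v - z) - dpart is f (x - v' - z)) \<le> ?B * norm ((x - v - z) - (x - v' - z))"
    proof (rule differentiable_bound[of "closed_segment (x - v - z) (x - v' - z)" _ ?f'])
      fix w assume "w \<in> closed_segment (x - v - z) (x - v' - z)"
      then obtain u where u: "0 \<le> u" "u \<le> 1" "w = (1 - u) *\<^sub>R (x - v - z) + u *\<^sub>R (x - v' - z)"
        by (auto simp: in_segment)
      have "x - z - w = (1 - u) *\<^sub>R v + u *\<^sub>R v'" using u by (simp add: algebra_simps)
      hence "norm (x - z - w) \<le> (1 - u) * norm v + u * norm v'"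
        using u norm_triangle_ineq[of "(1 - u) *\<^sub>R v" "u *\<^sub>R v'"] by simp
      also have "\<dots> \<le> norm v + norm v'" using u by (intro add_mono mult_left_le_one_le) auto
      finally have zz: "norm (x - z - w) \<le> norm v + norm v'" .
      have "norm z = norm (x - (x - z - w) - w)" by simp
      also have "\<dots> \<le> norm x + norm (x - z - w) + norm w"
        using norm_triangle_ineq4[of "x - (x - z - w)" w] norm_triangle_ineq4[of x "x - z - w"] by linarith
      finally have "norm z \<le> norm x + (norm v + norm v') + norm w" using zz by linarith
      moreover have "(1 + norm x) * (1 + (norm v + norm v')) * (1 + norm w) \<ge> 1 + (norm x + (norm v + norm v') + norm w)"
        by (simp add: algebra_simps add_nonneg_nonneg)
      ultimately have "1 + norm z \<le> (1 + norm x) * (1 + norm v + norm v') * (1 + norm w)" by (simp add: add.assoc)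
      hence "(1 + norm z) ^ N \<le> ((1 + norm x) * (1 + norm v + norm v')) ^ N * (1 + norm w) ^ N"
        unfolding power_mult_distrib[symmetric] by (intro power_mono) auto
      moreover have pw: "(1 + norm w) ^ N > 0" by (intro zero_less_power) (simp add: add_pos_nonneg)
      ultimately have "1 / (1 + norm w) ^ N \<le> ((1 + norm x) * (1 + norm v + norm v')) ^ N / (1 + norm z) ^ N"
        using pz by (simp add: field_simps)
      from mult_left_mono[OF this, of D] have "D / (1 + norm w) ^ N \<le> ?B" using D by simp
      thus "onorm (?f' w) \<le> ?B" using on[of w] by linarith
      show "(dpart is f has_derivative ?f' w) (at w within closed_segment (x - v - z) (x - v' - z))"
        using schwartz_has_derivative[OF f] by (rule has_derivative_at_withinI)
    qed auto
    also have "norm ((x - v - z) - (x - v' - z)) = norm (v - v')" by (simp add: norm_minus_commute)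
    finally have "norm (dpart is f (x - v - z) - dpart is f (x - v' - z)) \<le> ?B * norm (v - v')" .
    thus "(1 + norm z) ^ N * \<bar>dpart is f (x - v - z) - dpart is f (x - v' - z)\<bar>
       \<le> D * (1 + norm x) ^ N * (norm (v - v') * (1 + norm v + norm v') ^ N)"
    proof -
      assume le: "norm (dpart is f (x - v - z) - dpart is f (x - v' - z)) \<le> ?B * norm (v - v')"
      have "(1 + norm z) ^ N * \<bar>dpart is f (x - v - z) - dpart is f (x - v' - z)\<bar> \<le> (1 + norm z) ^ N * (?B * norm (v - v'))"
        using le pz by (intro mult_left_mono) auto
      also have "\<dots> = D * (1 + norm x) ^ N * (norm (v - v') * (1 + norm v + norm v') ^ N)"
        using pz by (simp add: power_mult_distrib del: power_eq_0_iff)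
      finally show ?thesis .
    qed
  qed
qed

section \<open>Tempered distributions tested on reflected translates\<close>

lemma
  assumes "schwartz f"
  shows schwartz_reflect: "schwartz (\<lambda>z. f (x - z))"
    and dpart_reflect: "dpart is (\<lambda>z. f (x - z)) = (\<lambda>z. (-1) ^ length is * dpart is f (x - z))"
  using schwartz_affine[OF assms, of "-1" x] dpart_affine[OF assms, of "is" x "-1"] by simp_all

lemma finite_lists_le: "finite {is :: 'd::finite list. length is \<le> N}"
  using finite_lists_length_le[of "UNIV :: 'd set" N] by simp

text \<open>Replaces the double sum of seminorms by one uniform bound at the highest order: every
  seminorm in the sum is at most \<open>K\<close>, and their number is absorbed into
  \<open>A\<close>.\<close>

lemma tempered_bound:
  fixes T :: "(real^'d::finite \<Rightarrow> real) \<Rightarrow> 'x::banach"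
  assumes "tempered T"
  obtains A N where "A > 0" "\<And>g K. schwartz g \<Longrightarrow> K \<ge> 0 \<Longrightarrow>
    (\<And>is z. length is \<le> N \<Longrightarrow> (1 + norm z) ^ N * \<bar>dpart is g z\<bar> \<le> K) \<Longrightarrow> norm (T g) \<le> A * K"
proof -
  obtain C N where C: "\<And>f. schwartz f \<Longrightarrow> norm (T f) \<le> C * (\<Sum>is\<in>{is::'d list. length is \<le> N}. \<Sum>n\<le>N. snorm n is f)"
    using assms unfolding tempered_def by blast
  define m where "m = real (card {is::'d list. length is \<le> N}) * (real N + 1)"
  have m: "m \<ge> 0" by (simp add: m_def)
  show ?thesis
  proof (rule that[of "\<bar>C\<bar> * m + 1" N])
    show "\<bar>C\<bar> * m + 1 > 0" using m by (simp add: add_nonneg_pos)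
    fix g :: "real^'d \<Rightarrow> real" and K :: real
    assume g: "schwartz g" and K: "K \<ge> 0"
      and b: "\<And>is z. length is \<le> N \<Longrightarrow> (1 + norm z) ^ N * \<bar>dpart is g z\<bar> \<le> K"
    \<comment> \<open>Nonnegativity is recorded as well, because the constant \<open>C\<close> may
      be negative and is about to be replaced by its absolute value.\<close>
    have sn: "snorm n is g \<le> K \<and> 0 \<le> snorm n is g" if "length is \<le> N" "n \<le> N" for n "is"
    proof -
      have le: "(1 + norm z) ^ n * \<bar>dpart is g z\<bar> \<le> K" for z
        using that by (intro order_trans[OF mult_right_mono b[of "is" z]] power_increasing) auto
      hence bd: "bdd_above (range (\<lambda>z. (1 + norm z) ^ n * \<bar>dpart is g z\<bar>))" by (auto simp: bdd_above_def)
      have "0 \<le> (1 + norm (0::real^'d)) ^ n * \<bar>dpart is g 0\<bar>" by simp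
      also have "\<dots> \<le> snorm n is g" unfolding snorm_def by (intro cSUP_upper bd) auto
      finally show ?thesis unfolding snorm_def using le by (auto intro!: cSUP_least)
    qed
    let ?S = "\<Sum>is\<in>{is::'d list. length is \<le> N}. \<Sum>n\<le>N. snorm n is g"
    have S0: "0 \<le> ?S" using sn by (intro sum_nonneg) auto
    have "?S \<le> (\<Sum>is\<in>{is::'d list. length is \<le> N}. \<Sum>n\<le>N. K)"
      using sn by (intro sum_mono) auto
    also have "\<dots> = m * K" by (simp add: m_def algebra_simps)
    finally have S1: "?S \<le> m * K" .
    have "norm (T g) \<le> C * ?S" by (rule C[OF g])
    also have "\<dots> \<le> \<bar>C\<bar> * ?S" using S0 by (intro mult_right_mono) auto
    also have "\<dots> \<le> \<bar>C\<bar> * (m * K)" using S1 by (intro mult_left_mono) auto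
    also have "\<dots> \<le> (\<bar>C\<bar> * m + 1) * K" using K by (simp add: algebra_simps)
    finally show "norm (T g) \<le> (\<bar>C\<bar> * m + 1) * K" .
  qed
qed

lemma schwartz_translate_lipschitz_uniform:
  fixes f :: "real^'d::finite \<Rightarrow> real"
  assumes f: "schwartz f"
  obtains C where "C > 0"
    "\<And>is v v' z. length is \<le> M \<Longrightarrow> (1 + norm z) ^ N * \<bar>dpart is f (x - v - z) - dpart is f (x - v' - z)\<bar>
       \<le> C * (norm (v - v') * (1 + norm v + norm v') ^ N)"
proof -
  have "\<exists>C. \<forall>is. C is > 0 \<and> (\<forall>v v' z. (1 + norm z) ^ N * \<bar>dpart is f (x - v - z) - dpart is f (x - v' - z)\<bar>
       \<le> C is * (norm (v - v') * (1 + norm v + norm v') ^ N))"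
    using schwartz_translate_lipschitz[OF f, of N _ x] by (intro choice) metis
  then obtain C where C: "\<And>is. C is > 0" "\<And>is v v' z. (1 + norm z) ^ N * \<bar>dpart is f (x - v - z) - dpart is f (x - v' - z)\<bar>
       \<le> C is * (norm (v - v') * (1 + norm v + norm v') ^ N)" by blast
  let ?I = "{is :: 'd list. length is \<le> M}"
  show ?thesis
  proof (rule that[of "sum C ?I"])
    have "[] \<in> ?I" by simp
    thus "sum C ?I > 0" using C by (intro sum_pos finite_lists_le) blast+
    fix "is" :: "'d list" and v v' z :: "real^'d" assume "length is \<le> M"
    hence "C is \<le> sum C ?I" using C by (intro member_le_sum finite_lists_le) (auto intro: less_imp_le)
    hence "C is * (norm (v - v') * (1 + norm v + norm v') ^ N) \<le> sum C ?I * (norm (v - v') * (1 + norm v + norm v') ^ N)"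
      by (intro mult_right_mono) auto
    thus "(1 + norm z) ^ N * \<bar>dpart is f (x - v - z) - dpart is f (x - v' - z)\<bar>
       \<le> sum C ?I * (norm (v - v') * (1 + norm v + norm v') ^ N)" using C(2)[of z "is" v v'] by linarith
  qed
qed

lemma tempered_diff:
  assumes "tempered T" "schwartz f" "schwartz g"
  shows "T (\<lambda>z. f z - g z) = T f - T g" "schwartz (\<lambda>z. f z - g z)" "dpart is (\<lambda>z. f z - g z) = (\<lambda>z. dpart is f z - dpart is g z)"
proof -
  have "T (\<lambda>z. 1 * f z + (-1) * g z) = 1 *\<^sub>R T f + (-1) *\<^sub>R T g"
    using assms unfolding tempered_def by blast
  thus "T (\<lambda>z. f z - g z) = T f - T g" by simp
  show "schwartz (\<lambda>z. f z - g z)" "dpart is (\<lambda>z. f z - g z) = (\<lambda>z. dpart is f z - dpart is g z)"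
    using schwartz_lincomb[OF assms(2,3), of 1 "-1"] dpart_lincomb[OF assms(2,3), of "is" 1 "-1"] by simp_all
qed

lemma tempered_translate_lipschitz:
  fixes T :: "(real^'d::finite \<Rightarrow> real) \<Rightarrow> 'x::banach"
  assumes T: "tempered T" and f: "schwartz f"
  obtains C N where "C > 0" "\<And>v v'. norm (T (\<lambda>z. f (x - v - z)) - T (\<lambda>z. f (x - v' - z)))
     \<le> C * (norm (v - v') * (1 + norm v + norm v') ^ N)"
proof -
  obtain A N where A: "A > 0" "\<And>g K. schwartz g \<Longrightarrow> K \<ge> 0 \<Longrightarrow>
    (\<And>is z. length is \<le> N \<Longrightarrow> (1 + norm z) ^ N * \<bar>dpart is g z\<bar> \<le> K) \<Longrightarrow> norm (T g) \<le> A * K"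
    using tempered_bound[OF T] by blast
  obtain C where C: "C > 0"
    "\<And>is v v' z. length is \<le> N \<Longrightarrow> (1 + norm z) ^ N * \<bar>dpart is f (x - v - z) - dpart is f (x - v' - z)\<bar>
       \<le> C * (norm (v - v') * (1 + norm v + norm v') ^ N)"
    using schwartz_translate_lipschitz_uniform[OF f] by blast
  note td = tempered_diff[OF T schwartz_reflect[OF f] schwartz_reflect[OF f]]
  show ?thesis
  proof (rule that[of "A * C" N])
    show "A * C > 0" using A C by simp
    fix v v' :: "real^'d"
    have "norm (T (\<lambda>z. f (x - v - z) - f (x - v' - z))) \<le> A * (C * (norm (v - v') * (1 + norm v + norm v') ^ N))"
    proof (rule A(2))
      show "0 \<le> C * (norm (v - v') * (1 + norm v + norm v') ^ N)" using C by simp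
      fix "is" :: "'d list" and z :: "real^'d" assume l: "length is \<le> N"
      have "\<bar>dpart is (\<lambda>z. f (x - v - z) - f (x - v' - z)) z\<bar> = \<bar>dpart is f (x - v - z) - dpart is f (x - v' - z)\<bar>"
        unfolding td dpart_reflect[OF f] right_diff_distrib[symmetric] by (simp add: abs_mult power_abs)
      thus "(1 + norm z) ^ N * \<bar>dpart is (\<lambda>z. f (x - v - z) - f (x - v' - z)) z\<bar> \<le> C * (norm (v - v') * (1 + norm v + norm v') ^ N)"
        using C(2)[OF l] by simp
    qed (rule td)
    thus "norm (T (\<lambda>z. f (x - v - z)) - T (\<lambda>z. f (x - v' - z))) \<le> A * C * (norm (v - v') * (1 + norm v + norm v') ^ N)"
      by (simp add: td mult.assoc)
  qed
qed

lemma tempered_conv_continuous: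
  fixes T :: "(real^'d::finite \<Rightarrow> real) \<Rightarrow> 'x::banach"
  assumes T: "tempered T" and f: "schwartz f"
  shows "continuous_on UNIV (\<lambda>x. T (\<lambda>z. f (x - z)))"
  unfolding continuous_on_sequentially
proof (intro allI ballI impI)
  fix X a assume X: "(\<forall>n. X n \<in> (UNIV::(real^'d) set)) \<and> X \<longlonglongrightarrow> a"
  \<comment> \<open>With base point 0 and v = -x the Lipschitz estimate for translates becomes one
    in the variable x.\<close>
  obtain C N where C: "C > 0" "\<And>v v'. norm (T (\<lambda>z. f (0 - v - z)) - T (\<lambda>z. f (0 - v' - z)))
     \<le> C * (norm (v - v') * (1 + norm v + norm v') ^ N)" using tempered_translate_lipschitz[OF T f] by blast
  have "(\<lambda>n. T (\<lambda>z. f (X n - z)) - T (\<lambda>z. f (a - z))) \<longlonglongrightarrow> 0"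
  proof (rule Lim_null_comparison)
    show "\<forall>\<^sub>F n in sequentially. norm (T (\<lambda>z. f (X n - z)) - T (\<lambda>z. f (a - z)))
      \<le> C * (norm (X n - a) * (1 + norm (X n) + norm a) ^ N)"
      using C(2)[of "- X _" "-a"] by (auto simp: norm_minus_commute)
    have "(\<lambda>n. C * (norm (X n - a) * (1 + norm (X n) + norm a) ^ N)) \<longlonglongrightarrow> C * (norm (a - a) * (1 + norm a + norm a) ^ N)"
      using X by (intro tendsto_intros) auto
    thus "(\<lambda>n. C * (norm (X n - a) * (1 + norm (X n) + norm a) ^ N)) \<longlonglongrightarrow> 0" by simp
  qed
  thus "((\<lambda>x. T (\<lambda>z. f (x - z))) \<circ> X) \<longlonglongrightarrow> T (\<lambda>z. f (a - z))"
    unfolding o_def by (subst (asm) LIM_zero_iff)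
qed

text \<open>Differentiation under the integral sign. The difference quotients of
  \<open>dpart js f\<close> along a null sequence are bounded by its Lipschitz constant, so
  dominated convergence applies, and both sides of the identity pass to the same limit.\<close>

lemma conv_identity_dpart:
  fixes f g :: "real^'d::finite \<Rightarrow> real"
  assumes f: "schwartz f" and g: "schwartz g"
    and rep: "\<And>z. (LINT y|lborel. f (z - y) * g y) = \<kappa> * f z"
  shows "(LINT y|lborel. dpart is f (z - y) * g y) = \<kappa> * dpart is f z"
proof (induction "is" arbitrary: z)
  case (Cons i js)
  have gi: "integrable lborel g" using schwartz_integrable[OF g, of 0 "[]"] by simp
  have [measurable]: "dpart is f \<in> borel_measurable borel" "g \<in> borel_measurable borel" for "is"
    using schwartz_measurable[OF f] schwartz_measurable[OF g, of "[]"] by simp_all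
  obtain L where L: "L > 0" "\<And>v v' z. (1 + norm z) ^ 0 * \<bar>dpart js f (0 - v - z) - dpart js f (0 - v' - z)\<bar>
       \<le> L * (norm (v - v') * (1 + norm v + norm v') ^ 0)"
    using schwartz_translate_lipschitz[OF f] by blast
  define t where "t = (\<lambda>n. 1 / real (Suc n))"
  have t: "t n > 0" for n by (simp add: t_def)
  define Q where "Q = (\<lambda>w n. (dpart js f (w + t n *\<^sub>R axis i 1) - dpart js f w) / t n)"
  have Qlim: "Q w \<longlonglongrightarrow> dpart (i # js) f w" for w
  proof -
    let ?f' = "frechet_derivative (dpart js f) (at w)"
    interpret bounded_linear ?f' using schwartz_has_derivative[OF f] by (rule has_derivative_bounded_linear)
    have "((\<lambda>t. dpart js f (w + t *\<^sub>R axis i 1)) has_derivative (\<lambda>t. ?f' (t *\<^sub>R axis i 1))) (at 0)"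
    proof (rule has_derivative_compose[of "\<lambda>t. w + t *\<^sub>R axis i 1" "\<lambda>t. t *\<^sub>R axis i 1" 0 UNIV "dpart js f" ?f'])
      show "((\<lambda>t. w + t *\<^sub>R axis i 1) has_derivative (\<lambda>t. t *\<^sub>R axis i 1)) (at 0)" by (auto intro!: derivative_eq_intros)
    qed (use schwartz_has_derivative[OF f] in simp)
    hence "((\<lambda>t. dpart js f (w + t *\<^sub>R axis i 1)) has_field_derivative ?f' (axis i 1)) (at 0)"
      unfolding has_field_derivative_def by (simp add: scaleR mult.commute[of _ "?f' _"])
    hence "((\<lambda>h. (dpart js f (w + h *\<^sub>R axis i 1) - dpart js f w) / h) \<longlongrightarrow> dpart (i # js) f w) (at 0)"
      unfolding DERIV_def dpart_Cons_frechet[OF f] by simp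
    moreover have "filterlim t (at 0) sequentially"
      unfolding filterlim_at t_def using LIMSEQ_inverse_real_of_nat by (simp add: inverse_eq_divide)
    ultimately show ?thesis unfolding Q_def by (rule filterlim_compose)
  qed
  have Qb: "\<bar>Q w n\<bar> \<le> L" for w n
  proof -
    have "\<bar>dpart js f (w + t n *\<^sub>R axis i 1) - dpart js f w\<bar> \<le> L * t n"
      using L(2)[of 0 "- (w + t n *\<^sub>R axis i 1)" "-w"] t[of n] by (simp add: add.commute)
    thus ?thesis using t[of n] by (simp add: Q_def abs_divide field_simps)
  qed
  have bi: "integrable lborel (\<lambda>y. dpart js f (w - y) * g y)" for w
  proof -
    obtain C where C: "C > 0" "\<And>x. (1 + norm x) ^ 0 * \<bar>dpart js f x\<bar> \<le> C"
      using schwartz_decay[OF f] by blast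
    show ?thesis
      by (rule Bochner_Integration.integrable_bound[of _ "\<lambda>y. C * g y"])
        (use gi C in \<open>auto simp: abs_mult intro!: mult_right_mono\<close>)
  qed
  have "(\<lambda>n. LINT y|lborel. Q (z - y) n * g y) \<longlonglongrightarrow> (LINT y|lborel. dpart (i # js) f (z - y) * g y)"
  proof (rule integral_dominated_convergence[where w="\<lambda>y. L * \<bar>g y\<bar>"])
    show "AE y in lborel. (\<lambda>n. Q (z - y) n * g y) \<longlonglongrightarrow> dpart (i # js) f (z - y) * g y"
      by (intro AE_I2 tendsto_intros Qlim)
    show "AE y in lborel. norm (Q (z - y) n * g y) \<le> L * \<bar>g y\<bar>" for n
      using Qb by (auto simp: abs_mult intro!: mult_right_mono)
  qed (use gi in \<open>auto simp: Q_def simp del: dpart.simps(2)\<close>)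
  moreover have "(LINT y|lborel. Q (z - y) n * g y) = \<kappa> * Q z n" for n
  proof -
    have "(LINT y|lborel. Q (z - y) n * g y)
      = (LINT y|lborel. (dpart js f ((z + t n *\<^sub>R axis i 1) - y) * g y - dpart js f (z - y) * g y) / t n)"
      by (intro Bochner_Integration.integral_cong) (auto simp: Q_def algebra_simps diff_divide_distrib)
    also have "\<dots> = \<kappa> * Q z n"
      unfolding integral_divide_zero Bochner_Integration.integral_diff[OF bi bi] Cons
      by (simp add: Q_def right_diff_distrib)
    finally show ?thesis .
  qed
  ultimately have "(\<lambda>n. \<kappa> * Q z n) \<longlonglongrightarrow> (LINT y|lborel. dpart (i # js) f (z - y) * g y)" by simp
  moreover have "(\<lambda>n. \<kappa> * Q z n) \<longlonglongrightarrow> \<kappa> * dpart (i # js) f z" by (intro tendsto_intros Qlim)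
  ultimately show ?case by (rule LIMSEQ_unique)
qed (use rep in simp)

text \<open>Bochner integrals with values in a nonseparable space are not available, so the
  functional is pulled through the convolution via simple functions approximating the identity;
  only the resulting inequality between norms is kept.\<close>
lemma tempered_reproducing_bound:
  fixes T :: "(real^'d::finite \<Rightarrow> real) \<Rightarrow> 'x::banach"
  assumes T: "tempered T" and f: "schwartz f" and g: "schwartz g" and \<kappa>: "\<kappa> \<ge> 0"
    and rep: "\<And>z. (LINT y|lborel. f (z - y) * g y) = \<kappa> * f z"
  shows "ennreal (\<kappa> * norm (T (\<lambda>z. f (x - z)))) \<le> (\<integral>\<^sup>+y. ennreal (\<bar>g y\<bar> * norm (T (\<lambda>z. f (x - y - z)))) \<partial>lborel)"
    (is "_ \<le> ?J")
proof -
  have gi: "integrable lborel g" using schwartz_integrable[OF g, of 0 "[]"] by simp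
  have dm[measurable]: "dpart is f \<in> borel_measurable borel" and gm[measurable]: "g \<in> borel_measurable borel" for "is"
    using schwartz_measurable[OF f] schwartz_measurable[OF g, of "[]"] by simp_all
  define \<tau> where "\<tau> = (\<lambda>v. T (\<lambda>z. f (x - v - z)))"
  obtain A N where A: "A > 0" "\<And>g K. schwartz g \<Longrightarrow> K \<ge> 0 \<Longrightarrow>
    (\<And>is z. length is \<le> N \<Longrightarrow> (1 + norm z) ^ N * \<bar>dpart is g z\<bar> \<le> K) \<Longrightarrow> norm (T g) \<le> A * K"
    using tempered_bound[OF T] by blast
  obtain L where L: "L > 0"
    "\<And>is v v' z. length is \<le> N \<Longrightarrow> (1 + norm z) ^ N * \<bar>dpart is f (x - v - z) - dpart is f (x - v' - z)\<bar>
       \<le> L * (norm (v - v') * (1 + norm v + norm v') ^ N)"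
    using schwartz_translate_lipschitz_uniform[OF f] by blast
  obtain L' N' where L': "L' > 0" "\<And>v v'. norm (\<tau> v - \<tau> v') \<le> L' * (norm (v - v') * (1 + norm v + norm v') ^ N')"
    using tempered_translate_lipschitz[OF T f, of x] unfolding \<tau>_def by blast
  have \<tau>c: "continuous_on UNIV \<tau>"
    unfolding \<tau>_def using continuous_on_compose2[OF tempered_conv_continuous[OF T f], of UNIV "\<lambda>v. x - v"]
    by (simp add: continuous_intros)
  have \<tau>m[measurable]: "(\<lambda>v. norm (\<tau> v)) \<in> borel_measurable borel"
    using \<tau>c by (intro borel_measurable_continuous_onI continuous_intros)
  \<comment> \<open>Each \<open>r i\<close> takes finitely many values and tends to the identity
    with |r i y| <= 2 |y|. Replacing y by \<open>r i y\<close> in the translate turns the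
    convolution into a finite combination of translates, to which \<open>T\<close> can be
    applied.\<close>
  obtain r :: "nat \<Rightarrow> real^'d \<Rightarrow> real^'d" where r: "\<And>i. simple_function borel (r i)"
      "\<And>y. (\<lambda>i. r i y) \<longlonglongrightarrow> y" "\<And>i y. dist (r i y) 0 \<le> 2 * dist y 0"
    using borel_measurable_implies_sequence_metric[of "\<lambda>y::real^'d. y" borel 0] by auto
  have rm[measurable]: "r i \<in> borel_measurable borel" for i using r(1) by (rule borel_measurable_simple_function)
  have rfin: "finite (range (r i))" for i using r(1)[of i] by (simp add: simple_function_def)
  \<comment> \<open>The modulus from the Lipschitz estimates between y and \<open>r i y\<close>. It
    tends to zero pointwise and is dominated by a power of 1 + |y|, which the decay of
    \<open>g\<close> makes integrable; hence \<open>E n i\<close> tends to zero.\<close>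
  define W where "W = (\<lambda>n i y. norm (y - r i y) * (1 + norm y + norm (r i y)) ^ n)"
  define E where "E = (\<lambda>n i. LINT y|lborel. W n i y * \<bar>g y\<bar>)"
  have W0: "0 \<le> W n i y" for n i y by (simp add: W_def)
  have Wb: "W n i y \<le> 3 ^ (n + 1) * (1 + norm y) ^ (n + 1)" for n i y
  proof -
    have nr: "norm (r i y) \<le> 2 * norm y" using r(3)[of i y] by simp
    have "norm (y - r i y) \<le> norm y + 2 * norm y"
      by (rule order_trans[OF norm_triangle_ineq4]) (intro add_left_mono nr)
    hence "norm (y - r i y) \<le> 3 * (1 + norm y)" by simp
    moreover have "1 + norm y + norm (r i y) \<le> 3 * (1 + norm y)" using nr by simp
    hence "(1 + norm y + norm (r i y)) ^ n \<le> (3 * (1 + norm y)) ^ n" by (intro power_mono) auto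
    ultimately have "W n i y \<le> (3 * (1 + norm y)) * (3 * (1 + norm y)) ^ n"
      unfolding W_def by (intro mult_mono) auto
    also have "\<dots> = 3 ^ (n + 1) * (1 + norm y) ^ (n + 1)" unfolding power_mult_distrib by simp
    finally show ?thesis .
  qed
  have gN: "integrable lborel (\<lambda>y. 3 ^ (n + 1) * ((1 + norm y) ^ (n + 1) * \<bar>g y\<bar>))" for n
  proof -
    have "\<bar>(1 + norm y) ^ (n + 1) * g y\<bar> = (1 + norm y) ^ (n + 1) * \<bar>g y\<bar>" for y
      unfolding abs_mult by simp
    thus ?thesis using integrable_abs[OF schwartz_integrable[OF g, of "n + 1" "[]"]]
      by (intro integrable_mult_right) simp
  qed
  have Wm[measurable]: "W n i \<in> borel_measurable borel" for n i unfolding W_def by measurable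
  have Wi: "integrable lborel (\<lambda>y. W n i y * \<bar>g y\<bar>)" for n i
    by (rule Bochner_Integration.integrable_bound[OF gN[of n]])
      (use Wb[of n i] W0 in \<open>auto simp: abs_mult mult.assoc[symmetric] intro!: mult_right_mono\<close>)
  have Elim: "(\<lambda>i. E n i) \<longlonglongrightarrow> 0" for n
  proof -
    have "(\<lambda>i. E n i) \<longlonglongrightarrow> (LINT y|(lborel :: (real^'d) measure). 0)"
      unfolding E_def
    proof (rule integral_dominated_convergence[OF _ _ gN[of n]])
      show "AE y in lborel. (\<lambda>i. W n i y * \<bar>g y\<bar>) \<longlonglongrightarrow> 0"
      proof (rule AE_I2)
        fix y
        have "(\<lambda>i. W n i y * \<bar>g y\<bar>) \<longlonglongrightarrow> (norm (y - y) * (1 + norm y + norm y) ^ n) * \<bar>g y\<bar>"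
          unfolding W_def by (intro tendsto_intros r)
        thus "(\<lambda>i. W n i y * \<bar>g y\<bar>) \<longlonglongrightarrow> 0" by simp
      qed
      show "AE y in lborel. norm (W n i y * \<bar>g y\<bar>) \<le> 3 ^ (n + 1) * ((1 + norm y) ^ (n + 1) * \<bar>g y\<bar>)" for i
        using Wb[of n i] W0 by (auto simp: abs_mult mult.assoc[symmetric] intro!: mult_right_mono)
    qed auto
    thus ?thesis by simp
  qed
  define I where "I = (\<lambda>i v y. indicator (r i -` {v}) y :: real)"
  have Im[measurable]: "I i v \<in> borel_measurable borel" for i v
    unfolding I_def using measurable_sets[OF rm[of i], of "{v}"] by simp
  have Ii: "integrable lborel (\<lambda>y. I i v y * g y)" for i v
    by (rule Bochner_Integration.integrable_bound[OF gi]) (auto simp: I_def abs_mult indicator_def)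
  have Isum: "h (r i y) = (\<Sum>v\<in>range (r i). h v * I i v y)" for h :: "real^'d \<Rightarrow> real" and i y
  proof -
    have "(\<Sum>v\<in>range (r i). h v * I i v y) = (\<Sum>v\<in>range (r i). if v = r i y then h v else 0)"
      by (intro sum.cong) (auto simp: I_def)
    thus ?thesis using rfin by (simp add: sum.delta)
  qed
  \<comment> \<open>The integral of \<open>g\<close> over the set where \<open>r i\<close> equals v,
    that is, the coefficient of the translate by v.\<close>
  define c where "c = (\<lambda>i v. LINT y|lborel. I i v y * g y)"
  have csum: "(LINT y|lborel. h (r i y) * g y) = (\<Sum>v\<in>range (r i). c i v * h v)" for h i
  proof -
    have "(LINT y|lborel. h (r i y) * g y) = (LINT y|lborel. (\<Sum>v\<in>range (r i). h v * (I i v y * g y)))"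
      by (intro Bochner_Integration.integral_cong refl) (subst Isum, simp add: sum_distrib_right mult.assoc)
    also have "\<dots> = (\<Sum>v\<in>range (r i). c i v * h v)"
      using Ii by (subst Bochner_Integration.integral_sum) (auto simp: c_def mult.commute)
    finally show ?thesis .
  qed
  have bound: "ennreal (\<kappa> * norm (T (\<lambda>z. f (x - z)))) \<le> ennreal (A * (L * E N i) + L' * E N' i) + ?J" for i
  proof -
    \<comment> \<open>The discretised convolution. The distribution is small on its difference from
      \<kappa> f (x - z), by continuity of \<open>T\<close>, and is estimated on \<open>S\<close>
      itself by the triangle inequality.\<close>
    define S where "S = (\<lambda>z. \<Sum>v\<in>range (r i). c i v * f (x - v - z))"
    have S: "schwartz S" "dpart is S = (\<lambda>z. \<Sum>v\<in>range (r i). c i v * dpart is (\<lambda>z. f (x - v - z)) z)"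
      "T S = (\<Sum>v\<in>range (r i). c i v *\<^sub>R \<tau> v)" for "is"
      unfolding S_def \<tau>_def
      by (rule schwartz_sum[OF rfin schwartz_reflect[OF f]] dpart_sum[OF rfin schwartz_reflect[OF f]]
        tempered_sum[OF rfin schwartz_reflect[OF f] T])+
    define F where "F = (\<lambda>z. \<kappa> * f (x - z) + (-1) * S z)"
    have F: "schwartz F" "dpart is F = (\<lambda>z. \<kappa> * dpart is (\<lambda>z. f (x - z)) z + (-1) * dpart is S z)" for "is"
      unfolding F_def by (rule schwartz_lincomb[OF schwartz_reflect[OF f] S(1)] dpart_lincomb[OF schwartz_reflect[OF f] S(1)])+
    have TF: "T F = \<kappa> *\<^sub>R T (\<lambda>z. f (x - z)) + (-1) *\<^sub>R T S"
      unfolding F_def using T S(1) schwartz_reflect[OF f, of x] unfolding tempered_def by blast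
    have E0: "0 \<le> E n i" for n unfolding E_def using W0 by (intro integral_nonneg_AE) auto
    have nTF: "norm (T F) \<le> A * (L * E N i)"
    proof (rule A(2)[OF F(1)])
      show "0 \<le> L * E N i" using L E0 by simp
      fix "is" :: "'d list" and z :: "real^'d" assume l: "length is \<le> N"
      let ?D = "dpart is f"
      obtain C where C: "C > 0" "\<And>x. (1 + norm x) ^ 0 * \<bar>?D x\<bar> \<le> C" using schwartz_decay[OF f] by blast
      have i1: "integrable lborel (\<lambda>y. ?D (x - y - z) * g y)"
        by (rule Bochner_Integration.integrable_bound[of _ "\<lambda>y. C * g y"])
          (use gi C in \<open>auto simp: abs_mult intro!: mult_right_mono\<close>)
      have i2: "integrable lborel (\<lambda>y. ?D (x - r i y - z) * g y)"
        by (rule Bochner_Integration.integrable_bound[of _ "\<lambda>y. C * g y"])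
          (use gi C in \<open>auto simp: abs_mult intro!: mult_right_mono\<close>)
      have "dpart is F z = (-1) ^ length is * (\<kappa> * ?D (x - z) - (\<Sum>v\<in>range (r i). c i v * ?D (x - v - z)))"
        unfolding F S dpart_reflect[OF f] by (simp add: right_diff_distrib sum_distrib_left sum_negf mult.left_commute)
      also have "\<dots> = (-1) ^ length is * (LINT y|lborel. ?D (x - y - z) * g y - ?D (x - r i y - z) * g y)"
        using conv_identity_dpart[OF f g rep, of "is" "x - z"] csum[of "\<lambda>v. ?D (x - v - z)" i]
        unfolding Bochner_Integration.integral_diff[OF i1 i2] by (simp add: diff_diff_eq add.commute)
      finally have "\<bar>dpart is F z\<bar> = \<bar>LINT y|lborel. ?D (x - y - z) * g y - ?D (x - r i y - z) * g y\<bar>"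
        by (simp add: abs_mult power_abs)
      also have "\<dots> \<le> (LINT y|lborel. \<bar>?D (x - y - z) * g y - ?D (x - r i y - z) * g y\<bar>)"
        by (rule integral_abs_bound)
      finally have "(1 + norm z) ^ N * \<bar>dpart is F z\<bar> \<le> (LINT y|lborel. (1 + norm z) ^ N * \<bar>?D (x - y - z) * g y - ?D (x - r i y - z) * g y\<bar>)"
        by (simp add: mult_left_mono)
      also have "\<dots> \<le> (LINT y|lborel. L * (W N i y * \<bar>g y\<bar>))"
      proof (intro integral_mono integrable_mult_right Wi integrable_abs Bochner_Integration.integrable_diff i1 i2)
        fix y
        have "(1 + norm z) ^ N * \<bar>?D (x - y - z) * g y - ?D (x - r i y - z) * g y\<bar>
          = ((1 + norm z) ^ N * \<bar>?D (x - y - z) - ?D (x - r i y - z)\<bar>) * \<bar>g y\<bar>"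
          by (simp add: abs_mult flip: left_diff_distrib)
        also have "\<dots> \<le> (L * W N i y) * \<bar>g y\<bar>"
          using L(2)[OF l, of z y "r i y"] unfolding W_def by (intro mult_right_mono) auto
        finally show "(1 + norm z) ^ N * \<bar>?D (x - y - z) * g y - ?D (x - r i y - z) * g y\<bar> \<le> L * (W N i y * \<bar>g y\<bar>)"
          by (simp add: mult.assoc)
      qed
      also have "\<dots> = L * E N i" by (simp add: E_def)
      finally show "(1 + norm z) ^ N * \<bar>dpart is F z\<bar> \<le> L * E N i" .
    qed
    \<comment> \<open>A second error occurs here: the triangle inequality produces the norm of
      \<tau> at \<open>r i y\<close>, which has to be replaced by its value at y.\<close>
    have nTS: "ennreal (norm (T S)) \<le> ennreal (L' * E N' i) + ?J"
    proof -
      have Iai: "integrable lborel (\<lambda>y. I i v y * \<bar>g y\<bar>)" for v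
        by (rule Bochner_Integration.integrable_bound[OF gi]) (auto simp: I_def abs_mult indicator_def)
      have eq: "norm (\<tau> (r i y)) * \<bar>g y\<bar> = (\<Sum>v\<in>range (r i). norm (\<tau> v) * (I i v y * \<bar>g y\<bar>))" for y
        by (subst Isum[of "\<lambda>v. norm (\<tau> v)"]) (simp add: sum_distrib_right mult.assoc)
      have int: "integrable lborel (\<lambda>y. norm (\<tau> (r i y)) * \<bar>g y\<bar>)"
        unfolding eq using Iai by (intro Bochner_Integration.integrable_sum integrable_mult_right)
      have "norm (T S) \<le> (\<Sum>v\<in>range (r i). \<bar>c i v\<bar> * norm (\<tau> v))"
        unfolding S by (rule order_trans[OF norm_sum]) simp
      also have "\<dots> \<le> (\<Sum>v\<in>range (r i). (LINT y|lborel. I i v y * \<bar>g y\<bar>) * norm (\<tau> v))"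
      proof (intro sum_mono mult_right_mono)
        fix v
        have "\<bar>c i v\<bar> \<le> (LINT y|lborel. \<bar>I i v y * g y\<bar>)" unfolding c_def by (rule integral_abs_bound)
        also have "\<dots> = (LINT y|lborel. I i v y * \<bar>g y\<bar>)" by (simp add: abs_mult I_def)
        finally show "\<bar>c i v\<bar> \<le> (LINT y|lborel. I i v y * \<bar>g y\<bar>)" .
      qed simp
      also have "\<dots> = (LINT y|lborel. norm (\<tau> (r i y)) * \<bar>g y\<bar>)"
        unfolding eq using Iai by (subst Bochner_Integration.integral_sum) (auto simp: mult.commute)
      finally have "ennreal (norm (T S)) \<le> ennreal (LINT y|lborel. norm (\<tau> (r i y)) * \<bar>g y\<bar>)" by (rule ennreal_leI)
      also have "\<dots> = (\<integral>\<^sup>+y. ennreal (norm (\<tau> (r i y)) * \<bar>g y\<bar>) \<partial>lborel)"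
        using int by (intro nn_integral_eq_integral[symmetric]) auto
      also have "\<dots> \<le> (\<integral>\<^sup>+y. (ennreal (L' * (W N' i y * \<bar>g y\<bar>)) + ennreal (\<bar>g y\<bar> * norm (\<tau> y))) \<partial>lborel)"
      proof (rule nn_integral_mono)
        fix y
        have "norm (\<tau> (r i y)) \<le> L' * W N' i y + norm (\<tau> y)"
          using L'(2)[of y "r i y"] norm_triangle_sub[of "\<tau> (r i y)" "\<tau> y"] unfolding W_def
          by (simp add: norm_minus_commute)
        hence "norm (\<tau> (r i y)) * \<bar>g y\<bar> \<le> (L' * W N' i y + norm (\<tau> y)) * \<bar>g y\<bar>" by (intro mult_right_mono) auto
        also have "\<dots> = L' * (W N' i y * \<bar>g y\<bar>) + \<bar>g y\<bar> * norm (\<tau> y)" by (simp add: algebra_simps)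
        finally show "ennreal (norm (\<tau> (r i y)) * \<bar>g y\<bar>) \<le> ennreal (L' * (W N' i y * \<bar>g y\<bar>)) + ennreal (\<bar>g y\<bar> * norm (\<tau> y))"
          using L'(1) W0 by (simp add: ennreal_leI flip: ennreal_plus)
      qed
      also have "\<dots> = (\<integral>\<^sup>+y. ennreal (L' * (W N' i y * \<bar>g y\<bar>)) \<partial>lborel) + (\<integral>\<^sup>+y. ennreal (\<bar>g y\<bar> * norm (\<tau> y)) \<partial>lborel)"
        by (rule nn_integral_add) auto
      also have "(\<integral>\<^sup>+y. ennreal (L' * (W N' i y * \<bar>g y\<bar>)) \<partial>lborel) = ennreal (L' * E N' i)"
        unfolding E_def using L'(1) W0 Wi[of N' i] by (subst nn_integral_eq_integral) auto
      finally show ?thesis unfolding \<tau>_def .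
    qed
    have "\<kappa> *\<^sub>R T (\<lambda>z. f (x - z)) = T F + T S" using TF by simp
    hence "norm (\<kappa> *\<^sub>R T (\<lambda>z. f (x - z))) \<le> norm (T F) + norm (T S)" by (simp add: norm_triangle_ineq)
    hence "\<kappa> * norm (T (\<lambda>z. f (x - z))) \<le> A * (L * E N i) + norm (T S)" using \<kappa> nTF by simp
    hence "ennreal (\<kappa> * norm (T (\<lambda>z. f (x - z)))) \<le> ennreal (A * (L * E N i)) + ennreal (norm (T S))"
      using A L E0 by (simp add: ennreal_leI flip: ennreal_plus)
    also have "\<dots> \<le> ennreal (A * (L * E N i)) + (ennreal (L' * E N' i) + ?J)"
      by (intro add_left_mono nTS)
    also have "\<dots> = ennreal (A * (L * E N i) + L' * E N' i) + ?J"
      using A L L' E0 by (simp add: ennreal_plus add.assoc)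
    finally show ?thesis .
  qed
  have "(\<lambda>i. ennreal (A * (L * E N i) + L' * E N' i) + ?J) \<longlonglongrightarrow> ennreal (A * (L * 0) + L' * 0) + ?J"
    by (intro tendsto_intros tendsto_ennrealI Elim)
  from LIMSEQ_le_const[OF this] bound show ?thesis by simp
qed

section \<open>Powers, sums and sequence norms in the extended reals\<close>

lemma enn_powr_ennreal: "x \<ge> 0 \<Longrightarrow> enn_powr (ennreal x) r = ennreal (x powr r)"
  by (simp add: enn_powr_def)

lemma enn_powr_top [simp]: "enn_powr top r = top"
  by (simp add: enn_powr_def)

lemma enn_powr_0 [simp]: "enn_powr 0 r = 0"
  by (simp add: enn_powr_def)

lemma enn_powr_1 [simp]: "enn_powr a 1 = a"
  by (cases a) (auto simp: enn_powr_ennreal)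

lemma enn_powr_mono:
  assumes "a \<le> b" "r \<ge> 0"
  shows "enn_powr a r \<le> enn_powr b r"
proof (cases "b = top")
  case False
  hence "enn2real a \<le> enn2real b" "a \<noteq> top" using assms by (auto intro: enn2real_mono simp: top_unique less_top[symmetric])
  thus ?thesis using False assms by (simp add: enn_powr_def ennreal_leI powr_mono2)
qed simp

lemma enn_powr_eq_0_iff:
  assumes "r > 0"
  shows "enn_powr a r = 0 \<longleftrightarrow> a = 0"
proof (cases a)
  case (real x)
  show ?thesis unfolding real(2) enn_powr_ennreal[OF real(1)] using real(1) by (simp add: ennreal_eq_0_iff)
qed simp

lemma enn_powr_mult:
  assumes r: "r > 0"
  shows "enn_powr (a * b) r = enn_powr a r * enn_powr b r"
proof (cases "a = top \<or> b = top")
  case False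
  obtain x where x: "0 \<le> x" "a = ennreal x" using False by (cases a) blast+
  obtain y where y: "0 \<le> y" "b = ennreal y" using False by (cases b) blast+
  have "enn_powr (a * b) r = ennreal (x powr r * y powr r)"
    unfolding x(2) y(2) using x(1) y(1) by (subst ennreal_mult[symmetric]) (auto simp: enn_powr_ennreal powr_mult)
  also have "\<dots> = enn_powr a r * enn_powr b r"
    unfolding x(2) y(2) using x(1) y(1) by (simp add: enn_powr_ennreal ennreal_mult)
  finally show ?thesis .
next
  case True
  show ?thesis
  proof (cases "a = 0 \<or> b = 0")
    case True thus ?thesis by auto
  next
    case False
    hence "enn_powr a r \<noteq> 0" "enn_powr b r \<noteq> 0" using enn_powr_eq_0_iff[OF r] by auto
    thus ?thesis using False \<open>a = top \<or> b = top\<close>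
      by (metis enn_powr_top ennreal_mult_eq_top_iff)
  qed
qed

lemma enn_powr_powr: "enn_powr (enn_powr a r) s = enn_powr a (r * s)"
  by (cases a) (auto simp: enn_powr_ennreal powr_powr)

lemma enn_powr_measurable [measurable]:
  assumes [measurable]: "f \<in> borel_measurable M"
  shows "(\<lambda>x. enn_powr (f x) r) \<in> borel_measurable M"
proof -
  have "Measurable.pred M (\<lambda>x. f x = top)" by measurable
  thus ?thesis unfolding enn_powr_def by measurable
qed

lemma enn_powr_add_le:
  assumes "p \<ge> 0"
  shows "enn_powr (a + b) p \<le> ennreal (2 powr p) * (enn_powr a p + enn_powr b p)"
proof -
  have *: "enn_powr (a + b) p \<le> ennreal (2 powr p) * enn_powr (max a b) p"
  proof (cases "max a b")
    case (real x)
    have "a + b \<le> ennreal x + ennreal x" unfolding real(2)[symmetric] by (intro add_mono) auto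
    hence "a + b \<le> ennreal (2 * x)" using real by (simp flip: ennreal_plus)
    hence "enn_powr (a + b) p \<le> enn_powr (ennreal (2 * x)) p" using assms by (rule enn_powr_mono)
    also have "\<dots> = ennreal (2 powr p) * enn_powr (ennreal x) p"
      using real by (subst (1 2) enn_powr_ennreal) (auto simp: powr_mult simp flip: ennreal_mult)
    finally show ?thesis using real by simp
  qed (simp add: ennreal_mult_top)
  have "enn_powr (max a b) p \<le> enn_powr a p + enn_powr b p"
    by (cases "a \<le> b") (auto simp: max_def add_increasing add_increasing2)
  from order_trans[OF * mult_left_mono[OF this]] show ?thesis by simp
qed

text \<open>Either a <= t, or a/t >= 1 and then a/t <= (a/t)^p. Unlike Hoelder's inequality this is
  linear in a^p, so it survives integration against any measure without a separate treatment of
  infinite values.\<close>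

lemma ennreal_young:
  assumes "p \<ge> 1" "t > 0"
  shows "a \<le> ennreal t + ennreal (t powr (1 - p)) * enn_powr a p"
proof (cases a)
  case (real x)
  have "x \<le> t + t powr (1 - p) * x powr p"
  proof (cases "x \<le> t")
    case False
    hence e: "x = t * (x / t) powr 1" using assms by simp
    have "t * (x / t) powr 1 \<le> t * (x / t) powr p" using assms False by (intro mult_left_mono powr_mono) auto
    also have "\<dots> = t powr (1 - p) * x powr p" using assms False by (simp add: powr_divide powr_diff)
    finally show ?thesis using assms e by linarith
  next
    case True
    have "0 \<le> t powr (1 - p) * x powr p" by simp
    thus ?thesis using True by linarith
  qed
  hence "ennreal x \<le> ennreal (t + t powr (1 - p) * x powr p)" by (rule ennreal_leI)
  also have "\<dots> = ennreal t + ennreal (t powr (1 - p)) * ennreal (x powr p)"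
    using assms by (simp add: ennreal_plus ennreal_mult)
  finally show ?thesis unfolding real(2) enn_powr_ennreal[OF real(1)] .
qed (use assms in \<open>simp add: ennreal_mult_top\<close>)

text \<open>Jensen's inequality up to a constant, by integrating the preceding bound at the optimal \<open>t\<close>.\<close>
lemma nn_integral_weighted_powr:
  assumes [measurable]: "\<nu> \<in> borel_measurable M" "F \<in> borel_measurable M"
    and p: "p \<ge> 1" and K: "K \<ge> 0" "(\<integral>\<^sup>+x. \<nu> x \<partial>M) \<le> ennreal K"
  shows "enn_powr (\<integral>\<^sup>+x. \<nu> x * F x \<partial>M) p \<le> ennreal ((K + 1) powr p) * (\<integral>\<^sup>+x. \<nu> x * enn_powr (F x) p \<partial>M)"
proof (cases "\<integral>\<^sup>+x. \<nu> x * enn_powr (F x) p \<partial>M")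
  case top
  show ?thesis unfolding top using K by (simp add: ennreal_mult_top)
next
  case (real i)
  have le: "(\<integral>\<^sup>+x. \<nu> x * F x \<partial>M) \<le> ennreal (t * K + t powr (1 - p) * i)" if t: "t > 0" for t
  proof -
    have "(\<integral>\<^sup>+x. \<nu> x * F x \<partial>M) \<le> (\<integral>\<^sup>+x. ennreal t * \<nu> x + ennreal (t powr (1 - p)) * (\<nu> x * enn_powr (F x) p) \<partial>M)"
    proof (rule nn_integral_mono)
      fix x
      have "\<nu> x * F x \<le> \<nu> x * (ennreal t + ennreal (t powr (1 - p)) * enn_powr (F x) p)"
        by (intro mult_left_mono ennreal_young p t) simp
      thus "\<nu> x * F x \<le> ennreal t * \<nu> x + ennreal (t powr (1 - p)) * (\<nu> x * enn_powr (F x) p)"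
        by (simp add: distrib_left ac_simps)
    qed
    also have "\<dots> = ennreal t * (\<integral>\<^sup>+x. \<nu> x \<partial>M) + ennreal (t powr (1 - p)) * ennreal i"
      unfolding real(2)[symmetric] by (simp add: nn_integral_add nn_integral_cmult)
    also have "\<dots> \<le> ennreal t * ennreal K + ennreal (t powr (1 - p)) * ennreal i"
      using K by (intro add_right_mono mult_left_mono) auto
    also have "\<dots> = ennreal (t * K + t powr (1 - p) * i)"
      using K t real by (simp flip: ennreal_mult ennreal_plus)
    finally show ?thesis .
  qed
  show ?thesis
  proof (cases "i = 0")
    case False
    hence i: "i > 0" using real by simp
    \<comment> \<open>For t = i^(1/p) the second term t^(1-p) i is again i^(1/p), so both terms are
      multiples of the same power; this produces the constant K + 1.\<close>
    have eq: "i powr (1/p) * K + (i powr (1/p)) powr (1 - p) * i = (K + 1) * i powr (1/p)"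
    proof -
      have "(i powr (1/p)) powr (1 - p) * i = i powr (1/p * (1 - p) + 1)"
        using i by (simp add: powr_powr powr_add)
      also have "1/p * (1 - p) + 1 = 1/p" using p by (simp add: field_simps)
      finally show ?thesis by (simp add: algebra_simps)
    qed
    have "(\<integral>\<^sup>+x. \<nu> x * F x \<partial>M) \<le> ennreal ((K + 1) * i powr (1/p))"
      unfolding eq[symmetric] by (rule le) (use i in simp)
    hence "enn_powr (\<integral>\<^sup>+x. \<nu> x * F x \<partial>M) p \<le> enn_powr (ennreal ((K + 1) * i powr (1/p))) p"
      using p by (intro enn_powr_mono) auto
    also have "\<dots> = ennreal ((K + 1) powr p * i)"
      using K i p by (simp add: enn_powr_ennreal powr_mult powr_powr)
    finally show ?thesis using K i real by (simp add: ennreal_mult)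
  next
    \<comment> \<open>With i = 0 the two terms cannot be balanced; instead t = e/(K + 1) bounds the
      integral by an arbitrary e > 0.\<close>
    case True
    have "(\<integral>\<^sup>+x. \<nu> x * F x \<partial>M) \<le> 0 + ennreal e" if "e > 0" for e
    proof -
      have "(\<integral>\<^sup>+x. \<nu> x * F x \<partial>M) \<le> ennreal (e / (K + 1) * K)"
        using le[of "e / (K + 1)"] that K True by simp
      moreover have "e / (K + 1) * K \<le> e" using that K by (simp add: field_simps)
      ultimately show ?thesis by (simp add: order_trans[OF _ ennreal_leI])
    qed
    hence "(\<integral>\<^sup>+x. \<nu> x * F x \<partial>M) \<le> 0" by (rule ennreal_le_epsilon) auto
    thus ?thesis by simp
  qed
qed

lemma suminf_weighted_powr:
  fixes \<nu> F :: "nat \<Rightarrow> ennreal"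
  assumes "p \<ge> 1" "K \<ge> 0" "(\<Sum>k. \<nu> k) \<le> ennreal K"
  shows "enn_powr (\<Sum>k. \<nu> k * F k) p \<le> ennreal ((K + 1) powr p) * (\<Sum>k. \<nu> k * enn_powr (F k) p)"
  using nn_integral_weighted_powr[of \<nu> "count_space UNIV" F p K] assms
  by (simp add: nn_integral_count_space_nat)

text \<open>Every term is at most the total S, so its r-th power is at most S^(r-1) times the term.
  This is the embedding of l^1 into l^r.\<close>

lemma suminf_enn_powr_le:
  fixes m :: "nat \<Rightarrow> ennreal"
  assumes r: "r \<ge> 1"
  shows "(\<Sum>k. enn_powr (m k) r) \<le> enn_powr (\<Sum>k. m k) r"
proof (cases "\<Sum>k. m k")
  case (real S)
  have "enn_powr (m k) r \<le> ennreal (S powr (r - 1)) * m k" for k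
  proof -
    have "m k \<le> ennreal S" using sum_le_suminf[of m "{k}"] unfolding real(2)[symmetric] by auto
    then obtain x where x: "m k = ennreal x" "0 \<le> x" "x \<le> S"
      using real(1) by (cases "m k") (auto simp: top_unique)
    have "x powr r \<le> S powr (r - 1) * x"
    proof (cases "x = 0")
      case False
      hence "x powr r = x powr (r - 1) * x" using x by (simp add: powr_diff)
      also have "\<dots> \<le> S powr (r - 1) * x" using x r by (intro mult_right_mono powr_mono2) auto
      finally show ?thesis .
    qed simp
    thus ?thesis using x by (simp add: enn_powr_ennreal ennreal_leI flip: ennreal_mult)
  qed
  hence "(\<Sum>k. enn_powr (m k) r) \<le> (\<Sum>k. ennreal (S powr (r - 1)) * m k)" by (intro suminf_le) auto
  also have "\<dots> = ennreal (S powr (r - 1)) * ennreal S" by (simp add: real(2)[symmetric])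
  also have "\<dots> = ennreal (S powr r)"
    using real(1) by (cases "S = 0") (auto simp: powr_diff simp flip: ennreal_mult)
  finally show ?thesis using real by (simp add: enn_powr_ennreal)
qed simp

section \<open>Geometric sums with a uniform bound\<close>

lemma sum_geometric_inj_le:
  fixes r :: real
  assumes "finite A" "inj_on h A" "0 \<le> r" "r < 1"
  shows "(\<Sum>k\<in>A. r ^ h k) \<le> 1 / (1 - r)"
proof -
  have "(\<Sum>k\<in>A. r ^ h k) = (\<Sum>j\<in>h ` A. r ^ j)" using assms by (simp add: sum.reindex)
  also have "\<dots> \<le> (\<Sum>j. r ^ j)" using assms by (intro sum_le_suminf) auto
  finally show ?thesis using assms by (simp add: suminf_geometric)
qed

text \<open>The point is uniformity in the real centre t. The indices are split at the integer part
  of t; on either side |k - t| is at least an integer distance that is injective in k, so each half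
  is dominated by a full geometric series.\<close>

lemma suminf_two_sided_geometric:
  assumes c: "c > 0"
  obtains K where "K > 0" "\<And>t. (\<Sum>k. ennreal (2 powr (- c * \<bar>real k - t\<bar>))) \<le> ennreal K"
proof -
  define r :: real where "r = 2 powr (- c)"
  have r: "0 < r" "r < 1" using c powr_less_cancel_iff[of 2 "-c" 0] by (auto simp: r_def)
  have rp: "2 powr (- c * u) = r powr u" for u by (simp add: r_def powr_powr)
  show ?thesis
  proof (rule that[of "2 / (1 - r)"])
    show "2 / (1 - r) > 0" using r by simp
    fix t :: real
    \<comment> \<open>For negative t this is 0; the lower half then consists of the index 0 alone
      and the estimate still holds.\<close>
    define m where "m = nat \<lfloor>t\<rfloor>"
    have fin: "(\<Sum>k<n. 2 powr (- c * \<bar>real k - t\<bar>)) \<le> 2 / (1 - r)" for n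
    proof -
      let ?A = "{..<n} \<inter> {..m}" and ?B = "{..<n} - {..m}"
      have "(\<Sum>k<n. 2 powr (- c * \<bar>real k - t\<bar>)) = (\<Sum>k\<in>?A. 2 powr (- c * \<bar>real k - t\<bar>)) + (\<Sum>k\<in>?B. 2 powr (- c * \<bar>real k - t\<bar>))"
        by (rule sum.Int_Diff) simp
      also have "\<dots> \<le> (\<Sum>k\<in>?A. r ^ (m - k)) + (\<Sum>k\<in>?B. r ^ (k - Suc m))"
      proof (intro add_mono sum_mono)
        fix k assume k: "k \<in> ?A"
        have "real (m - k) \<le> \<bar>real k - t\<bar>"
        proof (cases "t \<ge> 0")
          case True
          hence "real m \<le> t" by (simp add: m_def)
          thus ?thesis using k by (simp add: of_nat_diff)
        qed (use k in \<open>simp add: m_def\<close>)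
        thus "2 powr (- c * \<bar>real k - t\<bar>) \<le> r ^ (m - k)"
          unfolding rp powr_realpow[OF r(1), symmetric] using r by (intro powr_mono') auto
      next
        fix k assume k: "k \<in> ?B"
        have "t \<le> real m + 1" unfolding m_def by linarith
        hence "real (k - Suc m) \<le> \<bar>real k - t\<bar>" using k by (simp add: of_nat_diff)
        thus "2 powr (- c * \<bar>real k - t\<bar>) \<le> r ^ (k - Suc m)"
          unfolding rp powr_realpow[OF r(1), symmetric] using r by (intro powr_mono') auto
      qed
      also have "\<dots> \<le> 1 / (1 - r) + 1 / (1 - r)"
        using r by (intro add_mono sum_geometric_inj_le) (auto simp: inj_on_def)
      finally show ?thesis by simp
    qed
    show "(\<Sum>k. ennreal (2 powr (- c * \<bar>real k - t\<bar>))) \<le> ennreal (2 / (1 - r))"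
      unfolding suminf_eq_SUP using fin by (auto intro!: SUP_least ennreal_leI simp: sum_ennreal)
  qed
qed

text \<open>One progression decreases and the other increases; they cross at the real index t = log
  2 (A/B) / (\<alpha> + \<beta>), where both have the value M = A^(\<beta>/(\<alpha>+\<beta>))
  B^(\<alpha>/(\<alpha>+\<beta>)). Away from t the minimum decays at rate min \<alpha> \<beta>, so
  the whole sum is comparable to \<open>M\<close>.\<close>

lemma suminf_min_geometric:
  assumes \<alpha>: "\<alpha> > 0" and \<beta>: "\<beta> > 0"
  obtains K where "K > 0" "\<And>A B. A \<ge> 0 \<Longrightarrow> B \<ge> 0 \<Longrightarrow>
    (\<Sum>k. ennreal (min (A * 2 powr (- real k * \<alpha>)) (B * 2 powr (real k * \<beta>))))
      \<le> ennreal (K * (A powr (\<beta> / (\<alpha> + \<beta>)) * B powr (\<alpha> / (\<alpha> + \<beta>))))"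
proof -
  define c where "c = min \<alpha> \<beta>"
  have c: "c > 0" using \<alpha> \<beta> by (simp add: c_def)
  obtain K where K: "K > 0" "\<And>t. (\<Sum>k. ennreal (2 powr (- c * \<bar>real k - t\<bar>))) \<le> ennreal K"
    using suminf_two_sided_geometric[OF c] by blast
  show ?thesis
  proof (rule that[OF K(1)])
    fix A B :: real assume AB: "A \<ge> 0" "B \<ge> 0"
    show "(\<Sum>k. ennreal (min (A * 2 powr (- real k * \<alpha>)) (B * 2 powr (real k * \<beta>))))
      \<le> ennreal (K * (A powr (\<beta> / (\<alpha> + \<beta>)) * B powr (\<alpha> / (\<alpha> + \<beta>))))"
    proof (cases "A = 0 \<or> B = 0")
      case True
      hence "min (A * 2 powr (- real k * \<alpha>)) (B * 2 powr (real k * \<beta>)) = 0" for k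
        using AB True by (cases "A = 0") (auto simp: min_absorb1 min_absorb2)
      thus ?thesis by simp
    next
      case False
      hence pos: "A > 0" "B > 0" using AB by auto
      define t where "t = log 2 (A / B) / (\<alpha> + \<beta>)"
      define M where "M = A powr (\<beta> / (\<alpha> + \<beta>)) * B powr (\<alpha> / (\<alpha> + \<beta>))"
      have t2: "2 powr (t * u) = (A / B) powr (u / (\<alpha> + \<beta>))" for u
      proof -
        have "2 powr (t * u) = (2 powr (log 2 (A / B))) powr (u / (\<alpha> + \<beta>))"
          unfolding powr_powr t_def by simp
        thus ?thesis using pos by simp
      qed
      have sp: "u powr (\<alpha> / (\<alpha> + \<beta>)) * u powr (\<beta> / (\<alpha> + \<beta>)) = u" if "u > 0" for u :: real
        using that \<alpha> \<beta> by (simp add: add_divide_distrib[symmetric] flip: powr_add)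
      have MA: "A = M * 2 powr (t * \<alpha>)"
      proof -
        have "M * 2 powr (t * \<alpha>) = A powr (\<alpha> / (\<alpha> + \<beta>)) * A powr (\<beta> / (\<alpha> + \<beta>))"
          using pos unfolding t2 M_def by (simp add: powr_divide)
        thus ?thesis using sp[OF pos(1)] by simp
      qed
      have MB: "M = B * 2 powr (t * \<beta>)"
      proof -
        have "B * 2 powr (t * \<beta>) = B powr (\<alpha> / (\<alpha> + \<beta>)) * B powr (\<beta> / (\<alpha> + \<beta>)) * 2 powr (t * \<beta>)"
          using sp[OF pos(2)] by simp
        thus ?thesis using pos unfolding t2 M_def by (simp add: powr_divide)
      qed
      have M0: "M > 0" using pos by (simp add: M_def)
      have "min (A * 2 powr (- real k * \<alpha>)) (B * 2 powr (real k * \<beta>)) \<le> M * 2 powr (- c * \<bar>real k - t\<bar>)" for k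
      proof (cases "t \<le> real k")
        case True
        have "A * 2 powr (- real k * \<alpha>) = M * 2 powr (- \<alpha> * (real k - t))"
          unfolding MA mult.assoc powr_add[symmetric] by (simp add: algebra_simps)
        also have "\<dots> \<le> M * 2 powr (- c * \<bar>real k - t\<bar>)"
          using True M0 by (intro mult_left_mono powr_mono) (auto simp: c_def mult_right_mono)
        finally show ?thesis by simp
      next
        case False
        have "B * 2 powr (real k * \<beta>) = M * 2 powr (- \<beta> * (t - real k))"
          unfolding MB mult.assoc powr_add[symmetric] by (simp add: algebra_simps)
        also have "\<dots> \<le> M * 2 powr (- c * \<bar>real k - t\<bar>)"
          using False M0 by (intro mult_left_mono powr_mono) (auto simp: c_def mult_right_mono)
        finally show ?thesis by simp
      qed
      hence "(\<Sum>k. ennreal (min (A * 2 powr (- real k * \<alpha>)) (B * 2 powr (real k * \<beta>))))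
        \<le> (\<Sum>k. ennreal M * ennreal (2 powr (- c * \<bar>real k - t\<bar>)))"
        using M0 by (intro suminf_le) (auto intro!: ennreal_leI simp flip: ennreal_mult)
      also have "\<dots> \<le> ennreal M * ennreal K" using K(2)[of t] by (simp add: mult_left_mono)
      also have "\<dots> = ennreal (K * M)" using M0 K by (simp add: mult.commute flip: ennreal_mult)
      finally show ?thesis by (simp add: M_def)
    qed
  qed
qed

section \<open>Sequence norms\<close>

lemma lq_norm_ennreal:
  assumes "r \<ge> 0"
  shows "lq_norm (ennreal r) a = enn_powr (\<Sum>k. ennreal (\<bar>a k\<bar> powr r)) (1 / r)"
  unfolding lq_norm_def using assms by simp

text \<open>For finite indices this is \<open>suminf_enn_powr_le\<close> for the q0-th powers with
  exponent q1/q0; for an infinite q1 each single term is below the sum.\<close>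

lemma lq_norm_antimono:
  assumes q: "1 \<le> q0" "q0 \<le> q1"
  shows "lq_norm q1 a \<le> lq_norm q0 a"
proof (cases q0)
  case top
  hence "q1 = top" using q(2) by (simp only: top_unique)
  thus ?thesis unfolding top by simp
next
  case (real r)
  have r: "r \<ge> 1" using q(1) unfolding real(2) by simp
  define S where "S = (\<Sum>k. ennreal (\<bar>a k\<bar> powr r))"
  have l0: "lq_norm q0 a = enn_powr S (1 / r)"
    unfolding real(2) S_def by (rule lq_norm_ennreal[OF real(1)])
  show ?thesis
  proof (cases q1)
    case top
    have "ennreal \<bar>a k\<bar> \<le> enn_powr S (1 / r)" for k
    proof -
      have "ennreal (\<bar>a k\<bar> powr r) \<le> S" unfolding S_def by (rule ennreal_le_suminf)
      hence "enn_powr (ennreal (\<bar>a k\<bar> powr r)) (1 / r) \<le> enn_powr S (1 / r)" using r by (intro enn_powr_mono) auto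
      moreover have "(\<bar>a k\<bar> powr r) powr (1 / r) = \<bar>a k\<bar>" using r by (simp add: powr_powr)
      ultimately show ?thesis by (simp add: enn_powr_ennreal)
    qed
    thus ?thesis unfolding l0 unfolding top lq_norm_def by (simp only: simp_thms if_True) (rule SUP_least)
  next
    case (real u)
    have u: "u \<ge> r" using q(2) real(1) unfolding real(2) \<open>q0 = ennreal r\<close> by simp
    have p: "(\<bar>a k\<bar> powr r) powr (u / r) = \<bar>a k\<bar> powr u" for k using r by (simp add: powr_powr)
    have "lq_norm q1 a = enn_powr (\<Sum>k. enn_powr (ennreal (\<bar>a k\<bar> powr r)) (u / r)) (1 / u)"
      unfolding real(2) lq_norm_ennreal[OF real(1)] enn_powr_ennreal[OF powr_ge_zero] p ..
    also have "\<dots> \<le> enn_powr (enn_powr S (u / r)) (1 / u)"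
      unfolding S_def using u r by (intro enn_powr_mono suminf_enn_powr_le) auto
    also have "\<dots> = enn_powr S (1 / r)" using u r by (simp add: enn_powr_powr)
    finally show ?thesis unfolding l0 .
  qed
qed

lemma lq_norm_1: "lq_norm 1 a = (\<Sum>k. ennreal \<bar>a k\<bar>)"
  by (simp add: lq_norm_def)

lemma le_lq_norm_top: "ennreal \<bar>a k\<bar> \<le> lq_norm top a"
  unfolding lq_norm_def by (simp only: if_True simp_thms) (rule SUP_upper, rule UNIV_I)

lemma lq_norm_measurable [measurable]:
  assumes [measurable]: "\<And>k. (\<lambda>x. a x k) \<in> borel_measurable M"
  shows "(\<lambda>x. lq_norm q (a x)) \<in> borel_measurable M"
  unfolding lq_norm_def by (cases "q = top") simp_all

section \<open>Weighted bounds for band-limited functions\<close>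

text \<open>Both parts rest on 1 + |u + v| <= (1 + |u|)(1 + |v|). They allow the kernel centred at x
  to be exchanged for the one centred at the origin.\<close>

lemma kernel_submultiplicative:
  "1 / (1 + norm x) ^ M * (1 / (1 + norm y) ^ M) \<le> 1 / (1 + norm (x - y)) ^ M"
  "1 / (1 + norm (x - y)) ^ M \<le> (1 + norm x) ^ M * (1 / (1 + norm (y::'a::real_normed_vector)) ^ M)"
proof -
  have *: "1 + norm (u + v) \<le> (1 + norm u) * (1 + norm v)" for u v :: 'a
  proof -
    have "1 + norm (u + v) \<le> 1 + (norm u + norm v)" by (intro add_left_mono norm_triangle_ineq)
    also have "\<dots> \<le> (1 + norm u) * (1 + norm v)" by (simp add: algebra_simps)
    finally show ?thesis .
  qed
  have p: "(1 + norm u) ^ M > 0" for u :: 'a by (intro zero_less_power) (simp add: add_pos_nonneg)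
  have "(1 + norm (x - y)) ^ M \<le> (1 + norm x) ^ M * (1 + norm y) ^ M"
    unfolding power_mult_distrib[symmetric] using *[of x "-y"] by (intro power_mono) auto
  thus "1 / (1 + norm x) ^ M * (1 / (1 + norm y) ^ M) \<le> 1 / (1 + norm (x - y)) ^ M"
    using p by (simp add: field_simps)
  have "(1 + norm y) ^ M \<le> (1 + norm x) ^ M * (1 + norm (x - y)) ^ M"
    unfolding power_mult_distrib[symmetric] using *[of x "-(x - y)"]
    by (intro power_mono) (auto simp: norm_minus_commute)
  thus "1 / (1 + norm (x - y)) ^ M \<le> (1 + norm x) ^ M * (1 / (1 + norm y) ^ M)"
    using p by (simp add: field_simps)
qed

text \<open>The mass of \<open>F\<close> near the origin, where a power weight may fail to be comparable to a
  constant, is absorbed into the left-hand side: it is at most a small multiple of the supremum of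
  \<open>F\<close> over a small ball.\<close>
lemma absorb_origin:
  assumes B: "B > 0"
  obtains c C :: real where "0 < c" "c \<le> 1" "C > 0"
    "\<And>(F :: 'a::euclidean_space \<Rightarrow> real) x. continuous_on UNIV F \<Longrightarrow> (\<And>x. F x \<ge> 0) \<Longrightarrow>
      (\<And>x. ennreal (F x) \<le> ennreal B * (\<integral>\<^sup>+y. ennreal (1 / (1 + norm (x - y)) ^ M * F y) \<partial>lborel)) \<Longrightarrow>
      ennreal (F x) \<le> ennreal C * (\<integral>\<^sup>+y. indicator {y. c \<le> norm y} y * ennreal (1 / (1 + norm (x - y)) ^ M * F y) \<partial>lborel)"
proof -
  define V where "V = unit_ball_vol (real DIM('a))"
  have V: "V \<ge> 0" by (simp add: V_def)
  \<comment> \<open>Small enough that \<open>B\<close> times the volume of the ball of radius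
    \<open>c\<close> is at most 1/2; since c <= 1, the d-th power of c may be estimated by
    c.\<close>
  define c where "c = 1 / (2 * B * V + 1)"
  have BV: "2 * B * V + 1 > 0" using B V by (simp add: add_nonneg_pos)
  have c: "0 < c" "c \<le> 1" using BV B V by (auto simp: c_def field_simps)
  have "c ^ DIM('a) \<le> c ^ 1" using c by (intro power_decreasing) auto
  hence "B * (V * c ^ DIM('a)) \<le> B * (V * c)" using B V by (intro mult_left_mono) auto
  also have "\<dots> \<le> 1 / 2" using BV B V by (simp add: c_def field_simps)
  finally have small: "B * (V * c ^ DIM('a)) \<le> 1 / 2" .
  \<comment> \<open>The summand 4^M arises from recentring the kernel twice, at a cost of 2^M each:
    from \<open>J z\<close> to \<open>J 0\<close>, and for the local term seen from x.\<close>
  define C where "C = B * (1 + 4 ^ M)"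
  have C: "C > 0" using B by (simp add: C_def add_pos_nonneg)
  show ?thesis
  proof (rule that[OF c C])
    fix F :: "'a \<Rightarrow> real" and x :: 'a
    assume cont: "continuous_on UNIV F" and F0: "\<And>x. F x \<ge> 0"
      and hyp: "\<And>x. ennreal (F x) \<le> ennreal B * (\<integral>\<^sup>+y. ennreal (1 / (1 + norm (x - y)) ^ M * F y) \<partial>lborel)"
    have [measurable]: "F \<in> borel_measurable borel" using cont by (rule borel_measurable_continuous_onI)
    have [measurable]: "{y::'a. c \<le> norm y} \<in> sets borel" "cball (0::'a) c \<in> sets borel" by measurable
    define E where "E = (\<lambda>z::'a. 1 / (1 + norm z) ^ M)"
    have E0: "0 \<le> E z" for z by (simp add: E_def)
    have E1: "E z \<le> 1" for z
    proof -
      have "1 \<le> (1 + norm z) ^ M" by (rule one_le_power) simp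
      thus ?thesis unfolding E_def by (subst divide_le_eq_1_pos) linarith+
    qed
    have Em[measurable]: "E \<in> borel_measurable borel" unfolding E_def by measurable
    have Esub: "E u * E v \<le> E (u - v)" "E (u - v) \<le> (1 + norm u) ^ M * E v" for u v
      unfolding E_def by (rule kernel_submultiplicative)+
    define J where "J = (\<lambda>x. \<integral>\<^sup>+y. indicator {y. c \<le> norm y} y * ennreal (E (x - y) * F y) \<partial>lborel)"
    \<comment> \<open>Continuity and compactness make the supremum over the small ball a finite real
      number attained at some z, without which nothing could be absorbed.\<close>
    obtain z where z: "norm z \<le> c" "\<And>y. norm y \<le> c \<Longrightarrow> F y \<le> F z"
    proof -
      have "\<exists>z\<in>cball 0 c. \<forall>y\<in>cball 0 c. F y \<le> F z"
        using c by (intro continuous_attains_sup continuous_on_subset[OF cont]) auto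
      thus ?thesis using that by auto
    qed
    define s where "s = F z"
    have s0: "0 \<le> s" using F0 by (simp add: s_def)
    have split: "ennreal (F u) \<le> ennreal B * (J u + ennreal (s * (V * c ^ DIM('a)) * e))"
      if e: "\<And>y. norm y \<le> c \<Longrightarrow> E (u - y) \<le> e" "e \<ge> 0" for u e
    proof -
      have "(\<integral>\<^sup>+y. ennreal (E (u - y) * F y) \<partial>lborel)
        \<le> (\<integral>\<^sup>+y. indicator {y. c \<le> norm y} y * ennreal (E (u - y) * F y) + ennreal (s * e) * indicator (cball 0 c) y \<partial>lborel)"
      proof (rule nn_integral_mono)
        fix y
        show "ennreal (E (u - y) * F y) \<le> indicator {y. c \<le> norm y} y * ennreal (E (u - y) * F y) + ennreal (s * e) * indicator (cball 0 c) y"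
        proof (cases "c \<le> norm y")
          case False
          hence "E (u - y) * F y \<le> e * s" using e z(2)[of y] E0 F0 s0 by (intro mult_mono) (auto simp: s_def)
          thus ?thesis using False by (simp add: mult.commute ennreal_leI)
        qed simp
      qed
      also have "\<dots> = J u + ennreal (s * e) * emeasure lborel (cball (0::'a) c)"
        unfolding J_def by (subst nn_integral_add) (auto simp: nn_integral_cmult_indicator simp del: indicator_times_eq_if)
      also have "ennreal (s * e) * emeasure lborel (cball (0::'a) c) = ennreal (s * (V * c ^ DIM('a)) * e)"
        using c s0 e V by (simp add: emeasure_cball V_def[symmetric] ac_simps flip: ennreal_mult)
      finally have le: "(\<integral>\<^sup>+y. ennreal (E (u - y) * F y) \<partial>lborel) \<le> J u + ennreal (s * (V * c ^ DIM('a)) * e)" .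
      show ?thesis
      proof -
        have "ennreal (F u) \<le> ennreal B * (\<integral>\<^sup>+y. ennreal (E (u - y) * F y) \<partial>lborel)"
          using hyp[of u] by (simp only: E_def)
        thus ?thesis using mult_left_mono[OF le, of "ennreal B"] by (rule order_trans) simp
      qed
    qed
    have Ble: "ennreal B * ennreal (s * (V * c ^ DIM('a)) * e) \<le> ennreal (s * e / 2)" if "e \<ge> 0" for e
    proof -
      have "B * (s * (V * c ^ DIM('a)) * e) = (B * (V * c ^ DIM('a))) * (s * e)" by simp
      also have "\<dots> \<le> 1 / 2 * (s * e)" using small s0 that by (intro mult_right_mono) auto
      finally have "B * (s * (V * c ^ DIM('a)) * e) \<le> s * e / 2" by simp
      thus ?thesis using B by (simp add: ennreal_leI flip: ennreal_mult')
    qed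
    \<comment> \<open>At the maximum point itself the contribution of the small ball is at most s/2,
      and s/2 can be subtracted because s is finite.\<close>
    have "ennreal s \<le> ennreal B * J z + ennreal (s / 2)"
    proof -
      have "ennreal s \<le> ennreal B * (J z + ennreal (s * (V * c ^ DIM('a)) * 1))"
        using split[of z 1] E1 by (simp add: s_def)
      also have "\<dots> = ennreal B * J z + ennreal B * ennreal (s * (V * c ^ DIM('a)) * 1)" by (rule distrib_left)
      also have "\<dots> \<le> ennreal B * J z + ennreal (s * 1 / 2)" by (intro add_left_mono Ble) simp
      finally show ?thesis by simp
    qed
    hence s1: "ennreal s \<le> ennreal (2 * B) * J z"
    proof (cases "J z")
      case (real j)
      have "s \<le> B * j + s / 2" if "ennreal s \<le> ennreal B * J z + ennreal (s / 2)"
        using that real B s0 by (simp flip: ennreal_mult ennreal_plus)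
      hence "s \<le> (2 * B) * j" if "ennreal s \<le> ennreal B * J z + ennreal (s / 2)" using that by simp
      thus ?thesis if "ennreal s \<le> ennreal B * J z + ennreal (s / 2)"
        using that real B by (simp add: ennreal_leI flip: ennreal_mult)
    qed (use B in \<open>simp add: ennreal_mult_top\<close>)
    have Jz: "J z \<le> ennreal (2 ^ M) * J 0"
    proof -
      have "J z \<le> (\<integral>\<^sup>+y. ennreal (2 ^ M) * (indicator {y. c \<le> norm y} y * ennreal (E (0 - y) * F y)) \<partial>lborel)"
        unfolding J_def
      proof (rule nn_integral_mono)
        fix y
        have "E (z - y) \<le> (1 + norm z) ^ M * E y" by (rule Esub)
        also have "\<dots> \<le> 2 ^ M * E y" using z c by (intro mult_right_mono power_mono E0) auto
        finally have "E (z - y) * F y \<le> 2 ^ M * (E (0 - y) * F y)"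
          using F0[of y] mult_right_mono[of "E (z - y)" "2 ^ M * E y" "F y"] by (simp add: E_def)
        hence "ennreal (E (z - y) * F y) \<le> ennreal (2 ^ M) * ennreal (E (0 - y) * F y)"
          by (simp add: ennreal_leI flip: ennreal_mult')
        thus "indicator {y. c \<le> norm y} y * ennreal (E (z - y) * F y) \<le> ennreal (2 ^ M) * (indicator {y. c \<le> norm y} y * ennreal (E (0 - y) * F y))"
          by (simp add: indicator_def)
      qed
      thus ?thesis unfolding J_def by (subst (asm) nn_integral_cmult) auto
    qed
    have EJ: "ennreal (E x) * J 0 \<le> J x"
      unfolding J_def
    proof (subst nn_integral_cmult[symmetric], measurable, rule nn_integral_mono)
      fix y
      have "E x * E y * F y \<le> E (x - y) * F y" by (intro mult_right_mono Esub F0)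
      hence "ennreal (E x) * ennreal (E (0 - y) * F y) \<le> ennreal (E (x - y) * F y)"
        using E0 by (simp add: ennreal_leI E_def mult.assoc flip: ennreal_mult')
      thus "ennreal (E x) * (indicator {y. c \<le> norm y} y * ennreal (E (0 - y) * F y)) \<le> indicator {y. c \<le> norm y} y * ennreal (E (x - y) * F y)"
        by (simp add: indicator_def)
    qed
    have ex: "E (x - y) \<le> 2 ^ M * E x" if "norm y \<le> c" for y
    proof -
      have "E (y - x) \<le> (1 + norm y) ^ M * E x" by (rule Esub)
      also have "\<dots> \<le> 2 ^ M * E x" using that c by (intro mult_right_mono power_mono E0) auto
      finally show ?thesis by (simp add: E_def norm_minus_commute)
    qed
    have "ennreal (F x) \<le> ennreal B * (J x + ennreal (s * (V * c ^ DIM('a)) * (2 ^ M * E x)))"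
      using ex E0 by (intro split) auto
    also have "\<dots> = ennreal B * J x + ennreal B * ennreal (s * (V * c ^ DIM('a)) * (2 ^ M * E x))" by (rule distrib_left)
    also have "\<dots> \<le> ennreal B * J x + ennreal (s * (2 ^ M * E x) / 2)" using E0 by (intro add_left_mono Ble) auto
    finally have Fx: "ennreal (F x) \<le> ennreal B * J x + ennreal (s * (2 ^ M * E x) / 2)" .
    have "ennreal (s * (2 ^ M * E x) / 2) = ennreal (2 ^ M / 2 * E x) * ennreal s"
      using s0 E0 by (simp add: ac_simps flip: ennreal_mult)
    also have "\<dots> \<le> ennreal (2 ^ M / 2 * E x) * (ennreal (2 * B) * (ennreal (2 ^ M) * J 0))"
      by (intro mult_left_mono order_trans[OF s1] Jz) auto
    also have "\<dots> = ennreal (B * 4 ^ M) * (ennreal (E x) * J 0)"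
    proof -
      have "(4::real) ^ M = 2 ^ M * 2 ^ M" by (simp flip: power_mult_distrib)
      hence "ennreal (2 ^ M / 2 * E x) * ennreal (2 * B) * ennreal (2 ^ M) = ennreal (B * 4 ^ M) * ennreal (E x)"
        using B E0 by (simp add: ac_simps flip: ennreal_mult)
      thus ?thesis by (simp add: mult.assoc[symmetric])
    qed
    also have "\<dots> \<le> ennreal (B * 4 ^ M) * J x" by (intro mult_left_mono EJ) auto
    finally have "ennreal (s * (2 ^ M * E x) / 2) \<le> ennreal (B * 4 ^ M) * J x" .
    from order_trans[OF Fx add_left_mono[OF this]]
    have "ennreal (F x) \<le> (ennreal B + ennreal (B * 4 ^ M)) * J x" by (simp add: distrib_right)
    also have "ennreal B + ennreal (B * 4 ^ M) = ennreal C"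
      using B by (simp add: C_def distrib_left flip: ennreal_plus)
    finally show "ennreal (F x) \<le> ennreal C * (\<integral>\<^sup>+y. indicator {y. c \<le> norm y} y * ennreal (1 / (1 + norm (x - y)) ^ M * F y) \<partial>lborel)"
      by (simp add: J_def E_def)
  qed
qed

text \<open>For |y| >= c the quantities max 1 |x| and |y| differ at most by the factor (2/c)(1 + |x
  - y|), in either direction, so the power \<gamma>/p of the weight passes from y to x at the price
  of (1 + |x - y|)^(|\<gamma>|/p). The \<open>N\<close> surplus powers of the kernel pay for this;
  the remaining d + 1 keep it integrable, and \<open>nn_integral_weighted_powr\<close> brings the
  p-th power inside the integral.\<close>

lemma local_power_bound:
  assumes B: "B > 0" and p: "p \<ge> 1" and N: "real N \<ge> \<bar>\<gamma>\<bar> / p"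
  obtains c C :: real where "0 < c" "c \<le> 1" "C > 0"
    "\<And>(F :: 'a::euclidean_space \<Rightarrow> real) x. continuous_on UNIV F \<Longrightarrow> (\<And>x. F x \<ge> 0) \<Longrightarrow>
      (\<And>x. ennreal (F x) \<le> ennreal B * (\<integral>\<^sup>+y. ennreal (1 / (1 + norm (x - y)) ^ (DIM('a) + 1 + N) * F y) \<partial>lborel)) \<Longrightarrow>
      ennreal (F x powr p) \<le> ennreal (C * max 1 (norm x) powr (- \<gamma>)) *
        (\<integral>\<^sup>+y. indicator {y. c \<le> norm y} y * ennreal (1 / (1 + norm (x - y)) ^ (DIM('a) + 1) * (F y powr p * norm y powr \<gamma>)) \<partial>lborel)"
proof -
  define D where "D = DIM('a) + 1"
  define b where "b = \<gamma> / p"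
  obtain c C0 :: real where c: "0 < c" "c \<le> 1" and C0: "C0 > 0" and absorb:
    "\<And>(F :: 'a \<Rightarrow> real) x. continuous_on UNIV F \<Longrightarrow> (\<And>x. F x \<ge> 0) \<Longrightarrow>
      (\<And>x. ennreal (F x) \<le> ennreal B * (\<integral>\<^sup>+y. ennreal (1 / (1 + norm (x - y)) ^ (D + N) * F y) \<partial>lborel)) \<Longrightarrow>
      ennreal (F x) \<le> ennreal C0 * (\<integral>\<^sup>+y. indicator {y. c \<le> norm y} y * ennreal (1 / (1 + norm (x - y)) ^ (D + N) * F y) \<partial>lborel)"
    using absorb_origin[OF B, where 'a='a and M="D + N"] by blast
  define K0 where "K0 = enn2real (\<integral>\<^sup>+(z::'a). ennreal (1 / (1 + norm z) ^ D) \<partial>lborel)"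
  have K0: "(\<integral>\<^sup>+(z::'a). ennreal (1 / (1 + norm z) ^ D) \<partial>lborel) = ennreal K0"
    unfolding K0_def using poly_decay_nn_integral[where 'a='a and M=D] by (simp add: D_def)
  have K00: "K0 \<ge> 0" by (simp add: K0_def)
  define K where "K = (2 / c) powr \<bar>b\<bar>"
  have K: "K > 0" using c by (simp add: K_def)
  define C where "C = (C0 * K) powr p * (K0 + 1) powr p"
  have C: "C > 0" using C0 K K00 by (simp add: C_def)
  show ?thesis
  proof (rule that[OF c C])
    fix F :: "'a \<Rightarrow> real" and x :: 'a
    assume cont: "continuous_on UNIV F" and F0: "\<And>x. F x \<ge> 0"
      and hyp: "\<And>x. ennreal (F x) \<le> ennreal B * (\<integral>\<^sup>+y. ennreal (1 / (1 + norm (x - y)) ^ (DIM('a) + 1 + N) * F y) \<partial>lborel)"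
    have [measurable]: "F \<in> borel_measurable borel" using cont by (rule borel_measurable_continuous_onI)
    have [measurable]: "{y::'a. c \<le> norm y} \<in> sets borel" by measurable
    define m where "m = max 1 (norm x)"
    have m: "m \<ge> 1" "norm x \<le> m" "m \<le> 1 + norm x" by (auto simp: m_def)
    define \<nu> where "\<nu> = (\<lambda>y. indicator {y. c \<le> norm y} y * ennreal (1 / (1 + norm (x - y)) ^ D))"
    define G where "G = (\<lambda>y. ennreal (F y * norm y powr b))"
    have [measurable]: "\<nu> \<in> borel_measurable borel" "G \<in> borel_measurable borel" unfolding \<nu>_def G_def by measurable
    have \<nu>K: "(\<integral>\<^sup>+y. \<nu> y \<partial>lborel) \<le> ennreal K0"
    proof -
      have "(\<integral>\<^sup>+y. \<nu> y \<partial>lborel) \<le> (\<integral>\<^sup>+y. ennreal (1 / (1 + norm (x + (-1) *\<^sub>R y)) ^ D) \<partial>lborel)"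
        unfolding \<nu>_def by (intro nn_integral_mono) (auto simp: indicator_def)
      also have "\<dots> = ennreal K0"
        using nn_integral_lborel_affine[of "\<lambda>z::'a. ennreal (1 / (1 + norm z) ^ D)" "-1" x] K0 by simp
      finally show ?thesis .
    qed
    have pt: "indicator {y. c \<le> norm y} y * ennreal (1 / (1 + norm (x - y)) ^ (D + N) * F y)
      \<le> ennreal (K * m powr (- b)) * (\<nu> y * G y)" for y
    proof (cases "c \<le> norm y")
      case True
      define d where "d = norm (x - y)"
      have d: "d \<ge> 0" by (simp add: d_def)
      have y0: "norm y > 0" using True c by linarith
      define t where "t = 2 / c * (1 + d)"
      have c2: "2 / c \<ge> 2" using c by (simp add: field_simps)
      have tpos: "t > 0" using c d by (simp add: t_def)
      have "norm x \<le> d + norm y" using norm_triangle_ineq[of "x - y" y] by (simp add: d_def)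
      moreover have "0 \<le> d * norm y" using d by simp
      ultimately have "m \<le> 1 + (d + (norm y + d * norm y))" using m(3) by linarith
      hence "m \<le> (1 + d) * (1 + norm y)" by (simp add: algebra_simps)
      also have "\<dots> \<le> (1 + d) * (2 / c * norm y)"
      proof (intro mult_left_mono)
        have "1 \<le> norm y / c" "norm y \<le> norm y / c" using True c y0 by (auto simp: field_simps)
        thus "1 + norm y \<le> 2 / c * norm y" by simp
      qed (use d in simp)
      finally have r1: "m / norm y \<le> t" using y0 by (simp add: t_def field_simps)
      have "norm y \<le> norm x + d" using norm_triangle_ineq4[of x "x - y"] by (simp add: d_def)
      also have "\<dots> \<le> m * (1 + d)"
      proof -
        have "1 * d \<le> m * d" using m d by (intro mult_right_mono) auto
        thus ?thesis using m by (simp add: distrib_left)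
      qed
      also have "\<dots> \<le> m * t" using m d c2 unfolding t_def by (intro mult_left_mono) (auto intro: mult_right_mono[of 1 "2/c" "1 + d", simplified])
      finally have r2: "norm y / m \<le> t" using m by (simp add: field_simps)
      have "(m / norm y) powr b \<le> t powr \<bar>b\<bar>"
      proof (cases "b \<ge> 0")
        case True
        thus ?thesis using r1 m y0 by (simp add: powr_mono2)
      next
        case False
        have "(m / norm y) powr b = (norm y / m) powr \<bar>b\<bar>"
          using False m y0 by (simp add: powr_divide powr_minus field_simps)
        also have "\<dots> \<le> t powr \<bar>b\<bar>" using r2 m by (intro powr_mono2) auto
        finally show ?thesis .
      qed
      also have "t powr \<bar>b\<bar> = K * (1 + d) powr \<bar>b\<bar>" using c d unfolding t_def K_def by (subst powr_mult) auto
      also have "(1 + d) powr \<bar>b\<bar> \<le> (1 + d) powr real N" using N d p by (intro powr_mono) (auto simp: b_def abs_divide)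
      hence "K * (1 + d) powr \<bar>b\<bar> \<le> K * (1 + d) ^ N" using K d by (simp add: powr_realpow mult_left_mono)
      finally have "m powr b / norm y powr b \<le> K * (1 + d) ^ N" using m y0 by (simp add: powr_divide)
      hence "1 \<le> K * m powr (- b) * norm y powr b * (1 + d) ^ N"
        using m y0 by (simp add: powr_minus field_simps)
      from mult_right_mono[OF this, of "1 / (1 + d) ^ (D + N) * F y"]
      have "1 / (1 + d) ^ (D + N) * F y \<le> (K * m powr (- b)) * (1 / (1 + d) ^ D * (F y * norm y powr b))"
        using F0[of y] d by (simp add: power_add field_simps)
      hence "ennreal (1 / (1 + d) ^ (D + N) * F y) \<le> ennreal (K * m powr (- b)) * (ennreal (1 / (1 + d) ^ D) * ennreal (F y * norm y powr b))"
        using K F0 d by (simp add: ennreal_leI flip: ennreal_mult)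
      thus ?thesis using True by (simp add: \<nu>_def G_def d_def)
    qed (simp add: \<nu>_def)
    have "ennreal (F x) \<le> ennreal C0 * (\<integral>\<^sup>+y. indicator {y. c \<le> norm y} y * ennreal (1 / (1 + norm (x - y)) ^ (D + N) * F y) \<partial>lborel)"
      using hyp by (intro absorb cont F0) (simp add: D_def)
    also have "\<dots> \<le> ennreal C0 * (\<integral>\<^sup>+y. ennreal (K * m powr (- b)) * (\<nu> y * G y) \<partial>lborel)"
      by (intro mult_left_mono nn_integral_mono pt) auto
    also have "\<dots> = ennreal (C0 * K * m powr (- b)) * (\<integral>\<^sup>+y. \<nu> y * G y \<partial>lborel)"
    proof -
      have "(\<integral>\<^sup>+y. ennreal (K * m powr (- b)) * (\<nu> y * G y) \<partial>lborel) = ennreal (K * m powr (- b)) * (\<integral>\<^sup>+y. \<nu> y * G y \<partial>lborel)"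
        by (rule nn_integral_cmult) simp
      moreover have "ennreal (C0 * K * m powr (- b)) = ennreal C0 * ennreal (K * m powr (- b))"
        unfolding mult.assoc using C0 by (intro ennreal_mult') simp
      ultimately show ?thesis by (simp add: mult.assoc)
    qed
    finally have "enn_powr (ennreal (F x)) p \<le> enn_powr (ennreal (C0 * K * m powr (- b)) * (\<integral>\<^sup>+y. \<nu> y * G y \<partial>lborel)) p"
      using p by (intro enn_powr_mono) auto
    also have "\<dots> = ennreal ((C0 * K * m powr (- b)) powr p) * enn_powr (\<integral>\<^sup>+y. \<nu> y * G y \<partial>lborel) p"
      using p C0 K by (simp add: enn_powr_mult enn_powr_ennreal)
    also have "\<dots> \<le> ennreal ((C0 * K * m powr (- b)) powr p) * (ennreal ((K0 + 1) powr p) * (\<integral>\<^sup>+y. \<nu> y * enn_powr (G y) p \<partial>lborel))"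
      by (intro mult_left_mono nn_integral_weighted_powr p K00 \<nu>K) auto
    also have "\<dots> = ennreal (C * m powr (- \<gamma>)) * (\<integral>\<^sup>+y. \<nu> y * enn_powr (G y) p \<partial>lborel)"
    proof -
      have "(C0 * K * m powr (- b)) powr p * (K0 + 1) powr p = C * m powr (- \<gamma>)"
        using C0 K p m by (simp add: C_def powr_mult powr_powr b_def)
      thus ?thesis by (simp add: mult.assoc[symmetric] flip: ennreal_mult)
    qed
    also have "(\<integral>\<^sup>+y. \<nu> y * enn_powr (G y) p \<partial>lborel)
      = (\<integral>\<^sup>+y. indicator {y. c \<le> norm y} y * ennreal (1 / (1 + norm (x - y)) ^ D * (F y powr p * norm y powr \<gamma>)) \<partial>lborel)"
    proof (rule nn_integral_cong)
      fix y
      have "(F y * norm y powr b) powr p = F y powr p * norm y powr \<gamma>"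
        using F0[of y] p by (simp add: powr_mult powr_powr b_def)
      hence "enn_powr (G y) p = ennreal (F y powr p * norm y powr \<gamma>)"
        unfolding G_def using F0[of y] by (simp add: enn_powr_ennreal)
      thus "\<nu> y * enn_powr (G y) p = indicator {y. c \<le> norm y} y * ennreal (1 / (1 + norm (x - y)) ^ D * (F y powr p * norm y powr \<gamma>))"
        unfolding \<nu>_def by (subst ennreal_mult) (auto simp: mult.assoc)
    qed
    finally show "ennreal (F x powr p) \<le> ennreal (C * max 1 (norm x) powr (- \<gamma>)) *
        (\<integral>\<^sup>+y. indicator {y. c \<le> norm y} y * ennreal (1 / (1 + norm (x - y)) ^ (DIM('a) + 1) * (F y powr p * norm y powr \<gamma>)) \<partial>lborel)"
      using F0[of x] by (simp add: enn_powr_ennreal m_def D_def)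
  qed
qed

text \<open>The unscaled bound is applied to F (u/L) and the integrals are transformed back. Neither
  \<open>c\<close> nor \<open>C\<close> depends on \<open>L\<close>, so one pair of constants serves
  all dyadic scales.\<close>

lemma scaled_power_bound:
  assumes B: "B > 0" and p: "p \<ge> 1" and N: "real N \<ge> \<bar>\<gamma>\<bar> / p"
  obtains c C :: real where "0 < c" "c \<le> 1" "C > 0"
    "\<And>(F :: 'a::euclidean_space \<Rightarrow> real) x L. L > 0 \<Longrightarrow> continuous_on UNIV F \<Longrightarrow> (\<And>x. F x \<ge> 0) \<Longrightarrow>
      (\<And>x. ennreal (F x) \<le> ennreal B * (\<integral>\<^sup>+y. ennreal (L ^ DIM('a) / (1 + L * norm (x - y)) ^ (DIM('a) + 1 + N) * F y) \<partial>lborel)) \<Longrightarrow>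
      ennreal (F x powr p) \<le> ennreal (C * max 1 (L * norm x) powr (- \<gamma>)) *
        (\<integral>\<^sup>+y. indicator {y. c \<le> L * norm y} y * ennreal (L ^ DIM('a) / (1 + L * norm (x - y)) ^ (DIM('a) + 1) * (F y powr p * (L * norm y) powr \<gamma>)) \<partial>lborel)"
proof -
  obtain c C :: real where c: "0 < c" "c \<le> 1" "C > 0" and local:
    "\<And>(F :: 'a::euclidean_space \<Rightarrow> real) x. continuous_on UNIV F \<Longrightarrow> (\<And>x. F x \<ge> 0) \<Longrightarrow>
      (\<And>x. ennreal (F x) \<le> ennreal B * (\<integral>\<^sup>+y. ennreal (1 / (1 + norm (x - y)) ^ (DIM('a) + 1 + N) * F y) \<partial>lborel)) \<Longrightarrow>
      ennreal (F x powr p) \<le> ennreal (C * max 1 (norm x) powr (- \<gamma>)) *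
        (\<integral>\<^sup>+y. indicator {y. c \<le> norm y} y * ennreal (1 / (1 + norm (x - y)) ^ (DIM('a) + 1) * (F y powr p * norm y powr \<gamma>)) \<partial>lborel)"
    using local_power_bound[OF B p N, where 'a='a] by blast
  show ?thesis
  proof (rule that[OF c])
    fix F :: "'a \<Rightarrow> real" and x :: 'a and L :: real
    assume L: "L > 0" and cont: "continuous_on UNIV F" and F0: "\<And>x. F x \<ge> 0"
      and hyp: "\<And>x. ennreal (F x) \<le> ennreal B * (\<integral>\<^sup>+y. ennreal (L ^ DIM('a) / (1 + L * norm (x - y)) ^ (DIM('a) + 1 + N) * F y) \<partial>lborel)"
    have Fm[measurable]: "F \<in> borel_measurable borel" using cont by (rule borel_measurable_continuous_onI)
    define G where "G = (\<lambda>u. F ((1 / L) *\<^sub>R u))"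
    have nL: "L * norm (u - v) = norm (L *\<^sub>R u - L *\<^sub>R v)" for u v :: 'a
      using L by (simp flip: scaleR_diff_right)
    have Gh: "ennreal (G u) \<le> ennreal B * (\<integral>\<^sup>+w. ennreal (1 / (1 + norm (u - w)) ^ (DIM('a) + 1 + N) * G w) \<partial>lborel)" for u
    proof -
      have "(\<integral>\<^sup>+y. ennreal (L ^ DIM('a) / (1 + L * norm ((1 / L) *\<^sub>R u - y)) ^ (DIM('a) + 1 + N) * F y) \<partial>lborel)
        = ennreal (\<bar>1 / L\<bar> ^ DIM('a)) * (\<integral>\<^sup>+w. ennreal (L ^ DIM('a) / (1 + L * norm ((1 / L) *\<^sub>R u - (0 + (1 / L) *\<^sub>R w))) ^ (DIM('a) + 1 + N) * F (0 + (1 / L) *\<^sub>R w)) \<partial>lborel)"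
        using L by (intro nn_integral_lborel_affine) auto
      also have "\<dots> = (\<integral>\<^sup>+w. ennreal (\<bar>1 / L\<bar> ^ DIM('a)) * ennreal (L ^ DIM('a) / (1 + L * norm ((1 / L) *\<^sub>R u - (0 + (1 / L) *\<^sub>R w))) ^ (DIM('a) + 1 + N) * F (0 + (1 / L) *\<^sub>R w)) \<partial>lborel)"
        by (rule nn_integral_cmult[symmetric]) measurable
      also have "\<dots> = (\<integral>\<^sup>+w. ennreal (1 / (1 + norm (u - w)) ^ (DIM('a) + 1 + N) * G w) \<partial>lborel)"
      proof (rule nn_integral_cong)
        fix w
        have "L * norm ((1 / L) *\<^sub>R u - (0 + (1 / L) *\<^sub>R w)) = norm (u - w)" unfolding nL using L by simp
        moreover have "\<bar>1 / L\<bar> ^ DIM('a) * L ^ DIM('a) = 1" using L by (simp add: power_one_over)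
        ultimately show "ennreal (\<bar>1 / L\<bar> ^ DIM('a)) * ennreal (L ^ DIM('a) / (1 + L * norm ((1 / L) *\<^sub>R u - (0 + (1 / L) *\<^sub>R w))) ^ (DIM('a) + 1 + N) * F (0 + (1 / L) *\<^sub>R w))
          = ennreal (1 / (1 + norm (u - w)) ^ (DIM('a) + 1 + N) * G w)"
          by (simp only: G_def add_0 mult.assoc[symmetric] times_divide_eq_right ennreal_mult'[symmetric] zero_le_power abs_ge_zero)
      qed
      finally show ?thesis using hyp[of "(1 / L) *\<^sub>R u"] by (simp add: G_def)
    qed
    have Gc: "continuous_on UNIV G" unfolding G_def
      by (rule continuous_on_compose2[OF cont]) (auto intro!: continuous_intros)
    have "ennreal (G (L *\<^sub>R x) powr p) \<le> ennreal (C * max 1 (norm (L *\<^sub>R x)) powr (- \<gamma>)) *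
        (\<integral>\<^sup>+y. indicator {y. c \<le> norm y} y * ennreal (1 / (1 + norm (L *\<^sub>R x - y)) ^ (DIM('a) + 1) * (G y powr p * norm y powr \<gamma>)) \<partial>lborel)"
      by (rule local[OF Gc _ Gh]) (simp add: G_def F0)
    also have "(\<integral>\<^sup>+y. indicator {y. c \<le> norm y} y * ennreal (1 / (1 + norm (L *\<^sub>R x - y)) ^ (DIM('a) + 1) * (G y powr p * norm y powr \<gamma>)) \<partial>lborel)
      = ennreal (\<bar>L\<bar> ^ DIM('a)) * (\<integral>\<^sup>+y. indicator {y. c \<le> norm y} (0 + L *\<^sub>R y) * ennreal (1 / (1 + norm (L *\<^sub>R x - (0 + L *\<^sub>R y))) ^ (DIM('a) + 1) * (G (0 + L *\<^sub>R y) powr p * norm (0 + L *\<^sub>R y) powr \<gamma>)) \<partial>lborel)"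
      using L by (intro nn_integral_lborel_affine) (auto simp: G_def)
    also have "\<dots> = (\<integral>\<^sup>+y. ennreal (\<bar>L\<bar> ^ DIM('a)) * (indicator {y. c \<le> norm y} (0 + L *\<^sub>R y) * ennreal (1 / (1 + norm (L *\<^sub>R x - (0 + L *\<^sub>R y))) ^ (DIM('a) + 1) * (G (0 + L *\<^sub>R y) powr p * norm (0 + L *\<^sub>R y) powr \<gamma>))) \<partial>lborel)"
      by (rule nn_integral_cmult[symmetric]) (auto simp: G_def)
    also have "\<dots> = (\<integral>\<^sup>+y. indicator {y. c \<le> L * norm y} y * ennreal (L ^ DIM('a) / (1 + L * norm (x - y)) ^ (DIM('a) + 1) * (F y powr p * (L * norm y) powr \<gamma>)) \<partial>lborel)"
    proof (rule nn_integral_cong)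
      fix y
      have G: "G (0 + L *\<^sub>R y) = F y" "norm (0 + L *\<^sub>R y) = L * norm y" using L by (auto simp: G_def)
      have n: "norm (L *\<^sub>R x - (0 + L *\<^sub>R y)) = L * norm (x - y)" using nL[of x y] by simp
      show "ennreal (\<bar>L\<bar> ^ DIM('a)) * (indicator {y. c \<le> norm y} (0 + L *\<^sub>R y) * ennreal (1 / (1 + norm (L *\<^sub>R x - (0 + L *\<^sub>R y))) ^ (DIM('a) + 1) * (G (0 + L *\<^sub>R y) powr p * norm (0 + L *\<^sub>R y) powr \<gamma>)))
        = indicator {y. c \<le> L * norm y} y * ennreal (L ^ DIM('a) / (1 + L * norm (x - y)) ^ (DIM('a) + 1) * (F y powr p * (L * norm y) powr \<gamma>))"
      proof (cases "c \<le> L * norm y")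
        case True
        hence "indicator {y. c \<le> norm y} (0 + L *\<^sub>R y) = (1::ennreal)" "indicator {y. c \<le> L * norm y} y = (1::ennreal)"
          using G(2) by (auto simp: indicator_def)
        thus ?thesis unfolding G n using L by (simp flip: ennreal_mult')
      next
        case False
        hence "indicator {y. c \<le> norm y} (0 + L *\<^sub>R y) = (0::ennreal)" "indicator {y. c \<le> L * norm y} y = (0::ennreal)"
          using G(2) by (auto simp: indicator_def)
        thus ?thesis by simp
      qed
    qed
    finally show "ennreal (F x powr p) \<le> ennreal (C * max 1 (L * norm x) powr (- \<gamma>)) *
        (\<integral>\<^sup>+y. indicator {y. c \<le> L * norm y} y * ennreal (L ^ DIM('a) / (1 + L * norm (x - y)) ^ (DIM('a) + 1) * (F y powr p * (L * norm y) powr \<gamma>)) \<partial>lborel)"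
      using L by (simp add: G_def)
  qed
qed

text \<open>On the shell 2^(-j-1) < |x| <= 2^(-j) the integrand is comparable to 2^(-j\<beta>), and
  the shell lies in a ball of volume proportional to 2^(-jd). This gives a geometric series of ratio
  2^(-(\<beta>+d)) < 1. The origin contributes nothing, since a power of 0 is 0.\<close>

lemma power_norm_unit_ball_nn_integral:
  assumes \<beta>: "\<beta> > - real DIM('a::euclidean_space)"
  shows "(\<integral>\<^sup>+(x::'a). indicator (cball 0 1) x * ennreal (norm x powr \<beta>) \<partial>lborel) < \<infinity>"
proof -
  define V where "V = unit_ball_vol (real DIM('a))"
  have V: "V \<ge> 0" by (simp add: V_def)
  define r where "r j = 2 powr (- real j)" for j
  have r0: "r j > 0" for j by (simp add: r_def)
  have rS: "r (Suc j) = r j / 2" for j by (simp add: r_def powr_diff powr_minus_divide powr_add)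
  have rn: "r j = (1/2) ^ j" for j by (simp add: r_def powr_minus power_one_over powr_realpow inverse_eq_divide)
  have "(\<integral>\<^sup>+(x::'a). indicator (cball 0 1) x * ennreal (norm x powr \<beta>) \<partial>lborel)
    \<le> (\<integral>\<^sup>+(x::'a). (\<Sum>j. ennreal (2 powr \<bar>\<beta>\<bar> * r j powr \<beta>) * indicator (cball 0 (r j)) x) \<partial>lborel)"
  proof (rule nn_integral_mono)
    fix x :: 'a
    show "indicator (cball 0 1) x * ennreal (norm x powr \<beta>) \<le> (\<Sum>j. ennreal (2 powr \<bar>\<beta>\<bar> * r j powr \<beta>) * indicator (cball 0 (r j)) x)"
    proof (cases "x \<noteq> 0 \<and> norm x \<le> 1")
      case True
      obtain n where "(1/2::real) ^ n < norm x" using True real_arch_pow_inv[of "norm x" "1/2"] by auto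
      hence ex: "r n < norm x" by (simp add: rn)
      define k where "k = (LEAST k. r k < norm x)"
      have k: "r k < norm x" unfolding k_def by (rule LeastI[of "\<lambda>k. r k < norm x", OF ex])
      have "r 0 = 1" by (simp add: r_def)
      hence "k \<noteq> 0" using k True by (metis linorder_not_less)
      then obtain j where j: "k = Suc j" by (cases k) auto
      have xj: "norm x \<le> r j" using not_less_Least[of j "\<lambda>k. r k < norm x"] j by (simp add: k_def)
      have jx: "r j / 2 \<le> norm x" using k j rS[of j] by simp
      have "norm x powr \<beta> \<le> 2 powr \<bar>\<beta>\<bar> * r j powr \<beta>"
      proof (cases "\<beta> \<ge> 0")
        case True
        hence "norm x powr \<beta> \<le> 1 * r j powr \<beta>" using xj by (simp add: powr_mono2)
        also have "\<dots> \<le> 2 powr \<bar>\<beta>\<bar> * r j powr \<beta>" by (intro mult_right_mono ge_one_powr_ge_zero) auto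
        finally show ?thesis .
      next
        case False
        hence "norm x powr \<beta> \<le> (r j / 2) powr \<beta>" using jx r0[of j] by (intro powr_mono2') auto
        also have "\<dots> = 2 powr \<bar>\<beta>\<bar> * r j powr \<beta>" using r0[of j] False by (simp add: powr_divide powr_minus field_simps)
        finally show ?thesis .
      qed
      hence "indicator (cball 0 1) x * ennreal (norm x powr \<beta>) \<le> ennreal (2 powr \<bar>\<beta>\<bar> * r j powr \<beta>) * indicator (cball 0 (r j)) x"
        using xj True by (simp add: ennreal_leI)
      also have "\<dots> \<le> (\<Sum>j. ennreal (2 powr \<bar>\<beta>\<bar> * r j powr \<beta>) * indicator (cball 0 (r j)) x)"
        by (rule ennreal_le_suminf)
      finally show ?thesis .
    qed (auto simp: indicator_def)
  qed
  also have "\<dots> = (\<Sum>j. ennreal (2 powr \<bar>\<beta>\<bar> * r j powr \<beta>) * emeasure lborel (cball (0::'a) (r j)))"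
  proof (subst nn_integral_suminf)
    show "(\<lambda>x::'a. ennreal (2 powr \<bar>\<beta>\<bar> * r j powr \<beta>) * indicator (cball 0 (r j)) x) \<in> borel_measurable lborel" for j
    proof -
      have [measurable]: "cball (0::'a) (r j) \<in> sets borel" by simp
      show ?thesis by measurable
    qed
  qed (intro suminf_cong nn_integral_cmult_indicator, simp)
  also have "\<dots> = (\<Sum>j. ennreal (2 powr \<bar>\<beta>\<bar> * V * (2 powr (- (\<beta> + real DIM('a)))) ^ j))"
  proof (intro suminf_cong)
    fix j
    have "r j powr \<beta> * r j ^ DIM('a) = (2 powr (- (\<beta> + real DIM('a)))) ^ j"
    proof -
      have "r j powr \<beta> * r j ^ DIM('a) = r j powr (\<beta> + real DIM('a))"
        using r0[of j] by (simp add: powr_add powr_realpow)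
      also have "\<dots> = (2 powr (- (\<beta> + real DIM('a)))) powr real j"
        unfolding r_def powr_powr by (simp add: algebra_simps)
      finally show ?thesis by (simp add: powr_realpow)
    qed
    hence "2 powr \<bar>\<beta>\<bar> * r j powr \<beta> * (V * r j ^ DIM('a)) = 2 powr \<bar>\<beta>\<bar> * V * (2 powr (- (\<beta> + real DIM('a)))) ^ j"
      by (simp add: ac_simps)
    thus "ennreal (2 powr \<bar>\<beta>\<bar> * r j powr \<beta>) * emeasure lborel (cball (0::'a) (r j)) = ennreal (2 powr \<bar>\<beta>\<bar> * V * (2 powr (- (\<beta> + real DIM('a)))) ^ j)"
      using V r0[of j] by (simp add: emeasure_cball V_def[symmetric] less_imp_le flip: ennreal_mult)
  qed
  also have "\<dots> < \<infinity>"
  proof -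
    have "2 powr (- (\<beta> + real DIM('a))) < 2 powr 0" using \<beta> by (intro powr_less_mono) auto
    hence "summable (\<lambda>j. 2 powr \<bar>\<beta>\<bar> * V * (2 powr (- (\<beta> + real DIM('a)))) ^ j)"
      by (intro summable_mult summable_geometric) auto
    thus ?thesis using V by (subst suminf_ennreal2) auto
  qed
  finally show ?thesis .
qed

section \<open>Low and high frequencies\<close>

lemma two_powr_scale:
  assumes "r > 0"
  shows "2 ^ k * r = 2 powr (real k - (- log 2 r))"
  using assms by (simp add: powr_add powr_realpow)

text \<open>For r = |x| write 2^(ka) = r^(-a) (2^k r)^a. Over the range 2^k r <= 1 the numbers (2^k
  r)^(a/2) have a sum bounded uniformly in r and serve as weights \<nu>; the other half of the power
  stays with b k in \<open>G\<close>. Then \<open>suminf_weighted_powr\<close> moves the p-th power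
  inside the sum, and each level can be integrated on its own.\<close>

lemma hardy_dyadic:
  assumes a: "a > 0" and p: "p \<ge> 1"
  obtains C where "C > 0" "\<And>b :: nat \<Rightarrow> ennreal.
    (\<integral>\<^sup>+(x::'a::euclidean_space). enn_powr (\<Sum>k. indicator {x. 2 ^ k * norm x \<le> 1} x * (ennreal (2 powr (real k * a)) * b k)) p
        * ennreal (norm x powr (a * p - real DIM('a))) \<partial>lborel) \<le> ennreal C * (\<Sum>k. enn_powr (b k) p)"
proof -
  have a2: "a / 2 > 0" using a by simp
  obtain K where K: "K > 0" "\<And>t. (\<Sum>k. ennreal (2 powr (- (a / 2) * \<bar>real k - t\<bar>))) \<le> ennreal K"
    using suminf_two_sided_geometric[OF a2] by blast
  \<comment> \<open>Collects a/2 from the weights and a p/2 from the p-th power of \<open>G\<close>;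
    being positive, it makes |x|^(\<beta> - d) integrable at the origin.\<close>
  define \<beta> where "\<beta> = a * (1 + p) / 2"
  have \<beta>: "\<beta> > 0" using a p by (simp add: \<beta>_def)
  define Z where "Z = enn2real (\<integral>\<^sup>+(x::'a). indicator (cball 0 1) x * ennreal (norm x powr (\<beta> - real DIM('a))) \<partial>lborel)"
  have Z: "(\<integral>\<^sup>+(x::'a). indicator (cball 0 1) x * ennreal (norm x powr (\<beta> - real DIM('a))) \<partial>lborel) = ennreal Z"
    unfolding Z_def using power_norm_unit_ball_nn_integral[where 'a='a and \<beta>="\<beta> - real DIM('a)"] \<beta> by simp
  have Z0: "Z \<ge> 0" by (simp add: Z_def)
  define C where "C = (K + 1) powr p * Z + 1"
  have C: "C > 0" using Z0 by (simp add: C_def add_nonneg_pos)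
  let ?I = "\<lambda>k. {x::'a. 2 ^ k * norm x \<le> 1}"
  have [measurable]: "?I k \<in> sets borel" for k by measurable
  have [measurable]: "cball (0::'a) 1 \<in> sets borel" by simp
  show ?thesis
  proof (rule that[OF C])
    fix b :: "nat \<Rightarrow> ennreal"
    have pt: "enn_powr (\<Sum>k. indicator (?I k) x * (ennreal (2 powr (real k * a)) * b k)) p * ennreal (norm x powr (a * p - real DIM('a)))
      \<le> (\<Sum>k. (ennreal ((K + 1) powr p) * enn_powr (b k) p) * (indicator (?I k) x * ennreal ((2 ^ k * norm x) powr \<beta> * norm x powr (- real DIM('a)))))" for x :: 'a
    proof (cases "x = 0")
      case False
      define r where "r = norm x"
      have r: "r > 0" using False by (simp add: r_def)
      define t where "t = - log 2 r"
      have sc: "2 ^ k * r = 2 powr (real k - t)" for k unfolding t_def by (rule two_powr_scale[OF r])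
      define i where "i = (\<lambda>k. indicator (?I k) x :: ennreal)"
      have i: "i k = (if 2 ^ k * r \<le> 1 then 1 else 0)" for k by (simp add: i_def r_def indicator_def)
      define \<nu> where "\<nu> = (\<lambda>k. i k * ennreal ((2 ^ k * r) powr (a / 2)))"
      define G where "G = (\<lambda>k. ennreal ((2 ^ k * r) powr (a / 2) * r powr (- a)) * b k)"
      have \<nu>K: "(\<Sum>k. \<nu> k) \<le> ennreal K"
      proof (rule order_trans[OF suminf_le K(2)[of t]])
        show "\<nu> k \<le> ennreal (2 powr (- (a / 2) * \<bar>real k - t\<bar>))" for k
        proof (cases "2 ^ k * r \<le> 1")
          case True
          hence "2 powr (real k - t) \<le> 2 powr 0" unfolding sc by simp
          hence "real k - t \<le> 0" by (subst (asm) powr_le_cancel_iff) auto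
          hence ab: "\<bar>real k - t\<bar> = t - real k" by simp
          have "(real k - t) * (a / 2) = - (a / 2) * \<bar>real k - t\<bar>" unfolding ab by (simp add: field_simps)
          hence "(2 ^ k * r) powr (a / 2) = 2 powr (- (a / 2) * \<bar>real k - t\<bar>)"
            unfolding sc powr_powr by (rule arg_cong)
          thus ?thesis using True by (simp add: \<nu>_def i)
        qed (simp add: \<nu>_def i)
      qed auto
      have e1: "i k * (ennreal (2 powr (real k * a)) * b k) = \<nu> k * G k" for k
      proof -
        have "(2 ^ k * r) powr (a / 2) * ((2 ^ k * r) powr (a / 2) * r powr (- a)) = (2 ^ k * r) powr a * r powr (- a)"
          by (simp add: mult.assoc[symmetric] flip: powr_add)
        also have "\<dots> = 2 powr (real k * a)"
          using r by (simp add: powr_mult powr_minus powr_powr flip: powr_realpow)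
        finally have "ennreal (2 powr (real k * a)) = ennreal ((2 ^ k * r) powr (a / 2)) * ennreal ((2 ^ k * r) powr (a / 2) * r powr (- a))"
          by (simp flip: ennreal_mult)
        thus ?thesis by (simp add: \<nu>_def G_def mult.assoc)
      qed
      have e2: "\<nu> k * enn_powr (G k) p * ennreal (r powr (a * p - real DIM('a)))
        = enn_powr (b k) p * (i k * ennreal ((2 ^ k * r) powr \<beta> * r powr (- real DIM('a))))" for k
      proof -
        have eG: "enn_powr (G k) p = ennreal (((2 ^ k * r) powr (a / 2) * r powr (- a)) powr p) * enn_powr (b k) p"
          unfolding G_def using p by (subst enn_powr_mult) (auto simp: enn_powr_ennreal)
        have "(2 ^ k * r) powr (a / 2) * ((2 ^ k * r) powr (a / 2) * r powr (- a)) powr p * r powr (a * p - real DIM('a))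
          = (2 ^ k * r) powr \<beta> * r powr (- real DIM('a))"
        proof -
          have "((2 ^ k * r) powr (a / 2) * r powr (- a)) powr p = (2 ^ k * r) powr (a / 2 * p) * r powr (- a * p)"
            by (subst powr_mult) (auto simp: powr_powr)
          moreover have "(2 ^ k * r) powr \<beta> = (2 ^ k * r) powr (a / 2) * (2 ^ k * r) powr (a / 2 * p)"
            by (simp add: \<beta>_def field_simps flip: powr_add)
          moreover have "r powr (- real DIM('a)) = r powr (- a * p) * r powr (a * p - real DIM('a))"
            by (simp flip: powr_add)
          ultimately show ?thesis by (simp add: ac_simps)
        qed
        hence eE: "ennreal ((2 ^ k * r) powr (a / 2)) * ennreal (((2 ^ k * r) powr (a / 2) * r powr (- a)) powr p) * ennreal (r powr (a * p - real DIM('a)))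
          = ennreal ((2 ^ k * r) powr \<beta> * r powr (- real DIM('a)))" by (simp flip: ennreal_mult)
        show ?thesis unfolding \<nu>_def eG eE[symmetric] by (simp only: ac_simps)
      qed
      have "enn_powr (\<Sum>k. i k * (ennreal (2 powr (real k * a)) * b k)) p \<le> ennreal ((K + 1) powr p) * (\<Sum>k. \<nu> k * enn_powr (G k) p)"
        unfolding e1 using K(1) by (intro suminf_weighted_powr p \<nu>K) auto
      from mult_right_mono[OF this zero_le[of "ennreal (r powr (a * p - real DIM('a)))"]]
      have "enn_powr (\<Sum>k. i k * (ennreal (2 powr (real k * a)) * b k)) p * ennreal (r powr (a * p - real DIM('a)))
        \<le> ennreal ((K + 1) powr p) * (\<Sum>k. \<nu> k * enn_powr (G k) p * ennreal (r powr (a * p - real DIM('a))))"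
        unfolding ennreal_suminf_multc by (simp only: mult.assoc)
      also have "\<dots> = (\<Sum>k. (ennreal ((K + 1) powr p) * enn_powr (b k) p) * (i k * ennreal ((2 ^ k * r) powr \<beta> * r powr (- real DIM('a)))))"
        unfolding e2 by (simp add: mult.assoc)
      finally show ?thesis by (simp add: i_def r_def)
    qed simp
    \<comment> \<open>The measure |x|^(-d) dx is invariant under dilations, so every level
      contributes the same constant \<open>Z\<close>.\<close>
    have sc: "(\<integral>\<^sup>+x. indicator (?I k) x * ennreal ((2 ^ k * norm x) powr \<beta> * norm x powr (- real DIM('a))) \<partial>lborel) = ennreal Z" for k
    proof -
      have "ennreal Z = ennreal (\<bar>2 ^ k\<bar> ^ DIM('a)) * (\<integral>\<^sup>+(x::'a). indicator (cball 0 1) (0 + (2 ^ k) *\<^sub>R x) * ennreal (norm (0 + (2 ^ k) *\<^sub>R x) powr (\<beta> - real DIM('a))) \<partial>lborel)"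
        unfolding Z[symmetric] by (intro nn_integral_lborel_affine borel_measurable_times_ennreal borel_measurable_indicator) auto
      also have "\<dots> = (\<integral>\<^sup>+(x::'a). ennreal (\<bar>2 ^ k\<bar> ^ DIM('a)) * (indicator (cball 0 1) (0 + (2 ^ k) *\<^sub>R x) * ennreal (norm (0 + (2 ^ k) *\<^sub>R x) powr (\<beta> - real DIM('a)))) \<partial>lborel)"
        by (rule nn_integral_cmult[symmetric]) measurable
      also have "\<dots> = (\<integral>\<^sup>+x. indicator (?I k) x * ennreal ((2 ^ k * norm x) powr \<beta> * norm x powr (- real DIM('a))) \<partial>lborel)"
      proof (rule nn_integral_cong)
        fix x :: 'a
        have i: "indicator (cball 0 1) (0 + (2 ^ k) *\<^sub>R x) = (indicator (?I k) x :: ennreal)" by (simp add: indicator_def)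
        have "(2 ^ k) ^ DIM('a) * (2 ^ k * norm x) powr (\<beta> - real DIM('a)) = (2 ^ k * norm x) powr \<beta> * norm x powr (- real DIM('a))"
        proof (cases "x = 0")
          case False
          hence "(2 ^ k * norm x) powr (\<beta> - real DIM('a)) = (2 ^ k * norm x) powr \<beta> / ((2 ^ k) ^ DIM('a) * norm x ^ DIM('a))"
            by (simp add: powr_diff powr_realpow power_mult_distrib)
          moreover have "norm x powr (- real DIM('a)) = 1 / norm x ^ DIM('a)"
            using False by (simp add: powr_minus powr_realpow inverse_eq_divide)
          ultimately show ?thesis by simp
        qed simp
        hence e: "ennreal (\<bar>2 ^ k\<bar> ^ DIM('a)) * ennreal (norm (0 + (2 ^ k) *\<^sub>R x) powr (\<beta> - real DIM('a)))
           = ennreal ((2 ^ k * norm x) powr \<beta> * norm x powr (- real DIM('a)))"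
          by (simp flip: ennreal_mult)
        show "ennreal (\<bar>2 ^ k\<bar> ^ DIM('a)) * (indicator (cball 0 1) (0 + (2 ^ k) *\<^sub>R x) * ennreal (norm (0 + (2 ^ k) *\<^sub>R x) powr (\<beta> - real DIM('a))))
           = indicator (?I k) x * ennreal ((2 ^ k * norm x) powr \<beta> * norm x powr (- real DIM('a)))"
          unfolding i e[symmetric] by (simp only: ac_simps)
      qed
      finally show ?thesis by simp
    qed
    have "(\<integral>\<^sup>+x. enn_powr (\<Sum>k. indicator (?I k) x * (ennreal (2 powr (real k * a)) * b k)) p
        * ennreal (norm x powr (a * p - real DIM('a))) \<partial>lborel)
      \<le> (\<integral>\<^sup>+x. (\<Sum>k. (ennreal ((K + 1) powr p) * enn_powr (b k) p) * (indicator (?I k) x * ennreal ((2 ^ k * norm x) powr \<beta> * norm x powr (- real DIM('a))))) \<partial>lborel)"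
      by (intro nn_integral_mono pt)
    also have "\<dots> = (\<Sum>k. (ennreal ((K + 1) powr p) * enn_powr (b k) p) * ennreal Z)"
    proof (subst nn_integral_suminf)
      show "(\<Sum>k. \<integral>\<^sup>+x. (ennreal ((K + 1) powr p) * enn_powr (b k) p) * (indicator (?I k) x * ennreal ((2 ^ k * norm x) powr \<beta> * norm x powr (- real DIM('a)))) \<partial>lborel)
        = (\<Sum>k. (ennreal ((K + 1) powr p) * enn_powr (b k) p) * ennreal Z)"
      proof (rule suminf_cong)
        fix k
        show "(\<integral>\<^sup>+x. (ennreal ((K + 1) powr p) * enn_powr (b k) p) * (indicator (?I k) x * ennreal ((2 ^ k * norm x) powr \<beta> * norm x powr (- real DIM('a)))) \<partial>lborel)
          = (ennreal ((K + 1) powr p) * enn_powr (b k) p) * ennreal Z"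
          unfolding sc[of k, symmetric] by (rule nn_integral_cmult) measurable
      qed
    qed measurable
    also have "\<dots> = ennreal ((K + 1) powr p * Z) * (\<Sum>k. enn_powr (b k) p)"
    proof -
      have "(ennreal ((K + 1) powr p) * enn_powr (b k) p) * ennreal Z = ennreal ((K + 1) powr p * Z) * enn_powr (b k) p" for k
        using Z0 by (simp add: ennreal_mult ac_simps)
      thus ?thesis by simp
    qed
    also have "\<dots> \<le> ennreal C * (\<Sum>k. enn_powr (b k) p)"
      by (intro mult_right_mono ennreal_leI) (auto simp: C_def)
    finally show "(\<integral>\<^sup>+x. enn_powr (\<Sum>k. indicator (?I k) x * (ennreal (2 powr (real k * a)) * b k)) p
        * ennreal (norm x powr (a * p - real DIM('a))) \<partial>lborel) \<le> ennreal C * (\<Sum>k. enn_powr (b k) p)" .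
  qed
qed

text \<open>A statement at one point with r = |x|: \<open>h\<close> is the value of the majorant
  there and \<open>G\<close> stands for its norm. If p0 = p1, the first bound alone sums
  geometrically with rate \<epsilon>, starting at 2^k = 1/r. If p0 < p1, a factor r^\<epsilon> is
  taken out and the two bounds are balanced by \<open>suminf_min_geometric\<close>. The exponents
  come out so that the p1-th power contains exactly h^p0 r^\<gamma>0, which integrates to the p0-th
  power of the norm.\<close>

lemma high_frequency_sum:
  assumes p: "1 \<le> p0" "p0 \<le> p1" and d: "d > 0"
    and c1: "\<gamma>1 / p1 \<le> \<gamma>0 / p0" and c2: "(d + \<gamma>1) / p1 < (d + \<gamma>0) / p0"
    and c3: "s0 - (d + \<gamma>0) / p0 \<ge> s1 - (d + \<gamma>1) / p1"
  obtains K where "K > 0" "\<And>f r h G. r > 0 \<Longrightarrow> h \<ge> 0 \<Longrightarrow> G \<ge> 0 \<Longrightarrow>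
      (\<And>k. 1 \<le> 2 ^ k * r \<Longrightarrow> 0 \<le> f k \<and> f k \<le> 2 powr (- real k * s0) * h \<and>
         f k \<le> 2 powr (real k * (d / p0 - s0)) * (r powr (- \<gamma>0 / p0) * G)) \<Longrightarrow>
      enn_powr (\<Sum>k. of_bool (1 \<le> 2 ^ k * r) * ennreal (2 powr (real k * s1) * f k)) p1 * ennreal (r powr \<gamma>1)
        \<le> ennreal (K * (if p0 = p1 then 1 else G powr (p1 - p0))) * ennreal (h powr p0 * r powr \<gamma>0)"
proof -
  define \<epsilon> where "\<epsilon> = \<gamma>0 / p0 - \<gamma>1 / p1"
  define \<eta> where "\<eta> = d / p0 - d / p1"
  have \<epsilon>: "\<epsilon> \<ge> 0" using c1 by (simp add: \<epsilon>_def)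
  have \<eta>: "\<eta> \<ge> 0" using p d by (simp add: \<eta>_def frac_le)
  have s: "s1 - s0 \<le> - \<epsilon> - \<eta>" using c3 by (simp add: \<epsilon>_def \<eta>_def add_divide_distrib)
  have two: "2 powr (real k * s1) * 2 powr (- real k * s0) \<le> 2 powr (- real k * \<epsilon>) * 2 powr (- real k * \<eta>)" for k
  proof -
    have "real k * (s1 - s0) \<le> real k * (- \<epsilon> - \<eta>)" using s by (intro mult_left_mono) auto
    hence "real k * s1 + - real k * s0 \<le> - real k * \<epsilon> + - real k * \<eta>" by (simp add: algebra_simps)
    thus ?thesis unfolding powr_add[symmetric] by (intro powr_mono) auto
  qed
  show ?thesis
  proof (cases "p0 = p1")
    case True
    have e0: "\<epsilon> > 0" using c2 True d p unfolding \<epsilon>_def by (simp add: add_divide_distrib)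
    obtain K where K: "K > 0" "\<And>t. (\<Sum>k. ennreal (2 powr (- \<epsilon> * \<bar>real k - t\<bar>))) \<le> ennreal K"
      using suminf_two_sided_geometric[OF e0] by blast
    show ?thesis
    proof (rule that[of "K powr p1"])
      show "K powr p1 > 0" using K by simp
      fix f :: "nat \<Rightarrow> real" and r h G :: real
      assume r: "r > 0" and h: "h \<ge> 0"
        and f: "\<And>k. 1 \<le> 2 ^ k * r \<Longrightarrow> 0 \<le> f k \<and> f k \<le> 2 powr (- real k * s0) * h \<and>
          f k \<le> 2 powr (real k * (d / p0 - s0)) * (r powr (- \<gamma>0 / p0) * G)"
      define t where "t = - log 2 r"
      have sc: "2 ^ k * r = 2 powr (real k - t)" for k unfolding t_def by (rule two_powr_scale[OF r])
      have rt: "r powr \<epsilon> = 2 powr (- t * \<epsilon>)" using r unfolding t_def by (simp add: powr_powr[symmetric])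
      have "of_bool (1 \<le> 2 ^ k * r) * ennreal (2 powr (real k * s1) * f k) \<le> ennreal (r powr \<epsilon> * h) * ennreal (2 powr (- \<epsilon> * \<bar>real k - t\<bar>))" for k
      proof (cases "1 \<le> 2 ^ k * r")
        case True
        hence "2 powr 0 \<le> 2 powr (real k - t)" unfolding sc by simp
        hence kt: "0 \<le> real k - t" by (subst (asm) powr_le_cancel_iff) auto
        have "2 powr (real k * s1) * f k \<le> 2 powr (real k * s1) * (2 powr (- real k * s0) * h)"
          using f[OF True] by (intro mult_left_mono) auto
        also have "\<dots> \<le> (2 powr (- real k * \<epsilon>) * 2 powr (- real k * \<eta>)) * h"
          unfolding mult.assoc[symmetric] using two[of k] h by (intro mult_right_mono) auto
        also have "\<dots> \<le> (2 powr (- real k * \<epsilon>) * 1) * h"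
        proof (intro mult_right_mono mult_left_mono)
          have "2 powr (- real k * \<eta>) \<le> 2 powr 0" using \<eta> by (intro powr_mono) auto
          thus "2 powr (- real k * \<eta>) \<le> 1" by simp
        qed (use h in auto)
        also have "\<dots> = r powr \<epsilon> * h * 2 powr (- \<epsilon> * \<bar>real k - t\<bar>)"
        proof -
          have "- real k * \<epsilon> = - t * \<epsilon> + - \<epsilon> * \<bar>real k - t\<bar>" using kt by (simp add: algebra_simps)
          thus ?thesis unfolding rt by (simp only: powr_add) simp
        qed
        finally show ?thesis using True h by (simp add: ennreal_leI flip: ennreal_mult)
      qed simp
      hence "(\<Sum>k. of_bool (1 \<le> 2 ^ k * r) * ennreal (2 powr (real k * s1) * f k)) \<le> (\<Sum>k. ennreal (r powr \<epsilon> * h) * ennreal (2 powr (- \<epsilon> * \<bar>real k - t\<bar>)))"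
        by (intro suminf_le) auto
      also have "\<dots> \<le> ennreal (r powr \<epsilon> * h) * ennreal K" using K(2)[of t] by (simp add: mult_left_mono)
      also have "\<dots> = ennreal (K * (r powr \<epsilon> * h))" using K h by (simp add: mult.commute flip: ennreal_mult)
      finally have "enn_powr (\<Sum>k. of_bool (1 \<le> 2 ^ k * r) * ennreal (2 powr (real k * s1) * f k)) p1 \<le> enn_powr (ennreal (K * (r powr \<epsilon> * h))) p1"
        using p by (intro enn_powr_mono) auto
      also have "\<dots> = ennreal (K powr p1 * (r powr (\<epsilon> * p1) * h powr p1))"
        using K h by (simp add: enn_powr_ennreal powr_mult powr_powr)
      finally have "enn_powr (\<Sum>k. of_bool (1 \<le> 2 ^ k * r) * ennreal (2 powr (real k * s1) * f k)) p1 * ennreal (r powr \<gamma>1)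
        \<le> ennreal (K powr p1 * (r powr (\<epsilon> * p1) * h powr p1)) * ennreal (r powr \<gamma>1)" by (rule mult_right_mono) simp
      also have "\<dots> = ennreal (K powr p1 * (h powr p0 * r powr \<gamma>0))"
      proof -
        have "\<epsilon> * p1 + \<gamma>1 = \<gamma>0" using True p by (simp add: \<epsilon>_def field_simps)
        hence "r powr (\<epsilon> * p1) * r powr \<gamma>1 = r powr \<gamma>0" by (simp flip: powr_add)
        hence "K powr p1 * (r powr (\<epsilon> * p1) * h powr p1) * r powr \<gamma>1 = K powr p1 * (h powr p0 * r powr \<gamma>0)"
          unfolding True by (metis (no_types, opaque_lifting) mult.assoc mult.commute)
        thus ?thesis by (simp flip: ennreal_mult')
      qed
      finally show "enn_powr (\<Sum>k. of_bool (1 \<le> 2 ^ k * r) * ennreal (2 powr (real k * s1) * f k)) p1 * ennreal (r powr \<gamma>1)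
        \<le> ennreal (K powr p1 * (if p0 = p1 then 1 else G powr (p1 - p0))) * ennreal (h powr p0 * r powr \<gamma>0)"
        using True by (simp add: ennreal_mult')
    qed
  next
    case False
    hence pp: "p0 < p1" using p by simp
    have p0: "p0 > 0" "p1 > 0" using p by auto
    have e0: "\<eta> > 0" using pp p0 d by (simp add: \<eta>_def frac_less2)
    have dp: "d / p1 > 0" using d p0 by simp
    \<comment> \<open>The decaying bound has rate \<eta>, the growing one rate d/p1; their sum d/p0
      makes the interpolation exponents p0/p1 and 1 - p0/p1.\<close>
    have sumd: "\<eta> + d / p1 = d / p0" by (simp add: \<eta>_def)
    have ex1: "(d / p1) / (\<eta> + d / p1) = p0 / p1" unfolding sumd using d p0 by simp
    have ex2: "\<eta> / (\<eta> + d / p1) = 1 - p0 / p1"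
    proof -
      have "\<eta> / (\<eta> + d / p1) = (d / p0 - d / p1) / (d / p0)" by (simp add: \<eta>_def)
      also have "\<dots> = 1 - p0 / p1" using d p0 by (simp add: field_simps)
      finally show ?thesis .
    qed
    obtain K where K: "K > 0" "\<And>A B. A \<ge> 0 \<Longrightarrow> B \<ge> 0 \<Longrightarrow>
        (\<Sum>k. ennreal (min (A * 2 powr (- real k * \<eta>)) (B * 2 powr (real k * (d / p1)))))
        \<le> ennreal (K * (A powr (p0 / p1) * B powr (1 - p0 / p1)))"
      using suminf_min_geometric[OF e0 dp] unfolding ex1 ex2 by blast
    show ?thesis
    proof (rule that[of "K powr p1"])
      show "K powr p1 > 0" using K by simp
      fix f :: "nat \<Rightarrow> real" and r h G :: real
      assume r: "r > 0" and h: "h \<ge> 0" and G: "G \<ge> 0"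
        and f: "\<And>k. 1 \<le> 2 ^ k * r \<Longrightarrow> 0 \<le> f k \<and> f k \<le> 2 powr (- real k * s0) * h \<and>
          f k \<le> 2 powr (real k * (d / p0 - s0)) * (r powr (- \<gamma>0 / p0) * G)"
      define B where "B = r powr (- \<gamma>0 / p0) * G"
      have B: "B \<ge> 0" using G by (simp add: B_def)
      have "of_bool (1 \<le> 2 ^ k * r) * ennreal (2 powr (real k * s1) * f k)
        \<le> ennreal (r powr \<epsilon>) * ennreal (min (h * 2 powr (- real k * \<eta>)) (B * 2 powr (real k * (d / p1))))" for k
      proof (cases "1 \<le> 2 ^ k * r")
        case True
        \<comment> \<open>High frequency means 1/2^k <= r, and \<epsilon> >= 0; this trades the
          decay 2^(-k\<epsilon>) for a power of r that is independent of k.\<close>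
        have re: "2 powr (- real k * \<epsilon>) \<le> r powr \<epsilon>"
        proof -
          have "1 / 2 ^ k \<le> r" using True by (simp add: field_simps)
          hence "(1 / 2 ^ k) powr \<epsilon> \<le> r powr \<epsilon>" using \<epsilon> by (intro powr_mono2) auto
          moreover have "(1 / 2 ^ k) powr \<epsilon> = 2 powr (- real k * \<epsilon>)"
            by (simp add: powr_divide powr_minus powr_powr inverse_eq_divide flip: powr_realpow)
          ultimately show ?thesis by simp
        qed
        have A: "2 powr (real k * s1) * f k \<le> r powr \<epsilon> * (h * 2 powr (- real k * \<eta>))"
        proof -
          have "2 powr (real k * s1) * f k \<le> 2 powr (real k * s1) * (2 powr (- real k * s0) * h)"
            using f[OF True] by (intro mult_left_mono) auto
          also have "\<dots> \<le> (2 powr (- real k * \<epsilon>) * 2 powr (- real k * \<eta>)) * h"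
            unfolding mult.assoc[symmetric] using two[of k] h by (intro mult_right_mono) auto
          also have "\<dots> \<le> (r powr \<epsilon> * 2 powr (- real k * \<eta>)) * h"
            using re h by (intro mult_right_mono) auto
          finally show ?thesis by (simp add: ac_simps)
        qed
        have A2: "2 powr (real k * s1) * f k \<le> r powr \<epsilon> * (B * 2 powr (real k * (d / p1)))"
        proof -
          have "2 powr (real k * s1) * f k \<le> 2 powr (real k * s1) * (2 powr (real k * (d / p0 - s0)) * B)"
            using f[OF True] by (intro mult_left_mono) (auto simp: B_def)
          also have "2 powr (real k * (d / p0 - s0)) = 2 powr (- real k * s0) * 2 powr (real k * (d / p0))"
            by (simp add: algebra_simps flip: powr_add)
          also have "2 powr (real k * s1) * (2 powr (- real k * s0) * 2 powr (real k * (d / p0)) * B)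
             = (2 powr (real k * s1) * 2 powr (- real k * s0)) * (2 powr (real k * (d / p0)) * B)" by simp
          also have "\<dots> \<le> (r powr \<epsilon> * 2 powr (- real k * \<eta>)) * (2 powr (real k * (d / p0)) * B)"
            using two[of k] re B by (intro mult_right_mono order_trans[OF two]) auto
          also have "\<dots> = r powr \<epsilon> * (B * (2 powr (- real k * \<eta>) * 2 powr (real k * (d / p0))))" by simp
          also have "2 powr (- real k * \<eta>) * 2 powr (real k * (d / p0)) = 2 powr (real k * (d / p1))"
            unfolding sumd[symmetric] powr_add[symmetric] by (simp add: algebra_simps)
          finally show ?thesis .
        qed
        have "2 powr (real k * s1) * f k \<le> r powr \<epsilon> * min (h * 2 powr (- real k * \<eta>)) (B * 2 powr (real k * (d / p1)))"
          using A A2 by (simp add: min_def)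
        thus ?thesis using True by (simp add: ennreal_leI flip: ennreal_mult')
      qed simp
      hence "(\<Sum>k. of_bool (1 \<le> 2 ^ k * r) * ennreal (2 powr (real k * s1) * f k))
         \<le> (\<Sum>k. ennreal (r powr \<epsilon>) * ennreal (min (h * 2 powr (- real k * \<eta>)) (B * 2 powr (real k * (d / p1)))))"
        by (intro suminf_le) auto
      also have "\<dots> \<le> ennreal (r powr \<epsilon>) * ennreal (K * (h powr (p0 / p1) * B powr (1 - p0 / p1)))"
        using K(2)[OF h B] by (simp add: mult_left_mono)
      also have "\<dots> = ennreal (r powr \<epsilon> * (K * (h powr (p0 / p1) * B powr (1 - p0 / p1))))" using K by (simp add: ennreal_mult)
      finally have "enn_powr (\<Sum>k. of_bool (1 \<le> 2 ^ k * r) * ennreal (2 powr (real k * s1) * f k)) p1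
          \<le> enn_powr (ennreal (r powr \<epsilon> * (K * (h powr (p0 / p1) * B powr (1 - p0 / p1))))) p1"
        using p0 by (intro enn_powr_mono) auto
      also have "\<dots> = ennreal (r powr (\<epsilon> * p1) * (K powr p1 * (h powr p0 * B powr (p1 - p0))))"
      proof -
        have "(1 - p0 / p1) * p1 = p1 - p0" using p0 by (simp add: field_simps)
        thus ?thesis using K p0 by (simp add: enn_powr_ennreal powr_mult powr_powr)
      qed
      finally have "enn_powr (\<Sum>k. of_bool (1 \<le> 2 ^ k * r) * ennreal (2 powr (real k * s1) * f k)) p1 * ennreal (r powr \<gamma>1)
        \<le> ennreal (r powr (\<epsilon> * p1) * (K powr p1 * (h powr p0 * B powr (p1 - p0)))) * ennreal (r powr \<gamma>1)" by (rule mult_right_mono) simp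
      also have "\<dots> = ennreal (K powr p1 * G powr (p1 - p0) * (h powr p0 * r powr \<gamma>0))"
      proof -
        have "B powr (p1 - p0) = r powr (- \<gamma>0 / p0 * (p1 - p0)) * G powr (p1 - p0)"
          unfolding B_def using G by (simp add: powr_mult powr_powr)
        moreover have "\<epsilon> * p1 + (- \<gamma>0 / p0 * (p1 - p0)) + \<gamma>1 = \<gamma>0" using p0 by (simp add: \<epsilon>_def field_simps)
        hence "r powr (\<epsilon> * p1) * r powr (- \<gamma>0 / p0 * (p1 - p0)) * r powr \<gamma>1 = r powr \<gamma>0" by (simp only: powr_add[symmetric])
        ultimately have "r powr (\<epsilon> * p1) * (K powr p1 * (h powr p0 * B powr (p1 - p0))) * r powr \<gamma>1 = K powr p1 * G powr (p1 - p0) * (h powr p0 * r powr \<gamma>0)"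
          by (metis (no_types, opaque_lifting) mult.assoc mult.commute)
        thus ?thesis by (simp flip: ennreal_mult')
      qed
      finally show "enn_powr (\<Sum>k. of_bool (1 \<le> 2 ^ k * r) * ennreal (2 powr (real k * s1) * f k)) p1 * ennreal (r powr \<gamma>1)
        \<le> ennreal (K powr p1 * (if p0 = p1 then 1 else G powr (p1 - p0))) * ennreal (h powr p0 * r powr \<gamma>0)"
        using False by (simp add: ennreal_mult')
    qed
  qed
qed

text \<open>Both bounds are \<open>scaled_power_bound\<close> at L = 2^k. For 2^k |x| <= 1 the
  kernel seen from x is comparable to the one seen from the origin, so F k x is controlled by a mass
  \<open>m k\<close> independent of x. Summing the decaying factors of these masses over 2^k |y| >=
  c gives a bound uniform in y, which is why all \<open>m k\<close> together cost only one norm. For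
  2^k |x| >= 1 the kernel is simply estimated by 1 and the full norm appears.\<close>

lemma frequency_bounds:
  assumes B: "B > 0" and p: "p \<ge> 1" and N: "real N \<ge> \<bar>\<gamma>\<bar> / p"
  obtains c C1 C2 :: real where "0 < c" "C1 > 0" "C2 > 0"
    "\<And>(F :: nat \<Rightarrow> 'a::euclidean_space \<Rightarrow> real) (H :: 'a \<Rightarrow> ennreal) h m. (\<And>k. continuous_on UNIV (F k)) \<Longrightarrow> (\<And>k x. F k x \<ge> 0) \<Longrightarrow>
      (\<And>k x. ennreal (F k x) \<le> ennreal B * (\<integral>\<^sup>+y. ennreal ((2 ^ k) ^ DIM('a) / (1 + 2 ^ k * norm (x - y)) ^ (DIM('a) + 1 + N) * F k y) \<partial>lborel)) \<Longrightarrow>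
      H \<in> borel_measurable borel \<Longrightarrow> (\<And>k x. ennreal (2 powr (real k * s) * F k x) \<le> H x) \<Longrightarrow>
      h = (\<lambda>y. enn_powr (H y) p * ennreal (norm y powr \<gamma>)) \<Longrightarrow>
      m = (\<lambda>k. \<integral>\<^sup>+y. indicator {y. c \<le> 2 ^ k * norm y} y * (ennreal ((2 ^ k * norm y) powr (- real (DIM('a) + 1))) * h y) \<partial>lborel) \<Longrightarrow>
      (\<forall>k x. 2 ^ k * norm x \<le> 1 \<longrightarrow> ennreal (F k x powr p) \<le> ennreal (C1 * 2 powr (real k * (real DIM('a) + \<gamma> - s * p))) * m k) \<and>
      (\<forall>k x. 1 \<le> 2 ^ k * norm x \<longrightarrow> ennreal (F k x powr p) \<le> ennreal (C1 * 2 powr (real k * (real DIM('a) - s * p)) * norm x powr (- \<gamma>)) * (\<integral>\<^sup>+y. h y \<partial>lborel)) \<and>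
      (\<Sum>k. m k) \<le> ennreal C2 * (\<integral>\<^sup>+y. h y \<partial>lborel)"
proof -
  \<comment> \<open>The decay exponent of the kernel that is left after \<open>N\<close> powers have
    been spent on the weight.\<close>
  define q where "q = DIM('a) + 1"
  have q: "real q > 0" by (simp add: q_def)
  obtain c C :: real where c: "0 < c" "c \<le> 1" "C > 0" and local:
    "\<And>(F :: 'a::euclidean_space \<Rightarrow> real) x L. L > 0 \<Longrightarrow> continuous_on UNIV F \<Longrightarrow> (\<And>x. F x \<ge> 0) \<Longrightarrow>
      (\<And>x. ennreal (F x) \<le> ennreal B * (\<integral>\<^sup>+y. ennreal (L ^ DIM('a) / (1 + L * norm (x - y)) ^ (DIM('a) + 1 + N) * F y) \<partial>lborel)) \<Longrightarrow>
      ennreal (F x powr p) \<le> ennreal (C * max 1 (L * norm x) powr (- \<gamma>)) *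
        (\<integral>\<^sup>+y. indicator {y. c \<le> L * norm y} y * ennreal (L ^ DIM('a) / (1 + L * norm (x - y)) ^ (DIM('a) + 1) * (F y powr p * (L * norm y) powr \<gamma>)) \<partial>lborel)"
    using scaled_power_bound[OF B p N, where 'a='a] by blast
  obtain K where K: "K > 0" "\<And>t. (\<Sum>k. ennreal (2 powr (- real q * \<bar>real k - t\<bar>))) \<le> ennreal K"
    using suminf_two_sided_geometric[OF q] by blast
  define C1 where "C1 = C * 2 ^ q"
  define C2 where "C2 = c powr (- real q) * K"
  have C12: "C1 > 0" "C2 > 0" using c K by (auto simp: C1_def C2_def)
  show ?thesis
  proof (rule that[OF c(1) C12])
    fix F :: "nat \<Rightarrow> 'a \<Rightarrow> real" and H h :: "'a \<Rightarrow> ennreal" and m :: "nat \<Rightarrow> ennreal"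
    assume cont: "\<And>k. continuous_on UNIV (F k)" and F0: "\<And>k x. F k x \<ge> 0"
      and hyp: "\<And>k x. ennreal (F k x) \<le> ennreal B * (\<integral>\<^sup>+y. ennreal ((2 ^ k) ^ DIM('a) / (1 + 2 ^ k * norm (x - y)) ^ (DIM('a) + 1 + N) * F k y) \<partial>lborel)"
      and Hm[measurable]: "H \<in> borel_measurable borel" and FH: "\<And>k x. ennreal (2 powr (real k * s) * F k x) \<le> H x"
      and h: "h = (\<lambda>y. enn_powr (H y) p * ennreal (norm y powr \<gamma>))"
      and m: "m = (\<lambda>k. \<integral>\<^sup>+y. indicator {y. c \<le> 2 ^ k * norm y} y * (ennreal ((2 ^ k * norm y) powr (- real (DIM('a) + 1))) * h y) \<partial>lborel)"
    have hm[measurable]: "h \<in> borel_measurable borel" unfolding h by measurable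
    have [measurable]: "{y::'a. c \<le> 2 ^ k * norm y} \<in> sets borel" for k by measurable
    let ?i = "\<lambda>k y. indicator {y::'a. c \<le> 2 ^ k * norm y} y :: ennreal"
    have Fh: "ennreal (F k y powr p * norm y powr \<gamma>) \<le> ennreal (2 powr (- real k * s * p)) * h y" for k y
    proof -
      have "ennreal ((2 powr (real k * s) * F k y) powr p) \<le> enn_powr (H y) p"
        using enn_powr_mono[OF FH[of k y], of p] p F0[of k y] by (simp add: enn_powr_ennreal)
      hence "ennreal (2 powr (- real k * s * p) * norm y powr \<gamma>) * ennreal ((2 powr (real k * s) * F k y) powr p)
        \<le> ennreal (2 powr (- real k * s * p) * norm y powr \<gamma>) * enn_powr (H y) p"
        by (intro mult_left_mono) auto
      moreover have "ennreal (2 powr (- real k * s * p) * norm y powr \<gamma>) * ennreal ((2 powr (real k * s) * F k y) powr p)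
        = ennreal (F k y powr p * norm y powr \<gamma>)"
      proof -
        have "(2 powr (real k * s) * F k y) powr p = 2 powr (real k * s * p) * F k y powr p"
          using F0[of k y] by (simp add: powr_mult powr_powr)
        moreover have "2 powr (- real k * s * p) * 2 powr (real k * s * p) = (1::real)"
          unfolding powr_add[symmetric] by simp
        ultimately have "2 powr (- real k * s * p) * norm y powr \<gamma> * (2 powr (real k * s) * F k y) powr p = F k y powr p * norm y powr \<gamma>"
          using arg_cong[of _ _ "\<lambda>u. u * (F k y powr p * norm y powr \<gamma>)"] by (simp only: mult_1 ac_simps)
        thus ?thesis by (simp flip: ennreal_mult)
      qed
      moreover have "ennreal (2 powr (- real k * s * p) * norm y powr \<gamma>) * enn_powr (H y) p = ennreal (2 powr (- real k * s * p)) * h y"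
        unfolding h by (simp add: ennreal_mult ac_simps)
      ultimately show ?thesis by simp
    qed
    have main: "ennreal (F k x powr p) \<le> ennreal (C * max 1 (2 ^ k * norm x) powr (- \<gamma>) * 2 powr (real k * (real DIM('a) + \<gamma> - s * p)))
        * (\<integral>\<^sup>+y. ?i k y * (ennreal (1 / (1 + 2 ^ k * norm (x - y)) ^ q) * h y) \<partial>lborel)" for k x
    proof -
      have pw2: "(2 ^ k) ^ DIM('a) * (2 ^ k) powr \<gamma> * 2 powr (- real k * s * p) = 2 powr (real k * (real DIM('a) + \<gamma> - s * p))"
      proof -
        have "(2 ^ k) ^ DIM('a) = 2 powr (real k * real DIM('a))" by (simp add: powr_realpow[symmetric] powr_powr)
        moreover have "(2 ^ k) powr \<gamma> = 2 powr (real k * \<gamma>)" by (simp add: powr_realpow[symmetric] powr_powr)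
        moreover have "real k * (real DIM('a) + \<gamma> - s * p) = real k * real DIM('a) + real k * \<gamma> + - real k * s * p"
          by (simp add: algebra_simps)
        ultimately show ?thesis by (simp only: powr_add)
      qed
      have pt: "?i k y * ennreal ((2 ^ k) ^ DIM('a) / (1 + 2 ^ k * norm (x - y)) ^ (DIM('a) + 1) * (F k y powr p * (2 ^ k * norm y) powr \<gamma>))
        \<le> ennreal (2 powr (real k * (real DIM('a) + \<gamma> - s * p))) * (?i k y * (ennreal (1 / (1 + 2 ^ k * norm (x - y)) ^ q) * h y))" for y
      proof -
        have "(2 ^ k) ^ DIM('a) / (1 + 2 ^ k * norm (x - y)) ^ (DIM('a) + 1) * (F k y powr p * (2 ^ k * norm y) powr \<gamma>)
          = ((2 ^ k) ^ DIM('a) * (2 ^ k) powr \<gamma> * (1 / (1 + 2 ^ k * norm (x - y)) ^ q)) * (F k y powr p * norm y powr \<gamma>)"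
          by (simp add: powr_mult q_def)
        hence "ennreal ((2 ^ k) ^ DIM('a) / (1 + 2 ^ k * norm (x - y)) ^ (DIM('a) + 1) * (F k y powr p * (2 ^ k * norm y) powr \<gamma>))
          = ennreal ((2 ^ k) ^ DIM('a) * (2 ^ k) powr \<gamma> * (1 / (1 + 2 ^ k * norm (x - y)) ^ q)) * ennreal (F k y powr p * norm y powr \<gamma>)"
          by (simp only: ennreal_mult'' mult_nonneg_nonneg powr_ge_zero)
        also have "\<dots> \<le> ennreal ((2 ^ k) ^ DIM('a) * (2 ^ k) powr \<gamma> * (1 / (1 + 2 ^ k * norm (x - y)) ^ q)) * (ennreal (2 powr (- real k * s * p)) * h y)"
          by (intro mult_left_mono Fh) simp
        also have "\<dots> = ennreal ((2 ^ k) ^ DIM('a) * (2 ^ k) powr \<gamma> * 2 powr (- real k * s * p)) * (ennreal (1 / (1 + 2 ^ k * norm (x - y)) ^ q) * h y)"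
        proof -
          have "ennreal ((2 ^ k) ^ DIM('a) * (2 ^ k) powr \<gamma> * (1 / (1 + 2 ^ k * norm (x - y)) ^ q)) * ennreal (2 powr (- real k * s * p))
            = ennreal ((2 ^ k) ^ DIM('a) * (2 ^ k) powr \<gamma> * 2 powr (- real k * s * p)) * ennreal (1 / (1 + 2 ^ k * norm (x - y)) ^ q)"
            by (simp add: ac_simps flip: ennreal_mult)
          thus ?thesis by (simp only: mult.assoc[symmetric])
        qed
        finally have "?i k y * ennreal ((2 ^ k) ^ DIM('a) / (1 + 2 ^ k * norm (x - y)) ^ (DIM('a) + 1) * (F k y powr p * (2 ^ k * norm y) powr \<gamma>))
          \<le> ?i k y * (ennreal (2 powr (real k * (real DIM('a) + \<gamma> - s * p))) * (ennreal (1 / (1 + 2 ^ k * norm (x - y)) ^ q) * h y))"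
          unfolding pw2 by (intro mult_left_mono) auto
        thus ?thesis by (simp only: mult.left_commute)
      qed
      have "ennreal (F k x powr p) \<le> ennreal (C * max 1 (2 ^ k * norm x) powr (- \<gamma>)) *
        (\<integral>\<^sup>+y. ?i k y * ennreal ((2 ^ k) ^ DIM('a) / (1 + 2 ^ k * norm (x - y)) ^ (DIM('a) + 1) * (F k y powr p * (2 ^ k * norm y) powr \<gamma>)) \<partial>lborel)"
        by (intro local cont F0 hyp) simp
      also have "\<dots> \<le> ennreal (C * max 1 (2 ^ k * norm x) powr (- \<gamma>)) *
        (\<integral>\<^sup>+y. ennreal (2 powr (real k * (real DIM('a) + \<gamma> - s * p))) * (?i k y * (ennreal (1 / (1 + 2 ^ k * norm (x - y)) ^ q) * h y)) \<partial>lborel)"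
        by (intro mult_left_mono nn_integral_mono pt) simp
      also have "(\<integral>\<^sup>+y. ennreal (2 powr (real k * (real DIM('a) + \<gamma> - s * p))) * (?i k y * (ennreal (1 / (1 + 2 ^ k * norm (x - y)) ^ q) * h y)) \<partial>lborel)
        = ennreal (2 powr (real k * (real DIM('a) + \<gamma> - s * p))) * (\<integral>\<^sup>+y. ?i k y * (ennreal (1 / (1 + 2 ^ k * norm (x - y)) ^ q) * h y) \<partial>lborel)"
        by (rule nn_integral_cmult) measurable
      finally show ?thesis using c(3) by (simp add: ennreal_mult mult.assoc)
    qed
    \<comment> \<open>From 2^k |x| <= 1 and 2^k |y| >= c the kernel is at most 2^q (2^k |y|)^(-q),
      in which x no longer occurs.\<close>
    have A: "ennreal (F k x powr p) \<le> ennreal (C1 * 2 powr (real k * (real DIM('a) + \<gamma> - s * p))) * m k" if le: "2 ^ k * norm x \<le> 1" for k x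
    proof -
      have "(\<integral>\<^sup>+y. ?i k y * (ennreal (1 / (1 + 2 ^ k * norm (x - y)) ^ q) * h y) \<partial>lborel)
        \<le> (\<integral>\<^sup>+y. ennreal (2 ^ q) * (?i k y * (ennreal ((2 ^ k * norm y) powr (- real q)) * h y)) \<partial>lborel)"
      proof (rule nn_integral_mono)
        fix y
        show "?i k y * (ennreal (1 / (1 + 2 ^ k * norm (x - y)) ^ q) * h y) \<le> ennreal (2 ^ q) * (?i k y * (ennreal ((2 ^ k * norm y) powr (- real q)) * h y))"
        proof (cases "c \<le> 2 ^ k * norm y")
          case True
          define u where "u = 2 ^ k * norm y"
          have u: "u > 0" using True c by (simp add: u_def)
          have n: "2 ^ k * norm (x - y) = norm ((2 ^ k) *\<^sub>R x - (2 ^ k) *\<^sub>R y)" by (simp flip: scaleR_diff_right)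
          have "1 / (1 + 2 ^ k * norm (x - y)) ^ q \<le> (1 + norm ((2 ^ k) *\<^sub>R x)) ^ q * (1 / (1 + norm ((2 ^ k) *\<^sub>R y)) ^ q)"
            unfolding n by (rule kernel_submultiplicative)
          also have "\<dots> \<le> 2 ^ q * (1 / u ^ q)"
          proof (intro mult_mono)
            show "(1 + norm ((2 ^ k) *\<^sub>R x)) ^ q \<le> 2 ^ q" using le by (intro power_mono) auto
            have "u ^ q \<le> (1 + norm ((2 ^ k) *\<^sub>R y)) ^ q" using u by (intro power_mono) (auto simp: u_def)
            thus "1 / (1 + norm ((2 ^ k) *\<^sub>R y)) ^ q \<le> 1 / u ^ q" using u by (intro divide_left_mono) (auto simp: add_pos_nonneg)
          qed auto
          also have "1 / u ^ q = u powr (- real q)" using u by (simp add: powr_minus powr_realpow inverse_eq_divide)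
          finally have "ennreal (1 / (1 + 2 ^ k * norm (x - y)) ^ q) \<le> ennreal (2 ^ q) * ennreal (u powr (- real q))"
            by (simp add: ennreal_leI flip: ennreal_mult)
          from mult_right_mono[OF this zero_le[of "h y"]] show ?thesis using True by (simp add: u_def mult.assoc)
        qed simp
      qed
      also have "\<dots> = ennreal (2 ^ q) * m k" unfolding m q_def[symmetric] by (rule nn_integral_cmult) measurable
      finally have "ennreal (C * 2 powr (real k * (real DIM('a) + \<gamma> - s * p))) * (\<integral>\<^sup>+y. ?i k y * (ennreal (1 / (1 + 2 ^ k * norm (x - y)) ^ q) * h y) \<partial>lborel)
        \<le> ennreal (C * 2 powr (real k * (real DIM('a) + \<gamma> - s * p))) * (ennreal (2 ^ q) * m k)" by (intro mult_left_mono) auto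
      also have "\<dots> = ennreal (C1 * 2 powr (real k * (real DIM('a) + \<gamma> - s * p))) * m k"
      proof -
        have "ennreal (C * 2 powr (real k * (real DIM('a) + \<gamma> - s * p))) * ennreal (2 ^ q) = ennreal (C1 * 2 powr (real k * (real DIM('a) + \<gamma> - s * p)))"
          using c(3) by (simp add: C1_def ac_simps flip: ennreal_mult)
        thus ?thesis by (simp only: mult.assoc[symmetric])
      qed
      finally show ?thesis using main[of k x] le by (simp add: max_absorb1)
    qed
    have Bb: "ennreal (F k x powr p) \<le> ennreal (C1 * 2 powr (real k * (real DIM('a) - s * p)) * norm x powr (- \<gamma>)) * (\<integral>\<^sup>+y. h y \<partial>lborel)"
      if ge: "1 \<le> 2 ^ k * norm x" for k x
    proof -
      have i1: "(\<integral>\<^sup>+y. ?i k y * (ennreal (1 / (1 + 2 ^ k * norm (x - y)) ^ q) * h y) \<partial>lborel) \<le> (\<integral>\<^sup>+y. h y \<partial>lborel)"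
      proof (rule nn_integral_mono)
        fix y
        have "1 \<le> (1 + 2 ^ k * norm (x - y)) ^ q" by (rule one_le_power) simp
        hence "1 / (1 + 2 ^ k * norm (x - y)) ^ q \<le> 1" by (subst divide_le_eq_1_pos) linarith+
        hence "ennreal (1 / (1 + 2 ^ k * norm (x - y)) ^ q) \<le> 1" by simp
        hence "?i k y * (ennreal (1 / (1 + 2 ^ k * norm (x - y)) ^ q) * h y) \<le> 1 * (1 * h y)"
          by (intro mult_mono) (auto simp: indicator_def)
        thus "?i k y * (ennreal (1 / (1 + 2 ^ k * norm (x - y)) ^ q) * h y) \<le> h y" by simp
      qed
      have x0: "norm x > 0" using ge by (cases "norm x = 0") auto
      have "C * max 1 (2 ^ k * norm x) powr (- \<gamma>) * 2 powr (real k * (real DIM('a) + \<gamma> - s * p))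
        = C * norm x powr (- \<gamma>) * ((2 ^ k) powr (- \<gamma>) * 2 powr (real k * (real DIM('a) + \<gamma> - s * p)))"
        using ge by (simp add: max_absorb2 powr_mult)
      also have "(2 ^ k) powr (- \<gamma>) * 2 powr (real k * (real DIM('a) + \<gamma> - s * p)) = 2 powr (real k * (real DIM('a) - s * p))"
        by (simp add: powr_realpow[symmetric] powr_powr algebra_simps flip: powr_add)
      also have "C * norm x powr (- \<gamma>) * 2 powr (real k * (real DIM('a) - s * p)) \<le> C1 * 2 powr (real k * (real DIM('a) - s * p)) * norm x powr (- \<gamma>)"
      proof -
        have "C \<le> C1" using c(3) one_le_power[of "2::real" q] unfolding C1_def by simp
        hence "C * (norm x powr (- \<gamma>) * 2 powr (real k * (real DIM('a) - s * p))) \<le> C1 * (norm x powr (- \<gamma>) * 2 powr (real k * (real DIM('a) - s * p)))"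
          by (intro mult_right_mono) auto
        thus ?thesis by (simp add: ac_simps)
      qed
      finally have "ennreal (C * max 1 (2 ^ k * norm x) powr (- \<gamma>) * 2 powr (real k * (real DIM('a) + \<gamma> - s * p)))
         \<le> ennreal (C1 * 2 powr (real k * (real DIM('a) - s * p)) * norm x powr (- \<gamma>))" by (rule ennreal_leI)
      from mult_mono[OF this i1] show ?thesis using main[of k x] by (meson order_trans zero_le)
    qed
    \<comment> \<open>After exchanging sum and integral, the levels with 2^k |y| >= c form a
      one-sided geometric series starting at its largest term, so their sum is bounded uniformly in
      y.\<close>
    have "(\<Sum>k. m k) = (\<integral>\<^sup>+y. (\<Sum>k. ?i k y * (ennreal ((2 ^ k * norm y) powr (- real q)) * h y)) \<partial>lborel)"
      unfolding m q_def[symmetric] by (rule nn_integral_suminf[symmetric]) measurable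
    also have "\<dots> \<le> (\<integral>\<^sup>+y. ennreal C2 * h y \<partial>lborel)"
    proof (rule nn_integral_mono)
      fix y :: 'a
      show "(\<Sum>k. ?i k y * (ennreal ((2 ^ k * norm y) powr (- real q)) * h y)) \<le> ennreal C2 * h y"
      proof (cases "y = 0")
        case False
        define r where "r = norm y / c"
        have r: "r > 0" using False c by (simp add: r_def)
        define t where "t = - log 2 r"
        have sc: "2 ^ k * r = 2 powr (real k - t)" for k unfolding t_def by (rule two_powr_scale[OF r])
        have "?i k y * ennreal ((2 ^ k * norm y) powr (- real q)) \<le> ennreal (c powr (- real q)) * ennreal (2 powr (- real q * \<bar>real k - t\<bar>))" for k
        proof (cases "c \<le> 2 ^ k * norm y")
          case True
          hence "1 \<le> 2 ^ k * r" using c by (simp add: r_def)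
          hence "2 powr 0 \<le> 2 powr (real k - t)" unfolding sc by simp
          hence kt: "0 \<le> real k - t" by (subst (asm) powr_le_cancel_iff) auto
          have "2 ^ k * norm y = c * 2 powr (real k - t)" unfolding sc[symmetric] using c by (simp add: r_def)
          hence "(2 ^ k * norm y) powr (- real q) = c powr (- real q) * 2 powr (- real q * \<bar>real k - t\<bar>)"
            using c kt by (simp add: powr_mult powr_powr mult.commute)
          thus ?thesis using True by (simp flip: ennreal_mult)
        qed simp
        from mult_right_mono[OF this zero_le[of "h y"]]
        have "(\<Sum>k. ?i k y * (ennreal ((2 ^ k * norm y) powr (- real q)) * h y)) \<le> (\<Sum>k. (ennreal (c powr (- real q)) * ennreal (2 powr (- real q * \<bar>real k - t\<bar>))) * h y)"
          by (intro suminf_le) (auto simp: mult.assoc)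
        also have "\<dots> = ennreal (c powr (- real q)) * (\<Sum>k. ennreal (2 powr (- real q * \<bar>real k - t\<bar>))) * h y"
          unfolding ennreal_suminf_multc ennreal_suminf_cmult ..
        also have "\<dots> \<le> ennreal (c powr (- real q)) * ennreal K * h y"
          using K(2)[of t] by (intro mult_right_mono mult_left_mono) auto
        also have "\<dots> = ennreal C2 * h y" using K by (simp add: C2_def ennreal_mult)
        finally show ?thesis .
      next
        case True
        hence "?i k y = 0" for k using c by simp
        thus ?thesis by simp
      qed
    qed
    also have "\<dots> = ennreal C2 * (\<integral>\<^sup>+y. h y \<partial>lborel)" by (rule nn_integral_cmult) measurable
    finally have Cc: "(\<Sum>k. m k) \<le> ennreal C2 * (\<integral>\<^sup>+y. h y \<partial>lborel)" .
    show "(\<forall>k x. 2 ^ k * norm x \<le> 1 \<longrightarrow> ennreal (F k x powr p) \<le> ennreal (C1 * 2 powr (real k * (real DIM('a) + \<gamma> - s * p))) * m k) \<and>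
      (\<forall>k x. 1 \<le> 2 ^ k * norm x \<longrightarrow> ennreal (F k x powr p) \<le> ennreal (C1 * 2 powr (real k * (real DIM('a) - s * p)) * norm x powr (- \<gamma>)) * (\<integral>\<^sup>+y. h y \<partial>lborel)) \<and>
      (\<Sum>k. m k) \<le> ennreal C2 * (\<integral>\<^sup>+y. h y \<partial>lborel)"
      using A Bb Cc by blast
  qed
qed

text \<open>The sum over k is split at 2^k |x| = 1. The low part is at most a dyadic Hardy sum with
  b k = (m k)^(1/p0), and p1/p0 >= 1 bounds the sum of the p1-th powers by the p1/p0-th power of the
  total mass. The high part is \<open>high_frequency_sum\<close>, integrated over x; there the norm
  enters as P^((p1-p0)/p0) times \<open>P\<close>, again P^(p1/p0).\<close>

lemma weighted_sequence_embedding: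
  assumes B: "B > 0" and p: "1 \<le> p0" "p0 \<le> p1" and N: "real N \<ge> \<bar>\<gamma>0\<bar> / p0"
    and g: "\<gamma>0 > - real DIM('a::euclidean_space)" "\<gamma>1 > - real DIM('a)"
    and c1: "\<gamma>1 / p1 \<le> \<gamma>0 / p0" and c2: "(real DIM('a) + \<gamma>1) / p1 < (real DIM('a) + \<gamma>0) / p0"
    and c3: "s0 - (real DIM('a) + \<gamma>0) / p0 \<ge> s1 - (real DIM('a) + \<gamma>1) / p1"
  obtains C where "C > 0"
    "\<And>(F :: nat \<Rightarrow> 'a \<Rightarrow> real) (H :: 'a \<Rightarrow> ennreal). (\<And>k. continuous_on UNIV (F k)) \<Longrightarrow> (\<And>k x. F k x \<ge> 0) \<Longrightarrow>
      (\<And>k x. ennreal (F k x) \<le> ennreal B * (\<integral>\<^sup>+y. ennreal ((2 ^ k) ^ DIM('a) / (1 + 2 ^ k * norm (x - y)) ^ (DIM('a) + 1 + N) * F k y) \<partial>lborel)) \<Longrightarrow>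
      H \<in> borel_measurable borel \<Longrightarrow> (\<And>k x. ennreal (2 powr (real k * s0) * F k x) \<le> H x) \<Longrightarrow>
      (\<integral>\<^sup>+x. enn_powr (\<Sum>k. ennreal (2 powr (real k * s1) * F k x)) p1 * ennreal (norm x powr \<gamma>1) \<partial>lborel)
        \<le> ennreal C * enn_powr (\<integral>\<^sup>+x. enn_powr (H x) p0 * ennreal (norm x powr \<gamma>0) \<partial>lborel) (p1 / p0)"
proof -
  define d where "d = real DIM('a)"
  have d: "d > 0" by (simp add: d_def)
  have p0: "p0 > 0" "p1 > 0" "p1 \<ge> 1" using p by auto
  \<comment> \<open>The growth rate for which the Hardy weight exponent a p1 - d is exactly
    \<gamma>1; it is positive because \<gamma>1 > -d. The condition on s0 and s1 bounds the growth
    of the low blocks by 2^(ka).\<close>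
  define a where "a = (d + \<gamma>1) / p1"
  have a: "a > 0" using g p0 by (simp add: a_def d_def)
  have ag: "a * p1 - real DIM('a) = \<gamma>1" using p0 by (simp add: a_def d_def)
  obtain c C1 C2 :: real where C12: "0 < c" "C1 > 0" "C2 > 0" and freq:
    "\<And>(F :: nat \<Rightarrow> 'a::euclidean_space \<Rightarrow> real) (H :: 'a \<Rightarrow> ennreal) h m. (\<And>k. continuous_on UNIV (F k)) \<Longrightarrow> (\<And>k x. F k x \<ge> 0) \<Longrightarrow>
      (\<And>k x. ennreal (F k x) \<le> ennreal B * (\<integral>\<^sup>+y. ennreal ((2 ^ k) ^ DIM('a) / (1 + 2 ^ k * norm (x - y)) ^ (DIM('a) + 1 + N) * F k y) \<partial>lborel)) \<Longrightarrow>
      H \<in> borel_measurable borel \<Longrightarrow> (\<And>k x. ennreal (2 powr (real k * s0) * F k x) \<le> H x) \<Longrightarrow>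
      h = (\<lambda>y. enn_powr (H y) p0 * ennreal (norm y powr \<gamma>0)) \<Longrightarrow>
      m = (\<lambda>k. \<integral>\<^sup>+y. indicator {y. c \<le> 2 ^ k * norm y} y * (ennreal ((2 ^ k * norm y) powr (- real (DIM('a) + 1))) * h y) \<partial>lborel) \<Longrightarrow>
      (\<forall>k x. 2 ^ k * norm x \<le> 1 \<longrightarrow> ennreal (F k x powr p0) \<le> ennreal (C1 * 2 powr (real k * (real DIM('a) + \<gamma>0 - s0 * p0))) * m k) \<and>
      (\<forall>k x. 1 \<le> 2 ^ k * norm x \<longrightarrow> ennreal (F k x powr p0) \<le> ennreal (C1 * 2 powr (real k * (real DIM('a) - s0 * p0)) * norm x powr (- \<gamma>0)) * (\<integral>\<^sup>+y. h y \<partial>lborel)) \<and>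
      (\<Sum>k. m k) \<le> ennreal C2 * (\<integral>\<^sup>+y. h y \<partial>lborel)"
    using frequency_bounds[OF B p(1) N, where 'a='a and s=s0] by blast
  obtain Ch where Ch: "Ch > 0" "\<And>b :: nat \<Rightarrow> ennreal.
    (\<integral>\<^sup>+(x::'a). enn_powr (\<Sum>k. indicator {x. 2 ^ k * norm x \<le> 1} x * (ennreal (2 powr (real k * a)) * b k)) p1
        * ennreal (norm x powr \<gamma>1) \<partial>lborel) \<le> ennreal Ch * (\<Sum>k. enn_powr (b k) p1)"
    using hardy_dyadic[OF a p0(3), where 'a='a] unfolding ag by blast
  obtain K where K: "K > 0" "\<And>f r h G. r > 0 \<Longrightarrow> h \<ge> 0 \<Longrightarrow> G \<ge> 0 \<Longrightarrow>
      (\<And>k. 1 \<le> 2 ^ k * r \<Longrightarrow> 0 \<le> f k \<and> f k \<le> 2 powr (- real k * s0) * h \<and>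
         f k \<le> 2 powr (real k * (d / p0 - s0)) * (r powr (- \<gamma>0 / p0) * G)) \<Longrightarrow>
      enn_powr (\<Sum>k. of_bool (1 \<le> 2 ^ k * r) * ennreal (2 powr (real k * s1) * f k)) p1 * ennreal (r powr \<gamma>1)
        \<le> ennreal (K * (if p0 = p1 then 1 else G powr (p1 - p0))) * ennreal (h powr p0 * r powr \<gamma>0)"
    using high_frequency_sum[OF p d c1 c2[folded d_def] c3[folded d_def]] by blast
  define CL where "CL = (C1 powr (1 / p0)) powr p1 * (Ch * C2 powr (p1 / p0))"
  define CH where "CH = K * C1 powr ((p1 - p0) / p0)"
  have CL: "CL > 0" and CH: "CH > 0" using C12 Ch K by (auto simp: CL_def CH_def)
  show ?thesis
  proof (rule that[of "2 powr p1 * (CL + CH)"])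
    show "2 powr p1 * (CL + CH) > 0" using CL CH by simp
    fix F :: "nat \<Rightarrow> 'a \<Rightarrow> real" and H :: "'a \<Rightarrow> ennreal"
    assume cont: "\<And>k. continuous_on UNIV (F k)" and F0: "\<And>k x. F k x \<ge> 0"
      and hyp: "\<And>k x. ennreal (F k x) \<le> ennreal B * (\<integral>\<^sup>+y. ennreal ((2 ^ k) ^ DIM('a) / (1 + 2 ^ k * norm (x - y)) ^ (DIM('a) + 1 + N) * F k y) \<partial>lborel)"
      and Hm[measurable]: "H \<in> borel_measurable borel" and FH: "\<And>k x. ennreal (2 powr (real k * s0) * F k x) \<le> H x"
    have Fm[measurable]: "F k \<in> borel_measurable borel" for k using cont by (rule borel_measurable_continuous_onI)
    define h where "h = (\<lambda>y. enn_powr (H y) p0 * ennreal (norm y powr \<gamma>0))"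
    have hm[measurable]: "h \<in> borel_measurable borel" unfolding h_def by measurable
    define m where "m = (\<lambda>k. \<integral>\<^sup>+y. indicator {y. c \<le> 2 ^ k * norm y} y * (ennreal ((2 ^ k * norm y) powr (- real (DIM('a) + 1))) * h y) \<partial>lborel)"
    define P where "P = (\<integral>\<^sup>+y. h y \<partial>lborel)"
    have lowF: "\<And>k x. 2 ^ k * norm x \<le> 1 \<Longrightarrow> ennreal (F k x powr p0) \<le> ennreal (C1 * 2 powr (real k * (d + \<gamma>0 - s0 * p0))) * m k"
      and highF: "\<And>k x. 1 \<le> 2 ^ k * norm x \<Longrightarrow> ennreal (F k x powr p0) \<le> ennreal (C1 * 2 powr (real k * (d - s0 * p0)) * norm x powr (- \<gamma>0)) * P"
      and sumF: "(\<Sum>k. m k) \<le> ennreal C2 * P"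
      using freq[OF cont F0 hyp Hm FH h_def m_def] unfolding d_def P_def by blast+
    define SL where "SL = (\<lambda>x. \<Sum>k. indicator {x. 2 ^ k * norm x \<le> 1} x * ennreal (2 powr (real k * s1) * F k x))"
    define SH where "SH = (\<lambda>x. \<Sum>k. indicator {x. 1 \<le> 2 ^ k * norm x} x * ennreal (2 powr (real k * s1) * F k x))"
    have [measurable]: "{x::'a. 2 ^ k * norm x \<le> 1} \<in> sets borel" "{x::'a. 1 \<le> 2 ^ k * norm x} \<in> sets borel" for k by measurable
    have SLm[measurable]: "SL \<in> borel_measurable borel" and SHm[measurable]: "SH \<in> borel_measurable borel"
      unfolding SL_def SH_def by measurable
    have low: "(\<integral>\<^sup>+x. enn_powr (SL x) p1 * ennreal (norm x powr \<gamma>1) \<partial>lborel) \<le> ennreal CL * enn_powr P (p1 / p0)"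
    proof -
      define b where "b = (\<lambda>k. enn_powr (m k) (1 / p0))"
      have Fb: "ennreal (2 powr (real k * s1) * F k x) \<le> ennreal (C1 powr (1 / p0)) * (ennreal (2 powr (real k * a)) * b k)"
        if le: "2 ^ k * norm x \<le> 1" for k x
      proof -
        have e0: "1 / p0 > 0" using p0 by simp
        have "enn_powr (ennreal (F k x powr p0)) (1 / p0) \<le> enn_powr (ennreal (C1 * 2 powr (real k * (d + \<gamma>0 - s0 * p0))) * m k) (1 / p0)"
          using lowF[OF le] e0 by (intro enn_powr_mono) auto
        also have "\<dots> = ennreal ((C1 * 2 powr (real k * (d + \<gamma>0 - s0 * p0))) powr (1 / p0)) * b k"
          using C12 by (simp add: enn_powr_mult[OF e0] enn_powr_ennreal b_def)
        finally have "ennreal (F k x) \<le> ennreal ((C1 * 2 powr (real k * (d + \<gamma>0 - s0 * p0))) powr (1 / p0)) * b k"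
          using F0[of k x] p0 by (simp add: enn_powr_ennreal powr_powr)
        hence "ennreal (2 powr (real k * s1)) * ennreal (F k x) \<le> ennreal (2 powr (real k * s1)) * (ennreal ((C1 * 2 powr (real k * (d + \<gamma>0 - s0 * p0))) powr (1 / p0)) * b k)"
          by (intro mult_left_mono) auto
        also have "\<dots> = ennreal (2 powr (real k * s1) * (C1 * 2 powr (real k * (d + \<gamma>0 - s0 * p0))) powr (1 / p0)) * b k"
          by (simp add: ennreal_mult mult.assoc)
        also have "\<dots> \<le> ennreal (C1 powr (1 / p0) * 2 powr (real k * a)) * b k"
        proof (intro mult_right_mono ennreal_leI)
          have "(C1 * 2 powr (real k * (d + \<gamma>0 - s0 * p0))) powr (1 / p0) = C1 powr (1 / p0) * 2 powr (real k * ((d + \<gamma>0) / p0 - s0))"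
          proof -
            have "real k * (d + \<gamma>0 - s0 * p0) * (1 / p0) = real k * ((d + \<gamma>0) / p0 - s0)" using p0 by (simp add: field_simps)
            thus ?thesis using C12 by (simp add: powr_mult powr_powr)
          qed
          moreover have "2 powr (real k * s1) * 2 powr (real k * ((d + \<gamma>0) / p0 - s0)) \<le> 2 powr (real k * a)"
          proof -
            have "real k * (s1 + ((d + \<gamma>0) / p0 - s0)) \<le> real k * a"
              using c3 unfolding a_def d_def by (intro mult_left_mono) auto
            hence "real k * s1 + real k * ((d + \<gamma>0) / p0 - s0) \<le> real k * a" by (simp only: distrib_left)
            thus ?thesis unfolding powr_add[symmetric] by (intro powr_mono) auto
          qed
          hence "C1 powr (1 / p0) * (2 powr (real k * s1) * 2 powr (real k * ((d + \<gamma>0) / p0 - s0))) \<le> C1 powr (1 / p0) * 2 powr (real k * a)"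
            by (intro mult_left_mono) auto
          ultimately show "2 powr (real k * s1) * (C1 * 2 powr (real k * (d + \<gamma>0 - s0 * p0))) powr (1 / p0) \<le> C1 powr (1 / p0) * 2 powr (real k * a)"
            by (simp only: mult.left_commute)
        qed simp
        finally show ?thesis using F0[of k x] by (simp add: ennreal_mult mult.assoc)
      qed
      have pt: "enn_powr (SL x) p1 * ennreal (norm x powr \<gamma>1) \<le> ennreal ((C1 powr (1 / p0)) powr p1) *
        (enn_powr (\<Sum>k. indicator {x. 2 ^ k * norm x \<le> 1} x * (ennreal (2 powr (real k * a)) * b k)) p1 * ennreal (norm x powr \<gamma>1))" for x
      proof -
        have "SL x \<le> (\<Sum>k. ennreal (C1 powr (1 / p0)) * (indicator {x. 2 ^ k * norm x \<le> 1} x * (ennreal (2 powr (real k * a)) * b k)))"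
          unfolding SL_def using Fb by (intro suminf_le) (auto simp: indicator_def)
        also have "\<dots> = ennreal (C1 powr (1 / p0)) * (\<Sum>k. indicator {x. 2 ^ k * norm x \<le> 1} x * (ennreal (2 powr (real k * a)) * b k))"
          by (rule ennreal_suminf_cmult)
        finally have "enn_powr (SL x) p1 \<le> enn_powr (ennreal (C1 powr (1 / p0)) * (\<Sum>k. indicator {x. 2 ^ k * norm x \<le> 1} x * (ennreal (2 powr (real k * a)) * b k))) p1"
          using p0 by (intro enn_powr_mono) auto
        also have "\<dots> = ennreal ((C1 powr (1 / p0)) powr p1) * enn_powr (\<Sum>k. indicator {x. 2 ^ k * norm x \<le> 1} x * (ennreal (2 powr (real k * a)) * b k)) p1"
          by (simp only: enn_powr_mult[OF p0(2)] enn_powr_ennreal[OF powr_ge_zero])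
        finally show ?thesis unfolding mult.assoc[symmetric] by (rule mult_right_mono) simp
      qed
      have "(\<integral>\<^sup>+x. enn_powr (SL x) p1 * ennreal (norm x powr \<gamma>1) \<partial>lborel) \<le> (\<integral>\<^sup>+(x::'a). ennreal ((C1 powr (1 / p0)) powr p1) *
        (enn_powr (\<Sum>k. indicator {x. 2 ^ k * norm x \<le> 1} x * (ennreal (2 powr (real k * a)) * b k)) p1 * ennreal (norm x powr \<gamma>1)) \<partial>lborel)"
        by (rule nn_integral_mono) (rule pt)
      also have "\<dots> = ennreal ((C1 powr (1 / p0)) powr p1) * (\<integral>\<^sup>+(x::'a).
        enn_powr (\<Sum>k. indicator {x. 2 ^ k * norm x \<le> 1} x * (ennreal (2 powr (real k * a)) * b k)) p1 * ennreal (norm x powr \<gamma>1) \<partial>lborel)"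
        by (rule nn_integral_cmult) measurable
      also have "\<dots> \<le> ennreal ((C1 powr (1 / p0)) powr p1) * (ennreal Ch * (\<Sum>k. enn_powr (b k) p1))"
        by (intro mult_left_mono Ch) simp
      also have "\<dots> \<le> ennreal ((C1 powr (1 / p0)) powr p1) * (ennreal Ch * (ennreal (C2 powr (p1 / p0)) * enn_powr P (p1 / p0)))"
      proof (intro mult_left_mono)
        \<comment> \<open>This is where p0 <= p1 enters the low-frequency part: l^1 embeds into
          l^(p1/p0).\<close>
        have r: "p1 / p0 \<ge> 1" "p1 / p0 > 0" using p p0 by auto
        have "(\<Sum>k. enn_powr (b k) p1) = (\<Sum>k. enn_powr (m k) (p1 / p0))" by (simp add: b_def enn_powr_powr)
        also have "\<dots> \<le> enn_powr (\<Sum>k. m k) (p1 / p0)" by (rule suminf_enn_powr_le[OF r(1)])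
        also have "\<dots> \<le> enn_powr (ennreal C2 * P) (p1 / p0)" using r by (intro enn_powr_mono sumF) auto
        also have "\<dots> = ennreal (C2 powr (p1 / p0)) * enn_powr P (p1 / p0)"
          using C12 by (simp add: enn_powr_mult[OF r(2)] enn_powr_ennreal)
        finally show "(\<Sum>k. enn_powr (b k) p1) \<le> ennreal (C2 powr (p1 / p0)) * enn_powr P (p1 / p0)" .
      qed auto
      also have "\<dots> = ennreal CL * enn_powr P (p1 / p0)"
        using Ch by (simp add: CL_def ennreal_mult mult.assoc)
      finally show ?thesis .
    qed
    have high: "(\<integral>\<^sup>+x. enn_powr (SH x) p1 * ennreal (norm x powr \<gamma>1) \<partial>lborel) \<le> ennreal CH * enn_powr P (p1 / p0)" if Pf: "P \<noteq> top"
    proof -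
      obtain Pr where Pr: "0 \<le> Pr" "P = ennreal Pr" using Pf by (cases P) blast+
      \<comment> \<open>The p0-th root of the constant in the uniform high-frequency bound; it is a
        real number because \<open>P\<close> is finite in this branch.\<close>
      define G where "G = (C1 * Pr) powr (1 / p0)"
      define Gf where "Gf = (if p0 = p1 then 1 else G powr (p1 - p0))"
      have Gf0: "Gf \<ge> 0" by (simp add: Gf_def)
      \<comment> \<open>Finiteness of the integral makes h x finite almost everywhere, and off the
        origin, where the weight is positive, H x is then finite too.\<close>
      have AEh: "AE x in lborel. h x \<noteq> top"
        using nn_integral_PInf_AE[of h lborel] Pf unfolding P_def by simp
      have "AE x in lborel. enn_powr (SH x) p1 * ennreal (norm x powr \<gamma>1) \<le> ennreal (K * Gf) * h x"
        using AEh AE_lborel_singleton[of "0::'a"]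
      proof eventually_elim
        fix x :: 'a assume hx: "h x \<noteq> top" and x: "x \<noteq> 0"
        have nx: "norm x > 0" using x by simp
        have "H x \<noteq> top"
        proof
          assume "H x = top"
          hence "h x = top" using nx by (simp add: h_def ennreal_top_mult)
          thus False using hx by simp
        qed
        then obtain h0 where h0: "0 \<le> h0" "H x = ennreal h0" by (cases "H x") blast+
        have e1: "ennreal (h0 powr p0 * norm x powr \<gamma>0) = h x"
          using h0(1) by (simp add: h_def h0(2) enn_powr_ennreal ennreal_mult)
        have e2: "SH x = (\<Sum>k. of_bool (1 \<le> 2 ^ k * norm x) * ennreal (2 powr (real k * s1) * F k x))"
          unfolding SH_def by (intro suminf_cong) (auto simp: indicator_def)
        show "enn_powr (SH x) p1 * ennreal (norm x powr \<gamma>1) \<le> ennreal (K * Gf) * h x"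
          unfolding e1[symmetric] e2 Gf_def
        proof (rule K(2)[OF nx h0(1)])
          show "G \<ge> 0" by (simp add: G_def)
          fix k assume k: "1 \<le> 2 ^ k * norm x"
          have "2 powr (real k * s0) * F k x \<le> h0" using FH[of k x] h0 by (simp add: ennreal_le_iff)
          hence "2 powr (- real k * s0) * (2 powr (real k * s0) * F k x) \<le> 2 powr (- real k * s0) * h0" by (intro mult_left_mono) auto
          moreover have eq: "2 powr (- real k * s0) * (2 powr (real k * s0) * F k x) = F k x"
            unfolding mult.assoc[symmetric] powr_add[symmetric] by simp
          ultimately have A: "F k x \<le> 2 powr (- real k * s0) * h0" unfolding eq by (simp only:)
          have "ennreal (F k x powr p0) \<le> ennreal (C1 * 2 powr (real k * (d - s0 * p0)) * norm x powr (- \<gamma>0) * Pr)"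
            using highF[OF k] Pr C12 by (simp add: ennreal_mult)
          hence "F k x powr p0 \<le> C1 * 2 powr (real k * (d - s0 * p0)) * norm x powr (- \<gamma>0) * Pr"
            using C12 Pr by (simp add: ennreal_le_iff)
          hence "(F k x powr p0) powr (1 / p0) \<le> (2 powr (real k * (d - s0 * p0)) * (norm x powr (- \<gamma>0) * (C1 * Pr))) powr (1 / p0)"
            using p0 by (intro powr_mono2) (auto simp: ac_simps)
          also have "\<dots> = 2 powr (real k * (d / p0 - s0)) * (norm x powr (- \<gamma>0 / p0) * G)"
          proof -
            have "real k * (d - s0 * p0) * (1 / p0) = real k * (d / p0 - s0)" using p0 by (simp add: field_simps)
            thus ?thesis using C12 Pr by (simp add: powr_mult powr_powr G_def)
          qed
          finally have "F k x \<le> 2 powr (real k * (d / p0 - s0)) * (norm x powr (- \<gamma>0 / p0) * G)"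
            using F0[of k x] p0 by (simp add: powr_powr)
          thus "0 \<le> F k x \<and> F k x \<le> 2 powr (- real k * s0) * h0 \<and> F k x \<le> 2 powr (real k * (d / p0 - s0)) * (norm x powr (- \<gamma>0 / p0) * G)"
            using A F0 by blast
        qed
      qed
      hence "(\<integral>\<^sup>+x. enn_powr (SH x) p1 * ennreal (norm x powr \<gamma>1) \<partial>lborel) \<le> (\<integral>\<^sup>+x. ennreal (K * Gf) * h x \<partial>lborel)"
        by (rule nn_integral_mono_AE)
      also have "\<dots> = ennreal (K * Gf) * P" unfolding P_def by (rule nn_integral_cmult) simp
      also have "\<dots> = ennreal (K * Gf * Pr)" unfolding Pr(2) using K Gf0 Pr by (simp add: ennreal_mult)
      also have "K * Gf * Pr = CH * Pr powr (p1 / p0)"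
      proof (cases "p0 = p1")
        case True
        thus ?thesis using C12 p0 Pr by (simp add: CH_def Gf_def)
      next
        case False
        have "Gf = C1 powr ((p1 - p0) / p0) * Pr powr ((p1 - p0) / p0)"
          using False C12 Pr by (simp add: Gf_def G_def powr_powr powr_mult)
        moreover have "Pr powr ((p1 - p0) / p0) * Pr = Pr powr (p1 / p0)"
        proof (cases "Pr = 0")
          case False
          hence "Pr powr ((p1 - p0) / p0) * Pr = Pr powr ((p1 - p0) / p0 + 1)" using Pr by (simp add: powr_add)
          also have "(p1 - p0) / p0 + 1 = p1 / p0" using p0 by (simp add: field_simps)
          finally show ?thesis .
        qed simp
        ultimately show ?thesis by (simp add: CH_def)
      qed
      also have "ennreal (CH * Pr powr (p1 / p0)) = ennreal CH * enn_powr P (p1 / p0)"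
        unfolding Pr(2) using CH Pr(1) by (simp add: enn_powr_ennreal ennreal_mult)
      finally show ?thesis .
    qed
    have eqP: "(\<integral>\<^sup>+x. enn_powr (H x) p0 * ennreal (norm x powr \<gamma>0) \<partial>lborel) = P"
      by (simp add: P_def h_def)
    show "(\<integral>\<^sup>+x. enn_powr (\<Sum>k. ennreal (2 powr (real k * s1) * F k x)) p1 * ennreal (norm x powr \<gamma>1) \<partial>lborel)
        \<le> ennreal (2 powr p1 * (CL + CH)) * enn_powr (\<integral>\<^sup>+x. enn_powr (H x) p0 * ennreal (norm x powr \<gamma>0) \<partial>lborel) (p1 / p0)"
      unfolding eqP
    proof (cases "P = top")
      case True
      thus "(\<integral>\<^sup>+x. enn_powr (\<Sum>k. ennreal (2 powr (real k * s1) * F k x)) p1 * ennreal (norm x powr \<gamma>1) \<partial>lborel)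
        \<le> ennreal (2 powr p1 * (CL + CH)) * enn_powr P (p1 / p0)"
        using CL CH by (simp add: ennreal_mult_top)
    next
      case False
      have "(\<integral>\<^sup>+x. enn_powr (\<Sum>k. ennreal (2 powr (real k * s1) * F k x)) p1 * ennreal (norm x powr \<gamma>1) \<partial>lborel)
        \<le> (\<integral>\<^sup>+x. ennreal (2 powr p1) * (enn_powr (SL x) p1 * ennreal (norm x powr \<gamma>1) + enn_powr (SH x) p1 * ennreal (norm x powr \<gamma>1)) \<partial>lborel)"
      proof (rule nn_integral_mono)
        fix x :: 'a
        have "(\<Sum>k. ennreal (2 powr (real k * s1) * F k x)) \<le> (\<Sum>k. indicator {x. 2 ^ k * norm x \<le> 1} x * ennreal (2 powr (real k * s1) * F k x)
            + indicator {x. 1 \<le> 2 ^ k * norm x} x * ennreal (2 powr (real k * s1) * F k x))"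
          by (intro suminf_le) (auto simp: indicator_def)
        also have "\<dots> = SL x + SH x" unfolding SL_def SH_def by (rule suminf_add[symmetric]) auto
        finally have "enn_powr (\<Sum>k. ennreal (2 powr (real k * s1) * F k x)) p1 \<le> enn_powr (SL x + SH x) p1"
          using p0 by (intro enn_powr_mono) auto
        also have "\<dots> \<le> ennreal (2 powr p1) * (enn_powr (SL x) p1 + enn_powr (SH x) p1)" using p0 by (intro enn_powr_add_le) simp
        finally have "enn_powr (\<Sum>k. ennreal (2 powr (real k * s1) * F k x)) p1 * ennreal (norm x powr \<gamma>1)
          \<le> ennreal (2 powr p1) * (enn_powr (SL x) p1 + enn_powr (SH x) p1) * ennreal (norm x powr \<gamma>1)" by (rule mult_right_mono) simp
        thus "enn_powr (\<Sum>k. ennreal (2 powr (real k * s1) * F k x)) p1 * ennreal (norm x powr \<gamma>1)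
          \<le> ennreal (2 powr p1) * (enn_powr (SL x) p1 * ennreal (norm x powr \<gamma>1) + enn_powr (SH x) p1 * ennreal (norm x powr \<gamma>1))"
          by (simp only: mult.assoc distrib_right)
      qed
      also have "\<dots> = ennreal (2 powr p1) * ((\<integral>\<^sup>+x. enn_powr (SL x) p1 * ennreal (norm x powr \<gamma>1) \<partial>lborel) + (\<integral>\<^sup>+x. enn_powr (SH x) p1 * ennreal (norm x powr \<gamma>1) \<partial>lborel))"
      proof -
        have "(\<integral>\<^sup>+x. enn_powr (SL x) p1 * ennreal (norm x powr \<gamma>1) + enn_powr (SH x) p1 * ennreal (norm x powr \<gamma>1) \<partial>lborel)
          = (\<integral>\<^sup>+x. enn_powr (SL x) p1 * ennreal (norm x powr \<gamma>1) \<partial>lborel) + (\<integral>\<^sup>+x. enn_powr (SH x) p1 * ennreal (norm x powr \<gamma>1) \<partial>lborel)"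
          by (rule nn_integral_add) measurable
        thus ?thesis by (subst nn_integral_cmult) simp_all
      qed
      also have "\<dots> \<le> ennreal (2 powr p1) * (ennreal CL * enn_powr P (p1 / p0) + ennreal CH * enn_powr P (p1 / p0))"
        using low high[OF False] by (intro mult_left_mono add_mono) auto
      also have "\<dots> = ennreal (2 powr p1 * (CL + CH)) * enn_powr P (p1 / p0)"
      proof -
        have "ennreal (2 powr p1 * (CL + CH)) = ennreal (2 powr p1) * (ennreal CL + ennreal CH)"
          using CL CH by (simp add: ennreal_mult ennreal_plus)
        thus ?thesis by (simp only: distrib_right mult.assoc)
      qed
      finally show "(\<integral>\<^sup>+x. enn_powr (\<Sum>k. ennreal (2 powr (real k * s1) * F k x)) p1 * ennreal (norm x powr \<gamma>1) \<partial>lborel)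
        \<le> ennreal (2 powr p1 * (CL + CH)) * enn_powr P (p1 / p0)" .
    qed
  qed
qed

section \<open>Embeddings of Triebel-Lizorkin spaces\<close>

definition dilate :: "(real^'d::finite \<Rightarrow> real) \<Rightarrow> nat \<Rightarrow> real^'d \<Rightarrow> real" where
  "dilate \<phi> j x = (2 ^ j) ^ CARD('d) * \<phi> (2 ^ j *\<^sub>R x)"

lemma admissibleD:
  assumes "admissible \<phi>"
  shows "schwartz \<phi>" "norm \<xi> \<le> 1 \<Longrightarrow> fourier \<phi> \<xi> = 1" "norm \<xi> \<ge> 3/2 \<Longrightarrow> fourier \<phi> \<xi> = 0"
  using assms unfolding admissible_def by blast+

lemma phik_dilate: "phik \<phi> k = (\<lambda>x. 1 * dilate \<phi> k x + (if k = 0 then 0 else -1) * dilate \<phi> (k - 1) x)"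
  by (auto simp: phik_def dilate_def fun_eq_iff power_mult)

lemma schwartz_dilate:
  assumes "schwartz \<phi>"
  shows "schwartz (dilate \<phi> j)"
proof -
  have "schwartz (\<lambda>y. \<phi> (0 + 2 ^ j *\<^sub>R y))" by (intro schwartz_affine assms) simp
  from schwartz_lincomb[OF this this, of "(2 ^ j) ^ CARD('a)" 0] show ?thesis by (simp add: dilate_def[abs_def])
qed

lemma schwartz_phik: "schwartz \<phi> \<Longrightarrow> schwartz (phik \<phi> k)"
  unfolding phik_dilate by (intro schwartz_lincomb schwartz_dilate)

lemma schwartz_basic:
  assumes "schwartz \<phi>"
  shows "integrable lborel \<phi>" "continuous_on UNIV \<phi>" "\<phi> \<in> borel_measurable borel"
  using schwartz_integrable[OF assms, of 0 "[]"] schwartz_continuous[OF assms, of "[]"] schwartz_measurable[OF assms, of "[]"]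
  by simp_all

lemma schwartz_bounded:
  assumes "schwartz \<phi>"
  obtains C where "C > 0" "\<And>x. (1 + norm x) ^ M * \<bar>\<phi> x\<bar> \<le> C"
  using schwartz_decay[OF assms, of M "[]"] by auto

lemma fourier_lincomb:
  fixes f g :: "real^'d::finite \<Rightarrow> real"
  assumes "integrable lborel f" "integrable lborel g"
  shows "fourier (\<lambda>x. a * f x + b * g x) \<xi> = of_real a * fourier f \<xi> + of_real b * fourier g \<xi>"
proof -
  have [measurable]: "(\<lambda>x. cis (- (x \<bullet> \<xi>))) \<in> borel_measurable borel"
    unfolding cis_conv_exp by measurable
  have i: "integrable lborel (\<lambda>x. complex_of_real (u x) * cis (- (x \<bullet> \<xi>)))" if "integrable lborel u" for u :: "real^'d \<Rightarrow> real"
    by (rule Bochner_Integration.integrable_bound[OF that]) (use that in \<open>auto simp: norm_mult\<close>)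
  have "(LINT x|lborel. complex_of_real (a * f x + b * g x) * cis (- (x \<bullet> \<xi>)))
    = (LINT x|lborel. of_real a * (complex_of_real (f x) * cis (- (x \<bullet> \<xi>))) + of_real b * (complex_of_real (g x) * cis (- (x \<bullet> \<xi>))))"
    by (intro Bochner_Integration.integral_cong) (auto simp: algebra_simps)
  also have "\<dots> = of_real a * (LINT x|lborel. complex_of_real (f x) * cis (- (x \<bullet> \<xi>))) + of_real b * (LINT x|lborel. complex_of_real (g x) * cis (- (x \<bullet> \<xi>)))"
    by (subst Bochner_Integration.integral_add) (auto intro!: integrable_mult_right i assms simp del: of_real_mult)
  finally show ?thesis unfolding fourier_def by (simp add: algebra_simps)
qed

lemma fourier_dilate_pow:
  assumes "schwartz (\<phi> :: real^'d::finite \<Rightarrow> real)"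
  shows "fourier (dilate \<phi> j) \<xi> = fourier \<phi> (\<xi> /\<^sub>R 2 ^ j)"
  using fourier_dilate[of \<phi> "2 ^ j" \<xi>] schwartz_basic(3)[OF assms] by (simp add: dilate_def[abs_def])

lemma fourier_phik:
  assumes "schwartz (\<phi> :: real^'d::finite \<Rightarrow> real)"
  shows "fourier (phik \<phi> k) \<xi> = fourier \<phi> (\<xi> /\<^sub>R 2 ^ k) - (if k = 0 then 0 else fourier \<phi> (\<xi> /\<^sub>R 2 ^ (k - 1)))"
  unfolding phik_dilate using assms
  by (subst fourier_lincomb) (auto simp: schwartz_basic schwartz_dilate fourier_dilate_pow)

text \<open>The transform of \<open>phik \<phi> k\<close> vanishes for |\<xi>| >= 3/2 2^k, while
  that of \<open>dilate \<phi> j\<close> is known to be one only for |\<xi>| <= 2^j. Level k + 1 is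
  therefore the first whose plateau covers the whole spectrum of the block.\<close>

lemma phik_reproducing:
  assumes \<phi>: "admissible (\<phi> :: real^'d::finite \<Rightarrow> real)"
  shows "(LINT y|lborel. phik \<phi> k (x - y) * dilate \<phi> (k + 1) y) = (2 * pi) powr (real CARD('d) / 2) * phik \<phi> k x"
proof -
  note S = admissibleD(1)[OF \<phi>]
  have Sp: "schwartz (phik \<phi> k)" and Sd: "schwartz (dilate \<phi> (k + 1))"
    by (rule schwartz_phik[OF S] schwartz_dilate[OF S])+
  obtain C where C: "\<And>x. (1 + norm x) ^ 0 * \<bar>phik \<phi> k x\<bar> \<le> C" using schwartz_bounded[OF Sp] by blast
  have "(LINT y|lborel. phik \<phi> k (x - y) * dilate \<phi> (k + 1) y) = (2 * pi) powr (real CARD('d) / 2) * 1 * phik \<phi> k x"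
  proof (rule convolution_eqI)
    show "\<bar>phik \<phi> k x\<bar> \<le> C" "\<bar>phik \<phi> k x\<bar> \<le> C" for x using C[of x] by simp_all
    fix \<xi> :: "real^'d"
    show "fourier (phik \<phi> k) \<xi> * fourier (dilate \<phi> (k + 1)) \<xi> = complex_of_real 1 * fourier (phik \<phi> k) \<xi>"
    proof (cases "norm \<xi> \<le> 2 ^ (k + 1)")
      case True
      hence "norm (\<xi> /\<^sub>R 2 ^ (k + 1)) \<le> 1" by (simp add: field_simps)
      thus ?thesis unfolding fourier_dilate_pow[OF S] using admissibleD(2)[OF \<phi>] by simp
    next
      case False
      have j: "norm (\<xi> /\<^sub>R 2 ^ j) \<ge> 3 / 2" if "j \<le> k" for j
      proof -
        have "(2::real) ^ j \<le> 2 ^ k" using that by (intro power_increasing) auto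
        moreover have "(2::real) ^ j > 0" by simp
        moreover have "norm \<xi> > 2 * 2 ^ k" using False by simp
        ultimately have "norm \<xi> \<ge> 3 / 2 * 2 ^ j" by linarith
        thus ?thesis by (simp add: field_simps)
      qed
      have "norm (\<xi> /\<^sub>R 2 ^ k) \<ge> 3 / 2" "norm (\<xi> /\<^sub>R 2 ^ (k - 1)) \<ge> 3 / 2" by (rule j; simp)+
      thus ?thesis unfolding fourier_phik[OF S] using admissibleD(3)[OF \<phi>] by auto
    qed
  qed (use schwartz_basic[OF Sp] schwartz_basic[OF Sd] in auto)
  thus ?thesis by simp
qed

lemma Sk_continuous:
  assumes "admissible \<phi>" "tempered T"
  shows "continuous_on UNIV (Sk \<phi> k T)"
  unfolding Sk_def[abs_def] by (intro tempered_conv_continuous schwartz_phik admissibleD assms)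

text \<open>\<open>tempered_reproducing_bound\<close> is applied with the reproducing kernel of
  \<open>phik_reproducing\<close>, and the rapid decay of \<phi> replaces that kernel by an explicit
  one of order \<open>M\<close>. The constant is independent of k and of the distribution, as the
  summation over k requires.\<close>

lemma Sk_reproducing_bound:
  assumes \<phi>: "admissible (\<phi> :: real^'d::finite \<Rightarrow> real)"
  obtains B where "B > 0" "\<And>(T :: (real^'d \<Rightarrow> real) \<Rightarrow> 'x::banach) k x. tempered T \<Longrightarrow>
    ennreal (norm (Sk \<phi> k T x)) \<le> ennreal B * (\<integral>\<^sup>+y. ennreal ((2 ^ k) ^ CARD('d) / (1 + 2 ^ k * norm (x - y)) ^ M * norm (Sk \<phi> k T y)) \<partial>lborel)"
proof -
  note S = admissibleD(1)[OF \<phi>]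
  obtain C where C: "C > 0" "\<And>x. (1 + norm x) ^ M * \<bar>\<phi> x\<bar> \<le> C" using schwartz_bounded[OF S] by blast
  define \<kappa> where "\<kappa> = (2 * pi) powr (real CARD('d) / 2)"
  have \<kappa>: "\<kappa> > 0" by (simp add: \<kappa>_def)
  \<comment> \<open>The factor 2^d remains of the dilation factor at level k + 1 after the one at
    level k is split off; 1/\<kappa> undoes the normalisation.\<close>
  define B where "B = 2 ^ CARD('d) * C / \<kappa>"
  have B: "B > 0" using C \<kappa> by (simp add: B_def)
  show ?thesis
  proof (rule that[OF B])
    fix T :: "(real^'d \<Rightarrow> real) \<Rightarrow> 'x" and k x
    assume T: "tempered T"
    have Sm[measurable]: "(\<lambda>y. norm (Sk \<phi> k T y)) \<in> borel_measurable borel"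
      using Sk_continuous[OF \<phi> T] by (intro borel_measurable_continuous_onI continuous_intros)
    have dm[measurable]: "dilate \<phi> (k + 1) \<in> borel_measurable borel" using schwartz_dilate[OF S] by (rule schwartz_basic)
    have Db: "\<bar>dilate \<phi> (k + 1) w\<bar> \<le> \<kappa> * B * ((2 ^ k) ^ CARD('d) / (1 + 2 ^ k * norm w) ^ M)" for w
    proof -
      have p: "(1 + 2 ^ k * norm w) ^ M > 0" by (intro zero_less_power) (simp add: add_pos_nonneg)
      have "(1 + 2 ^ k * norm w) ^ M * \<bar>\<phi> (2 ^ (k + 1) *\<^sub>R w)\<bar> \<le> (1 + norm (2 ^ (k + 1) *\<^sub>R w)) ^ M * \<bar>\<phi> (2 ^ (k + 1) *\<^sub>R w)\<bar>"
        by (intro mult_right_mono power_mono) auto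
      also have "\<dots> \<le> C" by (rule C)
      finally have "\<bar>\<phi> (2 ^ (k + 1) *\<^sub>R w)\<bar> \<le> C / (1 + 2 ^ k * norm w) ^ M" using p by (simp add: field_simps)
      hence "(2 ^ (k + 1)) ^ CARD('d) * \<bar>\<phi> (2 ^ (k + 1) *\<^sub>R w)\<bar> \<le> (2 ^ (k + 1)) ^ CARD('d) * (C / (1 + 2 ^ k * norm w) ^ M)"
        by (intro mult_left_mono) auto
      also have "\<dots> = \<kappa> * B * ((2 ^ k) ^ CARD('d) / (1 + 2 ^ k * norm w) ^ M)"
        using \<kappa> by (simp add: B_def power_mult_distrib)
      finally show ?thesis by (simp add: dilate_def abs_mult)
    qed
    have "ennreal (\<kappa> * norm (T (\<lambda>z. phik \<phi> k (x - z)))) \<le> (\<integral>\<^sup>+y. ennreal (\<bar>dilate \<phi> (k + 1) y\<bar> * norm (T (\<lambda>z. phik \<phi> k (x - y - z)))) \<partial>lborel)"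
      by (rule tempered_reproducing_bound[OF T schwartz_phik[OF S] schwartz_dilate[OF S]])
        (use \<kappa> phik_reproducing[OF \<phi>] in \<open>auto simp: \<kappa>_def\<close>)
    hence "ennreal (\<kappa> * norm (Sk \<phi> k T x)) \<le> (\<integral>\<^sup>+y. ennreal (\<bar>dilate \<phi> (k + 1) y\<bar> * norm (Sk \<phi> k T (x - y))) \<partial>lborel)"
      by (simp add: Sk_def)
    also have "\<dots> = ennreal (\<bar>-1\<bar> ^ DIM(real^'d)) * (\<integral>\<^sup>+y. ennreal (\<bar>dilate \<phi> (k + 1) (x + (-1) *\<^sub>R y)\<bar> * norm (Sk \<phi> k T (x - (x + (-1) *\<^sub>R y)))) \<partial>lborel)"
    proof (rule nn_integral_lborel_affine)
      have [measurable]: "(\<lambda>y. norm (Sk \<phi> k T (x - y))) \<in> borel_measurable borel"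
        by (rule measurable_compose[OF _ Sm]) measurable
      show "(\<lambda>y. ennreal (\<bar>dilate \<phi> (k + 1) y\<bar> * norm (Sk \<phi> k T (x - y)))) \<in> borel_measurable borel" by measurable
    qed simp
    also have "\<dots> = (\<integral>\<^sup>+y. ennreal (\<bar>dilate \<phi> (k + 1) (x - y)\<bar> * norm (Sk \<phi> k T y)) \<partial>lborel)" by simp
    also have "\<dots> \<le> (\<integral>\<^sup>+y. ennreal (\<kappa> * B) * ennreal ((2 ^ k) ^ CARD('d) / (1 + 2 ^ k * norm (x - y)) ^ M * norm (Sk \<phi> k T y)) \<partial>lborel)"
    proof (rule nn_integral_mono)
      fix y
      have "\<bar>dilate \<phi> (k + 1) (x - y)\<bar> * norm (Sk \<phi> k T y) \<le> \<kappa> * B * ((2 ^ k) ^ CARD('d) / (1 + 2 ^ k * norm (x - y)) ^ M) * norm (Sk \<phi> k T y)"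
        by (intro mult_right_mono Db) simp
      thus "ennreal (\<bar>dilate \<phi> (k + 1) (x - y)\<bar> * norm (Sk \<phi> k T y)) \<le> ennreal (\<kappa> * B) * ennreal ((2 ^ k) ^ CARD('d) / (1 + 2 ^ k * norm (x - y)) ^ M * norm (Sk \<phi> k T y))"
        using \<kappa> B by (simp add: ennreal_leI mult.assoc flip: ennreal_mult')
    qed
    also have "\<dots> = ennreal (\<kappa> * B) * (\<integral>\<^sup>+y. ennreal ((2 ^ k) ^ CARD('d) / (1 + 2 ^ k * norm (x - y)) ^ M * norm (Sk \<phi> k T y)) \<partial>lborel)"
      by (rule nn_integral_cmult) measurable
    finally have "ennreal (1 / \<kappa>) * ennreal (\<kappa> * norm (Sk \<phi> k T x)) \<le> ennreal (1 / \<kappa>) * (ennreal (\<kappa> * B) * (\<integral>\<^sup>+y. ennreal ((2 ^ k) ^ CARD('d) / (1 + 2 ^ k * norm (x - y)) ^ M * norm (Sk \<phi> k T y)) \<partial>lborel))"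
      by (rule mult_left_mono) simp
    moreover have "ennreal (1 / \<kappa>) * ennreal (\<kappa> * norm (Sk \<phi> k T x)) = ennreal (norm (Sk \<phi> k T x))"
      using \<kappa> by (simp flip: ennreal_mult)
    moreover have "ennreal (1 / \<kappa>) * ennreal (\<kappa> * B) = ennreal B" using \<kappa> B by (simp flip: ennreal_mult)
    ultimately show "ennreal (norm (Sk \<phi> k T x)) \<le> ennreal B * (\<integral>\<^sup>+y. ennreal ((2 ^ k) ^ CARD('d) / (1 + 2 ^ k * norm (x - y)) ^ M * norm (Sk \<phi> k T y)) \<partial>lborel)"
      by (simp only: mult.assoc[symmetric])
  qed
qed

text \<open>Here the comparison takes place between sequence norms at each point, before
  integration, so any measurable weight is allowed. If s0 > s1 the chain runs from l^q1 to l^1,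
  through the geometric sum of 2^(-k(s0-s1)) to the supremum, and up to l^q0; if s0 = s1 it is the
  monotonicity of sequence norms.\<close>

lemma TL_embedding_same_weight:
  fixes \<phi> :: "real^'d::finite \<Rightarrow> real"
  assumes \<phi>: "admissible \<phi>" and p: "p > 0" and q: "1 \<le> q0" "1 \<le> q1"
    and s: "s0 > s1 \<or> (s0 = s1 \<and> q0 \<le> q1)" and w [measurable]: "w \<in> borel_measurable borel"
  shows "\<exists>C::real. \<forall>T :: (real^'d \<Rightarrow> real) \<Rightarrow> 'x::banach. tempered T \<longrightarrow>
    TL_norm \<phi> s1 p q1 w T \<le> ennreal C * TL_norm \<phi> s0 p q0 w T"
proof -
  have "\<exists>K>0. \<forall>f. (\<forall>k. f k \<ge> 0) \<longrightarrow> lq_norm q1 (\<lambda>k. 2 powr (real k * s1) * f k) \<le> ennreal K * lq_norm q0 (\<lambda>k. 2 powr (real k * s0) * f k)"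
  proof (cases "s0 > s1")
    case True
    hence e: "s0 - s1 > 0" by simp
    obtain K where K: "K > 0" "\<And>t. (\<Sum>k. ennreal (2 powr (- (s0 - s1) * \<bar>real k - t\<bar>))) \<le> ennreal K"
      using suminf_two_sided_geometric[OF e] by blast
    have "lq_norm q1 (\<lambda>k. 2 powr (real k * s1) * f k) \<le> ennreal K * lq_norm q0 (\<lambda>k. 2 powr (real k * s0) * f k)" if f: "\<forall>k. f k \<ge> 0" for f
    proof -
      let ?S = "lq_norm q0 (\<lambda>k. 2 powr (real k * s0) * f k)"
      have "lq_norm q1 (\<lambda>k. 2 powr (real k * s1) * f k) \<le> lq_norm 1 (\<lambda>k. 2 powr (real k * s1) * f k)"
        using q by (intro lq_norm_antimono) auto
      also have "\<dots> = (\<Sum>k. ennreal (2 powr (real k * s1) * f k))" using f by (simp add: lq_norm_1 abs_mult)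
      also have "\<dots> \<le> (\<Sum>k. ennreal (2 powr (- (s0 - s1) * \<bar>real k - 0\<bar>)) * ?S)"
      proof (intro suminf_le)
        fix k
        have "ennreal (2 powr (real k * s0) * f k) \<le> lq_norm top (\<lambda>k. 2 powr (real k * s0) * f k)"
          using le_lq_norm_top[of "\<lambda>k. 2 powr (real k * s0) * f k" k] f by (simp add: abs_mult)
        also have "\<dots> \<le> ?S" using q by (intro lq_norm_antimono) auto
        finally have "ennreal (2 powr (- (s0 - s1) * \<bar>real k - 0\<bar>)) * ennreal (2 powr (real k * s0) * f k) \<le> ennreal (2 powr (- (s0 - s1) * \<bar>real k - 0\<bar>)) * ?S"
          by (intro mult_left_mono) auto
        moreover have "2 powr (- (s0 - s1) * \<bar>real k - 0\<bar>) * (2 powr (real k * s0) * f k) = 2 powr (real k * s1) * f k"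
          unfolding mult.assoc[symmetric] powr_add[symmetric] by (simp add: algebra_simps)
        hence "ennreal (2 powr (- (s0 - s1) * \<bar>real k - 0\<bar>)) * ennreal (2 powr (real k * s0) * f k) = ennreal (2 powr (real k * s1) * f k)"
          by (simp only: ennreal_mult'[OF powr_ge_zero, symmetric])
        ultimately show "ennreal (2 powr (real k * s1) * f k) \<le> ennreal (2 powr (- (s0 - s1) * \<bar>real k - 0\<bar>)) * ?S" by (simp only:)
      qed auto
      also have "\<dots> = (\<Sum>k. ennreal (2 powr (- (s0 - s1) * \<bar>real k - 0\<bar>))) * ?S" by (rule ennreal_suminf_multc)
      also have "\<dots> \<le> ennreal K * ?S" by (intro mult_right_mono K) simp
      finally show ?thesis .
    qed
    thus ?thesis using K(1) by blast
  next
    case False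
    hence "s0 = s1" "q0 \<le> q1" using s by auto
    thus ?thesis using lq_norm_antimono[OF q(1)] by (intro exI[of _ 1]) simp
  qed
  then obtain K where K: "K > 0" "\<And>f. (\<And>k. f k \<ge> 0) \<Longrightarrow> lq_norm q1 (\<lambda>k. 2 powr (real k * s1) * f k) \<le> ennreal K * lq_norm q0 (\<lambda>k. 2 powr (real k * s0) * f k)"
    by blast
  show ?thesis
  proof (intro exI[of _ K] allI impI)
    fix T :: "(real^'d \<Rightarrow> real) \<Rightarrow> 'x" assume T: "tempered T"
    have [measurable]: "(\<lambda>x. norm (Sk \<phi> k T x)) \<in> borel_measurable borel" for k
      using Sk_continuous[OF \<phi> T] by (intro borel_measurable_continuous_onI continuous_intros)
    define L where "L = (\<lambda>q s x. lq_norm q (\<lambda>k. 2 powr (real k * s) * norm (Sk \<phi> k T x)))"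
    let ?I = "\<lambda>q s. \<integral>\<^sup>+x. enn_powr (L q s x) p * ennreal (w x) \<partial>lborel"
    have "?I q1 s1 \<le> (\<integral>\<^sup>+x. ennreal (K powr p) * (enn_powr (L q0 s0 x) p * ennreal (w x)) \<partial>lborel)"
    proof (rule nn_integral_mono)
      fix x
      have "enn_powr (L q1 s1 x) p \<le> enn_powr (ennreal K * L q0 s0 x) p"
        unfolding L_def using p by (intro enn_powr_mono K) auto
      also have "\<dots> = ennreal (K powr p) * enn_powr (L q0 s0 x) p"
        using K p by (simp add: enn_powr_mult enn_powr_ennreal)
      finally show "enn_powr (L q1 s1 x) p * ennreal (w x) \<le> ennreal (K powr p) * (enn_powr (L q0 s0 x) p * ennreal (w x))"
        unfolding mult.assoc[symmetric] by (rule mult_right_mono) simp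
    qed
    also have "\<dots> = ennreal (K powr p) * ?I q0 s0"
      unfolding L_def by (rule nn_integral_cmult) measurable
    finally have "enn_powr (?I q1 s1) (1 / p) \<le> enn_powr (ennreal (K powr p) * ?I q0 s0) (1 / p)"
      using p by (intro enn_powr_mono) auto
    also have "\<dots> = ennreal K * enn_powr (?I q0 s0) (1 / p)"
      using K p by (simp add: enn_powr_mult enn_powr_ennreal powr_powr)
    finally show "TL_norm \<phi> s1 p q1 w T \<le> ennreal K * TL_norm \<phi> s0 p q0 w T"
      unfolding TL_norm_def L_def .
  qed
qed

lemma pw_measurable [measurable]: "pw \<gamma> \<in> borel_measurable borel"
  unfolding pw_def[abs_def] by measurable

text \<open>Reduces to \<open>weighted_sequence_embedding\<close> for the norms of the blocks: their
  l^q1 norm lies below the l^1 norm, and their l^q0 norm lies above every single term and so serves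
  as the majorant \<open>H\<close>.\<close>

lemma TL_embedding_gain:
  fixes \<phi> :: "real^'d::finite \<Rightarrow> real"
  assumes \<phi>: "admissible \<phi>" and p: "1 \<le> p0" "p0 \<le> p1" and q: "1 \<le> q0" "1 \<le> q1"
    and g: "\<gamma>0 > - real CARD('d)" "\<gamma>1 > - real CARD('d)"
    and c1: "\<gamma>1 / p1 \<le> \<gamma>0 / p0" and c2: "(real CARD('d) + \<gamma>1) / p1 < (real CARD('d) + \<gamma>0) / p0"
    and c3: "s0 - (real CARD('d) + \<gamma>0) / p0 \<ge> s1 - (real CARD('d) + \<gamma>1) / p1"
  shows "\<exists>C::real. \<forall>T :: (real^'d \<Rightarrow> real) \<Rightarrow> 'x::banach. tempered T \<longrightarrow>
    TL_norm \<phi> s1 p1 q1 (pw \<gamma>1) T \<le> ennreal C * TL_norm \<phi> s0 p0 q0 (pw \<gamma>0) T"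
proof -
  \<comment> \<open>The extra decay demanded of the kernel, enough to absorb the weight of exponent
    \<gamma>0/p0.\<close>
  define N where "N = nat \<lceil>\<bar>\<gamma>0\<bar> / p0\<rceil>"
  have N: "real N \<ge> \<bar>\<gamma>0\<bar> / p0" unfolding N_def by linarith
  obtain B where B: "B > 0" "\<And>(T :: (real^'d \<Rightarrow> real) \<Rightarrow> 'x::banach) k x. tempered T \<Longrightarrow>
    ennreal (norm (Sk \<phi> k T x)) \<le> ennreal B * (\<integral>\<^sup>+y. ennreal ((2 ^ k) ^ CARD('d) / (1 + 2 ^ k * norm (x - y)) ^ (CARD('d) + 1 + N) * norm (Sk \<phi> k T y)) \<partial>lborel)"
    using Sk_reproducing_bound[OF \<phi>, where 'x='x and M="CARD('d) + 1 + N"] by blast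
  have dim: "DIM(real^'d) = CARD('d)" by simp
  obtain C where C: "C > 0"
    "\<And>(F :: nat \<Rightarrow> real^'d \<Rightarrow> real) H. (\<And>k. continuous_on UNIV (F k)) \<Longrightarrow> (\<And>k x. F k x \<ge> 0) \<Longrightarrow>
      (\<And>k x. ennreal (F k x) \<le> ennreal B * (\<integral>\<^sup>+y. ennreal ((2 ^ k) ^ CARD('d) / (1 + 2 ^ k * norm (x - y)) ^ (CARD('d) + 1 + N) * F k y) \<partial>lborel)) \<Longrightarrow>
      H \<in> borel_measurable borel \<Longrightarrow> (\<And>k x. ennreal (2 powr (real k * s0) * F k x) \<le> H x) \<Longrightarrow>
      (\<integral>\<^sup>+x. enn_powr (\<Sum>k. ennreal (2 powr (real k * s1) * F k x)) p1 * ennreal (norm x powr \<gamma>1) \<partial>lborel)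
        \<le> ennreal C * enn_powr (\<integral>\<^sup>+x. enn_powr (H x) p0 * ennreal (norm x powr \<gamma>0) \<partial>lborel) (p1 / p0)"
    using weighted_sequence_embedding[where 'a="real^'d", unfolded dim, OF B(1) p N g c1 c2 c3] by blast
  have p0: "p0 > 0" "p1 > 0" using p by auto
  show ?thesis
  proof (intro exI[of _ "C powr (1 / p1)"] allI impI)
    fix T :: "(real^'d \<Rightarrow> real) \<Rightarrow> 'x" assume T: "tempered T"
    define F where "F = (\<lambda>k x. norm (Sk \<phi> k T x))"
    have Fc: "continuous_on UNIV (F k)" for k
      using Sk_continuous[OF \<phi> T] unfolding F_def by (intro continuous_intros)
    have F0: "F k x \<ge> 0" for k x by (simp add: F_def)
    have [measurable]: "F k \<in> borel_measurable borel" for k using Fc by (rule borel_measurable_continuous_onI)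
    define H where "H = (\<lambda>x. lq_norm q0 (\<lambda>k. 2 powr (real k * s0) * F k x))"
    have Hm: "H \<in> borel_measurable borel" unfolding H_def by measurable
    have FH: "ennreal (2 powr (real k * s0) * F k x) \<le> H x" for k x
    proof -
      have "ennreal (2 powr (real k * s0) * F k x) \<le> lq_norm top (\<lambda>k. 2 powr (real k * s0) * F k x)"
        using le_lq_norm_top[of "\<lambda>k. 2 powr (real k * s0) * F k x" k] F0[of k x] by (simp add: abs_mult)
      also have "\<dots> \<le> H x" unfolding H_def using q by (intro lq_norm_antimono) auto
      finally show ?thesis .
    qed
    have "(\<integral>\<^sup>+x. enn_powr (lq_norm q1 (\<lambda>k. 2 powr (real k * s1) * F k x)) p1 * ennreal (pw \<gamma>1 x) \<partial>lborel)
      \<le> (\<integral>\<^sup>+x. enn_powr (\<Sum>k. ennreal (2 powr (real k * s1) * F k x)) p1 * ennreal (norm x powr \<gamma>1) \<partial>lborel)"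
    proof (rule nn_integral_mono)
      fix x
      have "lq_norm q1 (\<lambda>k. 2 powr (real k * s1) * F k x) \<le> lq_norm 1 (\<lambda>k. 2 powr (real k * s1) * F k x)"
        using q by (intro lq_norm_antimono) auto
      also have "\<dots> = (\<Sum>k. ennreal (2 powr (real k * s1) * F k x))" using F0 by (simp add: lq_norm_1 abs_mult)
      finally show "enn_powr (lq_norm q1 (\<lambda>k. 2 powr (real k * s1) * F k x)) p1 * ennreal (pw \<gamma>1 x)
        \<le> enn_powr (\<Sum>k. ennreal (2 powr (real k * s1) * F k x)) p1 * ennreal (norm x powr \<gamma>1)"
        unfolding pw_def using p0 by (intro mult_right_mono enn_powr_mono) auto
    qed
    also have "\<dots> \<le> ennreal C * enn_powr (\<integral>\<^sup>+x. enn_powr (H x) p0 * ennreal (norm x powr \<gamma>0) \<partial>lborel) (p1 / p0)"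
      by (rule C(2)[OF Fc F0 _ Hm FH]) (unfold F_def, rule B(2)[OF T])
    finally have "enn_powr (\<integral>\<^sup>+x. enn_powr (lq_norm q1 (\<lambda>k. 2 powr (real k * s1) * F k x)) p1 * ennreal (pw \<gamma>1 x) \<partial>lborel) (1 / p1)
      \<le> enn_powr (ennreal C * enn_powr (\<integral>\<^sup>+x. enn_powr (H x) p0 * ennreal (norm x powr \<gamma>0) \<partial>lborel) (p1 / p0)) (1 / p1)"
      using p0 by (intro enn_powr_mono) auto
    also have "\<dots> = ennreal (C powr (1 / p1)) * enn_powr (\<integral>\<^sup>+x. enn_powr (H x) p0 * ennreal (norm x powr \<gamma>0) \<partial>lborel) (1 / p0)"
      using C(1) p0 by (simp add: enn_powr_mult enn_powr_ennreal enn_powr_powr)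
    finally show "TL_norm \<phi> s1 p1 q1 (pw \<gamma>1) T \<le> ennreal (C powr (1 / p1)) * TL_norm \<phi> s0 p0 q0 (pw \<gamma>0) T"
      unfolding TL_norm_def H_def F_def pw_def .
  qed
qed

section \<open>Test functions\<close>

text \<open>Exponent inequalities are extracted from the test families through this criterion, with
  n indexing the dilation, the translation or the length of the sum.\<close>

lemma powr_bounded_imp_nonpos:
  assumes "\<And>n. n \<ge> n0 \<Longrightarrow> 2 powr (real n * t) \<le> K"
  shows "t \<le> 0"
proof (rule ccontr)
  assume "\<not> t \<le> 0"
  hence t: "t > 0" by simp
  hence "(2::real) powr 0 < 2 powr t" by (intro powr_less_mono) auto
  hence "1 < (2::real) powr t" by simp
  then obtain n where n: "K < (2 powr t) ^ n" using real_arch_pow by blast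
  have "(2 powr t) ^ n = 2 powr (real n * t)" by (simp add: powr_powr mult.commute flip: powr_realpow)
  also have "\<dots> \<le> 2 powr (real (max n n0) * t)" using t by (intro powr_mono mult_right_mono) auto
  also have "\<dots> \<le> K" by (rule assms) simp
  finally show False using n by simp
qed

text \<open>The regular distribution of a scalar function in a fixed direction v; all its blocks are
  scalar functions times v, so the necessity part becomes scalar.\<close>

definition function_distribution :: "(real^'d::finite \<Rightarrow> real) \<Rightarrow> 'x::banach \<Rightarrow> (real^'d \<Rightarrow> real) \<Rightarrow> 'x" where
  "function_distribution f v g = (LINT y|lborel. f y * g y) *\<^sub>R v"

lemma tempered_function_distribution:
  fixes f :: "real^'d::finite \<Rightarrow> real" and v :: "'x::banach"
  assumes f: "integrable lborel f"
  shows "tempered (function_distribution f v)"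
  unfolding tempered_def
proof (intro conjI allI impI)
  have fg: "integrable lborel (\<lambda>y. f y * g y)" if g: "schwartz g" for g
  proof -
    obtain C where C: "C > 0" "\<And>x. (1 + norm x) ^ 0 * \<bar>g x\<bar> \<le> C" using schwartz_bounded[OF g] by blast
    show ?thesis
      by (rule Bochner_Integration.integrable_bound[of _ "\<lambda>y. C * f y"])
        (use f C schwartz_basic(3)[OF g] in \<open>auto simp: abs_mult mult.commute[of "\<bar>f _\<bar>"] intro!: mult_right_mono\<close>)
  qed
  {
    fix g h :: "real^'d \<Rightarrow> real" and a b :: real
    assume g: "schwartz g" and h: "schwartz h"
    have "(LINT y|lborel. f y * (a * g y + b * h y)) = (LINT y|lborel. a * (f y * g y) + b * (f y * h y))"
      by (intro Bochner_Integration.integral_cong) (auto simp: algebra_simps)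
    also have "\<dots> = a * (LINT y|lborel. f y * g y) + b * (LINT y|lborel. f y * h y)"
      using fg[OF g] fg[OF h] by simp
    finally show "function_distribution f v (\<lambda>x. a * g x + b * h x) = a *\<^sub>R function_distribution f v g + b *\<^sub>R function_distribution f v h"
      by (simp add: function_distribution_def algebra_simps)
  }
  show "\<exists>C (N::nat). \<forall>g. schwartz g \<longrightarrow> norm (function_distribution f v g) \<le> C * (\<Sum>is\<in>{is::'d list. length is \<le> N}. \<Sum>n\<le>N. snorm n is g)"
  proof (intro exI[of _ "(LINT y|lborel. \<bar>f y\<bar>) * norm v"] exI[of _ 0] allI impI)
    fix g :: "real^'d \<Rightarrow> real" assume g: "schwartz g"
    obtain C where C: "C > 0" "\<And>x. (1 + norm x) ^ 0 * \<bar>g x\<bar> \<le> C" using schwartz_bounded[OF g] by blast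
    have gs: "\<bar>g y\<bar> \<le> snorm 0 [] g" for y
    proof -
      have "bdd_above (range (\<lambda>x. (1 + norm x) ^ 0 * \<bar>dpart [] g x\<bar>))" using C by (auto simp: bdd_above_def)
      from cSUP_upper[OF UNIV_I this, of y] show ?thesis by (simp add: snorm_def)
    qed
    have "\<bar>LINT y|lborel. f y * g y\<bar> \<le> (LINT y|lborel. \<bar>f y * g y\<bar>)" by (rule integral_abs_bound)
    also have "\<dots> \<le> (LINT y|lborel. \<bar>f y\<bar> * snorm 0 [] g)"
      using integrable_abs[OF fg[OF g]] f gs by (intro integral_mono) (auto simp: abs_mult intro!: mult_left_mono)
    also have "\<dots> = (LINT y|lborel. \<bar>f y\<bar>) * snorm 0 [] g" by simp
    finally have "\<bar>LINT y|lborel. f y * g y\<bar> * norm v \<le> (LINT y|lborel. \<bar>f y\<bar>) * snorm 0 [] g * norm v"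
      by (rule mult_right_mono) simp
    thus "norm (function_distribution f v g) \<le> (LINT y|lborel. \<bar>f y\<bar>) * norm v * (\<Sum>is\<in>{is::'d list. length is \<le> 0}. \<Sum>n\<le>0. snorm n is g)"
      by (simp add: function_distribution_def mult.commute mult.left_commute)
  qed
qed

text \<open>A bump of width 1/\<rho> whose transform consists of two rescaled copies of that of
  \<phi>, centred at plus and minus 7/8 2^k along one axis. A cosine is used rather than a character
  because test functions here are real valued.\<close>

definition wave :: "(real^'d::finite \<Rightarrow> real) \<Rightarrow> 'd \<Rightarrow> nat \<Rightarrow> real \<Rightarrow> real^'d \<Rightarrow> real" where
  "wave \<phi> i k \<rho> x = cos (((7/8 * 2 ^ k) *\<^sub>R axis i 1) \<bullet> x) * \<phi> (\<rho> *\<^sub>R x)"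

lemma fourier_cos_mult:
  fixes f :: "real^'d::finite \<Rightarrow> real"
  assumes f: "integrable lborel f"
  shows "fourier (\<lambda>x. cos (\<eta> \<bullet> x) * f x) \<xi> = (fourier f (\<xi> - \<eta>) + fourier f (\<xi> + \<eta>)) / 2"
proof -
  have [measurable]: "(\<lambda>x. cis (- (x \<bullet> \<xi>))) \<in> borel_measurable borel" for \<xi> :: "real^'d"
    unfolding cis_conv_exp by measurable
  have i: "integrable lborel (\<lambda>x. complex_of_real (f x) * cis (- (x \<bullet> \<xi>)))" for \<xi>
    by (rule Bochner_Integration.integrable_bound[OF f]) (use f in \<open>auto simp: norm_mult\<close>)
  have c: "complex_of_real (cos t) = (cis t + cis (- t)) / 2" for t
    by (simp add: complex_eq_iff)
  have "complex_of_real (cos (\<eta> \<bullet> x) * f x) * cis (- (x \<bullet> \<xi>))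
    = (complex_of_real (f x) * cis (- (x \<bullet> (\<xi> - \<eta>))) + complex_of_real (f x) * cis (- (x \<bullet> (\<xi> + \<eta>)))) / 2" for x
  proof -
    have "cis (\<eta> \<bullet> x) * cis (- (x \<bullet> \<xi>)) = cis (- (x \<bullet> (\<xi> - \<eta>)))" "cis (- (\<eta> \<bullet> x)) * cis (- (x \<bullet> \<xi>)) = cis (- (x \<bullet> (\<xi> + \<eta>)))"
      by (simp_all add: cis_mult inner_simps inner_commute algebra_simps)
    thus ?thesis by (simp add: c field_simps)
  qed
  note eq = this
  have "(LINT x|lborel. complex_of_real (cos (\<eta> \<bullet> x) * f x) * cis (- (x \<bullet> \<xi>)))
    = ((LINT x|lborel. complex_of_real (f x) * cis (- (x \<bullet> (\<xi> - \<eta>)))) + (LINT x|lborel. complex_of_real (f x) * cis (- (x \<bullet> (\<xi> + \<eta>))))) / 2"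
    unfolding eq integral_divide_zero by (subst Bochner_Integration.integral_add) (rule i refl)+
  thus ?thesis unfolding fourier_def by (simp add: algebra_simps add_divide_distrib)
qed

lemma fourier_scale:
  fixes \<phi> :: "real^'d::finite \<Rightarrow> real"
  assumes \<phi>: "schwartz \<phi>" and \<rho>: "\<rho> > 0"
  shows "fourier (\<lambda>x. \<phi> (\<rho> *\<^sub>R x)) \<xi> = of_real (inverse (\<rho> ^ CARD('d))) * fourier \<phi> (\<xi> /\<^sub>R \<rho>)"
proof -
  have i: "integrable lborel (\<lambda>x. \<rho> ^ CARD('d) * \<phi> (\<rho> *\<^sub>R x))"
    using integrable_lborel_affine[OF schwartz_basic(1)[OF \<phi>], of \<rho> 0] \<rho> by simp
  have "fourier (\<lambda>x. \<phi> (\<rho> *\<^sub>R x)) \<xi> = fourier (\<lambda>x. inverse (\<rho> ^ CARD('d)) * (\<rho> ^ CARD('d) * \<phi> (\<rho> *\<^sub>R x)) + 0 * (\<rho> ^ CARD('d) * \<phi> (\<rho> *\<^sub>R x))) \<xi>"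
    using \<rho> by (simp add: mult.assoc[symmetric])
  also have "\<dots> = of_real (inverse (\<rho> ^ CARD('d))) * fourier \<phi> (\<xi> /\<^sub>R \<rho>)"
    unfolding fourier_lincomb[OF i i] fourier_dilate[OF schwartz_basic(3)[OF \<phi>] \<rho>] by simp
  finally show ?thesis .
qed

lemma wave_basic:
  assumes \<phi>: "schwartz \<phi>" and \<rho>: "\<rho> > 0"
  shows "continuous_on UNIV (wave \<phi> i k \<rho>)" "wave \<phi> i k \<rho> \<in> borel_measurable borel" "integrable lborel (wave \<phi> i k \<rho>)"
    "\<bar>wave \<phi> i k \<rho> x\<bar> \<le> \<bar>\<phi> (\<rho> *\<^sub>R x)\<bar>"
proof -
  have le: "\<bar>wave \<phi> i k \<rho> x\<bar> \<le> \<bar>\<phi> (\<rho> *\<^sub>R x)\<bar>" for x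
    unfolding wave_def abs_mult using mult_right_mono[OF abs_cos_le_one, of "\<bar>\<phi> (\<rho> *\<^sub>R x)\<bar>"] by simp
  show "\<bar>wave \<phi> i k \<rho> x\<bar> \<le> \<bar>\<phi> (\<rho> *\<^sub>R x)\<bar>" by (rule le)
  show c: "continuous_on UNIV (wave \<phi> i k \<rho>)"
    unfolding wave_def[abs_def]
    by (intro continuous_intros continuous_on_compose2[OF schwartz_basic(2)[OF \<phi>]]) auto
  thus m: "wave \<phi> i k \<rho> \<in> borel_measurable borel" by (rule borel_measurable_continuous_onI)
  have "integrable lborel (\<lambda>x. \<phi> (\<rho> *\<^sub>R x))"
    using integrable_lborel_affine[OF schwartz_basic(1)[OF \<phi>], of \<rho> 0] \<rho> by simp
  thus "integrable lborel (wave \<phi> i k \<rho>)"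
    by (rule Bochner_Integration.integrable_bound) (use le m in auto)
qed

lemma fourier_wave:
  fixes \<phi> :: "real^'d::finite \<Rightarrow> real"
  assumes \<phi>: "schwartz \<phi>" and \<rho>: "\<rho> > 0"
  shows "fourier (wave \<phi> i k \<rho>) \<xi> = of_real (inverse (\<rho> ^ CARD('d)) / 2) *
    (fourier \<phi> ((\<xi> - (7/8 * 2 ^ k) *\<^sub>R axis i 1) /\<^sub>R \<rho>) + fourier \<phi> ((\<xi> + (7/8 * 2 ^ k) *\<^sub>R axis i 1) /\<^sub>R \<rho>))"
proof -
  have i: "integrable lborel (\<lambda>x. \<phi> (\<rho> *\<^sub>R x))"
    using integrable_lborel_affine[OF schwartz_basic(1)[OF \<phi>], of \<rho> 0] \<rho> by simp
  show ?thesis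
    unfolding wave_def[abs_def] fourier_cos_mult[OF i] fourier_scale[OF \<phi> \<rho>] by (simp add: algebra_simps add_divide_distrib)
qed

text \<open>The frequency \<open>7/8 2\<^sup>k\<close> is the middle of the annulus \<open>3/4 2\<^sup>k \<le> \<bar>\<xi>\<bar> \<le> 2\<^sup>k\<close> on which the \<open>k\<close>-th cut-off
  equals one and all others vanish; \<open>12 \<rho> \<le> 2\<^sup>k\<close> keeps the whole spectrum inside it.\<close>
lemma phik_wave:
  fixes \<phi> :: "real^'d::finite \<Rightarrow> real"
  assumes \<phi>: "admissible \<phi>" and \<rho>: "\<rho> > 0" "12 * \<rho> \<le> 2 ^ k" and k: "k \<ge> 1"
  shows "(LINT y|lborel. phik \<phi> j (x - y) * wave \<phi> i k \<rho> y)
    = (2 * pi) powr (real CARD('d) / 2) * (if j = k then wave \<phi> i k \<rho> x else 0)"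
proof -
  note S = admissibleD(1)[OF \<phi>]
  have Sp: "schwartz (phik \<phi> j)" by (rule schwartz_phik[OF S])
  obtain C where C: "\<And>x. (1 + norm x) ^ 0 * \<bar>phik \<phi> j x\<bar> \<le> C" using schwartz_bounded[OF Sp] by blast
  obtain C' where C': "\<And>x. (1 + norm x) ^ 0 * \<bar>\<phi> x\<bar> \<le> C'" using schwartz_bounded[OF S] by blast
  have "(LINT y|lborel. phik \<phi> j (x - y) * wave \<phi> i k \<rho> y) = (2 * pi) powr (real CARD('d) / 2) * (if j = k then 1 else 0) * wave \<phi> i k \<rho> x"
  proof (rule convolution_eqI)
    show "\<bar>phik \<phi> j x\<bar> \<le> C" for x using C[of x] by simp
    show "\<bar>wave \<phi> i k \<rho> x\<bar> \<le> C'" for x using C'[of "\<rho> *\<^sub>R x"] wave_basic(4)[OF S \<rho>(1), of i k x] by simp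
    fix \<xi> :: "real^'d"
    let ?e = "(7/8 * 2 ^ k) *\<^sub>R axis i 1 :: real^'d"
    show "fourier (phik \<phi> j) \<xi> * fourier (wave \<phi> i k \<rho>) \<xi> = complex_of_real (if j = k then 1 else 0) * fourier (wave \<phi> i k \<rho>) \<xi>"
    proof (cases "fourier (wave \<phi> i k \<rho>) \<xi> = 0")
      case False
      have ne: "norm ?e = 7/8 * 2 ^ k" by simp
      \<comment> \<open>Each spectral bump has radius 3/2 \<rho>, and 12 \<rho> <= 2^k makes this at
        most 2^k/8, half the width of the annulus.\<close>
      have near: "norm u < 2 ^ k / 8" if "norm (u /\<^sub>R \<rho>) < 3 / 2" for u :: "real^'d"
      proof -
        have "norm u < 3 / 2 * \<rho>" using that \<rho>(1) by (simp add: field_simps)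
        thus ?thesis using \<rho>(2) by linarith
      qed
      have "norm ((\<xi> - ?e) /\<^sub>R \<rho>) < 3 / 2 \<or> norm ((\<xi> + ?e) /\<^sub>R \<rho>) < 3 / 2"
        using False admissibleD(3)[OF \<phi>] unfolding fourier_wave[OF S \<rho>(1)] by (metis add.right_neutral mult_zero_right not_le)
      hence "norm (\<xi> - ?e) < 2 ^ k / 8 \<or> norm (\<xi> + ?e) < 2 ^ k / 8" using near by blast
      hence b: "3 / 4 * 2 ^ k \<le> norm \<xi>" "norm \<xi> \<le> 2 ^ k"
        using norm_triangle_ineq2[of \<xi> ?e] norm_triangle_ineq3[of \<xi> ?e] norm_triangle_ineq3[of \<xi> "-?e"] unfolding norm_minus_cancel ne
        by (auto simp: abs_le_iff)
      \<comment> \<open>On the annulus the rescaled cut-off is one for l >= k and zero for l < k,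
        since 3/4 2^k >= 3/2 2^l there; its consecutive differences vanish except at j = k.\<close>
      have one: "fourier \<phi> (\<xi> /\<^sub>R 2 ^ l) = 1" if "l \<ge> k" for l
      proof (rule admissibleD(2)[OF \<phi>])
        have "(2::real) ^ k \<le> 2 ^ l" using that by (intro power_increasing) auto
        hence "norm \<xi> \<le> 2 ^ l" using b(2) by (rule order_trans[rotated])
        thus "norm (\<xi> /\<^sub>R 2 ^ l) \<le> 1" by (simp add: field_simps)
      qed
      have zero: "fourier \<phi> (\<xi> /\<^sub>R 2 ^ l) = 0" if "l < k" for l
      proof (rule admissibleD(3)[OF \<phi>])
        have "(2::real) ^ Suc l \<le> 2 ^ k" using that by (intro power_increasing) auto
        hence "3 / 2 * 2 ^ l \<le> norm \<xi>" using b by simp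
        thus "3 / 2 \<le> norm (\<xi> /\<^sub>R 2 ^ l)" by (simp add: field_simps)
      qed
      have "fourier (phik \<phi> j) \<xi> = (if j = k then 1 else 0)"
      proof -
        consider "j < k" | "j = k" | "j > k" by linarith
        thus ?thesis
        proof cases
          case 1 thus ?thesis unfolding fourier_phik[OF S] using zero[of j] zero[of "j - 1"] by auto
        next
          case 2 thus ?thesis unfolding fourier_phik[OF S] using k one[of j] zero[of "j - 1"] by auto
        next
          case 3 thus ?thesis unfolding fourier_phik[OF S] using one[of j] one[of "j - 1"] by auto
        qed
      qed
      thus ?thesis by simp
    qed simp
  qed (use schwartz_basic[OF Sp] wave_basic[OF S \<rho>(1)] in auto)
  thus ?thesis by simp
qed

text \<open>Its transform does not vanish at the frequency 7/8 along the axis: one copy contributes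
  the value one of the transform of \<phi> at the origin, the other is evaluated at distance 7/4
  times 12, that is 21, outside the support.\<close>

lemma wave_zero_nonzero:
  assumes \<phi>: "admissible \<phi>"
  shows "\<exists>z. wave \<phi> i 0 (1/12) z \<noteq> 0"
proof (rule ccontr)
  note S = admissibleD(1)[OF \<phi>]
  let ?e = "(7/8) *\<^sub>R axis i 1 :: real^'a"
  assume "\<not> ?thesis"
  hence "wave \<phi> i 0 (1/12) = (\<lambda>_. 0)" by auto
  hence "fourier (wave \<phi> i 0 (1/12)) ?e = 0" by (simp add: fourier_def)
  moreover have "fourier (wave \<phi> i 0 (1/12)) ?e = of_real (inverse ((1/12) ^ CARD('a)) / 2) *
    (fourier \<phi> ((?e - (7/8 * 2 ^ 0) *\<^sub>R axis i 1) /\<^sub>R (1/12)) + fourier \<phi> ((?e + (7/8 * 2 ^ 0) *\<^sub>R axis i 1) /\<^sub>R (1/12)))"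
    by (rule fourier_wave[OF S]) simp
  moreover have "(?e - (7/8 * 2 ^ 0) *\<^sub>R axis i 1) /\<^sub>R (1/12) = 0" "(?e + (7/8 * 2 ^ 0) *\<^sub>R axis i 1) /\<^sub>R (1/12) = 21 *\<^sub>R axis i 1"
    by (simp_all flip: scaleR_add_left)
  moreover have "fourier \<phi> (21 *\<^sub>R axis i 1) = 0"
    by (rule admissibleD(3)[OF \<phi>]) simp
  moreover have "fourier \<phi> 0 = 1" by (rule admissibleD(2)[OF \<phi>]) simp
  ultimately show False by simp
qed

text \<open>With the largest admissible parameter \<rho> = 2^n/12 the waves of all levels are
  dilates of a single profile.\<close>

lemma wave_dilate: "wave \<phi> i n (2 ^ n / 12) x = wave \<phi> i 0 (1/12) (2 ^ n *\<^sub>R x)"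
  by (simp add: wave_def ac_simps)

section \<open>Weighted norms of translated and dilated bumps\<close>

lemma lq_norm_single:
  assumes "1 \<le> q"
  shows "lq_norm q (\<lambda>j. if j = k then c else 0) = ennreal \<bar>c\<bar>"
proof (rule antisym)
  have "lq_norm q (\<lambda>j. if j = k then c else 0) \<le> lq_norm 1 (\<lambda>j. if j = k then c else 0)"
    using assms by (intro lq_norm_antimono) auto
  also have "\<dots> = (\<Sum>j\<in>{k}. ennreal \<bar>if j = k then c else 0\<bar>)"
    unfolding lq_norm_1 by (intro suminf_finite) auto
  finally show "lq_norm q (\<lambda>j. if j = k then c else 0) \<le> ennreal \<bar>c\<bar>" by simp
  have "ennreal \<bar>c\<bar> \<le> lq_norm top (\<lambda>j. if j = k then c else 0)"
    using le_lq_norm_top[of "\<lambda>j. if j = k then c else 0" k] by simp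
  also have "\<dots> \<le> lq_norm q (\<lambda>j. if j = k then c else 0)" using assms by (intro lq_norm_antimono) auto
  finally show "ennreal \<bar>c\<bar> \<le> lq_norm q (\<lambda>j. if j = k then c else 0)" .
qed

text \<open>For a bump concentrated near a, the weight |x|^\<gamma> is exchanged for |a|^\<gamma> at
  the price of (1 + |x - a|)^|\<gamma>|, which \<open>N\<close> powers of the decay cover. Only for
  x in the unit ball and negative \<gamma> is this impossible; there |x|^\<gamma> is kept and is
  integrable because \<gamma> > -d.\<close>

lemma weighted_translate_upper:
  fixes f :: "'a::euclidean_space \<Rightarrow> real"
  assumes \<gamma>: "\<gamma> > - real DIM('a)" and p: "p \<ge> 1" and N: "real N \<ge> \<bar>\<gamma>\<bar>"
    and f: "\<And>z. (1 + norm z) ^ (N + (DIM('a) + 1)) * \<bar>f z\<bar> \<le> C"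
  obtains K where "K > 0" "\<And>a. norm a \<ge> 1 \<Longrightarrow> (\<integral>\<^sup>+x. ennreal (\<bar>f (x - a)\<bar> powr p * norm x powr \<gamma>) \<partial>lborel) \<le> ennreal (K * norm a powr \<gamma>)"
proof -
  define D where "D = DIM('a) + 1"
  define K0 where "K0 = enn2real (\<integral>\<^sup>+(z::'a). ennreal (1 / (1 + norm z) ^ D) \<partial>lborel)"
  have K0: "(\<integral>\<^sup>+(z::'a). ennreal (1 / (1 + norm z) ^ D) \<partial>lborel) = ennreal K0"
    unfolding K0_def using poly_decay_nn_integral[where 'a='a and M=D] by (simp add: D_def)
  define Z where "Z = enn2real (\<integral>\<^sup>+(x::'a). indicator (cball 0 1) x * ennreal (norm x powr \<gamma>) \<partial>lborel)"
  have Z: "(\<integral>\<^sup>+(x::'a). indicator (cball 0 1) x * ennreal (norm x powr \<gamma>) \<partial>lborel) = ennreal Z"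
    unfolding Z_def using power_norm_unit_ball_nn_integral[OF \<gamma>] by simp
  have pos: "K0 \<ge> 0" "Z \<ge> 0" by (simp_all add: K0_def Z_def)
  have C: "C \<ge> 0" using f[of 0] by (rule order_trans[rotated]) simp
  define K where "K = C powr p * (K0 + Z) + 1"
  have "K > 0" using pos by (simp add: K_def add_nonneg_pos)
  moreover have "(\<integral>\<^sup>+x. ennreal (\<bar>f (x - a)\<bar> powr p * norm x powr \<gamma>) \<partial>lborel) \<le> ennreal (K * norm a powr \<gamma>)" if a: "norm a \<ge> 1" for a
  proof -
    define l where "l = norm a"
    have l: "l \<ge> 1" using a by (simp add: l_def)
    have pt: "\<bar>f (x - a)\<bar> powr p * norm x powr \<gamma> \<le> C powr p * l powr \<gamma> * (1 / (1 + norm (x - a)) ^ D + indicator (cball 0 1) x * norm x powr \<gamma>)" for x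
    proof (cases "x = 0")
      case False
      define t where "t = 1 + norm (x - a)"
      have t: "t \<ge> 1" by (simp add: t_def)
      have tN: "t ^ N > 0" "t ^ D \<ge> 1" "t ^ N \<ge> 1" using t by auto
      have fz: "\<bar>f (x - a)\<bar> powr p \<le> C powr p * (1 / t ^ (N + D))"
      proof -
        have t1: "t ^ (N + D) \<ge> 1" using t by (rule one_le_power)
        have "\<bar>f (x - a)\<bar> \<le> C * (1 / t ^ (N + D))"
          using f[of "x - a"] t1 unfolding t_def D_def by (simp add: field_simps)
        hence "\<bar>f (x - a)\<bar> powr p \<le> (C * (1 / t ^ (N + D))) powr p" using p by (intro powr_mono2) auto
        also have "\<dots> = C powr p * (1 / t ^ (N + D)) powr p" using C t1 by (intro powr_mult)
        also have "(1 / t ^ (N + D)) powr p \<le> (1 / t ^ (N + D)) powr 1" using p t1 by (intro powr_mono') auto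
        hence "C powr p * (1 / t ^ (N + D)) powr p \<le> C powr p * (1 / t ^ (N + D))"
          using t1 by (intro mult_left_mono) auto
        finally show ?thesis .
      qed
      \<comment> \<open>The maximum on the unit ball merges the two possibilities: the factor 1 is
        what \<gamma> >= 0 needs, the factor |x|^\<gamma> what \<gamma> < 0 needs.\<close>
      have w: "1 / t ^ N * norm x powr \<gamma> \<le> l powr \<gamma> * (if norm x \<le> 1 then max 1 (norm x powr \<gamma>) else 1)"
      proof (cases "\<gamma> \<ge> 0")
        case True
        have "norm x \<le> norm (x - a) + l" unfolding l_def using norm_triangle_ineq[of "x - a" a] by simp
        also have "\<dots> \<le> l * t" using l by (simp add: t_def distrib_left mult_right_mono[of 1 l "norm (x - a)", simplified] add.commute)
        finally have "norm x powr \<gamma> \<le> (l * t) powr \<gamma>" using True by (intro powr_mono2) auto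
        also have "\<dots> = l powr \<gamma> * t powr \<gamma>" using l t by (intro powr_mult)
        also have "t powr \<gamma> \<le> t powr real N" using N t True by (intro powr_mono) auto
        hence "l powr \<gamma> * t powr \<gamma> \<le> l powr \<gamma> * t ^ N" using t by (simp add: powr_realpow mult_left_mono)
        finally have "1 / t ^ N * norm x powr \<gamma> \<le> l powr \<gamma> * 1" using tN by (simp add: field_simps)
        also have "\<dots> \<le> l powr \<gamma> * (if norm x \<le> 1 then max 1 (norm x powr \<gamma>) else 1)" by (intro mult_left_mono) auto
        finally show ?thesis .
      next
        case False
        have tg: "1 / t ^ N \<le> t powr \<gamma>"
        proof -
          have "t powr (- real N) \<le> t powr \<gamma>" using N t False by (intro powr_mono) auto
          thus ?thesis using t by (simp add: powr_minus powr_realpow inverse_eq_divide)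
        qed
        have lx: "l \<le> norm x + norm (x - a)" unfolding l_def using norm_triangle_ineq4[of x "x - a"] by simp
        show ?thesis
        proof (cases "norm x \<le> 1")
          case True
          hence "l \<le> t" using lx by (simp add: t_def)
          hence "t powr \<gamma> \<le> l powr \<gamma>" using l False by (intro powr_mono2') auto
          hence "1 / t ^ N * norm x powr \<gamma> \<le> l powr \<gamma> * norm x powr \<gamma>" using tg by (intro mult_right_mono) auto
          also have "\<dots> \<le> l powr \<gamma> * max 1 (norm x powr \<gamma>)" by (intro mult_left_mono) auto
          finally show ?thesis using True by simp
        next
          case nx: False
          have "l \<le> norm x * t"
          proof -
            have "norm (x - a) \<le> norm x * norm (x - a)" using nx mult_right_mono[of 1 "norm x" "norm (x - a)"] by simp
            thus ?thesis using lx by (simp add: t_def distrib_left)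
          qed
          hence "(norm x * t) powr \<gamma> \<le> l powr \<gamma>" using l False by (intro powr_mono2') auto
          hence "t powr \<gamma> * norm x powr \<gamma> \<le> l powr \<gamma>" using t by (simp add: powr_mult mult.commute)
          moreover have "1 / t ^ N * norm x powr \<gamma> \<le> t powr \<gamma> * norm x powr \<gamma>" using tg by (intro mult_right_mono) auto
          ultimately show ?thesis using nx by simp
        qed
      qed
      have "\<bar>f (x - a)\<bar> powr p * norm x powr \<gamma> \<le> C powr p * (1 / t ^ (N + D)) * norm x powr \<gamma>"
        using fz by (intro mult_right_mono) auto
      also have "\<dots> = C powr p * (1 / t ^ D) * (1 / t ^ N * norm x powr \<gamma>)" by (simp add: power_add)
      also have "\<dots> \<le> C powr p * (1 / t ^ D) * (l powr \<gamma> * (if norm x \<le> 1 then max 1 (norm x powr \<gamma>) else 1))"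
        using w t by (intro mult_left_mono) auto
      also have "\<dots> = C powr p * l powr \<gamma> * (1 / t ^ D * (if norm x \<le> 1 then max 1 (norm x powr \<gamma>) else 1))" by simp
      also have "\<dots> \<le> C powr p * l powr \<gamma> * (1 / t ^ D + indicator (cball 0 1) x * norm x powr \<gamma>)"
      proof (intro mult_left_mono)
        have d1: "1 / t ^ D \<le> 1" "0 \<le> 1 / t ^ D" using tN by (auto simp: field_simps)
        have "1 / t ^ D * max 1 (norm x powr \<gamma>) \<le> 1 / t ^ D + norm x powr \<gamma>"
        proof -
          have "1 / t ^ D * max 1 (norm x powr \<gamma>) \<le> 1 / t ^ D * (1 + norm x powr \<gamma>)" using d1 by (intro mult_left_mono) auto
          also have "\<dots> = 1 / t ^ D + 1 / t ^ D * norm x powr \<gamma>" by (simp add: distrib_left)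
          also have "\<dots> \<le> 1 / t ^ D + 1 * norm x powr \<gamma>" using d1 by (intro add_left_mono mult_right_mono) auto
          finally show ?thesis by simp
        qed
        thus "1 / t ^ D * (if norm x \<le> 1 then max 1 (norm x powr \<gamma>) else 1) \<le> 1 / t ^ D + indicator (cball 0 1) x * norm x powr \<gamma>"
          by (auto simp: indicator_def)
      qed simp
      finally show ?thesis by (simp add: t_def)
    qed simp
    have m1: "(\<lambda>x. ennreal (1 / (1 + norm (x - a)) ^ D)) \<in> borel_measurable lborel" by measurable
    have m2: "(\<lambda>x::'a. indicator (cball 0 1) x * ennreal (norm x powr \<gamma>)) \<in> borel_measurable lborel"
      by (intro borel_measurable_times_ennreal borel_measurable_indicator) auto
    have "(\<integral>\<^sup>+x. ennreal (\<bar>f (x - a)\<bar> powr p * norm x powr \<gamma>) \<partial>lborel)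
      \<le> (\<integral>\<^sup>+x. ennreal (C powr p * l powr \<gamma>) * (ennreal (1 / (1 + norm (x - a)) ^ D) + indicator (cball 0 1) x * ennreal (norm x powr \<gamma>)) \<partial>lborel)"
    proof (rule nn_integral_mono)
      fix x
      have "ennreal (\<bar>f (x - a)\<bar> powr p * norm x powr \<gamma>) \<le> ennreal (C powr p * l powr \<gamma> * (1 / (1 + norm (x - a)) ^ D + indicator (cball 0 1) x * norm x powr \<gamma>))"
        by (intro ennreal_leI pt)
      also have "\<dots> = ennreal (C powr p * l powr \<gamma>) * (ennreal (1 / (1 + norm (x - a)) ^ D) + ennreal (indicator (cball 0 1) x * norm x powr \<gamma>))"
        by (subst ennreal_plus[symmetric]) (auto simp: ennreal_mult')
      also have "ennreal (indicator (cball 0 1) x * norm x powr \<gamma>) = indicator (cball 0 1) x * ennreal (norm x powr \<gamma>)"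
        by (simp add: indicator_def)
      finally show "ennreal (\<bar>f (x - a)\<bar> powr p * norm x powr \<gamma>) \<le> ennreal (C powr p * l powr \<gamma>) * (ennreal (1 / (1 + norm (x - a)) ^ D) + indicator (cball 0 1) x * ennreal (norm x powr \<gamma>))" .
    qed
    also have "\<dots> = ennreal (C powr p * l powr \<gamma>) * (\<integral>\<^sup>+x. (ennreal (1 / (1 + norm (x - a)) ^ D) + indicator (cball 0 1) x * ennreal (norm x powr \<gamma>)) \<partial>lborel)"
      by (rule nn_integral_cmult, rule borel_measurable_add) (fact m1, fact m2)
    also have "(\<integral>\<^sup>+x. (ennreal (1 / (1 + norm (x - a)) ^ D) + indicator (cball 0 1) x * ennreal (norm x powr \<gamma>)) \<partial>lborel)
      = (\<integral>\<^sup>+x. ennreal (1 / (1 + norm (x - a)) ^ D) \<partial>lborel) + ennreal Z"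
      unfolding Z[symmetric] by (rule nn_integral_add) (fact m1, fact m2)
    also have "(\<integral>\<^sup>+x. ennreal (1 / (1 + norm (x - a)) ^ D) \<partial>lborel) = ennreal K0"
      using nn_integral_lborel_affine[of "\<lambda>z::'a. ennreal (1 / (1 + norm z) ^ D)" 1 "- a"] K0 by simp
    also have "ennreal (C powr p * l powr \<gamma>) * (ennreal K0 + ennreal Z) = ennreal (C powr p * l powr \<gamma> * (K0 + Z))"
      using pos by (simp add: ennreal_mult flip: ennreal_plus)
    also have "\<dots> \<le> ennreal (K * norm a powr \<gamma>)"
    proof (rule ennreal_leI)
      have "(C powr p * (K0 + Z)) * l powr \<gamma> \<le> K * l powr \<gamma>" by (intro mult_right_mono) (auto simp: K_def)
      thus "C powr p * l powr \<gamma> * (K0 + Z) \<le> K * norm a powr \<gamma>" by (simp add: l_def ac_simps)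
    qed
    finally show ?thesis .
  qed
  ultimately show ?thesis by (rule that)
qed

lemma continuous_nonzero_ball:
  fixes f :: "'a::euclidean_space \<Rightarrow> real"
  assumes c: "continuous_on UNIV f" and z: "f z \<noteq> 0" and d: "\<delta> > 0"
  obtains r \<eta> where "0 < r" "r \<le> \<delta>" "\<eta> > 0" "\<And>x. dist z x < r \<Longrightarrow> \<bar>f x\<bar> \<ge> \<eta>"
proof -
  have "isCont f z" using c by (simp add: continuous_on_eq_continuous_at)
  then obtain r where r: "r > 0" "\<And>x. dist x z < r \<Longrightarrow> dist (f x) (f z) < \<bar>f z\<bar> / 2"
    unfolding continuous_at_eps_delta using z by (meson half_gt_zero zero_less_abs_iff)
  show ?thesis
  proof (rule that[of "min r \<delta>" "\<bar>f z\<bar> / 2"])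
    fix x assume "dist z x < min r \<delta>"
    hence "dist (f x) (f z) < \<bar>f z\<bar> / 2" using r(2)[of x] by (simp add: dist_commute)
    thus "\<bar>f z\<bar> / 2 \<le> \<bar>f x\<bar>" by (simp add: dist_real_def abs_if split: if_splits)
  qed (use r d z in auto)
qed

text \<open>Only the ball on which the profile is at least \<eta> is integrated over. The condition
  on \<open>l\<close> keeps its translate away from the origin, so the weight there is at least
  l^\<gamma> up to the factor 2^(-|\<gamma>|).\<close>

lemma weighted_lower:
  fixes f :: "'a::euclidean_space \<Rightarrow> real"
  assumes r: "r > 0" and \<eta>: "\<eta> > 0" and f: "\<And>x. dist z x < r \<Longrightarrow> \<bar>f x\<bar> \<ge> \<eta>" and p: "p > 0"
  obtains c where "c > 0" "\<And>a l. l > 0 \<Longrightarrow> (\<And>x. dist z (x - a) < r \<Longrightarrow> l / 2 \<le> norm x \<and> norm x \<le> 2 * l) \<Longrightarrow>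
    ennreal (c * l powr \<gamma>) \<le> (\<integral>\<^sup>+x. ennreal (\<bar>f (x - a)\<bar> powr p * norm x powr \<gamma>) \<partial>lborel)"
proof -
  define V where "V = unit_ball_vol (real DIM('a))"
  have V: "V > 0" by (simp add: V_def)
  define c where "c = \<eta> powr p * 2 powr (- \<bar>\<gamma>\<bar>) * (V * r ^ DIM('a))"
  have "c > 0" using r \<eta> V by (simp add: c_def)
  moreover have "ennreal (c * l powr \<gamma>) \<le> (\<integral>\<^sup>+x. ennreal (\<bar>f (x - a)\<bar> powr p * norm x powr \<gamma>) \<partial>lborel)"
    if l: "l > 0" and b: "\<And>x. dist z (x - a) < r \<Longrightarrow> l / 2 \<le> norm x \<and> norm x \<le> 2 * l" for a l
  proof -
    have "ennreal (c * l powr \<gamma>) = ennreal (\<eta> powr p * (2 powr (- \<bar>\<gamma>\<bar>) * l powr \<gamma>)) * emeasure lborel (ball (z + a) r)"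
      using r V by (simp add: emeasure_ball V_def[symmetric] c_def ac_simps flip: ennreal_mult)
    also have "\<dots> = (\<integral>\<^sup>+x. ennreal (\<eta> powr p * (2 powr (- \<bar>\<gamma>\<bar>) * l powr \<gamma>)) * indicator (ball (z + a) r) x \<partial>lborel)"
      by (rule nn_integral_cmult_indicator[symmetric]) simp
    also have "\<dots> \<le> (\<integral>\<^sup>+x. ennreal (\<bar>f (x - a)\<bar> powr p * norm x powr \<gamma>) \<partial>lborel)"
    proof (rule nn_integral_mono)
      fix x
      show "ennreal (\<eta> powr p * (2 powr (- \<bar>\<gamma>\<bar>) * l powr \<gamma>)) * indicator (ball (z + a) r) x \<le> ennreal (\<bar>f (x - a)\<bar> powr p * norm x powr \<gamma>)"
      proof (cases "dist z (x - a) < r")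
        case True
        have "2 powr (- \<bar>\<gamma>\<bar>) * l powr \<gamma> \<le> norm x powr \<gamma>"
        proof (cases "\<gamma> \<ge> 0")
          case g: True
          have "2 powr (- \<bar>\<gamma>\<bar>) * l powr \<gamma> = (l / 2) powr \<gamma>" using l g by (simp add: powr_divide powr_minus field_simps)
          also have "\<dots> \<le> norm x powr \<gamma>" using b[OF True] l g by (intro powr_mono2) auto
          finally show ?thesis .
        next
          case g: False
          have "2 powr (- \<bar>\<gamma>\<bar>) * l powr \<gamma> = (2 * l) powr \<gamma>" using l g by (simp add: powr_mult)
          also have "\<dots> \<le> norm x powr \<gamma>" using b[OF True] l g by (intro powr_mono2') auto
          finally show ?thesis .
        qed
        moreover have "\<eta> powr p \<le> \<bar>f (x - a)\<bar> powr p" using f[OF True] \<eta> p by (intro powr_mono2) auto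
        ultimately have "\<eta> powr p * (2 powr (- \<bar>\<gamma>\<bar>) * l powr \<gamma>) \<le> \<bar>f (x - a)\<bar> powr p * norm x powr \<gamma>" by (intro mult_mono) auto
        thus ?thesis by (simp add: indicator_def ennreal_leI)
      next
        case False
        hence "x \<notin> ball (z + a) r" by (simp add: dist_norm algebra_simps)
        thus ?thesis by simp
      qed
    qed
    finally show ?thesis .
  qed
  ultimately show ?thesis by (rule that)
qed

text \<open>Finiteness is \<open>weighted_translate_upper\<close> for a shift of f by a unit vector,
  translated back by the same vector. Positivity comes from a small ball around a point other than
  the origin at which f does not vanish.\<close>

lemma weighted_finite_positive:
  fixes f :: "'a::euclidean_space \<Rightarrow> real"
  assumes \<gamma>: "\<gamma> > - real DIM('a)" and p: "p \<ge> 1"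
    and f: "\<And>M. \<exists>C. \<forall>z. (1 + norm z) ^ M * \<bar>f z\<bar> \<le> C" and c: "continuous_on UNIV f" and z: "f z \<noteq> 0"
  obtains l where "l > 0" "(\<integral>\<^sup>+x. ennreal (\<bar>f x\<bar> powr p * norm x powr \<gamma>) \<partial>lborel) = ennreal l"
proof -
  let ?I = "\<integral>\<^sup>+x. ennreal (\<bar>f x\<bar> powr p * norm x powr \<gamma>) \<partial>lborel"
  obtain b :: 'a where b: "norm b = 1" using nonempty_Basis norm_Basis by blast
  define N where "N = nat \<lceil>\<bar>\<gamma>\<bar>\<rceil>"
  have N: "real N \<ge> \<bar>\<gamma>\<bar>" unfolding N_def by linarith
  define M where "M = N + (DIM('a) + 1)"
  obtain C where C: "\<And>z. (1 + norm z) ^ M * \<bar>f z\<bar> \<le> C" using f by blast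
  \<comment> \<open>The shifted function has the same decay, since 1 + |z| <= 2 (1 + |z + b|) for a
    unit vector b.\<close>
  have Cb: "(1 + norm z) ^ M * \<bar>f (z + b)\<bar> \<le> 2 ^ M * C" for z
  proof -
    have "1 + norm z \<le> 2 + 2 * norm (z + b)" using norm_triangle_ineq4[of "z + b" b] b norm_ge_zero[of "z + b"] unfolding add_diff_cancel_right' by linarith
    hence "1 + norm z \<le> 2 * (1 + norm (z + b))" by (simp add: distrib_left)
    hence "(1 + norm z) ^ M \<le> 2 ^ M * (1 + norm (z + b)) ^ M"
      unfolding power_mult_distrib[symmetric] by (intro power_mono) auto
    hence "(1 + norm z) ^ M * \<bar>f (z + b)\<bar> \<le> 2 ^ M * (1 + norm (z + b)) ^ M * \<bar>f (z + b)\<bar>" by (rule mult_right_mono) simp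
    also have "\<dots> \<le> 2 ^ M * C" using C[of "z + b"] by (simp add: mult.assoc)
    finally show ?thesis .
  qed
  obtain K where K: "K > 0" "\<And>a. norm a \<ge> 1 \<Longrightarrow> (\<integral>\<^sup>+x. ennreal (\<bar>f (x - a + b)\<bar> powr p * norm x powr \<gamma>) \<partial>lborel) \<le> ennreal (K * norm a powr \<gamma>)"
    using weighted_translate_upper[OF \<gamma> p N Cb[unfolded M_def]] by blast
  have "?I \<le> ennreal K" using K(2)[of b] b by simp
  hence "?I < top" by (rule le_less_trans[OF _ ennreal_less_top])
  hence fin: "?I \<noteq> top" by (rule less_imp_neq)
  \<comment> \<open>The known nonzero value may sit at the origin, where the weight is not
    comparable to a constant; continuity then supplies a nearby point off the origin.\<close>
  obtain z1 where z1: "z1 \<noteq> 0" "f z1 \<noteq> 0"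
  proof (cases "z = 0")
    case True
    obtain r \<eta> where r: "0 < r" "r \<le> 1" "\<eta> > 0" "\<And>x. dist z x < r \<Longrightarrow> \<bar>f x\<bar> \<ge> \<eta>"
      using continuous_nonzero_ball[OF c z zero_less_one] by metis
    have "(r / 2) *\<^sub>R b \<noteq> 0" using r(1) b by auto
    moreover have "\<bar>f ((r / 2) *\<^sub>R b)\<bar> \<ge> \<eta>" using r(1) b True by (intro r(4)) simp
    ultimately show ?thesis using r(3) by (intro that[of "(r / 2) *\<^sub>R b"]) auto
  qed (use z that in blast)
  have "norm z1 / 2 > 0" using z1 by simp
  then obtain r \<eta> where r: "0 < r" "r \<le> norm z1 / 2" "\<eta> > 0" "\<And>x. dist z1 x < r \<Longrightarrow> \<bar>f x\<bar> \<ge> \<eta>"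
    using continuous_nonzero_ball[OF c z1(2)] by blast
  have p0: "p > 0" using p by simp
  obtain c0 where c0: "c0 > 0" "\<And>a l. l > 0 \<Longrightarrow> (\<And>x. dist z1 (x - a) < r \<Longrightarrow> l / 2 \<le> norm x \<and> norm x \<le> 2 * l) \<Longrightarrow>
    ennreal (c0 * l powr \<gamma>) \<le> (\<integral>\<^sup>+x. ennreal (\<bar>f (x - a)\<bar> powr p * norm x powr \<gamma>) \<partial>lborel)"
    using weighted_lower[where f=f and z=z1 and \<gamma>=\<gamma>, OF r(1) r(3) r(4) p0] by blast
  have low: "ennreal (c0 * norm z1 powr \<gamma>) \<le> (\<integral>\<^sup>+x. ennreal (\<bar>f (x - 0)\<bar> powr p * norm x powr \<gamma>) \<partial>lborel)"
  proof (rule c0(2))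
    fix x assume "dist z1 (x - 0) < r"
    hence "norm (z1 - x) < norm z1 / 2" using r(2) by (simp add: dist_norm)
    thus "norm z1 / 2 \<le> norm x \<and> norm x \<le> 2 * norm z1"
      using norm_triangle_ineq2[of z1 x] norm_triangle_ineq2[of x z1] by (auto simp: norm_minus_commute)
  qed (use z1 in simp)
  obtain l where l: "0 \<le> l" "?I = ennreal l" using fin by (cases ?I) blast+
  have "c0 * norm z1 powr \<gamma> \<le> l" using low l by (simp add: ennreal_le_iff)
  moreover have "c0 * norm z1 powr \<gamma> > 0" using c0(1) z1 by simp
  ultimately have "l > 0" by linarith
  thus ?thesis using l(2) by (rule that)
qed

section \<open>Necessity\<close>

lemma wave_decay:
  assumes \<phi>: "schwartz \<phi>" and \<rho>: "\<rho> > 0"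
  shows "\<exists>C. \<forall>z. (1 + norm z) ^ M * \<bar>wave \<phi> i k \<rho> z\<bar> \<le> C"
proof -
  have "schwartz (\<lambda>x. \<phi> (0 + \<rho> *\<^sub>R x))" by (intro schwartz_affine \<phi>) (use \<rho> in simp)
  then obtain C where C: "\<And>x. (1 + norm x) ^ M * \<bar>\<phi> (0 + \<rho> *\<^sub>R x)\<bar> \<le> C" using schwartz_bounded by blast
  have "(1 + norm z) ^ M * \<bar>wave \<phi> i k \<rho> z\<bar> \<le> C" for z
    using mult_left_mono[OF wave_basic(4)[OF \<phi> \<rho>, of i k z], of "(1 + norm z) ^ M"] C[of z] by simp
  thus ?thesis by blast
qed

text \<open>By \<open>phik_wave\<close> exactly one block survives. The sequence norm is then a
  single number whatever q is, and the space norm is an explicit multiple of a weighted L^p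
  norm.\<close>

lemma TL_norm_wave:
  fixes \<phi> :: "real^'d::finite \<Rightarrow> real" and v :: "'x::banach"
  assumes \<phi>: "admissible \<phi>" and \<rho>: "\<rho> > 0" "12 * \<rho> \<le> 2 ^ k" and k: "k \<ge> 1" and q: "1 \<le> q" and p: "p > 0"
  shows "tempered (function_distribution (\<lambda>x. wave \<phi> i k \<rho> (x - a)) v)"
    and "TL_norm \<phi> s p q (pw \<gamma>) (function_distribution (\<lambda>x. wave \<phi> i k \<rho> (x - a)) v)
      = ennreal (2 powr (real k * s)) * (ennreal ((2 * pi) powr (real CARD('d) / 2) * norm v)
        * enn_powr (\<integral>\<^sup>+x. ennreal (\<bar>wave \<phi> i k \<rho> (x - a)\<bar> powr p * norm x powr \<gamma>) \<partial>lborel) (1 / p))"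
proof -
  note S = admissibleD(1)[OF \<phi>]
  define f where "f = (\<lambda>x. wave \<phi> i k \<rho> (x - a))"
  define \<kappa> where "\<kappa> = (2 * pi) powr (real CARD('d) / 2)"
  define T where "T = function_distribution f v"
  have \<kappa>: "\<kappa> > 0" by (simp add: \<kappa>_def)
  have fi: "integrable lborel f"
    unfolding f_def using integrable_lborel_affine[OF wave_basic(3)[OF S \<rho>(1)], where c=1 and t="-a"] by simp
  show "tempered (function_distribution (\<lambda>x. wave \<phi> i k \<rho> (x - a)) v)"
    using tempered_function_distribution[OF fi] by (simp add: f_def)
  have fm[measurable]: "f \<in> borel_measurable borel" using fi by auto
  have Sk: "Sk \<phi> j T x = (if j = k then \<kappa> * f x else 0) *\<^sub>R v" for j x
  proof -
    have pm: "phik \<phi> j \<in> borel_measurable borel" by (rule schwartz_basic(3)[OF schwartz_phik[OF S]])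
    have [measurable]: "(\<lambda>y. phik \<phi> j (x - y)) \<in> borel_measurable borel"
      by (rule measurable_compose[OF _ pm]) measurable
    have "(LINT y|lborel. f y * phik \<phi> j (x - y)) = \<bar>1\<bar> ^ DIM(real^'d) *\<^sub>R (LINT y|lborel. f (a + 1 *\<^sub>R y) * phik \<phi> j (x - (a + 1 *\<^sub>R y)))"
      by (rule integral_lborel_affine) auto
    also have "\<dots> = (LINT y|lborel. phik \<phi> j ((x - a) - y) * wave \<phi> i k \<rho> y)"
      by (simp add: f_def mult.commute diff_diff_eq)
    also have "\<dots> = (if j = k then \<kappa> * f x else 0)"
      unfolding phik_wave[OF \<phi> \<rho> k] by (simp add: f_def \<kappa>_def)
    finally show ?thesis by (simp add: Sk_def T_def function_distribution_def)
  qed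
  define u where "u = 2 powr (real k * s) * (\<kappa> * norm v)"
  have u: "u \<ge> 0" using \<kappa> by (simp add: u_def)
  have lq: "lq_norm q (\<lambda>j. 2 powr (real j * s) * norm (Sk \<phi> j T x)) = ennreal (u * \<bar>f x\<bar>)" for x
  proof -
    have "(\<lambda>j. 2 powr (real j * s) * norm (Sk \<phi> j T x)) = (\<lambda>j. if j = k then u * \<bar>f x\<bar> else 0)"
      using \<kappa> by (auto simp: Sk u_def fun_eq_iff abs_mult)
    thus ?thesis using lq_norm_single[OF q, of k "u * \<bar>f x\<bar>"] u by (simp add: abs_mult)
  qed
  have "(\<integral>\<^sup>+x. enn_powr (ennreal (u * \<bar>f x\<bar>)) p * ennreal (pw \<gamma> x) \<partial>lborel)
    = (\<integral>\<^sup>+x. ennreal (u powr p) * ennreal (\<bar>f x\<bar> powr p * norm x powr \<gamma>) \<partial>lborel)"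
    using u by (intro nn_integral_cong) (simp add: enn_powr_ennreal powr_mult pw_def mult.assoc flip: ennreal_mult)
  also have "\<dots> = ennreal (u powr p) * (\<integral>\<^sup>+x. ennreal (\<bar>f x\<bar> powr p * norm x powr \<gamma>) \<partial>lborel)"
    by (rule nn_integral_cmult) measurable
  finally have "TL_norm \<phi> s p q (pw \<gamma>) T = enn_powr (ennreal (u powr p) * (\<integral>\<^sup>+x. ennreal (\<bar>f x\<bar> powr p * norm x powr \<gamma>) \<partial>lborel)) (1 / p)"
    unfolding TL_norm_def lq by (rule arg_cong)
  also have "\<dots> = ennreal u * enn_powr (\<integral>\<^sup>+x. ennreal (\<bar>f x\<bar> powr p * norm x powr \<gamma>) \<partial>lborel) (1 / p)"
    using p u by (simp add: enn_powr_mult enn_powr_ennreal powr_powr)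
  also have "ennreal u = ennreal (2 powr (real k * s)) * ennreal (\<kappa> * norm v)"
    using \<kappa> by (simp add: u_def ennreal_mult)
  finally show "TL_norm \<phi> s p q (pw \<gamma>) (function_distribution (\<lambda>x. wave \<phi> i k \<rho> (x - a)) v)
      = ennreal (2 powr (real k * s)) * (ennreal ((2 * pi) powr (real CARD('d) / 2) * norm v)
        * enn_powr (\<integral>\<^sup>+x. ennreal (\<bar>wave \<phi> i k \<rho> (x - a)\<bar> powr p * norm x powr \<gamma>) \<partial>lborel) (1 / p))"
    by (simp add: T_def f_def \<kappa>_def mult.assoc)
qed

text \<open>The embedding tested on one translated wave. Both sides carry the factor (2 pi)^(d/2)
  |v|, nonzero because v is, and it cancels.\<close>

lemma embedding_wave_inequality:
  fixes \<phi> :: "real^'d::finite \<Rightarrow> real" and v :: "'x::banach"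
  assumes emb: "\<And>T :: (real^'d \<Rightarrow> real) \<Rightarrow> 'x. tempered T \<Longrightarrow> TL_norm \<phi> s1 p1 q1 (pw \<gamma>1) T \<le> ennreal C * TL_norm \<phi> s0 p0 q0 (pw \<gamma>0) T"
    and \<phi>: "admissible \<phi>" and v: "v \<noteq> 0" and \<rho>: "\<rho> > 0" "12 * \<rho> \<le> 2 ^ k" and k: "k \<ge> 1"
    and q: "1 \<le> q0" "1 \<le> q1" and p: "p0 > 0" "p1 > 0"
    and I1: "ennreal A \<le> (\<integral>\<^sup>+x. ennreal (\<bar>wave \<phi> i k \<rho> (x - a)\<bar> powr p1 * norm x powr \<gamma>1) \<partial>lborel)" "A \<ge> 0"
    and I0: "(\<integral>\<^sup>+x. ennreal (\<bar>wave \<phi> i k \<rho> (x - a)\<bar> powr p0 * norm x powr \<gamma>0) \<partial>lborel) \<le> ennreal B" "B \<ge> 0"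
    and C: "C \<ge> 0"
  shows "2 powr (real k * s1) * A powr (1 / p1) \<le> C * (2 powr (real k * s0) * B powr (1 / p0))"
proof -
  define u where "u = (2 * pi) powr (real CARD('d) / 2) * norm v"
  have u: "u > 0" using v by (simp add: u_def)
  note W = TL_norm_wave[OF \<phi> \<rho> k]
  have "ennreal (2 powr (real k * s1)) * (ennreal u * ennreal (A powr (1 / p1)))
     \<le> ennreal (2 powr (real k * s1)) * (ennreal u * enn_powr (\<integral>\<^sup>+x. ennreal (\<bar>wave \<phi> i k \<rho> (x - a)\<bar> powr p1 * norm x powr \<gamma>1) \<partial>lborel) (1 / p1))"
    using enn_powr_mono[OF I1(1), of "1 / p1"] p I1(2) by (intro mult_left_mono) (auto simp: enn_powr_ennreal)
  also have "\<dots> \<le> ennreal C * (ennreal (2 powr (real k * s0)) * (ennreal u * enn_powr (\<integral>\<^sup>+x. ennreal (\<bar>wave \<phi> i k \<rho> (x - a)\<bar> powr p0 * norm x powr \<gamma>0) \<partial>lborel) (1 / p0)))"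
    using emb[OF W(1)[OF q(1) p(1), of i a v]] unfolding W(2)[OF q(1) p(1)] W(2)[OF q(2) p(2)] u_def .
  also have "\<dots> \<le> ennreal C * (ennreal (2 powr (real k * s0)) * (ennreal u * ennreal (B powr (1 / p0))))"
    using enn_powr_mono[OF I0(1), of "1 / p0"] p I0(2) by (intro mult_left_mono) (auto simp: enn_powr_ennreal)
  finally have "ennreal (2 powr (real k * s1) * (u * A powr (1 / p1))) \<le> ennreal (C * (2 powr (real k * s0) * (u * B powr (1 / p0))))"
    using u C by (simp add: ennreal_mult)
  hence "2 powr (real k * s1) * (u * A powr (1 / p1)) \<le> C * (2 powr (real k * s0) * (u * B powr (1 / p0)))"
    using u C by (simp add: ennreal_le_iff)
  hence "u * (2 powr (real k * s1) * A powr (1 / p1)) \<le> u * (C * (2 powr (real k * s0) * B powr (1 / p0)))"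
    by (simp add: ac_simps)
  thus ?thesis using u by (simp only: mult_le_cancel_left_pos)
qed

text \<open>The waves with \<rho> = 2^n/12 are dilates of one profile, so their norms are exactly
  proportional to 2^(n (s - (d + \<gamma>)/p)); the embedding bounds the ratio of two such powers
  for all n.\<close>

lemma dilation_condition:
  fixes \<phi> :: "real^'d::finite \<Rightarrow> real" and v :: "'x::banach"
  assumes emb: "\<And>T :: (real^'d \<Rightarrow> real) \<Rightarrow> 'x. tempered T \<Longrightarrow> TL_norm \<phi> s1 p1 q1 (pw \<gamma>1) T \<le> ennreal C * TL_norm \<phi> s0 p0 q0 (pw \<gamma>0) T"
    and \<phi>: "admissible \<phi>" and v: "v \<noteq> 0" and q: "1 \<le> q0" "1 \<le> q1" and p: "p0 \<ge> 1" "p1 \<ge> 1"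
    and g: "\<gamma>0 > - real CARD('d)" "\<gamma>1 > - real CARD('d)" and C: "C \<ge> 0"
  shows "s1 - (real CARD('d) + \<gamma>1) / p1 \<le> s0 - (real CARD('d) + \<gamma>0) / p0"
proof -
  note S = admissibleD(1)[OF \<phi>]
  fix i :: 'd
  define w where "w = wave \<phi> i 0 (1/12)"
  have r: "(1/12::real) > 0" by simp
  obtain z where z: "w z \<noteq> 0" unfolding w_def using wave_zero_nonzero[OF \<phi>] by blast
  have dim: "DIM(real^'d) = CARD('d)" by simp
  have fp: "\<exists>l>0. (\<integral>\<^sup>+x. ennreal (\<bar>w x\<bar> powr p * norm x powr \<gamma>) \<partial>lborel) = ennreal l"
    if "\<gamma> > - real CARD('d)" "p \<ge> 1" for p \<gamma>
  proof -
    have g': "\<gamma> > - real DIM(real^'d)" using that by simp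
    show ?thesis
      using weighted_finite_positive[OF g' that(2) wave_decay[OF S r] wave_basic(1)[OF S r] z[unfolded w_def]] unfolding w_def by blast
  qed
  obtain l0 where l0: "l0 > 0" "(\<integral>\<^sup>+x. ennreal (\<bar>w x\<bar> powr p0 * norm x powr \<gamma>0) \<partial>lborel) = ennreal l0"
    using fp[OF g(1) p(1)] by blast
  obtain l1 where l1: "l1 > 0" "(\<integral>\<^sup>+x. ennreal (\<bar>w x\<bar> powr p1 * norm x powr \<gamma>1) \<partial>lborel) = ennreal l1"
    using fp[OF g(2) p(2)] by blast
  have scale: "(\<integral>\<^sup>+x. ennreal (\<bar>wave \<phi> i n (2 ^ n / 12) (x - 0)\<bar> powr p * norm x powr \<gamma>) \<partial>lborel) = ennreal (2 powr (- real n * (real CARD('d) + \<gamma>)) * l)"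
    if l: "(\<integral>\<^sup>+x. ennreal (\<bar>w x\<bar> powr p * norm x powr \<gamma>) \<partial>lborel) = ennreal l" "l > 0" for n p \<gamma> l
  proof -
    have wm[measurable]: "w \<in> borel_measurable borel" unfolding w_def by (rule wave_basic(2)[OF S r])
    let ?I = "\<integral>\<^sup>+x. ennreal (\<bar>wave \<phi> i n (2 ^ n / 12) (x - 0)\<bar> powr p * norm x powr \<gamma>) \<partial>lborel"
    have "ennreal l = ennreal (\<bar>2 ^ n\<bar> ^ DIM(real^'d)) * (\<integral>\<^sup>+x. ennreal (\<bar>w (0 + 2 ^ n *\<^sub>R x)\<bar> powr p * norm (0 + 2 ^ n *\<^sub>R x :: real^'d) powr \<gamma>) \<partial>lborel)"
      unfolding l(1)[symmetric] by (rule nn_integral_lborel_affine) auto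
    also have "(\<integral>\<^sup>+x. ennreal (\<bar>w (0 + 2 ^ n *\<^sub>R x)\<bar> powr p * norm (0 + 2 ^ n *\<^sub>R x :: real^'d) powr \<gamma>) \<partial>lborel)
      = (\<integral>\<^sup>+x. ennreal ((2 ^ n) powr \<gamma>) * ennreal (\<bar>wave \<phi> i n (2 ^ n / 12) (x - 0)\<bar> powr p * norm x powr \<gamma>) \<partial>lborel)"
      by (intro nn_integral_cong) (simp add: w_def wave_dilate powr_mult ac_simps flip: ennreal_mult)
    also have "\<dots> = ennreal ((2 ^ n) powr \<gamma>) * ?I"
    proof (rule nn_integral_cmult)
      have [measurable]: "wave \<phi> i n (2 ^ n / 12) \<in> borel_measurable borel" by (rule wave_basic(2)[OF S]) simp
      show "(\<lambda>x. ennreal (\<bar>wave \<phi> i n (2 ^ n / 12) (x - 0)\<bar> powr p * norm x powr \<gamma>)) \<in> borel_measurable lborel" by simp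
    qed
    finally have e: "ennreal l = ennreal (\<bar>2 ^ n\<bar> ^ DIM(real^'d)) * (ennreal ((2 ^ n) powr \<gamma>) * ?I)" .
    \<comment> \<open>The inverse of the scaling factor. The equation is multiplied by it rather
      than divided, since \<open>?I\<close> is not yet known to be finite.\<close>
    define m where "m = 2 powr (- real n * (real CARD('d) + \<gamma>))"
    have "m * ((2 ^ n) ^ CARD('d) * (2 ^ n) powr \<gamma>) = 1"
    proof -
      have "(2 ^ n) ^ CARD('d) = (2::real) powr (real n * real CARD('d))" "(2 ^ n) powr \<gamma> = (2::real) powr (real n * \<gamma>)"
        by (simp_all add: powr_realpow[symmetric] powr_powr)
      thus ?thesis unfolding m_def by (simp add: algebra_simps flip: powr_add)
    qed
    hence "ennreal m * (ennreal (\<bar>2 ^ n\<bar> ^ DIM(real^'d)) * ennreal ((2 ^ n) powr \<gamma>)) = 1"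
      by (simp add: m_def flip: ennreal_mult)
    hence "?I = ennreal m * (ennreal (\<bar>2 ^ n\<bar> ^ DIM(real^'d)) * ennreal ((2 ^ n) powr \<gamma>)) * ?I" by simp
    also have "\<dots> = ennreal m * ennreal l" unfolding e by (simp only: mult.assoc)
    also have "\<dots> = ennreal (m * l)" using l(2) by (simp add: m_def ennreal_mult)
    finally show ?thesis by (simp only: m_def)
  qed
  have "(s1 - (real CARD('d) + \<gamma>1) / p1) - (s0 - (real CARD('d) + \<gamma>0) / p0) \<le> 0"
  proof (rule powr_bounded_imp_nonpos)
    fix n :: nat assume n: "n \<ge> 1"
    define A1 where "A1 = s1 - (real CARD('d) + \<gamma>1) / p1"
    define A0 where "A0 = s0 - (real CARD('d) + \<gamma>0) / p0"
    have pr: "2 powr (real n * s) * (2 powr (- real n * (real CARD('d) + \<gamma>)) * l) powr (1 / p) = 2 powr (real n * (s - (real CARD('d) + \<gamma>) / p)) * l powr (1 / p)"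
      if "l > 0" for s \<gamma> l p
    proof -
      have e1: "(2 powr (- real n * (real CARD('d) + \<gamma>)) * l) powr (1 / p) = 2 powr (- real n * (real CARD('d) + \<gamma>) * (1 / p)) * l powr (1 / p)"
        using that by (simp add: powr_mult powr_powr)
      have e2: "real n * (s - (real CARD('d) + \<gamma>) / p) = real n * s + - real n * (real CARD('d) + \<gamma>) * (1 / p)"
        by (simp add: right_diff_distrib)
      show ?thesis unfolding e1 e2 powr_add by (simp only: mult.assoc)
    qed
    have "2 powr (real n * s1) * (2 powr (- real n * (real CARD('d) + \<gamma>1)) * l1) powr (1 / p1)
      \<le> C * (2 powr (real n * s0) * (2 powr (- real n * (real CARD('d) + \<gamma>0)) * l0) powr (1 / p0))"
      by (rule embedding_wave_inequality[OF emb \<phi> v _ _ n q, where \<rho>="2 ^ n / 12" and a=0 and i=i])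
        (use p C l0(1) l1(1) scale[OF l0(2) l0(1), of n] scale[OF l1(2) l1(1), of n] in auto)
    hence "2 powr (real n * A1) * l1 powr (1 / p1) \<le> C * (2 powr (real n * A0) * l0 powr (1 / p0))"
      unfolding pr[OF l1(1)] pr[OF l0(1)] A1_def A0_def .
    moreover have "a / b \<le> C * y / x" if "a * x \<le> C * (b * y)" "b > 0" "x > 0" for a b x y :: real
      using that by (simp add: field_simps)
    moreover have "2 powr (real n * (A1 - A0)) = 2 powr (real n * A1) / 2 powr (real n * A0)"
      by (simp add: right_diff_distrib powr_diff)
    ultimately have "2 powr (real n * (A1 - A0)) \<le> C * l0 powr (1 / p0) / l1 powr (1 / p1)"
      using l1(1) by simp
    thus "2 powr (real n * (s1 - (real CARD('d) + \<gamma>1) / p1 - (s0 - (real CARD('d) + \<gamma>0) / p0))) \<le> C * l0 powr (1 / p0) / l1 powr (1 / p1)"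
      by (simp only: A1_def A0_def)
  qed
  thus ?thesis by simp
qed

text \<open>A wave of fixed frequency and shape is moved to distance 2^n from the origin. The
  smoothness factors stay constant, and the norms grow or decay like 2^(n \<gamma>/p), so comparing
  them isolates the weight exponents.\<close>

lemma translation_condition:
  fixes \<phi> :: "real^'d::finite \<Rightarrow> real" and v :: "'x::banach"
  assumes emb: "\<And>T :: (real^'d \<Rightarrow> real) \<Rightarrow> 'x. tempered T \<Longrightarrow> TL_norm \<phi> s1 p1 q1 (pw \<gamma>1) T \<le> ennreal C * TL_norm \<phi> s0 p0 q0 (pw \<gamma>0) T"
    and \<phi>: "admissible \<phi>" and v: "v \<noteq> 0" and q: "1 \<le> q0" "1 \<le> q1" and p: "p0 \<ge> 1" "p1 \<ge> 1"
    and g: "\<gamma>0 > - real CARD('d)" and C: "C \<ge> 0"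
  shows "\<gamma>1 / p1 \<le> \<gamma>0 / p0"
proof -
  note S = admissibleD(1)[OF \<phi>]
  fix i :: 'd
  \<comment> \<open>Level 1 is the lowest one allowed by \<open>TL_norm_wave\<close>; the profile is
    the nonvanishing one of level 0, dilated once.\<close>
  define w where "w = wave \<phi> i 1 (2 ^ 1 / 12)"
  have r6: "(2 ^ 1 / 12::real) > 0" by simp
  have p0: "p0 > 0" "p1 > 0" using p by auto
  obtain z0 where z0: "wave \<phi> i 0 (1/12) z0 \<noteq> 0" using wave_zero_nonzero[OF \<phi>] by blast
  have z: "w ((1/2) *\<^sub>R z0) \<noteq> 0" unfolding w_def wave_dilate using z0 by simp
  define z where "z = (1/2) *\<^sub>R z0"
  have wc: "continuous_on UNIV w" unfolding w_def by (rule wave_basic(1)[OF S r6])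
  obtain r \<eta> where r: "0 < r" "r \<le> 1" "\<eta> > 0" "\<And>x. dist z x < r \<Longrightarrow> \<bar>w x\<bar> \<ge> \<eta>"
    using continuous_nonzero_ball[OF wc z[folded z_def] zero_less_one] by metis
  obtain c where c: "c > 0" "\<And>a l. l > 0 \<Longrightarrow> (\<And>x. dist z (x - a) < r \<Longrightarrow> l / 2 \<le> norm x \<and> norm x \<le> 2 * l) \<Longrightarrow>
    ennreal (c * l powr \<gamma>1) \<le> (\<integral>\<^sup>+x. ennreal (\<bar>w (x - a)\<bar> powr p1 * norm x powr \<gamma>1) \<partial>lborel)"
    using weighted_lower[where f=w and z=z and \<gamma>=\<gamma>1, OF r(1) r(3) r(4) p0(2)] by blast
  define N where "N = nat \<lceil>\<bar>\<gamma>0\<bar>\<rceil>"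
  have N: "real N \<ge> \<bar>\<gamma>0\<bar>" unfolding N_def by linarith
  obtain D where D: "\<And>z. (1 + norm z) ^ (N + (DIM(real^'d) + 1)) * \<bar>w z\<bar> \<le> D"
    using wave_decay[OF S r6, of "N + (DIM(real^'d) + 1)" i 1] unfolding w_def by blast
  have g': "\<gamma>0 > - real DIM(real^'d)" using g by simp
  obtain K where K: "K > 0" "\<And>a. norm a \<ge> 1 \<Longrightarrow> (\<integral>\<^sup>+x. ennreal (\<bar>w (x - a)\<bar> powr p0 * norm x powr \<gamma>0) \<partial>lborel) \<le> ennreal (K * norm a powr \<gamma>0)"
    using weighted_translate_upper[OF g' p(1) N D] by blast
  \<comment> \<open>From this index on the relevant ball, of radius at most 1 around z + a, lies
    where |x| is between half and twice 2^n.\<close>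
  obtain n0 where n0: "2 * (norm z + 1) < 2 ^ n0" using real_arch_pow[of 2 "2 * (norm z + 1)"] by auto
  have "\<gamma>1 / p1 - \<gamma>0 / p0 \<le> 0"
  proof (rule powr_bounded_imp_nonpos)
    fix n assume n: "n \<ge> n0"
    define a where "a = (2 ^ n :: real) *\<^sub>R (axis i 1 :: real^'d)"
    have na: "norm a = 2 ^ n" by (simp add: a_def)
    have "(2::real) ^ n0 \<le> 2 ^ n" using n by (intro power_increasing) auto
    hence "2 * (norm z + 1) \<le> 2 ^ n" using n0 by (rule order_trans[OF less_imp_le, rotated])
    hence big: "norm z + 1 \<le> 2 ^ n / 2" by (simp add: field_simps)
    have low: "ennreal (c * (2 ^ n) powr \<gamma>1) \<le> (\<integral>\<^sup>+x. ennreal (\<bar>w (x - a)\<bar> powr p1 * norm x powr \<gamma>1) \<partial>lborel)"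
    proof (rule c(2))
      fix x assume "dist z (x - a) < r"
      hence "norm (x - a - z) < 1" using r(2) by (simp add: dist_norm norm_minus_commute)
      hence xa: "norm (x - a) \<le> 2 ^ n / 2" using big norm_triangle_ineq2[of "x - a" z] by linarith
      have "norm x \<le> norm (x - a) + norm a" "norm a \<le> norm (x - a) + norm x"
        using norm_triangle_ineq[of "x - a" a] norm_triangle_ineq4[of x "x - a"] by (auto simp: add.commute)
      thus "2 ^ n / 2 \<le> norm x \<and> norm x \<le> 2 * 2 ^ n" using xa na by linarith
    qed simp
    have up: "(\<integral>\<^sup>+x. ennreal (\<bar>w (x - a)\<bar> powr p0 * norm x powr \<gamma>0) \<partial>lborel) \<le> ennreal (K * (2 ^ n) powr \<gamma>0)"
      using K(2)[of a] na by simp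
    have "2 powr (real 1 * s1) * (c * (2 ^ n) powr \<gamma>1) powr (1 / p1) \<le> C * (2 powr (real 1 * s0) * (K * (2 ^ n) powr \<gamma>0) powr (1 / p0))"
      by (rule embedding_wave_inequality[OF emb \<phi> v r6 _ _ q p0 low[unfolded w_def] _ up[unfolded w_def] _ C]) (use c(1) K(1) in auto)
    moreover have pw2: "(b * (2 ^ n) powr g) powr (1 / p) = b powr (1 / p) * 2 powr (real n * (g / p))" if "b > 0" for b g p :: real
      using that by (simp add: powr_mult powr_powr flip: powr_realpow)
    ultimately have m: "2 powr s1 * (c powr (1 / p1) * 2 powr (real n * (\<gamma>1 / p1))) \<le> C * (2 powr s0 * (K powr (1 / p0) * 2 powr (real n * (\<gamma>0 / p0))))"
      using pw2[OF c(1)] pw2[OF K(1)] by simp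
    have "2 powr (real n * (\<gamma>1 / p1 - \<gamma>0 / p0)) = 2 powr (real n * (\<gamma>1 / p1)) / 2 powr (real n * (\<gamma>0 / p0))"
      by (simp add: right_diff_distrib powr_diff)
    also have "\<dots> \<le> C * (2 powr s0 * K powr (1 / p0)) / (2 powr s1 * c powr (1 / p1))"
      using m c(1) by (simp add: field_simps)
    finally show "2 powr (real n * (\<gamma>1 / p1 - \<gamma>0 / p0)) \<le> C * (2 powr s0 * K powr (1 / p0)) / (2 powr s1 * c powr (1 / p1))" .
  qed
  thus ?thesis by simp
qed

section \<open>Lacunary superpositions and the fine index\<close>

lemma cos_double_large: "\<bar>cos t\<bar> \<ge> 1/2 \<or> \<bar>cos (2 * t)\<bar> \<ge> (1/2::real)"
proof (rule ccontr)
  assume "\<not> ?thesis"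
  hence c: "\<bar>cos t\<bar> < 1/2" "\<bar>cos (2 * t)\<bar> < 1/2" by auto
  have "\<bar>cos t\<bar>\<^sup>2 < (1/2)\<^sup>2" using c(1) by (intro power_strict_mono) auto
  hence "(cos t)\<^sup>2 < 1/4" by (simp add: power2_eq_square)
  hence "cos (2 * t) < - 1/2" by (simp add: cos_double_cos)
  thus False using c(2) by linarith
qed

text \<open>The frequencies are grouped in pairs related by angle doubling, and each pair
  contributes at least (1/2)^r; hence 2n terms for a factor n, uniformly in t.\<close>

lemma sum_lacunary_cos_lower:
  fixes t r :: real
  assumes r: "r > 0"
  shows "real n * (1/2) powr r \<le> (\<Sum>j\<in>{1..2 * n}. \<bar>cos (2 ^ j * t)\<bar> powr r)"
proof (induction n)
  case (Suc n)
  have "{1..2 * Suc n} = insert (2 * n + 2) (insert (2 * n + 1) {1..2 * n})" by auto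
  hence "(\<Sum>j\<in>{1..2 * Suc n}. \<bar>cos (2 ^ j * t)\<bar> powr r)
    = \<bar>cos (2 ^ (2 * n + 2) * t)\<bar> powr r + (\<bar>cos (2 ^ (2 * n + 1) * t)\<bar> powr r + (\<Sum>j\<in>{1..2 * n}. \<bar>cos (2 ^ j * t)\<bar> powr r))"
    by simp
  moreover have "(1/2) powr r \<le> \<bar>cos (2 ^ (2 * n + 2) * t)\<bar> powr r + \<bar>cos (2 ^ (2 * n + 1) * t)\<bar> powr r"
  proof -
    have e: "2 ^ (2 * n + 2) * t = 2 * (2 ^ (2 * n + 1) * t)" by simp
    have "(1/2) powr r \<le> \<bar>cos u\<bar> powr r" if "\<bar>cos u\<bar> \<ge> 1/2" for u :: real
      using that r by (intro powr_mono2) auto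
    thus ?thesis using cos_double_large[of "2 ^ (2 * n + 1) * t"] unfolding e
      by (meson add_increasing add_increasing2 powr_ge_zero)
  qed
  ultimately show ?case using Suc by (simp add: distrib_right)
qed simp

text \<open>The test function is a sum of 2n waves with a common envelope \<psi>. At every point its
  normalised blocks are |cos| values times a multiple of |\<psi>|, so the l^q1 norm is at least of
  order n^(1/q1), and the l^q0 norm is at most (2n)^(1/q0), times that multiple. The envelope
  integrates out, and letting n grow gives 1/q1 <= 1/q0.\<close>

lemma fine_index_condition:
  fixes \<phi> :: "real^'d::finite \<Rightarrow> real" and v :: "'x::banach"
  assumes emb: "\<And>T :: (real^'d \<Rightarrow> real) \<Rightarrow> 'x. tempered T \<Longrightarrow> TL_norm \<phi> s p q1 (pw \<gamma>) T \<le> ennreal C * TL_norm \<phi> s p q0 (pw \<gamma>) T"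
    and \<phi>: "admissible \<phi>" and v: "v \<noteq> 0" and q: "1 \<le> q0" "1 \<le> q1" and p: "p \<ge> 1"
    and g: "\<gamma> > - real CARD('d)" and C: "C \<ge> 0"
  shows "q0 \<le> q1"
proof (cases q1)
  case top
  show ?thesis unfolding top by simp
next
  case (real r1)
  note S = admissibleD(1)[OF \<phi>]
  fix i :: 'd
  have r1: "r1 \<ge> 1" using q(2) unfolding real(2) by simp
  \<comment> \<open>The parameter \<rho> = 1/12 is admissible at every level at once, which lets all
    waves share this envelope.\<close>
  define \<psi> where "\<psi> = (\<lambda>x::real^'d. \<phi> ((1/12) *\<^sub>R x))"
  have S\<psi>: "schwartz \<psi>" unfolding \<psi>_def using schwartz_affine[OF S, of "1/12" 0] by simp
  have [measurable]: "\<psi> \<in> borel_measurable borel" using S\<psi> by (rule schwartz_basic)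
  have rho: "(1/12::real) > 0" by simp
  define \<kappa> where "\<kappa> = (2 * pi) powr (real CARD('d) / 2)"
  have \<kappa>: "\<kappa> > 0" by (simp add: \<kappa>_def)
  define u where "u = \<kappa> * norm v"
  have u: "u > 0" using v \<kappa> by (simp add: u_def)
  obtain z where z: "\<psi> z \<noteq> 0"
  proof -
    have "\<exists>y. \<phi> y \<noteq> 0"
    proof (rule ccontr)
      assume "\<not> ?thesis"
      hence "\<phi> = (\<lambda>_. 0)" by auto
      hence "fourier \<phi> 0 = 0" by (simp add: fourier_def)
      thus False using admissibleD(2)[OF \<phi>, of 0] by simp
    qed
    then obtain y where "\<phi> y \<noteq> 0" by blast
    thus ?thesis by (intro that[of "12 *\<^sub>R y"]) (simp add: \<psi>_def)
  qed
  have dec: "\<exists>C. \<forall>z. (1 + norm z) ^ M * \<bar>\<psi> z\<bar> \<le> C" for M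
    using schwartz_bounded[OF S\<psi>, of M] by metis
  have g': "\<gamma> > - real DIM(real^'d)" using g by simp
  obtain l where l: "l > 0" "(\<integral>\<^sup>+x. ennreal (\<bar>\<psi> x\<bar> powr p * norm x powr \<gamma>) \<partial>lborel) = ennreal l"
    using weighted_finite_positive[OF g' p dec schwartz_basic(2)[OF S\<psi>] z] by blast
  define L where "L = l powr (1 / p)"
  have L: "L > 0" using l by (simp add: L_def)
  define W where "W = (\<lambda>j. wave \<phi> i j (1/12))"
  have Wi: "integrable lborel (W j)" for j unfolding W_def by (rule wave_basic(3)[OF S rho])
  have [measurable]: "W j \<in> borel_measurable borel" for j using Wi by auto
  \<comment> \<open>The coefficients cancel the smoothness weights 2^(ks), so that every level
    enters the sequence norm with equal strength.\<close>
  define f where "f = (\<lambda>n x. \<Sum>j\<in>{1..2 * n}. 2 powr (- real j * s) * W j x)"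
  define T where "T = (\<lambda>n. function_distribution (f n) v)"
  have fi: "integrable lborel (f n)" for n
    unfolding f_def by (intro Bochner_Integration.integrable_sum integrable_mult_right Wi)
  have Tt: "tempered (T n)" for n unfolding T_def by (rule tempered_function_distribution[OF fi])
  define ind where "ind = (\<lambda>n k::nat. if k \<in> {1..2 * n} then 1 else (0::real))"
  have Sk: "Sk \<phi> k (T n) x = (ind n k * (2 powr (- real k * s) * (\<kappa> * W k x))) *\<^sub>R v" for k n x
  proof -
    have pm: "phik \<phi> k \<in> borel_measurable borel" by (rule schwartz_basic(3)[OF schwartz_phik[OF S]])
    have [measurable]: "(\<lambda>y. phik \<phi> k (x - y)) \<in> borel_measurable borel"
      by (rule measurable_compose[OF _ pm]) measurable
    obtain B where B: "B > 0" "\<And>x. (1 + norm x) ^ 0 * \<bar>phik \<phi> k x\<bar> \<le> B" using schwartz_bounded[OF schwartz_phik[OF S]] by blast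
    have ii: "integrable lborel (\<lambda>y. phik \<phi> k (x - y) * W j y)" for j
      by (rule Bochner_Integration.integrable_bound[of _ "\<lambda>y. B * W j y"])
        (use Wi[of j] B in \<open>auto simp: abs_mult intro!: mult_right_mono\<close>)
    have "(LINT y|lborel. f n y * phik \<phi> k (x - y)) = (LINT y|lborel. (\<Sum>j\<in>{1..2 * n}. 2 powr (- real j * s) * (phik \<phi> k (x - y) * W j y)))"
      unfolding f_def by (intro Bochner_Integration.integral_cong refl) (simp add: sum_distrib_left ac_simps)
    also have "\<dots> = (\<Sum>j\<in>{1..2 * n}. 2 powr (- real j * s) * (LINT y|lborel. phik \<phi> k (x - y) * W j y))"
      using ii by (subst Bochner_Integration.integral_sum) auto
    also have "\<dots> = (\<Sum>j\<in>{1..2 * n}. if j = k then 2 powr (- real k * s) * (\<kappa> * W k x) else 0)"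
    proof (rule sum.cong[OF refl])
      fix j assume j: "j \<in> {1..2 * n}"
      have "12 * (1/12) \<le> (2::real) ^ j" by simp
      moreover have "j \<ge> 1" using j by simp
      ultimately show "2 powr (- real j * s) * (LINT y|lborel. phik \<phi> k (x - y) * W j y) = (if j = k then 2 powr (- real k * s) * (\<kappa> * W k x) else 0)"
        unfolding W_def using phik_wave[OF \<phi> rho, of j k x i] by (simp add: \<kappa>_def)
    qed
    also have "\<dots> = ind n k * (2 powr (- real k * s) * (\<kappa> * W k x))"
      by (simp add: ind_def)
    finally show ?thesis by (simp add: Sk_def T_def function_distribution_def)
  qed
  \<comment> \<open>In terms of this angle the k-th wave is cos (2^k \<theta>) times the envelope,
    so consecutive waves differ by angle doubling.\<close>
  define \<theta> where "\<theta> = (\<lambda>x::real^'d. 7/8 * (axis i 1 \<bullet> x))"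
  have Wv: "\<bar>W k x\<bar> = \<bar>cos (2 ^ k * \<theta> x)\<bar> * \<bar>\<psi> x\<bar>" for k x
    by (simp add: W_def wave_def \<theta>_def \<psi>_def abs_mult ac_simps)
  have seq: "2 powr (real k * s) * norm (Sk \<phi> k (T n) x) = ind n k * (\<bar>cos (2 ^ k * \<theta> x)\<bar> * (u * \<bar>\<psi> x\<bar>))" for k n x
  proof -
    have e1: "2 powr (real k * s) * 2 powr (- real k * s) = (1::real)" unfolding powr_add[symmetric] by simp
    have e2: "norm (Sk \<phi> k (T n) x) = ind n k * (2 powr (- real k * s) * (\<kappa> * \<bar>W k x\<bar>)) * norm v"
      unfolding Sk using \<kappa> by (simp add: abs_mult ind_def)
    have "2 powr (real k * s) * norm (Sk \<phi> k (T n) x) = (2 powr (real k * s) * 2 powr (- real k * s)) * (ind n k * (\<kappa> * \<bar>W k x\<bar>) * norm v)"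
      unfolding e2 by (simp only: ac_simps)
    hence "2 powr (real k * s) * norm (Sk \<phi> k (T n) x) = ind n k * (\<kappa> * \<bar>W k x\<bar>) * norm v"
      unfolding e1 by simp
    thus ?thesis unfolding Wv u_def by simp
  qed
  have series: "(\<Sum>k. ennreal (\<bar>ind n k * (\<bar>cos (2 ^ k * \<theta> x)\<bar> * (u * \<bar>\<psi> x\<bar>))\<bar> powr r))
     = ennreal ((\<Sum>k\<in>{1..2 * n}. \<bar>cos (2 ^ k * \<theta> x)\<bar> powr r) * (u * \<bar>\<psi> x\<bar>) powr r)" for n r x
  proof -
    have "(\<Sum>k. ennreal (\<bar>ind n k * (\<bar>cos (2 ^ k * \<theta> x)\<bar> * (u * \<bar>\<psi> x\<bar>))\<bar> powr r))
      = (\<Sum>k\<in>{1..2 * n}. ennreal (\<bar>ind n k * (\<bar>cos (2 ^ k * \<theta> x)\<bar> * (u * \<bar>\<psi> x\<bar>))\<bar> powr r))"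
      by (rule suminf_finite) (auto simp: ind_def)
    also have "\<dots> = (\<Sum>k\<in>{1..2 * n}. ennreal (\<bar>cos (2 ^ k * \<theta> x)\<bar> powr r * (u * \<bar>\<psi> x\<bar>) powr r))"
      using u by (intro sum.cong) (auto simp: ind_def abs_mult powr_mult)
    also have "\<dots> = ennreal (\<Sum>k\<in>{1..2 * n}. \<bar>cos (2 ^ k * \<theta> x)\<bar> powr r * (u * \<bar>\<psi> x\<bar>) powr r)"
      by (rule sum_ennreal) simp
    finally show ?thesis by (simp add: sum_distrib_right)
  qed
  have lower: "ennreal (real n powr (1 / r1) / 2 * u * \<bar>\<psi> x\<bar>) \<le> lq_norm q1 (\<lambda>k. 2 powr (real k * s) * norm (Sk \<phi> k (T n) x))" for n x
  proof -
    have "ennreal (real n * (1/2) powr r1 * (u * \<bar>\<psi> x\<bar>) powr r1) \<le> ennreal ((\<Sum>k\<in>{1..2 * n}. \<bar>cos (2 ^ k * \<theta> x)\<bar> powr r1) * (u * \<bar>\<psi> x\<bar>) powr r1)"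
      using r1 by (intro ennreal_leI mult_right_mono sum_lacunary_cos_lower) auto
    hence "enn_powr (ennreal (real n * (1/2) powr r1 * (u * \<bar>\<psi> x\<bar>) powr r1)) (1 / r1) \<le> lq_norm q1 (\<lambda>k. 2 powr (real k * s) * norm (Sk \<phi> k (T n) x))"
      unfolding seq real(2) lq_norm_ennreal[OF real(1)] series using r1 by (intro enn_powr_mono) auto
    moreover have "(real n * (1/2) powr r1 * (u * \<bar>\<psi> x\<bar>) powr r1) powr (1 / r1) = real n powr (1 / r1) / 2 * u * \<bar>\<psi> x\<bar>"
    proof -
      have "(real n * (1/2) powr r1 * (u * \<bar>\<psi> x\<bar>) powr r1) powr (1 / r1) = real n powr (1 / r1) * ((1/2) powr r1) powr (1 / r1) * ((u * \<bar>\<psi> x\<bar>) powr r1) powr (1 / r1)"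
        using u by (simp add: powr_mult)
      also have "\<dots> = real n powr (1 / r1) * (1/2) * (u * \<bar>\<psi> x\<bar>)"
        unfolding powr_powr using r1 u by simp
      finally show ?thesis by simp
    qed
    ultimately show ?thesis by (simp add: enn_powr_ennreal)
  qed
  \<comment> \<open>Covers the infinite index as well: \<open>enn2real\<close> sends
    \<open>top\<close> to 0 and division by 0 yields 0, so e0 = 0 in that case.\<close>
  define e0 where "e0 = 1 / enn2real q0"
  have upper: "lq_norm q0 (\<lambda>k. 2 powr (real k * s) * norm (Sk \<phi> k (T n) x)) \<le> ennreal ((2 * real n) powr e0 * u * \<bar>\<psi> x\<bar>)" if n: "n \<ge> 1" for n x
  proof (cases q0)
    case top
    have "ennreal \<bar>ind n k * (\<bar>cos (2 ^ k * \<theta> x)\<bar> * (u * \<bar>\<psi> x\<bar>))\<bar> \<le> ennreal (u * \<bar>\<psi> x\<bar>)" for k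
    proof (rule ennreal_leI)
      have "\<bar>cos (2 ^ k * \<theta> x)\<bar> * (u * \<bar>\<psi> x\<bar>) \<le> 1 * (u * \<bar>\<psi> x\<bar>)" using u by (intro mult_right_mono) auto
      thus "\<bar>ind n k * (\<bar>cos (2 ^ k * \<theta> x)\<bar> * (u * \<bar>\<psi> x\<bar>))\<bar> \<le> u * \<bar>\<psi> x\<bar>"
        using u by (auto simp: ind_def abs_mult)
    qed
    hence "lq_norm top (\<lambda>k. ind n k * (\<bar>cos (2 ^ k * \<theta> x)\<bar> * (u * \<bar>\<psi> x\<bar>))) \<le> ennreal (u * \<bar>\<psi> x\<bar>)"
      unfolding lq_norm_def by (simp only: simp_thms if_True) (rule SUP_least)
    thus ?thesis unfolding seq e0_def top using n by simp
  next
    case (real r0)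
    have r0: "r0 \<ge> 1" using q(1) unfolding real(2) by simp
    have e0: "e0 = 1 / r0" using real by (simp add: e0_def)
    have "(\<Sum>k\<in>{1..2 * n}. \<bar>cos (2 ^ k * \<theta> x)\<bar> powr r0) \<le> (\<Sum>k\<in>{1..2 * n}. 1)"
      using r0 by (intro sum_mono powr_le1) auto
    hence "ennreal ((\<Sum>k\<in>{1..2 * n}. \<bar>cos (2 ^ k * \<theta> x)\<bar> powr r0) * (u * \<bar>\<psi> x\<bar>) powr r0) \<le> ennreal (2 * real n * (u * \<bar>\<psi> x\<bar>) powr r0)"
      by (intro ennreal_leI mult_right_mono) auto
    hence "lq_norm q0 (\<lambda>k. 2 powr (real k * s) * norm (Sk \<phi> k (T n) x)) \<le> enn_powr (ennreal (2 * real n * (u * \<bar>\<psi> x\<bar>) powr r0)) (1 / r0)"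
      unfolding seq real(2) lq_norm_ennreal[OF real(1)] series using r0 by (intro enn_powr_mono) auto
    also have "\<dots> = ennreal ((2 * real n) powr e0 * u * \<bar>\<psi> x\<bar>)"
    proof -
      have "(2 * real n * (u * \<bar>\<psi> x\<bar>) powr r0) powr (1 / r0) = (2 * real n) powr (1 / r0) * ((u * \<bar>\<psi> x\<bar>) powr r0) powr (1 / r0)"
        by (subst powr_mult) auto
      also have "\<dots> = (2 * real n) powr e0 * u * \<bar>\<psi> x\<bar>" unfolding powr_powr e0 using r0 u by simp
      finally show ?thesis by (simp add: enn_powr_ennreal)
    qed
    finally show ?thesis .
  qed
  have norm_eval: "enn_powr (\<integral>\<^sup>+x. enn_powr (ennreal (a * u * \<bar>\<psi> x\<bar>)) p * ennreal (pw \<gamma> x) \<partial>lborel) (1 / p) = ennreal (a * u * L)" if a: "a \<ge> 0" for a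
  proof -
    have "(\<integral>\<^sup>+x. enn_powr (ennreal (a * u * \<bar>\<psi> x\<bar>)) p * ennreal (pw \<gamma> x) \<partial>lborel) = (\<integral>\<^sup>+x. ennreal ((a * u) powr p) * ennreal (\<bar>\<psi> x\<bar> powr p * norm x powr \<gamma>) \<partial>lborel)"
    proof (rule nn_integral_cong)
      fix x
      have "(a * u * \<bar>\<psi> x\<bar>) powr p = (a * u) powr p * \<bar>\<psi> x\<bar> powr p" using a u by (intro powr_mult)
      thus "enn_powr (ennreal (a * u * \<bar>\<psi> x\<bar>)) p * ennreal (pw \<gamma> x) = ennreal ((a * u) powr p) * ennreal (\<bar>\<psi> x\<bar> powr p * norm x powr \<gamma>)"
        using a u by (simp add: enn_powr_ennreal pw_def mult.assoc flip: ennreal_mult)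
    qed
    also have "\<dots> = ennreal ((a * u) powr p) * ennreal l"
      unfolding l(2)[symmetric] by (rule nn_integral_cmult) measurable
    finally have I: "(\<integral>\<^sup>+x. enn_powr (ennreal (a * u * \<bar>\<psi> x\<bar>)) p * ennreal (pw \<gamma> x) \<partial>lborel) = ennreal ((a * u) powr p * l)"
      using l(1) by (simp add: ennreal_mult)
    have "((a * u) powr p * l) powr (1 / p) = ((a * u) powr p) powr (1 / p) * l powr (1 / p)"
      using l(1) by (simp only: powr_mult powr_ge_zero less_imp_le)
    also have "\<dots> = a * u * L" unfolding powr_powr L_def using a u p by simp
    finally show ?thesis unfolding I using l(1) by (simp add: enn_powr_ennreal)
  qed
  have main: "real n powr (1 / r1) / 2 \<le> C * (2 * real n) powr e0" if n: "n \<ge> 1" for n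
  proof -
    have a0: "0 \<le> real n powr (1 / r1) / 2" by simp
    have "ennreal (real n powr (1 / r1) / 2 * u * L) \<le> TL_norm \<phi> s p q1 (pw \<gamma>) (T n)"
      unfolding TL_norm_def norm_eval[OF a0, symmetric]
      using p lower[of n] by (intro enn_powr_mono nn_integral_mono mult_right_mono) auto
    also have "\<dots> \<le> ennreal C * TL_norm \<phi> s p q0 (pw \<gamma>) (T n)" by (rule emb[OF Tt])
    also have "\<dots> \<le> ennreal C * ennreal ((2 * real n) powr e0 * u * L)"
      unfolding TL_norm_def norm_eval[of "(2 * real n) powr e0", OF powr_ge_zero, symmetric]
      using p upper[OF n] by (intro mult_left_mono enn_powr_mono nn_integral_mono mult_right_mono) auto
    also have "\<dots> = ennreal (C * ((2 * real n) powr e0 * u * L))" using C by (simp add: ennreal_mult')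
    finally have "real n powr (1 / r1) / 2 * u * L \<le> C * ((2 * real n) powr e0 * u * L)"
      using C u L by (simp add: ennreal_le_iff)
    hence "(real n powr (1 / r1) / 2) * (u * L) \<le> (C * (2 * real n) powr e0) * (u * L)" by (simp only: mult.assoc)
    moreover have "u * L > 0" using u L by simp
    ultimately show ?thesis by (simp only: mult_le_cancel_right_pos)
  qed
  have "1 / r1 - e0 \<le> 0"
  proof (rule powr_bounded_imp_nonpos)
    \<comment> \<open>The lengths n = 2^m turn the comparison of powers of n into one of powers of
      2.\<close>
    fix m :: nat assume "m \<ge> 0"
    have "real (2 ^ m) powr (1 / r1) / 2 \<le> C * (2 * real (2 ^ m)) powr e0" by (rule main) simp
    moreover have "real (2 ^ m) powr (1 / r1) = 2 powr (real m * (1 / r1))" by (simp add: powr_powr flip: powr_realpow)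
    moreover have "(2 * real (2 ^ m)) powr e0 = 2 powr e0 * 2 powr (real m * e0)"
      by (subst powr_mult) (simp_all add: powr_powr flip: powr_realpow)
    moreover have "x / b \<le> 2 * C * y" if "x / 2 \<le> C * (y * b)" "b > 0" for x y b :: real
      using that by (simp add: field_simps)
    ultimately have "2 powr (real m * (1 / r1)) / 2 powr (real m * e0) \<le> 2 * C * 2 powr e0" by simp
    thus "2 powr (real m * (1 / r1 - e0)) \<le> 2 * C * 2 powr e0" by (simp add: right_diff_distrib powr_diff)
  qed
  hence le: "1 / r1 \<le> e0" by simp
  show ?thesis
  proof (cases q0)
    case top
    \<comment> \<open>For an infinite q0 the exponent e0 is 0, which contradicts 1/r1 > 0; so this
      case cannot occur with q1 finite.\<close>
    hence "1 / r1 \<le> 0" using le by (simp add: e0_def)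
    thus ?thesis using r1 by simp
  next
    case (real r0)
    have r0: "r0 \<ge> 1" using q(1) unfolding real(2) by simp
    have "1 / r1 \<le> 1 / r0" using le real by (simp add: e0_def)
    hence "r0 \<le> r1" using r0 r1 by (simp add: field_simps)
    thus ?thesis unfolding real(2) \<open>q1 = ennreal r1\<close> by (rule ennreal_leI)
  qed
qed

text \<open>Continuity of the inclusion is expressed as one norm inequality over all tempered
  distributions, with infinite norms allowed. The Banach space has to contain a nonzero vector:
  otherwise every norm vanishes and the embedding holds for all parameters.\<close>

theorem theorem1p2:
  fixes \<phi> :: "real^'d::finite \<Rightarrow> real"
    and p0 p1 s0 s1 \<gamma>0 \<gamma>1 :: real and q0 q1 :: ennreal
  assumes "admissible \<phi>"
    and "\<exists>v::'x::banach. v \<noteq> 0"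
    and "1 < p0" and "p0 \<le> p1"
    and "1 \<le> q0" and "1 \<le> q1"
    and "\<gamma>0 > - real CARD('d)" and "\<gamma>1 > - real CARD('d)"
  shows "(\<exists>C::real. \<forall>T :: (real^'d \<Rightarrow> real) \<Rightarrow> 'x. tempered T \<longrightarrow>
            TL_norm \<phi> s1 p1 q1 (pw \<gamma>1) T \<le> ennreal C * TL_norm \<phi> s0 p0 q0 (pw \<gamma>0) T)
     \<longleftrightarrow>
         ((\<gamma>0 = \<gamma>1 \<and> p0 = p1 \<and> (s0 > s1 \<or> (s0 = s1 \<and> q0 \<le> q1))) \<or>
          (\<gamma>1 / p1 \<le> \<gamma>0 / p0 \<and>
           (real CARD('d) + \<gamma>1) / p1 < (real CARD('d) + \<gamma>0) / p0 \<and>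
           s0 - (real CARD('d) + \<gamma>0) / p0 \<ge> s1 - (real CARD('d) + \<gamma>1) / p1))"
    (is "?emb \<longleftrightarrow> ?same \<or> ?gain")
proof
  assume ?emb
  then obtain C0 :: real where C0: "\<And>T :: (real^'d \<Rightarrow> real) \<Rightarrow> 'x. tempered T \<Longrightarrow>
      TL_norm \<phi> s1 p1 q1 (pw \<gamma>1) T \<le> ennreal C0 * TL_norm \<phi> s0 p0 q0 (pw \<gamma>0) T" by blast
  \<comment> \<open>The given constant may be negative. As \<open>ennreal\<close> sends negative
    numbers to 0, replacing it by a nonnegative one keeps the inequality and permits real arithmetic
    with it.\<close>
  define C where "C = max C0 0"
  have C: "C \<ge> 0" by (simp add: C_def)
  have emb: "TL_norm \<phi> s1 p1 q1 (pw \<gamma>1) T \<le> ennreal C * TL_norm \<phi> s0 p0 q0 (pw \<gamma>0) T"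
    if "tempered T" for T :: "(real^'d \<Rightarrow> real) \<Rightarrow> 'x"
    by (rule order_trans[OF C0[OF that] mult_right_mono]) (auto simp: C_def intro: ennreal_leI)
  obtain v :: 'x where v: "v \<noteq> 0" using assms(2) by blast
  have p: "1 \<le> p0" "1 \<le> p1" using assms by auto
  have dil: "s1 - (real CARD('d) + \<gamma>1) / p1 \<le> s0 - (real CARD('d) + \<gamma>0) / p0"
    by (rule dilation_condition[OF emb assms(1) v assms(5,6) p assms(7,8) C])
  have tra: "\<gamma>1 / p1 \<le> \<gamma>0 / p0"
    by (rule translation_condition[OF emb assms(1) v assms(5,6) p assms(7) C])
  show "?same \<or> ?gain"
  proof (cases "(real CARD('d) + \<gamma>1) / p1 < (real CARD('d) + \<gamma>0) / p0")
    case True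
    thus ?thesis using dil tra by blast
  next
    \<comment> \<open>Since \<gamma>1/p1 <= \<gamma>0/p0 is already known, failure of the strict
      inequality forces d/p0 <= d/p1; with p0 <= p1 this gives p0 = p1 and then \<gamma>0 =
      \<gamma>1. Only smoothness and fine indices remain to be compared.\<close>
    case False
    hence "real CARD('d) / p0 + \<gamma>0 / p0 \<le> real CARD('d) / p1 + \<gamma>1 / p1" by (simp add: add_divide_distrib)
    hence d: "real CARD('d) / p0 \<le> real CARD('d) / p1" using tra by linarith
    have "p1 \<le> p0"
    proof (rule ccontr)
      assume "\<not> p1 \<le> p0"
      hence "real CARD('d) / p1 < real CARD('d) / p0" using p by (intro divide_strict_left_mono) auto
      thus False using d by simp
    qed
    hence pe: "p0 = p1" using assms(4) by simp
    have "(real CARD('d) + \<gamma>0) / p1 \<le> (real CARD('d) + \<gamma>1) / p1" using False pe by simp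
    hence "\<gamma>0 \<le> \<gamma>1" using p by (simp add: divide_le_cancel)
    moreover have "\<gamma>1 \<le> \<gamma>0" using tra p unfolding pe by (simp add: divide_le_cancel)
    ultimately have ge: "\<gamma>0 = \<gamma>1" by simp
    have "s1 \<le> s0" using dil unfolding pe ge by simp
    moreover have "q0 \<le> q1" if se: "s0 = s1"
      by (rule fine_index_condition[OF emb[unfolded pe ge se] assms(1) v assms(5,6) p(2) assms(8) C])
    ultimately show ?thesis using pe ge by (auto simp: less_le)
  qed
next
  assume "?same \<or> ?gain"
  thus ?emb
  proof
    assume s: ?same
    hence "p1 > 0" using assms by auto
    thus ?emb using TL_embedding_same_weight[OF assms(1) _ assms(5,6) _ pw_measurable, of p1 s1 s0 \<gamma>1] s by blast
  next
    assume gain: ?gain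
    show ?emb
      by (rule TL_embedding_gain[OF assms(1) _ assms(4-8)]) (use assms(3) gain in auto)
  qed
qed

end
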